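(* Let $s\in\mathbb{R}$. (i) If $p\in(0,\infty)$ and either $q\in(0,\infty)$, $\tau\in(1/p,\infty)$, or $q=\infty$, $\tau\in[1/p,\infty)$, then $$\dot{F}^{s,\tau}_{p,q}(\mathbb{R}^n)=\dot{F}^{s+n(\tau-1/p)}_{\infty,\infty}(\mathbb{R}^n)=CMO^{s,q}_{\tau q+1-q/p}(\mathbb{R}^n)$$ with equivalent norms. (ii) If $p\in(0,\infty]$ and either $q\in(0,\infty)$, $\tau\in(1/p,\infty)$, or $q=\infty$, $\tau\in[1/p,\infty)$, then $$\dot{B}^{s,\tau}_{p,q}(\mathbb{R}^n)=\dot{B}^{s+n(\tau-1/p)}_{\infty,\infty}(\mathbb{R}^n)=CMO^{s,q}_{\tau q+1-q/p}(\mathbb{R}^n)$$ with equivalent norms. Here, for $q=\infty$, $CMO^{s,\infty}_{\tau q+1-q/p}(\mathbb{R}^n)$ denotes the space of all $f\in\mathcal{S}'_\infty(\mathbb{R}^n)$ with finite norm $\sup_{P\in\mathcal{Q}}|P|^{-(\tau-1/p)}\sup_{Q\in\mathcal{Q},\,Q\subset P}|Q|^{-s/n-1/2}|\langle f,\varphi_Q\rangle|$.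
   Context: $\mathcal{S}(\mathbb{R}^n)$ is the Schwartz space; $\mathcal{S}_\infty(\mathbb{R}^n)$ is the subspace of all $\varphi\in\mathcal{S}(\mathbb{R}^n)$ with $\int_{\mathbb{R}^n}\varphi(x)x^\gamma\,dx=0$ for all multi-indices $\gamma$, with the topology inherited from $\mathcal{S}(\mathbb{R}^n)$; $\mathcal{S}'_\infty(\mathbb{R}^n)$ is its topological dual (equivalently, $\mathcal{S}'(\mathbb{R}^n)$ modulo polynomials). $\mathcal{Q}$ is the set of all dyadic cubes $Q_{jk}=2^{-j}([0,1)^n+k)$, $j\in\mathbb{Z}$, $k\in\mathbb{Z}^n$. For $Q=Q_{jk}\in\mathcal{Q}$, $|Q|$ is its Lebesgue measure, $x_Q=2^{-j}k$, $\ell(Q)$ its side-length, $j_Q=-\log_2\ell(Q)$, and $\chi_Q$ its characteristic function. Sums over $Q\subset P$ run over dyadic cubes contained in $P$. Convention: $1/p=0$ and $q/p=0$ (for $q<\infty$) if $p=\infty$. Fix $\varphi\in\mathcal{S}(\mathbb{R}^n)$ with $\mathrm{supp}\,\widehat{\varphi}\subset\{\xi:1/2\le|\xi|\le2\}$ and $|\widehat{\varphi}(\xi)|\ge C>0$ when $3/5\le|\xi|\le5/3$. Put $\varphi_j(x)=2^{jn}\varphi(2^jx)$, $j\in\mathbb{Z}$, and $\varphi_Q(x)=|Q|^{-1/2}\varphi((x-x_Q)/\ell(Q))$, $Q\in\mathcal{Q}$. Generalized Carleson measure space ($s,r\in\mathbb{R}$, $q\in(0,\infty)$): $CMO^{s,q}_r(\mathbb{R}^n)$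 is the set of $f\in\mathcal{S}'_\infty(\mathbb{R}^n)$ with $$\|f\|_{CMO^{s,q}_r(\mathbb{R}^n)}=\sup_{P\in\mathcal{Q}}\left\{|P|^{-r}\int_P\sum_{Q\subset P}\left[|Q|^{-s/n-1/2}|\langle f,\varphi_Q\rangle|\chi_Q(x)\right]^qdx\right\}^{1/q}<\infty.$$ For $s\in\mathbb{R}$, $\tau\in[0,\infty)$, $q\in(0,\infty]$: the Triebel-Lizorkin-type space $\dot{F}^{s,\tau}_{p,q}(\mathbb{R}^n)$ ($p\in(0,\infty)$) is the set of $f\in\mathcal{S}'_\infty(\mathbb{R}^n)$ with $$\|f\|_{\dot{F}^{s,\tau}_{p,q}(\mathbb{R}^n)}=\sup_{P\in\mathcal{Q}}\frac1{|P|^{\tau}}\left\{\int_P\left[\sum_{j=j_P}^\infty 2^{jsq}|\varphi_j\ast f(x)|^q\right]^{p/q}dx\right\}^{1/p}<\infty,$$ and the Besov-type space $\dot{B}^{s,\tau}_{p,q}(\mathbb{R}^n)$ ($p\in(0,\infty]$) is the set of $f\in\mathcal{S}'_\infty(\mathbb{R}^n)$ with $$\|f\|_{\dot{B}^{s,\tau}_{p,q}(\mathbb{R}^n)}=\sup_{P\in\mathcal{Q}}\frac1{|P|^{\tau}}\left\{\sum_{j=j_P}^\infty 2^{jsq}\left[\int_P|\varphi_j\ast f(x)|^p\,dx\right]^{q/p}\right\}^{1/q}<\infty,$$ with the usual modifications when $p=\infty$ or $q=\infty$ (essential supremum over $P$; supremum over $j\ge j_P$). For $\sigma\in\mathbb{R}$,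 the classical homogeneous spaces $\dot{F}^{\sigma}_{\infty,\infty}(\mathbb{R}^n)=\dot{B}^{\sigma}_{\infty,\infty}(\mathbb{R}^n)$ consist of all $f\in\mathcal{S}'_\infty(\mathbb{R}^n)$ with $\sup_{j\in\mathbb{Z}}2^{j\sigma}\|\varphi_j\ast f\|_{L^\infty(\mathbb{R}^n)}<\infty$, this quantity being the norm. *)

theory Defs
  imports "HOL-Analysis.Analysis" "HOL-Probability.Essential_Supremum"
begin

section \<open>The Schwartz space\<close>

definition partial_deriv :: "'n::finite \<Rightarrow> (real^'n \<Rightarrow> complex) \<Rightarrow> real^'n \<Rightarrow> complex" where
  "partial_deriv i f x = frechet_derivative f (at x) (axis i 1)"

text \<open>Iterated partial derivatives are indexed by the list of directions. For smooth functions
  the order is irrelevant, so the lists give exactly the derivatives of all multi-indices.\<close>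

definition partial_derivs :: "'n::finite list \<Rightarrow> (real^'n \<Rightarrow> complex) \<Rightarrow> real^'n \<Rightarrow> complex" where
  "partial_derivs is f = foldr partial_deriv is f"

definition smooth :: "(real^'n::finite \<Rightarrow> complex) \<Rightarrow> bool" where
  "smooth f \<longleftrightarrow> (\<forall>is x. partial_derivs is f differentiable (at x))"

definition monomial :: "('n::finite \<Rightarrow> nat) \<Rightarrow> real^'n \<Rightarrow> real" where
  "monomial \<gamma> x = (\<Prod>i\<in>UNIV. (x $ i) ^ \<gamma> i)"

definition schwartz :: "(real^'n::finite \<Rightarrow> complex) set" where
  "schwartz = {f. smooth f \<and>
     (\<forall>\<gamma> is. bounded (range (\<lambda>x. of_real (monomial \<gamma> x) * partial_derivs is f x)))}"

definition schwartz_seminorm ::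
    "('n::finite \<Rightarrow> nat) \<Rightarrow> 'n list \<Rightarrow> (real^'n \<Rightarrow> complex) \<Rightarrow> real" where
  "schwartz_seminorm \<gamma> is f = (SUP x. norm (of_real (monomial \<gamma> x) * partial_derivs is f x))"

definition schwartz_topology :: "(real^'n::finite \<Rightarrow> complex) topology" where
  "schwartz_topology = topology_generated_by
     {{g \<in> schwartz. schwartz_seminorm \<gamma> is (\<lambda>x. g x - f x) < \<epsilon>} | f \<gamma> is \<epsilon>. f \<in> schwartz \<and> 0 < \<epsilon>}"

definition schwartz_inf :: "(real^'n::finite \<Rightarrow> complex) set" where
  "schwartz_inf = {f \<in> schwartz. \<forall>\<gamma>. (\<integral>x. f x * of_real (monomial \<gamma> x) \<partial>lborel) = 0}"

text \<open>The topological dual. Functionals are total HOL functions; \<^const>\<open>extensional\<close> fixes their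
  junk values outside the domain, so that HOL equality is equality of functionals.\<close>

definition schwartz_inf_dual :: "((real^'n::finite \<Rightarrow> complex) \<Rightarrow> complex) set" where
  "schwartz_inf_dual = {u \<in> extensional schwartz_inf.
     (\<forall>f\<in>schwartz_inf. \<forall>g\<in>schwartz_inf. u (\<lambda>x. f x + g x) = u f + u g) \<and>
     (\<forall>c. \<forall>f\<in>schwartz_inf. u (\<lambda>x. c * f x) = c * u f) \<and>
     continuous_map (subtopology schwartz_topology schwartz_inf) euclidean u}"

text \<open>The normalization without \<open>2\<pi>\<close> in the exponent matters here: the annulus
  \<open>1/2 \<le> |\<xi>| \<le> 2\<close> below has to lie in the cube \<open>[-\<pi>, \<pi>]\<^sup>n\<close> for samples at the
  points \<open>x\<^sub>Q\<close> to determine a distribution.\<close>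

definition fourier :: "(real^'n::finite \<Rightarrow> complex) \<Rightarrow> real^'n \<Rightarrow> complex" where
  "fourier f \<xi> = (\<integral>x. cis (- (x \<bullet> \<xi>)) * f x \<partial>lborel)"

definition admissible :: "(real^'n::finite \<Rightarrow> complex) \<Rightarrow> bool" where
  "admissible \<phi> \<longleftrightarrow> \<phi> \<in> schwartz \<and>
     closure {\<xi>. fourier \<phi> \<xi> \<noteq> 0} \<subseteq> {\<xi>. 1/2 \<le> norm \<xi> \<and> norm \<xi> \<le> 2} \<and>
     (\<exists>C>0. \<forall>\<xi>. 3/5 \<le> norm \<xi> \<and> norm \<xi> \<le> 5/3 \<longrightarrow> C \<le> norm (fourier \<phi> \<xi>))"

text \<open>\<open>f * \<psi>\<close> for a functional \<open>f\<close> and a test function \<open>\<psi>\<close>; the pairing is bilinear.\<close>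

definition conv :: "((real^'n::finite \<Rightarrow> complex) \<Rightarrow> complex) \<Rightarrow> (real^'n \<Rightarrow> complex)
    \<Rightarrow> real^'n \<Rightarrow> complex" where
  "conv f \<psi> x = f (\<lambda>y. \<psi> (x - y))"

definition dilate :: "int \<Rightarrow> (real^'n::finite \<Rightarrow> complex) \<Rightarrow> real^'n \<Rightarrow> complex" where
  "dilate j \<phi> x = of_real (2 powi (j * int CARD('n))) * \<phi> ((2 powi j) *\<^sub>R x)"

section \<open>Dyadic cubes\<close>

text \<open>A dyadic cube \<open>Q\<^sub>j\<^sub>k\<close> is represented by its index \<open>(j, k)\<close>, which it determines
  (\<open>inj_cube\<close> below); the first component is \<open>j\<^sub>Q\<close>.\<close>

type_synonym 'n dyadic = "int \<times> (int^'n)"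

definition side :: "'n::finite dyadic \<Rightarrow> real" where
  "side Q = 2 powi (- fst Q)"

definition corner :: "'n::finite dyadic \<Rightarrow> real^'n" where
  "corner Q = (2 powi (- fst Q)) *\<^sub>R (\<chi> i. of_int (snd Q $ i))"

definition cube :: "'n::finite dyadic \<Rightarrow> (real^'n) set" where
  "cube Q = (\<lambda>x. (2 powi (- fst Q)) *\<^sub>R (x + (\<chi> i. of_int (snd Q $ i)))) ` {x. \<forall>i. 0 \<le> x $ i \<and> x $ i < 1}"

definition vol :: "'n::finite dyadic \<Rightarrow> real" where
  "vol Q = measure lborel (cube Q)"

lemma mem_cube_iff:
  "y \<in> cube Q \<longleftrightarrow> (\<forall>i. corner Q $ i \<le> y $ i \<and> y $ i < corner Q $ i + side Q)"
proof -
  define c :: real where "c = 2 powi (- fst Q)"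
  define k :: "real^'a" where "k = (\<chi> i. of_int (snd Q $ i))"
  have c: "c > 0" by (simp add: c_def)
  have "y \<in> cube Q \<longleftrightarrow> (\<forall>i. 0 \<le> (y /\<^sub>R c - k) $ i \<and> (y /\<^sub>R c - k) $ i < 1)" (is "_ \<longleftrightarrow> ?R")
  proof
    assume "y \<in> cube Q"
    then obtain x where "y = c *\<^sub>R (x + k)" "\<forall>i. 0 \<le> x $ i \<and> x $ i < 1"
      by (auto simp: cube_def c_def k_def)
    then show ?R using c by simp
  next
    assume ?R
    moreover have "y = c *\<^sub>R ((y /\<^sub>R c - k) + k)" using c by simp
    ultimately show "y \<in> cube Q" unfolding cube_def c_def[symmetric] k_def[symmetric] by blast
  qed
  also have "\<dots> \<longleftrightarrow> (\<forall>i. corner Q $ i \<le> y $ i \<and> y $ i < corner Q $ i + side Q)"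
    using c unfolding corner_def side_def c_def[symmetric] k_def[symmetric]
    by (simp add: field_simps)
  finally show ?thesis .
qed

lemma inj_cube: "inj (cube :: 'n::finite dyadic \<Rightarrow> _)"
proof (rule injI)
  fix Q R :: "'n dyadic"
  assume eq: "cube Q = cube R"
  have side_pos: "side S > 0" for S :: "'n dyadic" by (simp add: side_def)
  have "corner S \<in> cube S" for S :: "'n dyadic" by (simp add: mem_cube_iff side_pos)
  then have "corner Q \<in> cube R" "corner R \<in> cube Q" using eq by blast+
  then have corner: "corner Q = corner R" by (simp add: mem_cube_iff vec_eq_iff order_antisym)
  have "side S \<le> side T" if "cube S = cube T" "corner S = corner T" for S T :: "'n dyadic"
  proof (rule ccontr)
    assume "\<not> side S \<le> side T"
    then have "corner S + (\<chi> i. side T) \<in> cube S" by (simp add: mem_cube_iff side_pos less_imp_le)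
    then have "corner T + (\<chi> i. side T) \<in> cube T" using that by simp
    then show False by (simp add: mem_cube_iff)
  qed
  then have "side Q = side R" using eq corner by (metis order_antisym)
  then have "(2::real) powr of_int (- fst Q) = 2 powr of_int (- fst R)"
    unfolding side_def by (subst (1 2) powr_real_of_int') auto
  then have "fst Q = fst R" by (simp add: powr_inj)
  moreover from this have "snd Q = snd R" using corner by (simp add: corner_def vec_eq_iff)
  ultimately show "Q = R" by (simp add: prod_eq_iff)
qed

definition phi_cube :: "(real^'n::finite \<Rightarrow> complex) \<Rightarrow> 'n dyadic \<Rightarrow> real^'n \<Rightarrow> complex" where
  "phi_cube \<phi> Q x = of_real (vol Q powr (-1/2)) * \<phi> ((x - corner Q) /\<^sub>R side Q)"

section \<open>Quasi-norms\<close>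

text \<open>Quasi-norms take values in \<^typ>\<open>ennreal\<close>, and the exponents \<open>p\<close>, \<open>q\<close> are of type
  \<^typ>\<open>ennreal\<close> too. As \<open>1 / \<infinity> = 0\<close> there, \<^term>\<open>enn2real (1 / p)\<close> and (for finite \<open>q\<close>)
  \<^term>\<open>enn2real (q / p)\<close> follow the conventions \<open>1/p = 0\<close> and \<open>q/p = 0\<close> for \<open>p = \<infinity>\<close>.\<close>

text \<open>Only used for exponents \<open>a > 0\<close>.\<close>

definition epowr :: "ennreal \<Rightarrow> real \<Rightarrow> ennreal" where
  "epowr x a = (if x = \<infinity> then \<infinity> else ennreal (enn2real x powr a))"

definition lebesgue_norm :: "ennreal \<Rightarrow> 'a::euclidean_space set \<Rightarrow> ('a \<Rightarrow> ennreal) \<Rightarrow> ennreal" where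
  "lebesgue_norm p A g =
     (if p = \<infinity> then esssup (restrict_space lborel A) g
      else epowr (\<integral>\<^sup>+x\<in>A. epowr (g x) (enn2real p) \<partial>lborel) (1 / enn2real p))"

definition seq_norm :: "ennreal \<Rightarrow> int set \<Rightarrow> (int \<Rightarrow> ennreal) \<Rightarrow> ennreal" where
  "seq_norm q J a =
     (if q = \<infinity> then (SUP j\<in>J. a j)
      else epowr (\<Sum>\<^sub>\<infinity>j\<in>J. epowr (a j) (enn2real q)) (1 / enn2real q))"

text \<open>The norms are those of \<open>L\<^sup>p(P; l\<^sup>q)\<close> and \<open>l\<^sup>q(L\<^sup>p(P))\<close>, applied to
  \<open>2\<^sup>j\<^sup>s (\<phi>\<^sub>j * f)\<close> for \<open>j \<ge> j\<^sub>P\<close>; infinite exponents are covered by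
  \<^const>\<open>lebesgue_norm\<close> and \<^const>\<open>seq_norm\<close>.\<close>

definition triebel_lizorkin_norm ::
    "(real^'n::finite \<Rightarrow> complex) \<Rightarrow> real \<Rightarrow> real \<Rightarrow> ennreal \<Rightarrow> ennreal \<Rightarrow>
     ((real^'n \<Rightarrow> complex) \<Rightarrow> complex) \<Rightarrow> ennreal" where
  "triebel_lizorkin_norm \<phi> s \<tau> p q f =
     (SUP P. ennreal (1 / vol P powr \<tau>) *
        lebesgue_norm p (cube P) (\<lambda>x. seq_norm q {fst P..}
          (\<lambda>j. ennreal (2 powr (of_int j * s) * norm (conv f (dilate j \<phi>) x)))))"

definition besov_norm ::
    "(real^'n::finite \<Rightarrow> complex) \<Rightarrow> real \<Rightarrow> real \<Rightarrow> ennreal \<Rightarrow> ennreal \<Rightarrow>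
     ((real^'n \<Rightarrow> complex) \<Rightarrow> complex) \<Rightarrow> ennreal" where
  "besov_norm \<phi> s \<tau> p q f =
     (SUP P. ennreal (1 / vol P powr \<tau>) *
        seq_norm q {fst P..} (\<lambda>j. ennreal (2 powr (of_int j * s)) *
          lebesgue_norm p (cube P) (\<lambda>x. ennreal (norm (conv f (dilate j \<phi>) x)))))"

text \<open>The common norm of the classical spaces \<open>F\<close> and \<open>B\<close> with smoothness \<open>\<sigma>\<close> and
  \<open>p = q = \<infinity>\<close>.\<close>

definition classical_inf_norm ::
    "(real^'n::finite \<Rightarrow> complex) \<Rightarrow> real \<Rightarrow> ((real^'n \<Rightarrow> complex) \<Rightarrow> complex) \<Rightarrow> ennreal" where
  "classical_inf_norm \<phi> \<sigma> f =
     (SUP j::int. ennreal (2 powr (of_int j * \<sigma>)) *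
        esssup lborel (\<lambda>x. ennreal (norm (conv f (dilate j \<phi>) x))))"

definition cmo_norm ::
    "(real^'n::finite \<Rightarrow> complex) \<Rightarrow> real \<Rightarrow> real \<Rightarrow> real \<Rightarrow>
     ((real^'n \<Rightarrow> complex) \<Rightarrow> complex) \<Rightarrow> ennreal" where
  "cmo_norm \<phi> s q r f =
     (SUP P. epowr (ennreal (vol P powr (- r)) *
        (\<integral>\<^sup>+x\<in>cube P. (\<Sum>\<^sub>\<infinity>Q\<in>{Q. cube Q \<subseteq> cube P}.
           ennreal ((vol Q powr (- s / real CARD('n) - 1/2) * norm (f (phi_cube \<phi> Q))
             * indicator (cube Q) x) powr q)) \<partial>lborel)) (1 / q))"

text \<open>The case \<open>q = \<infinity>\<close>, with weight \<open>t = \<tau> - 1/p\<close>.\<close>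

definition cmo_inf_norm ::
    "(real^'n::finite \<Rightarrow> complex) \<Rightarrow> real \<Rightarrow> real \<Rightarrow>
     ((real^'n \<Rightarrow> complex) \<Rightarrow> complex) \<Rightarrow> ennreal" where
  "cmo_inf_norm \<phi> s t f =
     (SUP P. ennreal (vol P powr (- t)) *
        (SUP Q\<in>{Q. cube Q \<subseteq> cube P}.
           ennreal (vol Q powr (- s / real CARD('n) - 1/2) * norm (f (phi_cube \<phi> Q)))))"

definition cmo_norm_ext ::
    "(real^'n::finite \<Rightarrow> complex) \<Rightarrow> real \<Rightarrow> real \<Rightarrow> ennreal \<Rightarrow> ennreal \<Rightarrow>
     ((real^'n \<Rightarrow> complex) \<Rightarrow> complex) \<Rightarrow> ennreal" where
  "cmo_norm_ext \<phi> s \<tau> p q =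
     (if q = \<infinity> then cmo_inf_norm \<phi> s (\<tau> - enn2real (1 / p))
      else cmo_norm \<phi> s (enn2real q) (\<tau> * enn2real q + 1 - enn2real (q / p)))"

section \<open>Equality of spaces with equivalent quasi-norms\<close>

definition finite_norm_space ::
    "(((real^'n::finite \<Rightarrow> complex) \<Rightarrow> complex) \<Rightarrow> ennreal) \<Rightarrow>
     ((real^'n \<Rightarrow> complex) \<Rightarrow> complex) set" where
  "finite_norm_space N = {f \<in> schwartz_inf_dual. N f < \<infinity>}"

definition same_space_equiv_norms ::
    "(((real^'n::finite \<Rightarrow> complex) \<Rightarrow> complex) \<Rightarrow> ennreal) \<Rightarrow>
     (((real^'n \<Rightarrow> complex) \<Rightarrow> complex) \<Rightarrow> ennreal) \<Rightarrow> bool" where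
  "same_space_equiv_norms N N' \<longleftrightarrow>
     finite_norm_space N = finite_norm_space N' \<and>
     (\<exists>C::real. C > 0 \<and> (\<forall>f\<in>finite_norm_space N. N' f \<le> ennreal C * N f \<and> N f \<le> ennreal C * N' f))"

end

theory Submission
  imports Defs "HOL-Real_Asymp.Real_Asymp" "HOL-Probability.Sinc_Integral"
    "HOL-Probability.Characteristic_Functions"
begin

text \<open>After rescaling to unit scale, everything rests on two identities for a continuous functional \<open>u\<close> on
  \<^const>\<open>schwartz_inf\<close> and \<open>g(x) = u(\<phi>(x - \<cdot>))\<close>. Since the spectrum of \<open>\<phi>\<close> lies inside \<open>[-\<pi>, \<pi>]\<^sup>n\<close>, expanding
  Fourier multipliers in Fourier series there gives the sampling formula
  \<open>g(x\<^sub>0 + x) = \<Sum>\<^sub>l \<kappa>(x + l) g(x\<^sub>0 - l)\<close> with a rapidly decreasing \<open>\<kappa>\<close>, and a local Calderon formula that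
  expresses the convolution with one admissible function through three neighbouring scales of another. Using
  lattice series instead of integrals makes these identities exact in the Schwartz topology, so that \<open>u\<close> can be
  applied termwise. The sampling formula bounds \<open>sup |g|\<close> by its lattice values and, for every \<open>p > 0\<close>, by the
  \<open>L\<^sup>p\<close> norms on unit cubes; the Calderon formula allows replacing \<open>\<phi>\<close> by its reflection, which is what the
  coefficients on cubes sample. Because \<open>\<tau> > 1/p\<close> (or \<open>q = \<infinity>\<close>), the sums over scales are geometric and only the
  largest cube matters, so all norms reduce to the supremum norm.\<close>

section \<open>Integration on \<open>\<real>\<^sup>n\<close>\<close>

text \<open>The exponent \<sigma> = s + n(\<tau> - 1/p) is dictated by scaling: for a cube P of
  level j, the factor |P|^(-\<tau>), the weight 2^(js) and the L^p norm of a constant over P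
  multiply to 2^(j\<sigma>). A converse estimate therefore has to use a single level j and cubes of
  exactly that level. Two obstacles shape it. For p < 1 neither duality nor an averaging inequality
  is at hand, so a pointwise lower bound on a subcube of fixed relative size replaces integral
  inequalities. Moreover every functional has its own order of growth, whereas the constants may
  depend on \<phi> and the exponents only. Fourier inversion and the Plancherel identity do not
  occur. Expansions are verified by comparing Fourier transforms, and uniqueness comes from the
  kernels ((1 + cos t)/2)^N. They are trigonometric polynomials, so vanishing of a transform on a
  lattice of frequencies can be tested against them; they lie between 0 and 1, and in the variable t
  sqrt N they tend to a Gaussian. The same kernels thus settle the transform on the whole space and
  Fourier series on the period cube.\<close>

lemma prod_Basis_vec:
  fixes g :: "real^'n::finite \<Rightarrow> 'b::comm_monoid_mult"
  shows "(\<Prod>b\<in>Basis. g b) = (\<Prod>i\<in>UNIV. g (axis i 1))"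
proof -
  have "Basis = (\<lambda>i. axis i 1 :: real^'n) ` UNIV"
    by (auto simp: Basis_vec_def)
  moreover have "inj (\<lambda>i::'n. axis i 1 :: real^'n)"
    by (auto simp: inj_on_def axis_eq_axis)
  ultimately show ?thesis using prod.reindex[of "\<lambda>i::'n. axis i 1 :: real^'n" UNIV g] by simp
qed

text \<open>Lebesgue measure on a Euclidean space is the image of a product measure indexed by
  \<open>Basis\<close>. The bijection \<open>ax\<close> between coordinates and \<open>Basis\<close>
  carries the product rule for integrals over to coordinates.\<close>

lemma
  fixes f :: "'n::finite \<Rightarrow> real \<Rightarrow> 'a::{real_normed_field,banach,second_countable_topology}"
  assumes f: "\<And>i. integrable lborel (f i)"
  shows integrable_lborel_prod: "integrable lborel (\<lambda>x::real^'n. \<Prod>i\<in>UNIV. f i (x $ i))"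
    and integral_lborel_prod: "(\<integral>x. (\<Prod>i\<in>UNIV. f i (x $ i)) \<partial>(lborel::(real^'n) measure)) = (\<Prod>i\<in>UNIV. \<integral>x. f i x \<partial>lborel)"
proof -
  interpret product_sigma_finite "\<lambda>_::real^'n. lborel :: real measure" by standard
  define ax where "ax = (\<lambda>i::'n. axis i 1 :: real^'n)"
  have inj: "inj ax" by (auto simp: inj_on_def axis_eq_axis ax_def)
  define g where "g = (\<lambda>b. f (inv ax b))"
  have [measurable]: "f i \<in> borel_measurable borel" for i using f[of i] by auto
  have g: "integrable lborel (g b)" for b unfolding g_def by (rule f)
  have eq: "(\<Prod>b\<in>Basis. g b (x \<bullet> b)) = (\<Prod>i\<in>UNIV. f i (x $ i))" for x :: "real^'n"
    unfolding prod_Basis_vec using inv_f_f[OF inj] by (intro prod.cong) (auto simp: g_def ax_def inner_axis)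
  have eq2: "(\<Prod>b\<in>Basis. g b (w b)) = (\<Prod>i\<in>UNIV. f i ((\<Sum>b\<in>Basis. w b *\<^sub>R b) $ i))" for w :: "real^'n \<Rightarrow> real"
  proof -
    have "(\<Prod>b\<in>Basis. g b ((\<Sum>b\<in>Basis. w b *\<^sub>R b) \<bullet> b)) = (\<Prod>b\<in>Basis. g b (w b))"
      by (rule prod.cong) auto
    then show ?thesis using eq by metis
  qed
  have m: "(\<lambda>f. \<Sum>b\<in>Basis. f b *\<^sub>R b :: real^'n) \<in> measurable (\<Pi>\<^sub>M b\<in>Basis. lborel) borel" by simp
  have m2: "(\<lambda>x::real^'n. \<Prod>i\<in>UNIV. f i (x $ i)) \<in> borel_measurable borel" by measurable
  have i1: "integrable (\<Pi>\<^sub>M b\<in>Basis. lborel) (\<lambda>x. \<Prod>b\<in>Basis. g b (x b))"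
    by (rule product_integrable_prod) (auto intro: g)
  show "integrable lborel (\<lambda>x::real^'n. \<Prod>i\<in>UNIV. f i (x $ i))"
    apply (subst lborel_eq)
    apply (subst integrable_distr_eq[OF m m2])
    using i1 unfolding eq2 by simp
  have "(\<integral>x. (\<Prod>i\<in>UNIV. f i (x $ i)) \<partial>(lborel::(real^'n) measure)) = (\<integral>x. (\<Prod>b\<in>Basis. g b (x b)) \<partial>(\<Pi>\<^sub>M b\<in>Basis. lborel))"
    apply (subst lborel_eq)
    apply (subst integral_distr[OF m m2])
    unfolding eq2 by simp
  also have "\<dots> = (\<Prod>b\<in>Basis. \<integral>x. g b x \<partial>lborel)"
    by (rule product_integral_prod) (auto intro: g)
  also have "\<dots> = (\<Prod>i\<in>UNIV. \<integral>x. f i x \<partial>lborel)"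
    unfolding prod_Basis_vec using inv_f_f[OF inj] by (intro prod.cong) (auto simp: g_def ax_def)
  finally show "(\<integral>x. (\<Prod>i\<in>UNIV. f i (x $ i)) \<partial>(lborel::(real^'n) measure)) = (\<Prod>i\<in>UNIV. \<integral>x. f i x \<partial>lborel)" .
qed

lemma nn_integral_affine_vec:
  fixes f :: "real^'n::finite \<Rightarrow> ennreal"
  assumes c: "c \<noteq> 0" and [measurable]: "f \<in> borel_measurable borel"
  shows "(\<integral>\<^sup>+x. f x \<partial>lborel) = ennreal (\<bar>c\<bar> ^ CARD('n)) * (\<integral>\<^sup>+x. f (t + c *\<^sub>R x) \<partial>lborel)"
  by (subst lborel_affine[OF c, of t])
     (simp add: nn_integral_density nn_integral_distr nn_integral_cmult)

lemma integrable_affine_vec: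
  fixes f :: "real^'n::finite \<Rightarrow> 'a :: {banach, second_countable_topology}"
  assumes f: "integrable lborel f" and c: "c \<noteq> 0"
  shows "integrable lborel (\<lambda>x. f (t + c *\<^sub>R x))"
  using f f[THEN borel_measurable_integrable] c unfolding integrable_iff_bounded
  by (subst (asm) nn_integral_affine_vec[where c=c and t=t]) (auto simp: ennreal_mult_less_top)

lemma integral_affine_vec:
  fixes f :: "real^'n::finite \<Rightarrow> 'a :: {banach, second_countable_topology}"
  assumes f: "integrable lborel f" and c: "c \<noteq> 0"
  shows "(\<integral>x. f x \<partial>lborel) = \<bar>c\<bar> ^ CARD('n) *\<^sub>R (\<integral>x. f (t + c *\<^sub>R x) \<partial>lborel)"
  using f[THEN borel_measurable_integrable] integrable_affine_vec[OF f c, of t]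
  by (subst lborel_affine[OF c, of t]) (simp add: integral_density integral_distr)

lemma integrable_inverse_square: "integrable lborel (\<lambda>x::real. 1 / (1 + x\<^sup>2))"
  using integrable_inverse_1_plus_square by (simp add: set_integrable_def einterval_def inverse_eq_divide)

text \<open>The exponent 2n makes the product of the integrable functions 1 / (1 + x_i^2) a
  majorant. One weight thus serves for integrals over the space and for sums over the
  lattice.\<close>

definition wt :: "real^'n::finite \<Rightarrow> real" where
  "wt x = 1 / (1 + norm x) ^ (2 * CARD('n))"

lemma wt_pos: "wt x > 0"
  by (simp add: wt_def add_pos_nonneg)

lemma wt_measurable [measurable]: "wt \<in> borel_measurable borel"
  unfolding wt_def by measurable

text \<open>Submultiplicativity is what moves polynomial weights from one argument of a convolution
  to the other.\<close>

lemma weight_add: "1 + norm (x + y) \<le> (1 + norm x) * (1 + norm (y::'a::real_normed_vector))"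
  using norm_triangle_ineq[of x y] by (simp add: algebra_simps) (smt (verit) mult_nonneg_nonneg norm_ge_zero)

lemma integrable_wt: "integrable lborel (wt :: real^'n::finite \<Rightarrow> real)"
proof (rule Bochner_Integration.integrable_bound)
  show "integrable lborel (\<lambda>x::real^'n. \<Prod>i\<in>UNIV. 1 / (1 + (x $ i)\<^sup>2))"
    by (rule integrable_lborel_prod) (rule integrable_inverse_square)
  show "AE x::real^'n in lborel. norm (wt x) \<le> norm (\<Prod>i\<in>UNIV. 1 / (1 + (x $ i)\<^sup>2))"
  proof (rule AE_I2)
    fix x :: "real^'n"
    have le: "1 + (x $ i)\<^sup>2 \<le> (1 + norm x)\<^sup>2" for i
    proof -
      have "\<bar>x $ i\<bar> \<le> norm x" by (rule component_le_norm_cart)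
      then have "(x $ i)\<^sup>2 \<le> (norm x)\<^sup>2" by (simp add: abs_le_square_iff[symmetric])
      then show ?thesis using norm_ge_zero[of x] by (simp add: power2_sum del: norm_ge_zero)
    qed
    have "(\<Prod>i\<in>(UNIV::'n set). 1 + (x $ i)\<^sup>2) \<le> (\<Prod>i\<in>(UNIV::'n set). (1 + norm x)\<^sup>2)"
      by (rule prod_mono) (auto intro: le add_nonneg_nonneg)
    then have *: "(\<Prod>i\<in>(UNIV::'n set). 1 + (x $ i)\<^sup>2) \<le> (1 + norm x) ^ (2 * CARD('n))"
      by (simp add: power_mult)
    have "(\<Prod>i\<in>(UNIV::'n set). 1 + (x $ i)\<^sup>2) > 0"
      by (rule prod_pos) (auto simp: add_pos_nonneg)
    then have "wt x \<le> 1 / (\<Prod>i\<in>(UNIV::'n set). 1 + (x $ i)\<^sup>2)"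
      unfolding wt_def using * by (simp add: frac_le)
    also have "\<dots> = (\<Prod>i\<in>UNIV. 1 / (1 + (x $ i)\<^sup>2))"
      by (simp add: prod_dividef)
    finally show "norm (wt x) \<le> norm (\<Prod>i\<in>UNIV. 1 / (1 + (x $ i)\<^sup>2))"
      using wt_pos[of x] by auto
  qed
qed measurable

section \<open>Rapidly decreasing functions\<close>

text \<open>Decay without smoothness. The class contains all derivatives of Schwartz functions as
  well as continuous functions of compact support, and it is stable under multiplication by
  coordinates, so that Fourier transforms can be differentiated inside it.\<close>

definition rapid :: "(real^'n::finite \<Rightarrow> complex) \<Rightarrow> bool" where
  "rapid h \<longleftrightarrow> h \<in> borel_measurable borel \<and> (\<forall>N. \<exists>C. \<forall>x. (1 + norm x) ^ N * norm (h x) \<le> C)"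

lemma rapid_measurable: "rapid h \<Longrightarrow> h \<in> borel_measurable borel"
  by (simp add: rapid_def)

lemma rapidD:
  assumes "rapid h"
  obtains C where "C > 0" "\<And>x. (1 + norm x) ^ N * norm (h x) \<le> C"
proof -
  obtain C where C: "\<And>x. (1 + norm x) ^ N * norm (h x) \<le> C" using assms unfolding rapid_def by blast
  show ?thesis by (rule that[of "max C 1"]) (auto intro: le_max_iff_disj[THEN iffD2] C)
qed

lemma rapidI:
  assumes "h \<in> borel_measurable borel" "\<And>N. \<exists>C. \<forall>x. (1 + norm x) ^ N * norm (h x) \<le> C"
  shows "rapid h"
  using assms by (simp add: rapid_def)

lemma rapid_bound_wt:
  assumes "rapid (h :: real^'n::finite \<Rightarrow> complex)"
  obtains C where "C > 0" "\<And>x. norm (h x) \<le> C * wt x"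
proof -
  obtain C where C: "C > 0" "\<And>x. (1 + norm x) ^ (2 * CARD('n)) * norm (h x) \<le> C" using rapidD[OF assms] by metis
  have "norm (h x) \<le> C * wt x" for x
    using C(2)[of x] unfolding wt_def by (simp add: field_simps add_pos_nonneg)
  with C(1) show ?thesis using that by blast
qed

lemma rapid_integrable: assumes "rapid h" shows "integrable lborel h"
proof -
  obtain C where C: "C > 0" "\<And>x. norm (h x) \<le> C * wt x" using rapid_bound_wt[OF assms] by blast
  show ?thesis
    by (rule Bochner_Integration.integrable_bound[of _ "\<lambda>x. C * wt x"])
      (use C integrable_wt rapid_measurable[OF assms] in \<open>auto intro!: AE_I2 order.trans[OF C(2)]\<close>)
qed

lemma rapid_bounded: assumes "rapid h" obtains C where "C > 0" "\<And>x. norm (h x) \<le> C"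
  using rapidD[OF assms, of 0] by auto

lemma rapid_dominated:
  assumes "rapid h" "g \<in> borel_measurable borel" "\<And>x. norm (g x) \<le> B * (1 + norm x) ^ k * norm (h x)" "B \<ge> 0"
  shows "rapid g"
proof (rule rapidI[OF assms(2)])
  fix N
  obtain C where C: "C > 0" "\<And>x. (1 + norm x) ^ (N + k) * norm (h x) \<le> C" using rapidD[OF assms(1)] by metis
  have "(1 + norm x) ^ N * norm (g x) \<le> B * C" for x
  proof -
    have "(1 + norm x) ^ N * norm (g x) \<le> (1 + norm x) ^ N * (B * (1 + norm x) ^ k * norm (h x))"
      by (intro mult_left_mono assms) auto
    also have "\<dots> = B * ((1 + norm x) ^ (N + k) * norm (h x))" by (simp add: power_add)
    also have "\<dots> \<le> B * C" using C assms(4) by (intro mult_left_mono) auto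
    finally show ?thesis .
  qed
  then show "\<exists>C. \<forall>x. (1 + norm x) ^ N * norm (g x) \<le> C" by blast
qed

lemma rapid_cmult: assumes "rapid h" shows "rapid (\<lambda>x. c * h x)"
  using rapid_measurable[OF assms]
  by (intro rapid_dominated[OF assms, of _ "norm c" 0]) (auto simp: norm_mult)

lemma rapid_coord: assumes "rapid h" shows "rapid (\<lambda>x. of_real (x $ i) * h x)"
proof (intro rapid_dominated[OF assms, of _ 1 1])
  show "(\<lambda>x. of_real (x $ i) * h x) \<in> borel_measurable borel" using rapid_measurable[OF assms] by measurable
  show "norm (of_real (x $ i) * h x) \<le> 1 * (1 + norm x)^1 * norm (h x)" for x
  proof -
    have "\<bar>x $ i\<bar> \<le> 1 + norm x" using component_le_norm_cart[of x i] by linarith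
    then show ?thesis by (auto simp: norm_mult intro: mult_right_mono)
  qed
qed auto

lemma rapid_norm: assumes "rapid h" shows "rapid (\<lambda>x. of_real (norm x) * h x)"
proof (intro rapid_dominated[OF assms, of _ 1 1])
  show "(\<lambda>x. of_real (norm x) * h x) \<in> borel_measurable borel" using rapid_measurable[OF assms] by measurable
qed (auto simp: norm_mult intro: mult_right_mono)

lemma rapid_add: assumes "rapid g" "rapid h" shows "rapid (\<lambda>x. g x + h x)"
proof (rule rapidI)
  show "(\<lambda>x. g x + h x) \<in> borel_measurable borel"
    using rapid_measurable[OF assms(1)] rapid_measurable[OF assms(2)] by measurable
  fix N
  obtain C where C: "C > 0" "\<And>x. (1 + norm x) ^ N * norm (g x) \<le> C" using rapidD[OF assms(1)] by metis
  obtain D where D: "D > 0" "\<And>x. (1 + norm x) ^ N * norm (h x) \<le> D" using rapidD[OF assms(2)] by metis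
  have "(1 + norm x) ^ N * norm (g x + h x) \<le> C + D" for x
  proof -
    have "(1 + norm x) ^ N * norm (g x + h x) \<le> (1 + norm x) ^ N * (norm (g x) + norm (h x))"
      by (intro mult_left_mono norm_triangle_ineq) auto
    then show ?thesis using C(2)[of x] D(2)[of x] by (simp add: algebra_simps)
  qed
  then show "\<exists>C. \<forall>x. (1 + norm x) ^ N * norm (g x + h x) \<le> C" by blast
qed

lemma rapid_affine:
  fixes h :: "real^'n::finite \<Rightarrow> complex"
  assumes "rapid h" "a \<noteq> 0" shows "rapid (\<lambda>x. h (t + a *\<^sub>R x))"
proof (rule rapidI)
  show "(\<lambda>x. h (t + a *\<^sub>R x)) \<in> borel_measurable borel" using rapid_measurable[OF assms(1)] by measurable
  fix N
  obtain C where C: "C > 0" "\<And>x. (1 + norm x) ^ N * norm (h x) \<le> C" using rapidD[OF assms(1)] by metis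
  \<comment> \<open>One factor pays for undoing the dilation by \<open>a\<close>, the other for
    undoing the translation by \<open>t\<close>.\<close>
  define b where "b = (1 + 1 / \<bar>a\<bar>) * (1 + norm t)"
  have b: "b \<ge> 0" by (simp add: b_def)
  have "(1 + norm x) ^ N * norm (h (t + a *\<^sub>R x)) \<le> b ^ N * C" for x
  proof -
    have "1 + norm (a *\<^sub>R x) \<le> (1 + norm (-t)) * (1 + norm (t + a *\<^sub>R x))"
      using weight_add[of "-t" "t + a *\<^sub>R x"] by simp
    then have 1: "1 + \<bar>a\<bar> * norm x \<le> (1 + norm t) * (1 + norm (t + a *\<^sub>R x))" by simp
    have 2: "1 + norm x \<le> (1 + 1 / \<bar>a\<bar>) * (1 + \<bar>a\<bar> * norm x)"
      using assms(2) by (simp add: field_simps)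
    have "(1 + 1 / \<bar>a\<bar>) * (1 + \<bar>a\<bar> * norm x) \<le> (1 + 1 / \<bar>a\<bar>) * ((1 + norm t) * (1 + norm (t + a *\<^sub>R x)))"
      by (rule mult_left_mono[OF 1]) auto
    with 2 have "1 + norm x \<le> b * (1 + norm (t + a *\<^sub>R x))" unfolding b_def by (simp add: mult.assoc)
    then have "(1 + norm x) ^ N \<le> (b * (1 + norm (t + a *\<^sub>R x))) ^ N" by (intro power_mono) auto
    then have "(1 + norm x) ^ N * norm (h (t + a *\<^sub>R x)) \<le> (b * (1 + norm (t + a *\<^sub>R x))) ^ N * norm (h (t + a *\<^sub>R x))"
      by (rule mult_right_mono) auto
    also have "\<dots> = b ^ N * ((1 + norm (t + a *\<^sub>R x)) ^ N * norm (h (t + a *\<^sub>R x)))" by (simp add: power_mult_distrib)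
    also have "\<dots> \<le> b ^ N * C" using b by (intro mult_left_mono C) auto
    finally show ?thesis .
  qed
  then show "\<exists>C. \<forall>x. (1 + norm x) ^ N * norm (h (t + a *\<^sub>R x)) \<le> C" by blast
qed

section \<open>The Fourier transform\<close>

lemma norm_cis_diff_le: "norm (cis a - cis b) \<le> \<bar>a - b\<bar>"
proof -
  have "cis a - cis b = cis b * (cis (a - b) - 1)" by (simp add: algebra_simps cis_mult)
  then have "norm (cis a - cis b) = norm (cis (a - b) - 1)" by (simp add: norm_mult)
  also have "\<dots> \<le> \<bar>a - b\<bar>"
    using iexp_approx1[of "a - b" 0] by (simp add: cis_conv_exp mult.commute)
  finally show ?thesis .
qed

lemma norm_cis_taylor: "norm (cis a - 1 - \<i> * of_real a) \<le> a\<^sup>2 / 2"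
  using iexp_approx1[of a 1] by (simp add: cis_conv_exp mult.commute power2_eq_square algebra_simps)

lemma cis_measurable [measurable]: "cis \<in> borel_measurable borel"
  by (intro borel_measurable_continuous_onI continuous_intros)

lemma integrable_cis_mult:
  fixes h :: "'a \<Rightarrow> complex"
  assumes h: "integrable M h" and [measurable]: "a \<in> borel_measurable M"
  shows "integrable M (\<lambda>x. cis (a x) * h x)"
  by (rule Bochner_Integration.integrable_bound[OF h])
     (use h[THEN borel_measurable_integrable] in \<open>auto simp: norm_mult\<close>)

lemma fourier_affine:
  fixes h :: "real^'n::finite \<Rightarrow> complex"
  assumes h: "integrable lborel h" and a: "a \<noteq> 0"
  shows "fourier (\<lambda>x. h (t + a *\<^sub>R x)) \<xi> = cis ((t \<bullet> \<xi>) / a) * fourier h (\<xi> /\<^sub>R a) / of_real (\<bar>a\<bar> ^ CARD('n))"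
proof -
  define F where "F = (\<lambda>y. cis (- (((y - t) \<bullet> \<xi>) / a)) * h y)"
  have iF: "integrable lborel F" unfolding F_def by (intro integrable_cis_mult h) measurable
  have "cis (- (((y - t) \<bullet> \<xi>) / a)) = cis ((t \<bullet> \<xi>) / a) * cis (- (y \<bullet> (\<xi> /\<^sub>R a)))" for y
    by (subst cis_mult) (rule arg_cong[where f=cis], simp add: inner_diff_left divide_inverse algebra_simps)
  then have "F y = cis ((t \<bullet> \<xi>) / a) * (cis (- (y \<bullet> (\<xi> /\<^sub>R a))) * h y)" for y
    by (simp add: F_def)
  then have 1: "(\<integral>y. F y \<partial>lborel) = cis ((t \<bullet> \<xi>) / a) * fourier h (\<xi> /\<^sub>R a)"
    unfolding fourier_def by simp
  have "(\<integral>y. F y \<partial>lborel) = \<bar>a\<bar> ^ CARD('n) *\<^sub>R (\<integral>x. F (t + a *\<^sub>R x) \<partial>lborel)"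
    by (rule integral_affine_vec[OF iF a])
  also have "(\<lambda>x. F (t + a *\<^sub>R x)) = (\<lambda>x. cis (- (x \<bullet> \<xi>)) * h (t + a *\<^sub>R x))"
    using a by (auto simp: F_def)
  finally have "(\<integral>y. F y \<partial>lborel) = \<bar>a\<bar> ^ CARD('n) *\<^sub>R fourier (\<lambda>x. h (t + a *\<^sub>R x)) \<xi>"
    unfolding fourier_def .
  with 1 a show ?thesis by (simp add: field_simps scaleR_conv_of_real)
qed

lemma fourier_translate:
  assumes "integrable lborel h"
  shows "fourier (\<lambda>x. h (x - l)) \<xi> = cis (- (l \<bullet> \<xi>)) * fourier h \<xi>"
  using fourier_affine[OF assms, of 1 "-l" \<xi>] by simp

lemma fourier_cmult: "fourier (\<lambda>x. c * h x) \<xi> = c * fourier h \<xi>"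
  unfolding fourier_def by (subst mult.left_commute) simp

lemma fourier_diff:
  assumes "integrable lborel g" "integrable lborel h"
  shows "fourier (\<lambda>x. g x - h x) \<xi> = fourier g \<xi> - fourier h \<xi>"
  unfolding fourier_def right_diff_distrib
  by (rule Bochner_Integration.integral_diff) (intro integrable_cis_mult assms; measurable)+

text \<open>The first moment \<open>L\<close> of \<open>h\<close> is a Lipschitz constant of its
  transform.\<close>

lemma continuous_fourier:
  assumes "rapid h"
  shows "continuous_on UNIV (fourier h)"
proof -
  have i: "integrable lborel h" by (rule rapid_integrable[OF assms])
  define L where "L = (\<integral>x. norm x * norm (h x) \<partial>lborel)"
  have iL: "integrable lborel (\<lambda>x. norm x * norm (h x))"
    using integrable_norm[OF rapid_integrable[OF rapid_norm[OF assms]]] by (simp add: norm_mult)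
  have "norm (fourier h \<xi> - fourier h \<eta>) \<le> L * norm (\<xi> - \<eta>)" for \<xi> \<eta>
  proof -
    have "fourier h \<xi> - fourier h \<eta> = (\<integral>x. cis (- (x \<bullet> \<xi>)) * h x - cis (- (x \<bullet> \<eta>)) * h x \<partial>lborel)"
      unfolding fourier_def by (rule Bochner_Integration.integral_diff[symmetric]) (intro integrable_cis_mult i; measurable)+
    also have "norm \<dots> \<le> (\<integral>x. norm (\<xi> - \<eta>) * (norm x * norm (h x)) \<partial>lborel)"
    proof (rule Bochner_Integration.integral_norm_bound_integral)
      show "integrable lborel (\<lambda>x. cis (- (x \<bullet> \<xi>)) * h x - cis (- (x \<bullet> \<eta>)) * h x)"
        by (intro Bochner_Integration.integrable_diff integrable_cis_mult i) measurable
      show "integrable lborel (\<lambda>x. norm (\<xi> - \<eta>) * (norm x * norm (h x)))" using iL by simp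
      fix x
      have "norm (cis (- (x \<bullet> \<xi>)) * h x - cis (- (x \<bullet> \<eta>)) * h x) = norm (cis (- (x \<bullet> \<xi>)) - cis (- (x \<bullet> \<eta>))) * norm (h x)"
        by (simp add: left_diff_distrib[symmetric] norm_mult)
      also have "\<dots> \<le> \<bar>- (x \<bullet> \<xi>) - - (x \<bullet> \<eta>)\<bar> * norm (h x)" by (intro mult_right_mono norm_cis_diff_le) auto
      also have "\<bar>- (x \<bullet> \<xi>) - - (x \<bullet> \<eta>)\<bar> = \<bar>x \<bullet> (\<xi> - \<eta>)\<bar>" by (simp add: inner_diff_right abs_minus_commute)
      also have "\<bar>x \<bullet> (\<xi> - \<eta>)\<bar> * norm (h x) \<le> (norm x * norm (\<xi> - \<eta>)) * norm (h x)"
        by (intro mult_right_mono Cauchy_Schwarz_ineq2) auto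
      finally show "norm (cis (- (x \<bullet> \<xi>)) * h x - cis (- (x \<bullet> \<eta>)) * h x) \<le> norm (\<xi> - \<eta>) * (norm x * norm (h x))"
        by (simp add: mult_ac)
    qed
    also have "\<dots> = L * norm (\<xi> - \<eta>)" by (simp add: L_def)
    finally show ?thesis .
  qed
  moreover have "L \<ge> 0" unfolding L_def by (rule Bochner_Integration.integral_nonneg) auto
  ultimately have "L-lipschitz_on UNIV (fourier h)"
    by (intro lipschitz_onI) (auto simp: dist_norm)
  then show ?thesis by (rule lipschitz_on_continuous_on)
qed

text \<open>A quadratic bound on the remainder replaces differentiation under the integral sign: in
  the next lemma the remainder is controlled by a second moment of \<open>h\<close>.\<close>

lemma has_vector_derivative_quadratic:
  fixes f :: "real \<Rightarrow> 'a::real_normed_vector"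
  assumes "\<And>t. norm (f t - f 0 - t *\<^sub>R D) \<le> K * t\<^sup>2"
  shows "(f has_vector_derivative D) (at 0)"
  unfolding has_vector_derivative_def has_derivative_at
proof (intro conjI bounded_linear_scaleR_left)
  have "((\<lambda>t::real. K * \<bar>t\<bar>) \<longlongrightarrow> 0) (at 0)" by (auto intro!: tendsto_eq_intros)
  moreover have "norm (norm (f (0 + t) - f 0 - t *\<^sub>R D) / norm t) \<le> K * \<bar>t\<bar>" if "t \<noteq> 0" for t
  proof -
    have "norm (f (0 + t) - f 0 - t *\<^sub>R D) / norm t \<le> K * t\<^sup>2 / norm t" using assms[of t] by (intro divide_right_mono) auto
    also have "\<dots> = K * \<bar>t\<bar>" using that by (simp add: power2_eq_square abs_if)
    finally show ?thesis by simp
  qed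
  ultimately show "(\<lambda>h. norm (f (0 + h) - f 0 - h *\<^sub>R D) / norm h) \<midarrow>0\<rightarrow> 0"
    by (intro Lim_null_comparison[OF _ \<open>((\<lambda>t::real. K * \<bar>t\<bar>) \<longlongrightarrow> 0) (at 0)\<close>])
       (auto simp: eventually_at intro!: exI[of _ 1])
qed

lemma fourier_has_partial_derivative:
  fixes h :: "real^'n::finite \<Rightarrow> complex"
  assumes "rapid h"
  shows "((\<lambda>t. fourier h (\<xi> + t *\<^sub>R axis i 1)) has_vector_derivative fourier (\<lambda>x. - \<i> * (of_real (x $ i) * h x)) \<xi>) (at 0)"
proof (rule has_vector_derivative_quadratic)
  fix t
  define K where "K = (\<integral>x. norm (of_real (x $ i) * (of_real (x $ i) * h x)) \<partial>lborel) / 2"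
  have i: "integrable lborel h" by (rule rapid_integrable[OF assms])
  have i2: "integrable lborel (\<lambda>x. - \<i> * (of_real (x $ i) * h x))"
    by (rule rapid_integrable[OF rapid_cmult[OF rapid_coord[OF assms]]])
  have i3: "integrable lborel (\<lambda>x. norm (of_real (x $ i) * (of_real (x $ i) * h x)))"
    by (rule integrable_norm[OF rapid_integrable[OF rapid_coord[OF rapid_coord[OF assms]]]])
  let ?D = "fourier (\<lambda>x. - \<i> * (of_real (x $ i) * h x)) \<xi>"
  define e where "e = \<xi> + t *\<^sub>R axis i 1"
  let ?G = "\<lambda>x. cis (- (x \<bullet> e)) * h x - cis (- (x \<bullet> (\<xi> + 0 *\<^sub>R axis i 1))) * h x - t *\<^sub>R (cis (- (x \<bullet> \<xi>)) * (- \<i> * (of_real (x $ i) * h x)))"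
  have "fourier h e - fourier h (\<xi> + 0 *\<^sub>R axis i 1) - t *\<^sub>R ?D = (\<integral>x. ?G x \<partial>lborel)"
  proof -
    have gen: "(\<integral>x. a x - b x - t *\<^sub>R c x \<partial>lborel) = (\<integral>x. a x \<partial>lborel) - (\<integral>x. b x \<partial>lborel) - t *\<^sub>R (\<integral>x. c x \<partial>lborel)"
      if "integrable lborel a" "integrable lborel b" "integrable lborel c" for a b c :: "real^'n \<Rightarrow> complex"
      using that by simp
    show ?thesis unfolding fourier_def
      by (rule gen[symmetric]) (intro integrable_cis_mult i i2; measurable)+
  qed
  also have "norm \<dots> \<le> (\<integral>x. t\<^sup>2 / 2 * norm (of_real (x $ i) * (of_real (x $ i) * h x)) \<partial>lborel)"
  proof (rule Bochner_Integration.integral_norm_bound_integral)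
    show "integrable lborel ?G"
      by (intro Bochner_Integration.integrable_diff integrable_cis_mult integrable_scaleR_right i i2) measurable
    show "integrable lborel (\<lambda>x. t\<^sup>2 / 2 * norm (of_real (x $ i) * (of_real (x $ i) * h x)))"
      using i3 by simp
    fix x
    have xe: "x \<bullet> e = x \<bullet> \<xi> + t * x $ i" by (simp add: e_def inner_add_right inner_axis mult.commute)
    have ce: "cis (- (x \<bullet> e)) = cis (- (x \<bullet> \<xi>)) * cis (- (t * x $ i))" by (simp add: xe cis_mult)
    have "?G x = cis (- (x \<bullet> \<xi>)) * h x * (cis (- (t * x $ i)) - 1 - \<i> * of_real (- (t * x $ i)))"
      unfolding ce by (simp add: algebra_simps scaleR_conv_of_real)
    then have "norm (?G x) = norm (h x) * norm (cis (- (t * x $ i)) - 1 - \<i> * of_real (- (t * x $ i)))"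
      by (simp only: norm_mult norm_cis mult_1)
    also have "\<dots> \<le> norm (h x) * ((- (t * x $ i))\<^sup>2 / 2)" by (intro mult_left_mono norm_cis_taylor) auto
    also have "\<dots> = t\<^sup>2 / 2 * norm (of_real (x $ i) * (of_real (x $ i) * h x))"
      by (simp add: norm_mult power2_eq_square abs_mult_self)
    finally show "norm (?G x) \<le> t\<^sup>2 / 2 * norm (of_real (x $ i) * (of_real (x $ i) * h x))" .
  qed
  also have "\<dots> = K * t\<^sup>2" by (simp add: K_def)
  finally show "norm (fourier h (\<xi> + t *\<^sub>R axis i 1) - fourier h (\<xi> + 0 *\<^sub>R axis i 1) - t *\<^sub>R ?D) \<le> (\<integral>x. norm (of_real (x $ i) * (of_real (x $ i) * h x)) \<partial>lborel) / 2 * t\<^sup>2"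
    unfolding e_def K_def .
qed

section \<open>Integrals of directional derivatives and integration by parts\<close>

lemma wt_shift:
  fixes x :: "real^'n::finite"
  shows "wt (x + y) \<le> (1 + norm y) ^ (2 * CARD('n)) * wt x"
proof -
  have "1 + norm x \<le> (1 + norm (x + y)) * (1 + norm y)"
    using weight_add[of "x + y" "- y"] by simp
  then have "(1 + norm x) ^ (2 * CARD('n)) \<le> ((1 + norm (x + y)) * (1 + norm y)) ^ (2 * CARD('n))"
    by (intro power_mono) auto
  then have *: "(1 + norm x) ^ (2 * CARD('n)) \<le> (1 + norm (x + y)) ^ (2 * CARD('n)) * (1 + norm y) ^ (2 * CARD('n))"
    by (simp only: power_mult_distrib)
  have "1 / a \<le> c * (1 / b)" if "b \<le> a * c" "a > 0" "b > 0" for a b c :: real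
    using that by (simp add: field_simps)
  from this[OF *] show ?thesis unfolding wt_def by (simp add: add_pos_nonneg)
qed

text \<open>The hypothesis speaks of time 0 but of every base point; moving the base point along the
  line reaches every other time.\<close>

lemma directional_derivative_along:
  fixes F :: "real^'n::finite \<Rightarrow> complex"
  assumes "\<And>x. ((\<lambda>t. F (x + t *\<^sub>R v)) has_vector_derivative F' x) (at 0)"
  shows "((\<lambda>t. F (x + t *\<^sub>R v)) has_vector_derivative F' (x + s *\<^sub>R v)) (at s)"
proof -
  have "((\<lambda>t. F ((x + s *\<^sub>R v) + t *\<^sub>R v)) has_vector_derivative F' (x + s *\<^sub>R v)) (at (s - s))"
    using assms[of "x + s *\<^sub>R v"] by simp
  moreover have "((\<lambda>t. t - s) has_vector_derivative 1) (at s)"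
    by (auto intro!: derivative_eq_intros)
  ultimately have "((\<lambda>t. F ((x + s *\<^sub>R v) + t *\<^sub>R v)) \<circ> (\<lambda>t. t - s) has_vector_derivative 1 *\<^sub>R F' (x + s *\<^sub>R v)) (at s)"
    by (intro vector_diff_chain_at) auto
  then show ?thesis by (simp add: o_def algebra_simps)
qed

lemma norm_directional_increment_le:
  fixes F :: "real^'n::finite \<Rightarrow> complex"
  assumes der: "\<And>x. ((\<lambda>t. F (x + t *\<^sub>R v)) has_vector_derivative F' x) (at 0)"
    and B: "\<And>s. 0 \<le> s \<Longrightarrow> s \<le> t \<Longrightarrow> norm (F' (x + s *\<^sub>R v)) \<le> B" and t: "t \<ge> 0"
  shows "norm (F (x + t *\<^sub>R v) - F x) \<le> t * B"
proof (cases "t = 0")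
  case False
  with t have t: "0 < t" by simp
  note d = directional_derivative_along[OF der]
  have "\<exists>s\<in>{0<..<t}. norm (F (x + t *\<^sub>R v) - F (x + 0 *\<^sub>R v)) \<le> norm ((t - 0) *\<^sub>R F' (x + s *\<^sub>R v))"
  proof (rule mvt_general[OF t])
    show "continuous_on {0..t} (\<lambda>s. F (x + s *\<^sub>R v))"
      by (intro continuous_at_imp_continuous_on ballI has_vector_derivative_continuous[OF d])
    show "((\<lambda>s. F (x + s *\<^sub>R v)) has_derivative (\<lambda>h. h *\<^sub>R F' (x + s *\<^sub>R v))) (at s)" for s
      using d[of x s] by (simp add: has_vector_derivative_def)
  qed
  then obtain s where "0 < s" "s < t" "norm (F (x + t *\<^sub>R v) - F x) \<le> t * norm (F' (x + s *\<^sub>R v))"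
    using t by auto
  then show ?thesis using B[of s] t by (smt (verit) mult_left_mono)
qed simp

text \<open>Translation invariance makes the integral of every difference quotient vanish.\<close>

lemma integral_partial_derivative_zero:
  fixes F :: "real^'n::finite \<Rightarrow> complex"
  assumes der: "\<And>x. ((\<lambda>t. F (x + t *\<^sub>R axis i 1)) has_vector_derivative F' x) (at 0)"
    and F: "integrable lborel F" and [measurable]: "F' \<in> borel_measurable borel"
    and C: "\<And>x. norm (F' x) \<le> C * wt x" and C0: "C \<ge> 0"
  shows "(\<integral>x. F' x \<partial>lborel) = 0"
proof -
  define h where "h k = 1 / real (Suc k)" for k
  define q where "q k x = (F (x + h k *\<^sub>R axis i 1) - F x) /\<^sub>R h k" for k x
  \<comment> \<open>By \<open>wt_shift\<close>, \<open>wt\<close> changes by at most the factor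
    2^(2n) under a shift of length at most 1. This gives one majorant for all difference quotients,
    since the steps \<open>h k\<close> do not exceed 1.\<close>
  define D where "D = C * 2 ^ (2 * CARD('n))"
  have [measurable]: "F \<in> borel_measurable borel" using F by auto
  have h: "h k > 0" "h k \<le> 1" "h k \<noteq> 0" for k by (auto simp: h_def)
  have iFs: "integrable lborel (\<lambda>x. F (x + h k *\<^sub>R axis i 1))" for k
    using integrable_affine_vec[OF F, of 1 "h k *\<^sub>R axis i 1"] by (simp add: add.commute)
  have "(\<integral>x. F (x + h k *\<^sub>R axis i 1) \<partial>lborel) = (\<integral>x. F x \<partial>lborel)" for k
    using integral_affine_vec[OF F, of 1 "h k *\<^sub>R axis i 1"] by (simp add: add.commute)
  then have q0: "(\<integral>x. q k x \<partial>lborel) = 0" for k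
    unfolding q_def using iFs F by simp
  have "(\<lambda>k. \<integral>x. q k x \<partial>lborel) \<longlonglongrightarrow> (\<integral>x. F' x \<partial>lborel)"
  proof (rule integral_dominated_convergence[where w="\<lambda>x. D * wt x"])
    show "integrable lborel (\<lambda>x::real^'n. D * wt x)" by (simp add: integrable_wt)
    show "q k \<in> borel_measurable lborel" for k unfolding q_def by measurable
    show "AE x in lborel. (\<lambda>k. q k x) \<longlonglongrightarrow> F' x"
    proof (rule AE_I2)
      fix x
      have "((\<lambda>t. (F (x + t *\<^sub>R axis i 1) - F x) /\<^sub>R t) \<longlongrightarrow> F' x) (at 0)"
      proof (rule LIM_zero_cancel, rule tendsto_norm_zero_cancel)
        have lim: "(\<lambda>t. norm (F (x + t *\<^sub>R axis i 1) - F x - t *\<^sub>R F' x) / norm t) \<midarrow>0\<rightarrow> 0"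
          using der[of x] by (simp add: has_vector_derivative_def has_derivative_at)
        have "norm (F (x + t *\<^sub>R axis i 1) - F x - t *\<^sub>R F' x) / norm t = norm ((F (x + t *\<^sub>R axis i 1) - F x) /\<^sub>R t - F' x)"
          if "t \<noteq> 0" for t
        proof -
          have "(F (x + t *\<^sub>R axis i 1) - F x) /\<^sub>R t - F' x = (F (x + t *\<^sub>R axis i 1) - F x - t *\<^sub>R F' x) /\<^sub>R t"
            using that by (simp add: scaleR_diff_right)
          then show ?thesis using that by (simp add: divide_inverse mult.commute)
        qed
        then show "(\<lambda>t. norm ((F (x + t *\<^sub>R axis i 1) - F x) /\<^sub>R t - F' x)) \<midarrow>0\<rightarrow> 0"
          by (intro Lim_transform_eventually[OF lim]) (auto simp: eventually_at intro!: exI[of _ 1])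
      qed
      moreover have "filterlim h (at 0) sequentially"
        unfolding filterlim_at using h LIMSEQ_inverse_real_of_nat by (simp add: h_def[abs_def] inverse_eq_divide)
      ultimately show "(\<lambda>k. q k x) \<longlonglongrightarrow> F' x"
        unfolding q_def by (rule filterlim_compose)
    qed
    show "AE x in lborel. norm (q k x) \<le> D * wt x" for k
    proof (rule AE_I2)
      fix x
      have "norm (F (x + h k *\<^sub>R axis i 1) - F x) \<le> h k * (D * wt x)"
      proof (rule norm_directional_increment_le[OF der])
        fix s assume s: "0 \<le> s" "s \<le> h k"
        have "norm (F' (x + s *\<^sub>R axis i 1)) \<le> C * wt (x + s *\<^sub>R axis i 1)" by (rule C)
        also have "\<dots> \<le> C * ((1 + norm (s *\<^sub>R (axis i 1 :: real^'n))) ^ (2 * CARD('n)) * wt x)"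
          using C0 by (intro mult_left_mono wt_shift)
        also have "\<dots> \<le> C * (2 ^ (2 * CARD('n)) * wt x)"
        proof -
          have "(1 + norm (s *\<^sub>R (axis i 1 :: real^'n))) ^ (2 * CARD('n)) \<le> 2 ^ (2 * CARD('n))"
            using s h(2)[of k] by (intro power_mono) (auto simp: norm_axis_1)
          then show ?thesis using C0 less_imp_le[OF wt_pos, of x] by (intro mult_left_mono mult_right_mono)
        qed
        finally show "norm (F' (x + s *\<^sub>R axis i 1)) \<le> D * wt x" by (simp add: D_def)
      qed (use h[of k] in auto)
      moreover have "norm (q k x) = norm (F (x + h k *\<^sub>R axis i 1) - F x) / h k"
        using h[of k] by (simp add: q_def divide_inverse mult.commute)
      ultimately show "norm (q k x) \<le> D * wt x" using h(1)[of k] by (simp add: pos_divide_le_eq mult_ac)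
    qed
  qed measurable
  then show ?thesis using q0 LIMSEQ_unique[OF _ tendsto_const] by simp
qed

lemma has_vector_derivative_cis_inner:
  fixes x y :: "real^'n::finite"
  shows "((\<lambda>t. cis ((x + t *\<^sub>R axis i 1) \<bullet> y)) has_vector_derivative \<i> * of_real (y $ i) * cis (x \<bullet> y)) (at 0)"
proof -
  have "((\<lambda>t. exp (\<i> * of_real (x \<bullet> y + t * y $ i))) has_vector_derivative \<i> * of_real (y $ i) * exp (\<i> * of_real (x \<bullet> y))) (at 0)"
  proof -
    have "((\<lambda>z. exp (\<i> * (of_real (x \<bullet> y) + z * of_real (y $ i)))) has_field_derivative \<i> * of_real (y $ i) * exp (\<i> * of_real (x \<bullet> y))) (at (of_real 0))"
      by (auto intro!: derivative_eq_intros)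
    from has_vector_derivative_real_field[OF this] show ?thesis by simp
  qed
  then show ?thesis by (simp add: cis_conv_exp inner_add_left inner_axis' )
qed

text \<open>Integration by parts: \<open>F'\<close> is the derivative of the product of the
  character and \<open>h\<close>, so its integral vanishes.\<close>

lemma integral_cis_partial_derivative:
  fixes h :: "real^'n::finite \<Rightarrow> complex"
  assumes der: "\<And>x. ((\<lambda>t. h (x + t *\<^sub>R axis i 1)) has_vector_derivative h' x) (at 0)"
    and h: "rapid h" and h': "rapid h'"
  shows "(\<integral>x. cis (x \<bullet> y) * h' x \<partial>lborel) = - \<i> * of_real (y $ i) * (\<integral>x. cis (x \<bullet> y) * h x \<partial>lborel)"
proof -
  note [measurable] = rapid_measurable[OF h] rapid_measurable[OF h']
  define F' where "F' x = cis (x \<bullet> y) * h' x + (\<i> * of_real (y $ i) * cis (x \<bullet> y)) * h x" for x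
  have r: "rapid F'" unfolding F'_def
    by (intro rapid_add)
       (rule rapid_dominated[OF h', of _ 1 0] rapid_dominated[OF h, of _ "\<bar>y $ i\<bar>" 0]; auto simp: norm_mult)+
  obtain C where C: "C > 0" "\<And>x. norm (F' x) \<le> C * wt x" using rapid_bound_wt[OF r] by blast
  have i1: "integrable lborel (\<lambda>x. cis (x \<bullet> y) * h' x)" and i2: "integrable lborel (\<lambda>x. cis (x \<bullet> y) * h x)"
    by (intro integrable_cis_mult rapid_integrable h h'; measurable)+
  have "(\<integral>x. F' x \<partial>lborel) = 0"
  proof (rule integral_partial_derivative_zero[where F="\<lambda>x. cis (x \<bullet> y) * h x" and i=i and C=C])
    fix x
    show "((\<lambda>t. cis ((x + t *\<^sub>R axis i 1) \<bullet> y) * h (x + t *\<^sub>R axis i 1)) has_vector_derivative F' x) (at 0)"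
      using has_vector_derivative_mult[OF has_vector_derivative_cis_inner[of x i y] der[of x]]
      by (simp add: F'_def)
  qed (use C i2 rapid_measurable[OF r] in auto)
  moreover have "(\<integral>x. F' x \<partial>lborel) = (\<integral>x. cis (x \<bullet> y) * h' x \<partial>lborel) + (\<integral>x. (\<i> * of_real (y $ i)) * (cis (x \<bullet> y) * h x) \<partial>lborel)"
    unfolding F'_def using i1 i2
    by (subst Bochner_Integration.integral_add[symmetric]) (auto simp: mult.assoc)
  ultimately show ?thesis by (simp add: add_eq_0_iff)
qed

lemma fourier_partial_derivative:
  fixes h :: "real^'n::finite \<Rightarrow> complex"
  assumes der: "\<And>x. ((\<lambda>t. h (x + t *\<^sub>R axis i 1)) has_vector_derivative h' x) (at 0)"
    and h: "rapid h" and h': "rapid h'"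
  shows "fourier h' \<xi> = \<i> * of_real (\<xi> $ i) * fourier h \<xi>"
  using integral_cis_partial_derivative[OF der h h', of "- \<xi>"] by (simp add: fourier_def)

text \<open>Near 0 the base behaves like 1 - v^2 / (4N), which explains the 4 in the
  Gaussian.\<close>

lemma cos_power_limit: "(\<lambda>N. ((1 + cos (v / sqrt (real N))) / 2) ^ N) \<longlonglongrightarrow> exp (- v\<^sup>2 / 4)"
proof -
  have "(\<lambda>N. ((1 + cos (v / sqrt (real N))) / 2) powr real N) \<longlonglongrightarrow> exp (- (v * v / 4))"
    by real_asymp
  then have "(\<lambda>N. ((1 + cos (v / sqrt (real N))) / 2) powr real N) \<longlonglongrightarrow> exp (- v\<^sup>2 / 4)"
    by (simp add: power2_eq_square)
  moreover have "eventually (\<lambda>N. (1 + cos (v / sqrt (real N))) / 2 > 0) sequentially"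
    by real_asymp
  ultimately show ?thesis
    by (rule Lim_transform_eventually[OF _ eventually_mono]) (auto simp: powr_realpow)
qed

section \<open>Uniqueness theorems\<close>

lemma LIMSEQ_of_zero_sequence:
  fixes X :: "nat \<Rightarrow> 'a::{t2_space,zero}"
  assumes "X \<longlonglongrightarrow> l" "\<And>n. X n = 0"
  shows "l = 0"
proof -
  have "X = (\<lambda>n. 0)" using assms(2) by auto
  with assms(1) show ?thesis by (auto intro: LIMSEQ_unique[OF _ tendsto_const])
qed

text \<open>Multiplying by \<open>(1 + cos (a x\<^sub>i - b)) / 2\<close> only mixes Fourier coefficients at distance \<open>a\<close>.\<close>

lemma fourier_vanishes_mult_cos:
  fixes g :: "real^'n::finite \<Rightarrow> complex" and b :: real
  assumes g: "integrable lborel g" and z: "\<And>\<xi>. \<xi> \<in> X \<Longrightarrow> fourier g \<xi> = 0"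
    and X: "\<And>\<xi>. \<xi> \<in> X \<Longrightarrow> \<xi> + a *\<^sub>R axis i 1 \<in> X" "\<And>\<xi>. \<xi> \<in> X \<Longrightarrow> \<xi> - a *\<^sub>R axis i 1 \<in> X"
  defines "g' \<equiv> (\<lambda>x. g x * of_real ((1 + cos (a * x $ i - b)) / 2))"
  shows "integrable lborel g'" "\<And>\<xi>. \<xi> \<in> X \<Longrightarrow> fourier g' \<xi> = 0"
proof -
  have [measurable]: "g \<in> borel_measurable borel" using g by auto
  show "integrable lborel g'" unfolding g'_def
  proof (rule Bochner_Integration.integrable_bound[OF g])
    show "AE x in lborel. norm (g x * of_real ((1 + cos (a * x $ i - b)) / 2)) \<le> norm (g x)"
    proof (rule AE_I2)
      fix x :: "real^'n"
      have "\<bar>(1 + cos (a * x $ i - b)) / 2\<bar> \<le> 1"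
        using cos_ge_minus_one[of "a * x $ i - b"] cos_le_one[of "a * x $ i - b"] by (auto simp: abs_if simp del: cos_ge_minus_one cos_le_one)
      then show "norm (g x * of_real ((1 + cos (a * x $ i - b)) / 2)) \<le> norm (g x)"
        by (simp only: norm_mult norm_of_real mult_left_le norm_ge_zero)
    qed
  qed measurable
  fix \<xi> assume \<xi>: "\<xi> \<in> X"
  have i: "integrable lborel (\<lambda>x. cis (- (x \<bullet> \<eta>)) * g x)" for \<eta> by (intro integrable_cis_mult g) measurable
  have "cis (- (x \<bullet> \<xi>)) * g' x = (1/2) * (cis (- (x \<bullet> \<xi>)) * g x)
      + (cis (- b) / 4) * (cis (- (x \<bullet> (\<xi> - a *\<^sub>R axis i 1))) * g x)
      + (cis b / 4) * (cis (- (x \<bullet> (\<xi> + a *\<^sub>R axis i 1))) * g x)" for x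
  proof -
    define u where "u = a * x $ i"
    have e: "x \<bullet> (\<xi> - a *\<^sub>R axis i 1) = x \<bullet> \<xi> - u" "x \<bullet> (\<xi> + a *\<^sub>R axis i 1) = x \<bullet> \<xi> + u"
      by (simp_all add: u_def inner_diff_right inner_add_right inner_axis)
    have c: "of_real (cos (u - b)) = (cis (u - b) + cis (- (u - b))) / 2"
      using cos_minus[of "u - b"] sin_minus[of "u - b"] by (simp add: complex_eq_iff)
    have m: "cis (- (x \<bullet> \<xi>)) * cis (u - b) = cis (- b) * cis (- (x \<bullet> \<xi> - u))"
       "cis (- (x \<bullet> \<xi>)) * cis (- (u - b)) = cis b * cis (- (x \<bullet> \<xi> + u))"
      by (simp_all add: cis_mult algebra_simps)
    have "cis (- (x \<bullet> \<xi>)) * g' x = (1/2) * (cis (- (x \<bullet> \<xi>)) * g x)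
      + (1/4) * (cis (- (x \<bullet> \<xi>)) * cis (u - b)) * g x
      + (1/4) * (cis (- (x \<bullet> \<xi>)) * cis (- (u - b))) * g x"
      unfolding g'_def u_def[symmetric] by (simp add: c field_simps)
    then show ?thesis unfolding m e by (simp add: mult.assoc)
  qed
  then have "fourier g' \<xi> = (\<integral>x. (1/2) * (cis (- (x \<bullet> \<xi>)) * g x)
      + (cis (- b) / 4) * (cis (- (x \<bullet> (\<xi> - a *\<^sub>R axis i 1))) * g x)
      + (cis b / 4) * (cis (- (x \<bullet> (\<xi> + a *\<^sub>R axis i 1))) * g x) \<partial>lborel)"
    unfolding fourier_def by simp
  also have "\<dots> = (1/2) * fourier g \<xi> + (cis (- b) / 4) * fourier g (\<xi> - a *\<^sub>R axis i 1) + (cis b / 4) * fourier g (\<xi> + a *\<^sub>R axis i 1)"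
    unfolding fourier_def using i by simp
  also have "\<dots> = 0" using z X \<xi> by simp
  finally show "fourier g' \<xi> = 0" .
qed

text \<open>A nonnegative trigonometric polynomial with frequencies in the lattice generated by
  \<open>a\<close> in each coordinate. A power of a raised cosine is preferred to a summability
  kernel of Fejer type because it has a Gaussian majorant around its peak.\<close>

definition cos_kernel :: "real \<Rightarrow> nat \<Rightarrow> real^'n::finite \<Rightarrow> real" where
  "cos_kernel a N x = (\<Prod>i\<in>UNIV. ((1 + cos (a * x $ i)) / 2) ^ N)"

lemma half_one_plus_cos: "0 \<le> (1 + cos t) / 2" "(1 + cos t) / 2 \<le> (1::real)"
  using cos_ge_minus_one[of t] cos_le_one[of t] by (auto simp del: cos_ge_minus_one cos_le_one)

lemma cos_kernel_nonneg: "0 \<le> cos_kernel a N x"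
  unfolding cos_kernel_def by (intro prod_nonneg ballI zero_le_power half_one_plus_cos)

lemma cos_kernel_le_1: "cos_kernel a N x \<le> 1"
  unfolding cos_kernel_def by (intro prod_le_1 conjI zero_le_power power_le_one half_one_plus_cos)

lemma cos_kernel_measurable [measurable]: "cos_kernel a N \<in> borel_measurable borel"
  unfolding cos_kernel_def by measurable

text \<open>Each cosine factor preserves the vanishing of the transform on \<open>X\<close>;
  induction on powers and on coordinates collects all factors, and the frequency 0 gives the
  integral.\<close>

lemma fourier_vanishes_mult_cos_kernel:
  fixes g :: "real^'n::finite \<Rightarrow> complex"
  assumes g: "integrable lborel g" and z: "\<And>\<xi>. \<xi> \<in> X \<Longrightarrow> fourier g \<xi> = 0"
    and X: "\<And>\<xi> i. \<xi> \<in> X \<Longrightarrow> \<xi> + a *\<^sub>R axis i 1 \<in> X" "\<And>\<xi> i. \<xi> \<in> X \<Longrightarrow> \<xi> - a *\<^sub>R axis i 1 \<in> X"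
    and X0: "0 \<in> X"
  shows "(\<integral>x. g x * of_real (cos_kernel a N (x - y)) \<partial>lborel) = 0"
proof -
  define c where "c i x = (1 + cos (a * x $ i - a * y $ i)) / 2" for i and x :: "real^'n"
  have step: "integrable lborel (\<lambda>x. h x * of_real (c i x ^ k)) \<and> (\<forall>\<xi>\<in>X. fourier (\<lambda>x. h x * of_real (c i x ^ k)) \<xi> = 0)"
    if "integrable lborel h" "\<forall>\<xi>\<in>X. fourier h \<xi> = 0" for h i k
  proof (induction k)
    case (Suc k)
    have eq: "(\<lambda>x. h x * of_real (c i x ^ k) * of_real ((1 + cos (a * x $ i - a * y $ i)) / 2)) = (\<lambda>x. h x * of_real (c i x ^ Suc k))"
      by (simp add: fun_eq_iff c_def)
    show ?case
      using fourier_vanishes_mult_cos[where g="\<lambda>x. h x * of_real (c i x ^ k)" and X=X and a=a and i=i and b="a * y $ i"] Suc X unfolding eq by blast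
  qed (use that in simp)
  have "integrable lborel (\<lambda>x. g x * of_real (\<Prod>i\<in>S. c i x ^ N)) \<and> (\<forall>\<xi>\<in>X. fourier (\<lambda>x. g x * of_real (\<Prod>i\<in>S. c i x ^ N)) \<xi> = 0)"
    if "finite S" for S
    using that
  proof (induction S)
    case empty then show ?case using g z by simp
  next
    case (insert i S)
    then have "(\<lambda>x. g x * of_real (\<Prod>i\<in>S. c i x ^ N) * of_real (c i x ^ N)) = (\<lambda>x. g x * of_real (\<Prod>i\<in>insert i S. c i x ^ N))"
      by (simp add: fun_eq_iff mult_ac)
    with step[of "\<lambda>x. g x * of_real (\<Prod>i\<in>S. c i x ^ N)" i N] insert.IH show ?case by simp
  qed
  from this[of UNIV] X0 have "fourier (\<lambda>x. g x * of_real (\<Prod>i\<in>UNIV. c i x ^ N)) 0 = 0" by simp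
  then show ?thesis unfolding fourier_def cos_kernel_def c_def by (simp add: right_diff_distrib)
qed

text \<open>The limit of the rescaled cosine kernels, kept without a normalising constant: the
  arguments end by dividing by its positive integral.\<close>

definition gauss :: "real^'n::finite \<Rightarrow> real" where
  "gauss x = (\<Prod>i\<in>UNIV. exp (- (x $ i)\<^sup>2 / 4))"

lemma gauss_pos: "gauss x > 0"
  unfolding gauss_def by (rule prod_pos) auto

lemma gauss_le_1: "gauss x \<le> 1"
  unfolding gauss_def by (rule prod_le_1) auto

lemma gauss_measurable [measurable]: "gauss \<in> borel_measurable borel"
  unfolding gauss_def by measurable

lemma integrable_gauss_1d:
  assumes "c > 0" shows "integrable lborel (\<lambda>x::real. exp (- c * x\<^sup>2))"
proof (rule Bochner_Integration.integrable_bound)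
  show "integrable lborel (\<lambda>x::real. (1 + 1 / c) * (1 / (1 + x\<^sup>2)))" by (intro integrable_mult_right integrable_inverse_square)
  show "AE x in lborel. norm (exp (- c * x\<^sup>2)) \<le> norm ((1 + 1 / c) * (1 / (1 + x\<^sup>2)))"
  proof (rule AE_I2)
    fix x :: real
    have "1 + c * x\<^sup>2 \<le> exp (c * x\<^sup>2)" by (rule exp_ge_add_one_self)
    moreover have "1 + x\<^sup>2 \<le> (1 + 1 / c) * (1 + c * x\<^sup>2)" using assms by (simp add: field_simps add_nonneg_nonneg)
    ultimately have "1 + x\<^sup>2 \<le> (1 + 1 / c) * exp (c * x\<^sup>2)"
      using assms by (smt (verit) mult_left_mono divide_nonneg_pos)
    moreover have "1 + x\<^sup>2 > 0" by (simp add: add_pos_nonneg)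
    ultimately have "1 / exp (c * x\<^sup>2) \<le> (1 + 1 / c) * (1 / (1 + x\<^sup>2))" by (simp add: field_simps)
    then show "norm (exp (- c * x\<^sup>2)) \<le> norm ((1 + 1 / c) * (1 / (1 + x\<^sup>2)))"
      using assms by (simp add: exp_minus inverse_eq_divide abs_of_pos add_pos_pos add_pos_nonneg)
  qed
qed measurable

lemma integrable_gauss_prod:
  assumes "c > 0" shows "integrable lborel (\<lambda>x::real^'n::finite. \<Prod>i\<in>UNIV. exp (- c * (x $ i)\<^sup>2))"
  by (rule integrable_lborel_prod) (rule integrable_gauss_1d[OF assms])

lemma integrable_gauss: "integrable lborel (gauss :: real^'n::finite \<Rightarrow> real)"
  using integrable_gauss_prod[of "1/4", where ?'n='n] by (simp add: gauss_def[abs_def])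

lemma integral_gauss_pos: "(\<integral>x. gauss x \<partial>(lborel :: (real^'n::finite) measure)) > 0"
proof -
  have "(\<integral>x. gauss x \<partial>(lborel :: (real^'n) measure)) \<ge> 0"
    by (rule Bochner_Integration.integral_nonneg) (simp add: gauss_pos less_imp_le)
  moreover have "(\<integral>x. gauss x \<partial>(lborel :: (real^'n) measure)) \<noteq> 0"
  proof
    assume "(\<integral>x. gauss x \<partial>(lborel :: (real^'n) measure)) = 0"
    then have "AE x::real^'n in lborel. gauss x = 0"
      by (subst (asm) integral_nonneg_eq_0_iff_AE[OF integrable_gauss]) (auto simp: gauss_pos less_imp_le)
    then have "AE x::real^'n in lborel. False" by eventually_elim (use gauss_pos in \<open>auto simp: less_le\<close>)
    then show False by (simp add: AE_iff_null null_sets_def emeasure_lborel_UNIV)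
  qed
  ultimately show ?thesis by simp
qed

lemma cos_kernel_limit:
  assumes "r > 0"
  shows "(\<lambda>N. cos_kernel (1 / (r * sqrt (real N))) N x) \<longlonglongrightarrow> gauss (x /\<^sub>R r)"
proof -
  have "1 / (r * sqrt (real N)) * x $ i = (x /\<^sub>R r) $ i / sqrt (real N)" for N i
    by (simp add: inverse_eq_divide)
  then have "(\<lambda>N. ((1 + cos (1 / (r * sqrt (real N)) * x $ i)) / 2) ^ N) \<longlonglongrightarrow> exp (- ((x /\<^sub>R r) $ i)\<^sup>2 / 4)" for i
    using cos_power_limit[of "(x /\<^sub>R r) $ i"] by (simp only:)
  then show ?thesis unfolding cos_kernel_def gauss_def by (intro tendsto_prod)
qed

text \<open>All frequencies are available, so the frequency step of the kernel may shrink like 1 /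
  (r sqrt N). As N grows this shows that Gaussian averages of width \<open>r\<close> around
  \<open>y\<close> vanish, and as \<open>r\<close> tends to 0 continuity recovers
  \<open>h y\<close>.\<close>

lemma fourier_injective:
  fixes h :: "real^'n::finite \<Rightarrow> complex"
  assumes h: "integrable lborel h" and cont: "continuous_on UNIV h" and bd: "\<And>x. norm (h x) \<le> B"
    and z: "\<And>\<xi>. fourier h \<xi> = 0"
  shows "h y = 0"
proof -
  have [measurable]: "h \<in> borel_measurable borel" using h by auto
  have gauss0: "(\<integral>x. h x * of_real (gauss ((x - y) /\<^sub>R r)) \<partial>lborel) = 0" if r: "r > 0" for r
  proof -
    have "(\<lambda>N. \<integral>x. h x * of_real (cos_kernel (1 / (r * sqrt (real N))) N (x - y)) \<partial>lborel)
      \<longlonglongrightarrow> (\<integral>x. h x * of_real (gauss ((x - y) /\<^sub>R r)) \<partial>lborel)"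
    proof (rule integral_dominated_convergence[where w="\<lambda>x. norm (h x)"])
      show "integrable lborel (\<lambda>x. norm (h x))" using h by simp
      show "AE x in lborel. (\<lambda>N. h x * of_real (cos_kernel (1 / (r * sqrt (real N))) N (x - y)))
         \<longlonglongrightarrow> h x * of_real (gauss ((x - y) /\<^sub>R r))"
        by (intro AE_I2 tendsto_intros cos_kernel_limit r)
      show "AE x in lborel. norm (h x * of_real (cos_kernel (1 / (r * sqrt (real N))) N (x - y))) \<le> norm (h x)" for N
        by (intro AE_I2) (simp add: norm_mult cos_kernel_nonneg cos_kernel_le_1 mult_left_le)
    qed measurable
    moreover have "(\<integral>x. h x * of_real (cos_kernel (1 / (r * sqrt (real N))) N (x - y)) \<partial>lborel) = 0" for N
      by (rule fourier_vanishes_mult_cos_kernel[of h UNIV]) (use h z in auto)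
    ultimately show ?thesis by (rule LIMSEQ_of_zero_sequence)
  qed
  have scaled: "(\<integral>x. h (y + r *\<^sub>R x) * of_real (gauss x) \<partial>lborel) = 0" if r: "r > 0" for r
  proof -
    have "integrable lborel (\<lambda>x. h x * of_real (gauss ((x - y) /\<^sub>R r)))"
      by (rule Bochner_Integration.integrable_bound[OF h])
         (auto simp: norm_mult gauss_le_1 less_imp_le[OF gauss_pos] mult_left_le)
    from integral_affine_vec[OF this, of r y] gauss0[OF r] r show ?thesis by simp
  qed
  have "(\<lambda>m. \<integral>x. h (y + (1 / real (Suc m)) *\<^sub>R x) * of_real (gauss x) \<partial>lborel) \<longlonglongrightarrow> (\<integral>x. h y * of_real (gauss x) \<partial>(lborel :: (real^'n) measure))"
  proof (rule integral_dominated_convergence[where w="\<lambda>x::real^'n. B * gauss x"])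
    show "integrable lborel (\<lambda>x::real^'n. B * gauss x)" by (intro integrable_mult_right integrable_gauss)
    show "AE x in lborel. (\<lambda>m. h (y + (1 / real (Suc m)) *\<^sub>R x) * of_real (gauss x)) \<longlonglongrightarrow> h y * of_real (gauss x)"
    proof (intro AE_I2 tendsto_intros)
      fix x :: "real^'n"
      have "(\<lambda>m. y + (1 / real (Suc m)) *\<^sub>R x) \<longlonglongrightarrow> y + 0 *\<^sub>R x"
        using LIMSEQ_inverse_real_of_nat by (intro tendsto_intros) (simp add: inverse_eq_divide)
      then have "(\<lambda>m. y + (1 / real (Suc m)) *\<^sub>R x) \<longlonglongrightarrow> y" by simp
      moreover have "isCont h y" using cont by (simp add: continuous_on_eq_continuous_at)
      ultimately show "(\<lambda>m. h (y + (1 / real (Suc m)) *\<^sub>R x)) \<longlonglongrightarrow> h y" by (rule isCont_tendsto_compose[rotated])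
    qed
    show "AE x in lborel. norm (h (y + (1 / real (Suc m)) *\<^sub>R x) * of_real (gauss x)) \<le> B * gauss x" for m
      by (intro AE_I2) (simp add: norm_mult less_imp_le[OF gauss_pos] abs_of_pos[OF gauss_pos] bd mult_right_mono)
  qed measurable
  then have "(\<integral>x. h y * of_real (gauss x) \<partial>(lborel :: (real^'n) measure)) = 0"
    by (rule LIMSEQ_of_zero_sequence) (rule scaled, simp del: of_nat_Suc)
  then have "h y * of_real (\<integral>x. gauss x \<partial>(lborel :: (real^'n) measure)) = 0" by simp
  then show ?thesis using integral_gauss_pos[where ?'n='n] by simp
qed

text \<open>The local analogue: only the frequencies in \<open>\<int>\<^sup>n\<close> are tested, so \<open>h\<close> must live in a
  neighbourhood of \<open>y\<close> that contains no other point of \<open>y + 2\<pi>\<int>\<^sup>n\<close>.\<close>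

lemma fourier_coefficients_injective:
  fixes h :: "real^'n::finite \<Rightarrow> complex"
  assumes h: "integrable lborel h" and cont: "isCont h y" and bd: "\<And>x. norm (h x) \<le> B"
    and supp: "\<And>x i. h x \<noteq> 0 \<Longrightarrow> \<bar>x $ i - y $ i\<bar> \<le> \<rho>" and \<rho>: "0 < \<rho>" "\<rho> < 2 * pi"
    and z: "\<And>l::int^'n. fourier h (\<chi> i. of_int (l $ i)) = 0"
  shows "h y = 0"
proof -
  have [measurable]: "h \<in> borel_measurable borel" using h by auto
  define X where "X = range (\<lambda>l::int^'n. \<chi> i. real_of_int (l $ i))"
  have "(\<chi> i. real_of_int (l $ i)) + 1 *\<^sub>R axis i 1 \<in> X" "(\<chi> i. real_of_int (l $ i)) - 1 *\<^sub>R axis i 1 \<in> X" for l :: "int^'n" and i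
    unfolding X_def
    by (rule image_eqI[of _ _ "l + axis i 1"] image_eqI[of _ _ "l - axis i 1"]; simp add: vec_eq_iff axis_def)+
  moreover have "0 \<in> X" unfolding X_def by (rule image_eqI[of _ _ 0]) (auto simp: vec_eq_iff)
  ultimately have k0: "(\<integral>x. h x * of_real (cos_kernel 1 N (x - y)) \<partial>lborel) = 0" for N
    by (intro fourier_vanishes_mult_cos_kernel[of h X]) (use h z in \<open>auto simp: X_def\<close>)
  \<comment> \<open>The sine is concave on [0, pi] and so lies above its chord on [0, \<rho>/2]; the
    slope of that chord is \<open>2 * c\<close>. Since \<rho> < 2 pi, \<open>c\<close> is positive,
    and \<open>(1 + cos t) / 2 = 1 - sin^2 (t/2)\<close> has a Gaussian majorant for all t with |t|
    <= \<rho>.\<close>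
  define c where "c = sin (\<rho> / 2) / \<rho>"
  have c: "c > 0" using \<rho> by (auto simp: c_def intro!: divide_pos_pos sin_gt_zero)
  have cos_le: "(1 + cos t) / 2 \<le> exp (- (c * t)\<^sup>2)" if "\<bar>t\<bar> \<le> \<rho>" for t
  proof -
    have conc: "concave_on {0..pi} sin"
    proof (rule f''_le0_imp_concave)
      show "convex {0..pi}" by simp
      show "(sin has_real_derivative cos x) (at x)" "(cos has_real_derivative - sin x) (at x)" for x :: real
        by (auto intro!: derivative_eq_intros)
      show "- sin x \<le> 0" if "x \<in> {0..pi}" for x using that by (simp add: sin_ge_zero)
    qed
    have "(1 - \<bar>t\<bar> / \<rho>) * sin 0 + (\<bar>t\<bar> / \<rho>) * sin (\<rho> / 2) \<le> sin ((1 - \<bar>t\<bar> / \<rho>) *\<^sub>R 0 + (\<bar>t\<bar> / \<rho>) *\<^sub>R (\<rho> / 2))"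
      by (rule concave_onD[OF conc]) (use that \<rho> in \<open>auto simp: field_simps\<close>)
    then have "c * \<bar>t\<bar> \<le> sin (\<bar>t\<bar> / 2)" using \<rho> by (simp add: c_def field_simps)
    moreover have "0 \<le> c * \<bar>t\<bar>" using c by simp
    ultimately have "(c * \<bar>t\<bar>)\<^sup>2 \<le> (sin (\<bar>t\<bar> / 2))\<^sup>2" by (intro power_mono)
    moreover have "cos t = 1 - 2 * (sin (\<bar>t\<bar> / 2))\<^sup>2" using cos_double_sin[of "\<bar>t\<bar> / 2"] by simp
    ultimately have "(1 + cos t) / 2 \<le> 1 - (c * t)\<^sup>2" by (simp add: power_mult_distrib)
    also have "\<dots> \<le> exp (- (c * t)\<^sup>2)" using exp_ge_add_one_self[of "- (c * t)\<^sup>2"] by simp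
    finally show ?thesis .
  qed
  \<comment> \<open>The frequency step is fixed at 1, so one parameter has to serve twice: the
    kernel of power \<open>Suc N\<close> concentrates around \<open>y\<close> at width
    \<open>r N\<close>, and in the variable rescaled by \<open>r N\<close> it tends to
    \<open>gauss\<close>.\<close>
  define r where "r N = 1 / sqrt (real (Suc N))" for N
  have r: "r N > 0" "r N \<noteq> 0" for N by (auto simp: r_def)
  have r2: "(r N)\<^sup>2 * real (Suc N) = 1" for N by (simp add: r_def power_divide del: of_nat_Suc)
  have scaled: "(\<integral>x. h (y + r N *\<^sub>R x) * of_real (cos_kernel (r N) (Suc N) x) \<partial>lborel) = 0" for N
  proof -
    have "integrable lborel (\<lambda>x. h x * of_real (cos_kernel 1 (Suc N) (x - y)))"
      by (rule Bochner_Integration.integrable_bound[OF h])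
         (auto simp: norm_mult cos_kernel_nonneg cos_kernel_le_1 mult_left_le)
    from integral_affine_vec[OF this, of "r N" y] k0[of "Suc N"] r[of N] show ?thesis by (simp add: cos_kernel_def)
  qed
  have "(\<lambda>N. \<integral>x. h (y + r N *\<^sub>R x) * of_real (cos_kernel (r N) (Suc N) x) \<partial>lborel) \<longlonglongrightarrow> (\<integral>x. h y * of_real (gauss x) \<partial>(lborel :: (real^'n) measure))"
  proof (rule integral_dominated_convergence[where w="\<lambda>x::real^'n. B * (\<Prod>i\<in>UNIV. exp (- c\<^sup>2 * (x $ i)\<^sup>2))"])
    show "integrable lborel (\<lambda>x::real^'n. B * (\<Prod>i\<in>UNIV. exp (- c\<^sup>2 * (x $ i)\<^sup>2)))"
      by (intro integrable_mult_right integrable_gauss_prod) (use c in auto)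
    show "AE x in lborel. (\<lambda>N. h (y + r N *\<^sub>R x) * of_real (cos_kernel (r N) (Suc N) x)) \<longlonglongrightarrow> h y * of_real (gauss x)"
    proof (intro AE_I2 tendsto_intros)
      fix x :: "real^'n"
      have r0: "r \<longlonglongrightarrow> 0" unfolding r_def[abs_def] by real_asymp
      have "(\<lambda>N. y + r N *\<^sub>R x) \<longlonglongrightarrow> y + 0 *\<^sub>R x" by (intro tendsto_intros r0)
      then have "(\<lambda>N. y + r N *\<^sub>R x) \<longlonglongrightarrow> y" by simp
      then show "(\<lambda>N. h (y + r N *\<^sub>R x)) \<longlonglongrightarrow> h y" using cont by (rule isCont_tendsto_compose[rotated])
      show "(\<lambda>N. cos_kernel (r N) (Suc N) x) \<longlonglongrightarrow> gauss x"
        using LIMSEQ_Suc[OF cos_kernel_limit[of 1 x]] by (simp add: r_def del: of_nat_Suc)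
    qed
    show "AE x in lborel. norm (h (y + r N *\<^sub>R x) * of_real (cos_kernel (r N) (Suc N) x)) \<le> B * (\<Prod>i\<in>UNIV. exp (- c\<^sup>2 * (x $ i)\<^sup>2))" for N
    proof (intro AE_I2)
      fix x :: "real^'n"
      have B: "B \<ge> 0" using bd[of 0] norm_ge_zero order.trans by blast
      show "norm (h (y + r N *\<^sub>R x) * of_real (cos_kernel (r N) (Suc N) x)) \<le> B * (\<Prod>i\<in>UNIV. exp (- c\<^sup>2 * (x $ i)\<^sup>2))"
      proof (cases "h (y + r N *\<^sub>R x) = 0")
        case True then show ?thesis using B by (simp add: prod_nonneg)
      next
        case False
        have "((1 + cos (r N * x $ i)) / 2) ^ Suc N \<le> exp (- c\<^sup>2 * (x $ i)\<^sup>2)" for i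
        proof -
          have "\<bar>r N * x $ i\<bar> \<le> \<rho>" using supp[OF False, of i] by simp
          then have "((1 + cos (r N * x $ i)) / 2) ^ Suc N \<le> exp (- (c * (r N * x $ i))\<^sup>2) ^ Suc N"
            by (intro power_mono cos_le half_one_plus_cos)
          also have "\<dots> = exp (real (Suc N) * - (c * (r N * x $ i))\<^sup>2)" by (rule exp_of_nat_mult[symmetric])
          also have "real (Suc N) * - (c * (r N * x $ i))\<^sup>2 = - c\<^sup>2 * (x $ i)\<^sup>2 * ((r N)\<^sup>2 * real (Suc N))"
            by (simp add: power_mult_distrib algebra_simps)
          finally show ?thesis unfolding r2 by simp
        qed
        then have "cos_kernel (r N) (Suc N) x \<le> (\<Prod>i\<in>UNIV. exp (- c\<^sup>2 * (x $ i)\<^sup>2))"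
          unfolding cos_kernel_def by (intro prod_mono conjI zero_le_power half_one_plus_cos) auto
        then show ?thesis using bd[of "y + r N *\<^sub>R x"] B cos_kernel_nonneg[of "r N" "Suc N" x]
          by (simp add: norm_mult mult_mono)
      qed
    qed
  qed measurable
  then have "(\<integral>x. h y * of_real (gauss x) \<partial>(lborel :: (real^'n) measure)) = 0"
    by (rule LIMSEQ_of_zero_sequence) (rule scaled)
  then have "h y * of_real (\<integral>x. gauss x \<partial>(lborel :: (real^'n) measure)) = 0" by simp
  then show ?thesis using integral_gauss_pos[where ?'n='n] by simp
qed

section \<open>Smoothness in a coordinate direction\<close>

text \<open>Only pure derivatives are needed for the decay of Fourier transforms; the recursive form, with an
  arbitrary function in place of the derivative outside \<open>S\<close>, makes products, reciprocals and gluing easy.\<close>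

primrec dsm :: "nat \<Rightarrow> 'n::finite \<Rightarrow> (real^'n) set \<Rightarrow> (real^'n \<Rightarrow> complex) \<Rightarrow> bool" where
  "dsm 0 i S h = continuous_on S h"
| "dsm (Suc k) i S h = (continuous_on S h \<and>
     (\<exists>h'. (\<forall>x\<in>S. ((\<lambda>t. h (x + t *\<^sub>R axis i 1)) has_vector_derivative h' x) (at 0)) \<and> dsm k i S h'))"

lemma dsm_continuous: "dsm k i S h \<Longrightarrow> continuous_on S h"
  by (cases k) auto

lemma dsm_SucE:
  assumes "dsm (Suc k) i S h"
  obtains h' where "\<And>x. x \<in> S \<Longrightarrow> ((\<lambda>t. h (x + t *\<^sub>R axis i 1)) has_vector_derivative h' x) (at 0)" "dsm k i S h'"
  using assms by auto

lemma dsm_SucI: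
  assumes "continuous_on S h"
    "\<And>x. x \<in> S \<Longrightarrow> ((\<lambda>t. h (x + t *\<^sub>R axis i 1)) has_vector_derivative h' x) (at 0)" "dsm k i S h'"
  shows "dsm (Suc k) i S h"
  using assms by auto

lemma dsm_Suc_imp: "dsm (Suc k) i S h \<Longrightarrow> dsm k i S h"
proof (induction k arbitrary: h)
  case 0 then show ?case by auto
next
  case (Suc k)
  from Suc.prems obtain h' where h': "\<And>x. x \<in> S \<Longrightarrow> ((\<lambda>t. h (x + t *\<^sub>R axis i 1)) has_vector_derivative h' x) (at 0)" "dsm (Suc k) i S h'"
    by (rule dsm_SucE) blast
  show ?case using dsm_continuous[OF Suc.prems] h'(1) Suc.IH[OF h'(2)] by (rule dsm_SucI)
qed

lemma open_line_preimage:
  fixes x v :: "'a::real_normed_vector"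
  assumes "open S" shows "open {t. x + t *\<^sub>R v \<in> S}"
proof -
  have "continuous_on UNIV (\<lambda>t. x + t *\<^sub>R v)" by (intro continuous_intros)
  from open_vimage[OF assms this] show ?thesis by (simp add: vimage_def)
qed

lemma dsm_cong:
  assumes "dsm k i S h" "open S" "\<And>x. x \<in> S \<Longrightarrow> h x = g x"
  shows "dsm k i S g"
proof (cases k)
  case 0 then show ?thesis using assms by (auto cong: continuous_on_cong)
next
  case (Suc j)
  with assms obtain h' where h': "\<And>x. x \<in> S \<Longrightarrow> ((\<lambda>t. h (x + t *\<^sub>R axis i 1)) has_vector_derivative h' x) (at 0)" "dsm j i S h'"
    by (metis dsm_SucE)
  have "((\<lambda>t. g (x + t *\<^sub>R axis i 1)) has_vector_derivative h' x) (at 0)" if "x \<in> S" for x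
    by (rule has_vector_derivative_transform_within_open[OF h'(1)[OF that] open_line_preimage[OF assms(2), of x "axis i 1"]])
       (use that assms(3) in auto)
  moreover have "continuous_on S g" using dsm_continuous[OF assms(1)] assms(3) by (auto cong: continuous_on_cong)
  ultimately show ?thesis unfolding Suc using h'(2) by (intro dsm_SucI)
qed

text \<open>Derivatives are unique, so the two candidates agree on the overlap and the glued
  function \<open>c\<close> is a derivative on the whole union. Openness lets regularity pass
  between functions that agree on a piece.\<close>

lemma dsm_Un:
  assumes "open S" "open T" "dsm k i S h" "dsm k i T h"
  shows "dsm k i (S \<union> T) h"
  using assms(3,4)
proof (induction k arbitrary: h)
  case 0 then show ?case using assms by (simp add: continuous_on_open_Un)
next
  case (Suc k)
  obtain a where a: "\<And>x. x \<in> S \<Longrightarrow> ((\<lambda>t. h (x + t *\<^sub>R axis i 1)) has_vector_derivative a x) (at 0)" "dsm k i S a"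
    using Suc.prems(1) by (rule dsm_SucE) blast
  obtain b where b: "\<And>x. x \<in> T \<Longrightarrow> ((\<lambda>t. h (x + t *\<^sub>R axis i 1)) has_vector_derivative b x) (at 0)" "dsm k i T b"
    using Suc.prems(2) by (rule dsm_SucE) blast
  define c where "c x = (if x \<in> S then a x else b x)" for x
  have cb: "b x = c x" if "x \<in> T" for x
    using vector_derivative_unique_at[OF a(1) b(1)] that by (auto simp: c_def)
  show ?case
  proof (rule dsm_SucI)
    show "continuous_on (S \<union> T) h" using dsm_continuous Suc.prems assms by (blast intro: continuous_on_open_Un)
    show "((\<lambda>t. h (x + t *\<^sub>R axis i 1)) has_vector_derivative c x) (at 0)" if "x \<in> S \<union> T" for x
      using that a(1)[of x] b(1)[of x] by (auto simp: c_def)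
    show "dsm k i (S \<union> T) c"
      by (rule Suc.IH) (rule dsm_cong[OF a(2) assms(1)] dsm_cong[OF b(2) assms(2)]; simp add: c_def cb[unfolded c_def])+
  qed
qed

lemma dsm_const: "dsm k i S (\<lambda>x. c)"
  by (induction k arbitrary: c) (auto intro!: exI[of _ "\<lambda>x. 0"] derivative_eq_intros)

lemma dsm_add: "dsm k i S g \<Longrightarrow> dsm k i S h \<Longrightarrow> dsm k i S (\<lambda>x. g x + h x)"
proof (induction k arbitrary: g h)
  case (Suc k)
  obtain a where a: "\<And>x. x \<in> S \<Longrightarrow> ((\<lambda>t. g (x + t *\<^sub>R axis i 1)) has_vector_derivative a x) (at 0)" "dsm k i S a"
    using Suc.prems(1) by (rule dsm_SucE) blast
  obtain b where b: "\<And>x. x \<in> S \<Longrightarrow> ((\<lambda>t. h (x + t *\<^sub>R axis i 1)) has_vector_derivative b x) (at 0)" "dsm k i S b"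
    using Suc.prems(2) by (rule dsm_SucE) blast
  show ?case
    by (rule dsm_SucI[where h'="\<lambda>x. a x + b x"])
       (use dsm_continuous[OF Suc.prems(1)] dsm_continuous[OF Suc.prems(2)] a b Suc.IH in
         \<open>auto intro!: continuous_intros has_vector_derivative_add\<close>)
qed (auto intro: continuous_intros)

lemma dsm_mult: "dsm k i S g \<Longrightarrow> dsm k i S h \<Longrightarrow> dsm k i S (\<lambda>x. g x * h x)"
proof (induction k arbitrary: g h)
  case (Suc k)
  obtain a where a: "\<And>x. x \<in> S \<Longrightarrow> ((\<lambda>t. g (x + t *\<^sub>R axis i 1)) has_vector_derivative a x) (at 0)" "dsm k i S a"
    using Suc.prems(1) by (rule dsm_SucE) blast
  obtain b where b: "\<And>x. x \<in> S \<Longrightarrow> ((\<lambda>t. h (x + t *\<^sub>R axis i 1)) has_vector_derivative b x) (at 0)" "dsm k i S b"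
    using Suc.prems(2) by (rule dsm_SucE) blast
  show ?case
  proof (rule dsm_SucI[where h'="\<lambda>x. g x * b x + a x * h x"])
    show "continuous_on S (\<lambda>x. g x * h x)"
      by (intro continuous_intros dsm_continuous[OF Suc.prems(1)] dsm_continuous[OF Suc.prems(2)])
    show "((\<lambda>t. g (x + t *\<^sub>R axis i 1) * h (x + t *\<^sub>R axis i 1)) has_vector_derivative g x * b x + a x * h x) (at 0)" if "x \<in> S" for x
      using has_vector_derivative_mult[OF a(1)[OF that] b(1)[OF that]] by simp
    show "dsm k i S (\<lambda>x. g x * b x + a x * h x)"
      by (intro dsm_add Suc.IH a(2) b(2) dsm_Suc_imp[OF Suc.prems(1)] dsm_Suc_imp[OF Suc.prems(2)])
  qed
qed (auto intro: continuous_intros)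

lemma dsm_cnj: "dsm k i S h \<Longrightarrow> dsm k i S (\<lambda>x. cnj (h x))"
proof (induction k arbitrary: h)
  case (Suc k)
  obtain a where a: "\<And>x. x \<in> S \<Longrightarrow> ((\<lambda>t. h (x + t *\<^sub>R axis i 1)) has_vector_derivative a x) (at 0)" "dsm k i S a"
    using Suc.prems by (rule dsm_SucE) blast
  show ?case
    by (rule dsm_SucI[where h'="\<lambda>x. cnj (a x)"])
       (use dsm_continuous[OF Suc.prems] a Suc.IH in \<open>auto intro!: continuous_intros has_vector_derivative_cnj\<close>)
qed (auto intro: continuous_intros)

lemma dsm_sum: "(\<And>a. a \<in> A \<Longrightarrow> dsm k i S (h a)) \<Longrightarrow> dsm k i S (\<lambda>x. \<Sum>a\<in>A. h a x)"
  by (induction A rule: infinite_finite_induct) (auto intro: dsm_add dsm_const)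

text \<open>The derivative of 1/h is built from 1/h itself and the derivative of h, so the induction
  hypothesis for the same \<open>h\<close> suffices.\<close>

lemma dsm_inverse: "dsm k i S h \<Longrightarrow> (\<And>x. x \<in> S \<Longrightarrow> h x \<noteq> 0) \<Longrightarrow> dsm k i S (\<lambda>x. inverse (h x))"
proof (induction k)
  case (Suc k)
  obtain a where a: "\<And>x. x \<in> S \<Longrightarrow> ((\<lambda>t. h (x + t *\<^sub>R axis i 1)) has_vector_derivative a x) (at 0)" "dsm k i S a"
    using Suc.prems(1) by (rule dsm_SucE) blast
  have IH: "dsm k i S (\<lambda>x. inverse (h x))" using Suc dsm_Suc_imp by blast
  show ?case
  proof (rule dsm_SucI[where h'="\<lambda>x. (-1) * (inverse (h x) * a x * inverse (h x))"])
    show "continuous_on S (\<lambda>x. inverse (h x))"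
      using Suc.prems(2) by (intro continuous_intros dsm_continuous[OF Suc.prems(1)]) auto
    show "dsm k i S (\<lambda>x. (-1) * (inverse (h x) * a x * inverse (h x)))"
      by (intro dsm_mult dsm_const IH a(2))
    fix x assume x: "x \<in> S"
    have "((\<lambda>t. inverse (h (x + t *\<^sub>R axis i 1))) has_derivative (\<lambda>t. - (inverse (h x) * (t *\<^sub>R a x) * inverse (h x)))) (at 0)"
      using Deriv.has_derivative_inverse[OF _ a(1)[OF x, unfolded has_vector_derivative_def]] Suc.prems(2)[OF x] by simp
    then show "((\<lambda>t. inverse (h (x + t *\<^sub>R axis i 1))) has_vector_derivative (-1) * (inverse (h x) * a x * inverse (h x))) (at 0)"
      by (simp add: has_vector_derivative_def)
  qed
qed (auto intro: continuous_intros)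

lemma dsm_subset: "dsm k i S h \<Longrightarrow> T \<subseteq> S \<Longrightarrow> dsm k i T h"
proof (induction k arbitrary: h)
  case (Suc k)
  obtain a where a: "\<And>x. x \<in> S \<Longrightarrow> ((\<lambda>t. h (x + t *\<^sub>R axis i 1)) has_vector_derivative a x) (at 0)" "dsm k i S a"
    using Suc.prems(1) by (rule dsm_SucE) blast
  show ?case
    by (rule dsm_SucI[where h'=a]) (use a Suc continuous_on_subset[OF dsm_continuous[OF Suc.prems(1)]] in auto)
qed (auto intro: continuous_on_subset)

text \<open>The open sets where \<open>h\<close> is nonzero and where \<open>Z\<close> is left cover
  the space. On the first the quotient is a product, on the second it is 0. A zero of
  \<open>h\<close> lies off \<open>Z\<close>, so the quotient there is \<open>0 / 0\<close>, which
  has the value 0 that continuity asks for.\<close>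

lemma dsm_divide:
  assumes g: "dsm k i UNIV g" and h: "dsm k i UNIV h" and Z: "closed Z"
    and gZ: "\<And>x. x \<notin> Z \<Longrightarrow> g x = 0" and hZ: "\<And>x. x \<in> Z \<Longrightarrow> h x \<noteq> 0"
  shows "dsm k i UNIV (\<lambda>x. g x / h x)"
proof -
  have h_cont: "continuous_on UNIV h" using h by (rule dsm_continuous)
  have 1: "open {x. h x \<noteq> 0}" using open_Collect_neq[OF h_cont continuous_on_const] .
  have "dsm k i {x. h x \<noteq> 0} (\<lambda>x. g x / h x)" unfolding divide_inverse
    by (intro dsm_mult dsm_inverse dsm_subset[OF g] dsm_subset[OF h]) auto
  moreover have "dsm k i (- Z) (\<lambda>x. g x / h x)"
    by (rule dsm_cong[OF dsm_const[where c=0]]) (use Z gZ in \<open>auto simp: open_Compl\<close>)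
  ultimately have "dsm k i ({x. h x \<noteq> 0} \<union> - Z) (\<lambda>x. g x / h x)"
    using 1 Z by (intro dsm_Un) (auto simp: open_Compl)
  moreover have "{x. h x \<noteq> 0} \<union> - Z = UNIV" using hZ by auto
  ultimately show ?thesis by simp
qed

lemma dsm_fourier: "rapid h \<Longrightarrow> dsm k i UNIV (fourier h)"
proof (induction k arbitrary: h)
  case 0 then show ?case by (simp add: continuous_fourier)
next
  case (Suc k)
  show ?case
    by (rule dsm_SucI[OF continuous_fourier[OF Suc.prems] fourier_has_partial_derivative[OF Suc.prems]])
       (rule Suc.IH[OF rapid_cmult[OF rapid_coord[OF Suc.prems]]])
qed

section \<open>Decay of Fourier integrals\<close>

lemma rapid_compact_support:
  fixes m :: "real^'n::finite \<Rightarrow> complex"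
  assumes "continuous_on UNIV m" "\<And>x. R < norm x \<Longrightarrow> m x = 0"
  shows "rapid m"
proof (rule rapidI)
  show "m \<in> borel_measurable borel" using assms(1) by (rule borel_measurable_continuous_onI)
  fix N
  have "compact ((\<lambda>x. (1 + norm x) ^ N * norm (m x)) ` cball 0 R)"
    by (intro compact_continuous_image continuous_intros continuous_on_subset[OF assms(1)]) auto
  then have "bounded ((\<lambda>x. (1 + norm x) ^ N * norm (m x)) ` cball 0 R)" by (rule compact_imp_bounded)
  then obtain C where C: "\<forall>x\<in>cball 0 R. (1 + norm x) ^ N * norm (m x) \<le> C"
    unfolding bounded_iff by (auto simp: abs_mult)
  have "(1 + norm x) ^ N * norm (m x) \<le> max C 0" for x
    using C assms(2)[of x] by (cases "norm x \<le> R") (auto simp: le_max_iff_disj)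
  then show "\<exists>C. \<forall>x. (1 + norm x) ^ N * norm (m x) \<le> C" by blast
qed

text \<open>The largest of 1 and the |y_i| bounds 1 + |y| up to the factor n + 1. Polynomial weights
  thus reduce to powers of single coordinates, which is why pure derivatives are enough for
  decay.\<close>

lemma weight_power_le:
  fixes y :: "real^'n::finite"
  shows "(1 + norm y) ^ N \<le> (real CARD('n) + 1) ^ N * (1 + (\<Sum>i\<in>UNIV. \<bar>y $ i\<bar> ^ N))"
proof -
  define M where "M = Max (insert 1 (range (\<lambda>i. \<bar>y $ i\<bar>)))"
  have M: "1 \<le> M" "\<bar>y $ i\<bar> \<le> M" for i unfolding M_def by (rule Max_ge; simp)+
  have "M \<in> insert 1 (range (\<lambda>i. \<bar>y $ i\<bar>))" unfolding M_def by (rule Max_in) auto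
  then have MN: "M ^ N \<le> 1 + (\<Sum>i\<in>UNIV. \<bar>y $ i\<bar> ^ N)"
  proof
    assume "M \<in> range (\<lambda>i. \<bar>y $ i\<bar>)"
    then obtain i where "M = \<bar>y $ i\<bar>" by auto
    moreover have "\<bar>y $ i\<bar> ^ N \<le> (\<Sum>i\<in>UNIV. \<bar>y $ i\<bar> ^ N)" by (rule member_le_sum) auto
    ultimately show ?thesis by simp
  qed (simp add: sum_nonneg)
  have "norm y \<le> (\<Sum>i\<in>UNIV. \<bar>y $ i\<bar>)" by (rule norm_le_l1_cart)
  also have "\<dots> \<le> (\<Sum>i\<in>(UNIV::'n set). M)" by (intro sum_mono M)
  finally have "1 + norm y \<le> (real CARD('n) + 1) * M" using M(1) by (simp add: algebra_simps)
  then have "(1 + norm y) ^ N \<le> ((real CARD('n) + 1) * M) ^ N" by (intro power_mono) auto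
  also have "\<dots> \<le> (real CARD('n) + 1) ^ N * (1 + (\<Sum>i\<in>UNIV. \<bar>y $ i\<bar> ^ N))"
    unfolding power_mult_distrib by (intro mult_left_mono MN) auto
  finally show ?thesis .
qed

text \<open>Each integration by parts trades a factor \<open>y $ i\<close> for a derivative of
  \<open>m\<close>, and the derivative still vanishes outside the same ball.\<close>

lemma fourier_integral_coordinate_decay:
  fixes m :: "real^'n::finite \<Rightarrow> complex"
  assumes "dsm k i UNIV m" "\<And>x. R < norm x \<Longrightarrow> m x = 0"
  shows "\<exists>C. \<forall>y. \<bar>y $ i\<bar> ^ k * norm (\<integral>x. cis (x \<bullet> y) * m x \<partial>lborel) \<le> C"
  using assms
proof (induction k arbitrary: m)
  case 0
  have r: "rapid m" by (rule rapid_compact_support[OF dsm_continuous[OF 0(1)] 0(2)])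
  have "norm (\<integral>x. cis (x \<bullet> y) * m x \<partial>lborel) \<le> (\<integral>x. norm (cis (x \<bullet> y) * m x) \<partial>lborel)" for y
    by (rule integral_norm_bound)
  then show ?case by (auto simp: norm_mult)
next
  case (Suc k)
  obtain a where a: "\<And>x. ((\<lambda>t. m (x + t *\<^sub>R axis i 1)) has_vector_derivative a x) (at 0)" "dsm k i UNIV a"
    using Suc.prems(1) by (rule dsm_SucE) auto
  have a0: "a x = 0" if x: "R < norm x" for x
  proof -
    have "open {x::real^'n. R < norm x}" by (intro open_Collect_less continuous_intros)
    then have "((\<lambda>t. m (x + t *\<^sub>R axis i 1)) has_vector_derivative 0) (at 0)"
      by (intro has_vector_derivative_transform_within_open[OF has_vector_derivative_const
        open_line_preimage[of "{x. R < norm x}" x "axis i 1"]]) (use x Suc.prems(2) in auto)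
    with a(1)[of x] show ?thesis by (rule vector_derivative_unique_at)
  qed
  have r: "rapid m" "rapid a"
    by (rule rapid_compact_support[OF dsm_continuous[OF Suc.prems(1)] Suc.prems(2)]
             rapid_compact_support[OF dsm_continuous[OF a(2)] a0]; assumption)+
  obtain C where C: "\<And>y. \<bar>y $ i\<bar> ^ k * norm (\<integral>x. cis (x \<bullet> y) * a x \<partial>lborel) \<le> C"
    using Suc.IH[OF a(2) a0] by blast
  have "\<bar>y $ i\<bar> ^ Suc k * norm (\<integral>x. cis (x \<bullet> y) * m x \<partial>lborel) \<le> C" for y
    using C[of y] unfolding integral_cis_partial_derivative[OF a(1) r]
    by (simp add: norm_mult mult_ac)
  then show ?case by blast
qed

lemma fourier_integral_decay:
  fixes m :: "real^'n::finite \<Rightarrow> complex"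
  assumes m: "\<And>k i. dsm k i UNIV m" and supp: "\<And>x. R < norm x \<Longrightarrow> m x = 0"
  shows "\<exists>C>0. \<forall>y. (1 + norm y) ^ N * norm (\<integral>x. cis (x \<bullet> y) * m x \<partial>lborel) \<le> C"
proof -
  define K where "K y = norm (\<integral>x. cis (x \<bullet> y) * m x \<partial>lborel)" for y
  have "\<exists>C. \<forall>i. \<forall>y. \<bar>y $ i\<bar> ^ k * K y \<le> C i" for k
    unfolding K_def by (intro choice allI fourier_integral_coordinate_decay[OF m supp])
  then obtain C C0 where C: "\<And>i y. \<bar>y $ i\<bar> ^ N * K y \<le> C i" and C0: "\<And>i y. \<bar>y $ i\<bar> ^ 0 * K y \<le> C0 i"
    by metis
  \<comment> \<open>\<open>C0\<close> holds the bounds for exponent 0, where the coordinate does not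
    enter; \<open>undefined\<close> merely names one.\<close>
  define A where "A = (real CARD('n) + 1) ^ N * (C0 undefined + (\<Sum>i\<in>UNIV. C i))"
  have "(1 + norm y) ^ N * K y \<le> max A 1" for y
  proof -
    have "(1 + norm y) ^ N * K y \<le> ((real CARD('n) + 1) ^ N * (1 + (\<Sum>i\<in>UNIV. \<bar>y $ i\<bar> ^ N))) * K y"
      by (intro mult_right_mono weight_power_le) (simp add: K_def)
    also have "\<dots> = (real CARD('n) + 1) ^ N * (K y + (\<Sum>i\<in>UNIV. \<bar>y $ i\<bar> ^ N * K y))"
      by (simp add: algebra_simps sum_distrib_left sum_distrib_right)
    also have "\<dots> \<le> A" unfolding A_def using C0[of y undefined]
      by (intro mult_left_mono add_mono sum_mono C) auto
    finally show ?thesis by simp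
  qed
  then show ?thesis unfolding K_def by (intro exI[of _ "max A 1"]) auto
qed

section \<open>Lattice sums and Fourier series\<close>

definition ivec :: "int^'n::finite \<Rightarrow> real^'n" where
  "ivec l = (\<chi> i. of_int (l $ i))"

lemma ivec_nth [simp]: "ivec l $ i = of_int (l $ i)"
  by (simp add: ivec_def)

lemma ivec_minus: "ivec (- l) = - ivec l" and ivec_add: "ivec (l + m) = ivec l + ivec m"
  by (simp_all add: vec_eq_iff)

text \<open>An enumeration of the lattice. It turns lattice sums into series over
  \<open>nat\<close>, to which the Weierstrass test and termwise integration apply.\<close>

definition lat :: "nat \<Rightarrow> int^'n::finite" where
  "lat = from_nat_into UNIV"

lemma bij_lat: "bij (lat :: nat \<Rightarrow> int^'n::finite)"
proof -
  have "range (\<lambda>f. \<chi> i. f i) = (UNIV :: (int^'n) set)"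
    by (auto simp: image_iff vec_eq_iff intro!: exI[of _ "\<lambda>i. _ $ i"])
  moreover have "countable (UNIV :: ('n \<Rightarrow> int) set)"
    using countable_PiE[of "UNIV :: 'n set" "\<lambda>_. UNIV :: int set"] by (simp add: PiE_UNIV_domain)
  ultimately have "countable (UNIV :: (int^'n) set)" by (metis countable_image)
  moreover have "infinite (UNIV :: (int^'n) set)"
  proof
    assume "finite (UNIV :: (int^'n) set)"
    then have "finite (range (\<lambda>c. (\<chi> i. c) :: int^'n))" by (rule finite_subset[rotated]) auto
    moreover have "inj (\<lambda>c. (\<chi> i. c) :: int^'n)" by (auto simp: inj_def vec_eq_iff)
    ultimately have "finite (UNIV :: int set)" by (rule finite_imageD)
    then show False by simp
  qed
  ultimately show ?thesis unfolding lat_def by (rule bij_betw_from_nat_into)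
qed

lemma box_halfopen_measure:
  fixes a :: "real^'n::finite"
  assumes "s \<ge> 0"
  shows "emeasure lborel {x. \<forall>i. a $ i \<le> x $ i \<and> x $ i < a $ i + s} = ennreal (s ^ CARD('n))"
    and "{x. \<forall>i. a $ i \<le> x $ i \<and> x $ i < a $ i + s} \<in> sets borel"
proof -
  let ?A = "{x. \<forall>i. a $ i \<le> x $ i \<and> x $ i < a $ i + s}"
  show A: "?A \<in> sets borel" by measurable
  have ind: "(indicator ?A :: _ \<Rightarrow> real) = (\<lambda>x. \<Prod>i\<in>UNIV. indicator {a $ i..<a $ i + s} (x $ i))"
    by (auto simp: indicator_def fun_eq_iff)
  have i: "integrable lborel (indicator {a $ i..<a $ i + s} :: real \<Rightarrow> real)" for i
    using assms by (intro integrable_real_indicator) auto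
  have "integrable lborel (indicator ?A :: _ \<Rightarrow> real)"
      "(\<integral>x. indicator ?A x \<partial>lborel) = (\<Prod>i\<in>(UNIV::'n set). s)"
    unfolding ind using integrable_lborel_prod[of "\<lambda>i. indicator {a $ i..<a $ i + s}", OF i]
      integral_lborel_prod[of "\<lambda>i. indicator {a $ i..<a $ i + s}", OF i] assms by simp_all
  then have "emeasure lborel ?A < \<infinity>" "measure lborel ?A = s ^ CARD('n)"
    using A by (simp_all add: integrable_indicator_iff)
  then show "emeasure lborel ?A = ennreal (s ^ CARD('n))"
    using emeasure_eq_ennreal_measure[of lborel ?A] by (simp add: less_top)
qed

text \<open>Comparison with an integral: on the half-open unit cube \<open>C n\<close> at a lattice
  point \<open>wt\<close> varies by at most the factor \<open>D\<close>, and these cubes are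
  disjoint. All partial sums are therefore bounded by \<open>D\<close> times the integral of
  \<open>wt\<close>.\<close>

lemma summable_lat_wt: "summable (\<lambda>n. wt (ivec (lat n) :: real^'n::finite))"
proof -
  define C where "C n = {x. \<forall>i. ivec (lat n :: int^'n) $ i \<le> x $ i \<and> x $ i < ivec (lat n :: int^'n) $ i + 1}" for n
  define D where "D = (1 + real CARD('n)) ^ (2 * CARD('n))"
  have Cm[measurable]: "C n \<in> sets borel" and Ce: "emeasure lborel (C n) = 1" for n
    using box_halfopen_measure[of 1 "ivec (lat n) :: real^'n"] by (auto simp: C_def)
  have le: "wt (ivec (lat n) :: real^'n) \<le> D * wt x" if "x \<in> C n" for n x
  proof -
    have "norm (ivec (lat n) - x) \<le> (\<Sum>i\<in>UNIV. \<bar>(ivec (lat n) - x) $ i\<bar>)" by (rule norm_le_l1_cart)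
    also have "\<dots> \<le> (\<Sum>i\<in>(UNIV::'n set). 1)"
    proof (intro sum_mono)
      fix i
      show "\<bar>(ivec (lat n) - x) $ i\<bar> \<le> 1" using that[unfolded C_def, simplified, rule_format, of i] by (simp add: abs_le_iff)
    qed
    finally have "norm (ivec (lat n) - x) \<le> real CARD('n)" by simp
    then have "(1 + norm (ivec (lat n) - x)) ^ (2 * CARD('n)) \<le> D" unfolding D_def by (intro power_mono) auto
    then have "(1 + norm (ivec (lat n) - x)) ^ (2 * CARD('n)) * wt x \<le> D * wt x"
      using wt_pos[of x] by (intro mult_right_mono) auto
    then show ?thesis using wt_shift[of x "ivec (lat n) - x"] by simp
  qed
  have disj: "n = m" if "x \<in> C n" "x \<in> C m" for n m x
  proof -
    have "(lat n :: int^'n) $ i = lat m $ i" for i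
      using that(1)[unfolded C_def, simplified, rule_format, of i] that(2)[unfolded C_def, simplified, rule_format, of i] by linarith
    then have "lat n = (lat m :: int^'n)" by (simp add: vec_eq_iff)
    then show ?thesis using bij_lat by (metis bij_pointE)
  qed
  have iw: "integrable lborel (\<lambda>x. indicator (C n) x * wt x)" for n
    using integrable_mult_indicator[OF _ integrable_wt, of "C n"] by simp
  show ?thesis
  proof (rule summableI_nonneg_bounded)
    show "0 \<le> wt (ivec (lat n) :: real^'n)" for n using wt_pos less_imp_le by blast
    fix N
    have "wt (ivec (lat n) :: real^'n) \<le> D * (\<integral>x. indicator (C n) x * wt x \<partial>lborel)" for n
    proof -
      have "wt (ivec (lat n) :: real^'n) = (\<integral>x. indicator (C n) x * wt (ivec (lat n) :: real^'n) \<partial>lborel)"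
        using Ce[of n] by (simp add: measure_def)
      also have "\<dots> \<le> (\<integral>x. D * (indicator (C n) x * wt x) \<partial>lborel)"
      proof (intro integral_mono integrable_mult_right iw integrable_mult_left)
        show "integrable lborel (indicator (C n) :: _ \<Rightarrow> real)" using Ce[of n] by (intro integrable_real_indicator) auto
        show "indicator (C n) x * wt (ivec (lat n) :: real^'n) \<le> D * (indicator (C n) x * wt x)" for x
          using le[of x n] by (auto simp: indicator_def)
      qed
      finally show ?thesis by simp
    qed
    then have "(\<Sum>n<N. wt (ivec (lat n) :: real^'n)) \<le> (\<Sum>n<N. D * (\<integral>x. indicator (C n) x * wt x \<partial>lborel))"
      by (intro sum_mono)
    also have "\<dots> = D * (\<integral>x. (\<Sum>n<N. indicator (C n) x * wt x) \<partial>lborel)"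
      using iw by (subst Bochner_Integration.integral_sum) (auto simp: sum_distrib_left)
    also have "\<dots> \<le> D * (\<integral>x. wt x \<partial>(lborel :: (real^'n) measure))"
    proof (intro mult_left_mono integral_mono integrable_wt)
      show "integrable lborel (\<lambda>x. \<Sum>n<N. indicator (C n) x * wt x)" using iw by (intro Bochner_Integration.integrable_sum)
      fix x :: "real^'n"
      show "(\<Sum>n<N. indicator (C n) x * wt x) \<le> wt x"
      proof (cases "\<exists>m<N. x \<in> C m")
        case True
        then obtain m where m: "m < N" "x \<in> C m" by blast
        have "(\<Sum>n<N. indicator (C n) x * wt x) = (\<Sum>n<N. if n = m then wt x else 0)"
          using m disj by (intro sum.cong) (auto simp: indicator_def)
        also have "\<dots> = wt x" using m by simp
        finally show ?thesis by (rule eq_refl)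
      next
        case False
        then have "(\<Sum>n<N. indicator (C n) x * wt x) = 0" by (intro sum.neutral) (auto simp: indicator_def)
        then show ?thesis using wt_pos[of x] by simp
      qed
    qed (simp add: D_def)
    finally show "(\<Sum>n<N. wt (ivec (lat n) :: real^'n)) \<le> D * (\<integral>x. wt x \<partial>(lborel :: (real^'n) measure))" .
  qed
qed

section \<open>Characters on the period cube and pointwise convergence of Fourier series\<close>

lemma integral_cis_period:
  fixes k :: int
  shows "(\<integral>t. indicator {-pi..pi} t *\<^sub>R cis (- (of_int k * t)) \<partial>lborel) = (if k = 0 then of_real (2 * pi) else 0)"
    and "integrable lborel (\<lambda>t. indicator {-pi..pi} t *\<^sub>R cis (- (of_int k * t)))"
proof -
  have cont: "continuous_on {-pi..pi} (\<lambda>t. cis (- (of_int k * t)))" by (intro continuous_intros)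
  show i: "integrable lborel (\<lambda>t. indicator {-pi..pi} t *\<^sub>R cis (- (of_int k * t)))"
    using borel_integrable_atLeastAtMost'[OF cont] by (simp add: set_integrable_def)
  show "(\<integral>t. indicator {-pi..pi} t *\<^sub>R cis (- (of_int k * t)) \<partial>lborel) = (if k = 0 then of_real (2 * pi) else 0)"
  proof (cases "k = 0")
    case True
    have "(\<integral>t. indicator {-pi..pi} t *\<^sub>R (1::complex) \<partial>lborel) = of_real (measure lborel {-pi..pi})"
      by (simp add: scaleR_conv_of_real)
    then show ?thesis using True by simp
  next
    case False
    define F where "F t = cis (- (of_int k * t)) / (- \<i> * of_int k)" for t :: real
    have "(F has_vector_derivative cis (- (of_int k * t))) (at t within {-pi..pi})" for t
    proof -
      have "((\<lambda>z. exp (- \<i> * of_int k * z) / (- \<i> * of_int k)) has_field_derivative exp (- \<i> * of_int k * of_real t)) (at (of_real t))"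
        using False by (auto intro!: derivative_eq_intros)
      from has_vector_derivative_real_field[OF this]
      have "((\<lambda>t. exp (- \<i> * of_int k * of_real t) / (- \<i> * of_int k)) has_vector_derivative exp (- \<i> * of_int k * of_real t)) (at t within {-pi..pi})"
        by (rule has_vector_derivative_at_within)
      then show ?thesis by (simp add: F_def[abs_def] cis_conv_exp mult.assoc)
    qed
    then have "(\<integral>t. indicator {-pi..pi} t *\<^sub>R cis (- (of_int k * t)) \<partial>lborel) = F pi - F (- pi)"
      using integral_FTC_atLeastAtMost[OF _ _ cont, of F] by simp
    moreover have "cis (of_int k * pi) = cis (- (of_int k * pi))"
      using sin_npi_int[of k] by (simp add: complex_eq_iff mult.commute)
    then have "F pi = F (- pi)" unfolding F_def by simp
    ultimately show ?thesis using False by simp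
  qed
qed

lemma integral_cis_cube:
  fixes l :: "int^'n::finite"
  defines "b \<equiv> {x::real^'n. \<forall>i. -pi \<le> x $ i \<and> x $ i \<le> pi}"
  shows "(\<integral>x. indicator b x *\<^sub>R cis (- (x \<bullet> ivec l)) \<partial>lborel) = (if l = 0 then of_real ((2 * pi) ^ CARD('n)) else 0)"
proof -
  have eq: "indicator b x *\<^sub>R cis (- (x \<bullet> ivec l)) = (\<Prod>i\<in>UNIV. indicator {-pi..pi} (x $ i) *\<^sub>R cis (- (of_int (l $ i) * x $ i)))" for x
  proof -
    have "indicator b x = (\<Prod>i\<in>UNIV. indicator {-pi..pi} (x $ i) :: real)" by (auto simp: indicator_def b_def)
    moreover have "cis (- (x \<bullet> ivec l)) = (\<Prod>i\<in>UNIV. cis (- (of_int (l $ i) * x $ i)))"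
      by (simp add: cis_conv_exp inner_vec_def sum_distrib_left sum_negf[symmetric] exp_sum mult.commute)
    ultimately show ?thesis by (simp add: scaleR_conv_of_real prod.distrib)
  qed
  have "(\<integral>x. indicator b x *\<^sub>R cis (- (x \<bullet> ivec l)) \<partial>lborel) = (\<Prod>i\<in>UNIV. if l $ i = 0 then of_real (2 * pi) else 0)"
    unfolding eq by (subst integral_lborel_prod[OF integral_cis_period(2)]) (simp add: integral_cis_period(1))
  also have "\<dots> = (if l = 0 then of_real ((2 * pi) ^ CARD('n)) else 0)"
    by (auto simp: vec_eq_iff)
  finally show ?thesis .
qed

text \<open>The inverse Fourier transform, defined at every real vector and not only at lattice
  points. Multiplying \<open>m\<close> by a character shifts its argument, so all coefficient
  sequences needed for sampling are shifts of one function.\<close>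

definition fourier_coeff :: "(real^'n::finite \<Rightarrow> complex) \<Rightarrow> real^'n \<Rightarrow> complex" where
  "fourier_coeff m y = (\<integral>x. cis (x \<bullet> y) * m x \<partial>lborel) / of_real ((2 * pi) ^ CARD('n))"

text \<open>The series \<open>P\<close> has the same integer coefficients as \<open>m\<close> on the
  period cube \<open>b\<close>, so the difference has vanishing transform at all integer
  frequencies. The radius 3 < pi matters: a point of \<open>b\<close> differs from \<open>y\<close>
  by at most pi + 3 < 2 pi in each coordinate, hence no periodic copy of \<open>y\<close>
  interferes.\<close>

lemma fourier_series:
  fixes m :: "real^'n::finite \<Rightarrow> complex"
  assumes m: "continuous_on UNIV m" and supp: "\<And>x. 3 < norm x \<Longrightarrow> m x = 0"
    and s: "summable (\<lambda>n. norm (fourier_coeff m (ivec (lat n))))" and y: "norm y \<le> 3"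
  shows "(\<lambda>n. fourier_coeff m (ivec (lat n)) * cis (- (ivec (lat n) \<bullet> y))) sums m y"
proof -
  define a where "a n = fourier_coeff m (ivec (lat n))" for n
  define b where "b = {x::real^'n. \<forall>i. -pi \<le> x $ i \<and> x $ i \<le> pi}"
  define P where "P x = (\<Sum>n. a n * cis (- (ivec (lat n) \<bullet> x)))" for x :: "real^'n"
  have a: "summable (\<lambda>n. norm (a n))" using s by (simp add: a_def)
  have Ps: "summable (\<lambda>n. a n * cis (- (ivec (lat n) \<bullet> x)))" for x :: "real^'n"
    by (rule summable_norm_cancel) (use a in \<open>simp add: norm_mult\<close>)
  have "uniform_limit UNIV (\<lambda>N x. \<Sum>n<N. a n * cis (- (ivec (lat n) \<bullet> x))) P sequentially"
    unfolding P_def by (rule Weierstrass_m_test[OF _ a]) (simp add: norm_mult)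
  then have P_cont: "continuous_on UNIV P"
    by (rule uniform_limit_theorem[rotated]) (auto intro!: always_eventually continuous_intros)
  have Pb: "norm (P x) \<le> (\<Sum>n. norm (a n))" for x
    unfolding P_def using summable_norm[of "\<lambda>n. a n * cis (- (ivec (lat n) \<bullet> x))"] a by (simp add: norm_mult)
  have r: "rapid m" by (rule rapid_compact_support[OF m supp])
  have im: "integrable lborel m" by (rule rapid_integrable[OF r])
  obtain M where M: "M > 0" "\<And>x. norm (m x) \<le> M" using rapid_bounded[OF r] by blast
  have b_cbox: "b = cbox (\<chi> i. - pi) (\<chi> i. pi)" by (auto simp: b_def mem_box_cart)
  have [measurable]: "b \<in> sets borel" unfolding b_cbox by simp
  have ib: "integrable lborel (\<lambda>x. indicator b x *\<^sub>R g x)" if "continuous_on UNIV g" for g :: "real^'n \<Rightarrow> complex"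
    using borel_integrable_compact[of b g] continuous_on_subset[OF that] by (simp add: b_cbox)
  have m_out: "m x = 0" if out: "x \<notin> b" for x
  proof -
    obtain i :: 'n where "\<not> (-pi \<le> x $ i \<and> x $ i \<le> pi)" using out unfolding b_def by blast
    then have "\<bar>x $ i\<bar> > pi" by linarith
    then have "norm x > 3" using component_le_norm_cart[of x i] pi_gt3 by linarith
    then show ?thesis by (rule supp)
  qed
  \<comment> \<open>The cut-off may jump on the boundary of \<open>b\<close>, but \<open>y\<close>
    is an interior point, and continuity is asked for at \<open>y\<close> alone.\<close>
  define h where "h x = indicator b x *\<^sub>R (P x - m x)" for x
  have ih: "integrable lborel h" unfolding h_def by (intro ib continuous_intros P_cont m)
  have "h y = 0"
  proof (rule fourier_coefficients_injective[OF ih])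
    have hP: "h x = P x - m x" if "norm x < pi" for x
    proof -
      have "\<bar>x $ i\<bar> \<le> pi" for i using component_le_norm_cart[of x i] that by linarith
      then have "x \<in> b" unfolding b_def by (auto simp: abs_le_iff minus_le_iff)
      then show ?thesis by (simp add: h_def)
    qed
    have "norm y < pi" using y pi_gt3 by linarith
    then have "eventually (\<lambda>x. norm x < pi) (nhds y)"
      by (intro eventually_nhds_in_open[of "{x. norm x < pi}", simplified] open_Collect_less continuous_intros)
    then have "eventually (\<lambda>x. h x = P x - m x) (nhds y)"
      using hP by (rule eventually_mono)
    moreover have "isCont (\<lambda>x. P x - m x) y"
      using P_cont m by (intro continuous_intros) (auto simp: continuous_on_eq_continuous_at)
    ultimately show "isCont h y" by (simp add: isCont_cong)
    show "norm (h x) \<le> (\<Sum>n. norm (a n)) + M" for x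
      using Pb[of x] M(2)[of x] norm_triangle_ineq4[of "P x" "m x"] norm_ge_zero[of "P x - m x"]
      by (auto simp: h_def indicator_def simp del: norm_ge_zero)
    show "\<bar>x $ i - y $ i\<bar> \<le> pi + 3" if "h x \<noteq> 0" for x i
    proof -
      have "x \<in> b" using that by (auto simp: h_def indicator_def split: if_splits)
      then have "\<bar>x $ i\<bar> \<le> pi" by (auto simp: b_def abs_le_iff minus_le_iff)
      then show ?thesis using component_le_norm_cart[of y i] y by linarith
    qed
    show "0 < pi + 3" "pi + 3 < 2 * pi" using pi_gt3 by auto
    fix l :: "int^'n"
    have i1: "integrable lborel (\<lambda>x. indicator b x *\<^sub>R (cis (- (x \<bullet> ivec l)) * P x))"
      by (intro ib continuous_intros P_cont)
    have i2: "integrable lborel (\<lambda>x. cis (- (x \<bullet> ivec l)) * m x)" by (intro integrable_cis_mult im) measurable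
    have "fourier h (ivec l) = (\<integral>x. indicator b x *\<^sub>R (cis (- (x \<bullet> ivec l)) * P x) - cis (- (x \<bullet> ivec l)) * m x \<partial>lborel)"
      unfolding fourier_def
      by (rule Bochner_Integration.integral_cong) (auto simp: h_def indicator_def m_out algebra_simps)
    also have "\<dots> = (\<integral>x. indicator b x *\<^sub>R (cis (- (x \<bullet> ivec l)) * P x) \<partial>lborel) - (\<integral>x. cis (- (x \<bullet> ivec l)) * m x \<partial>lborel)"
      by (rule Bochner_Integration.integral_diff[OF i1 i2])
    also have "(\<integral>x. indicator b x *\<^sub>R (cis (- (x \<bullet> ivec l)) * P x) \<partial>lborel) = of_real ((2 * pi) ^ CARD('n)) * fourier_coeff m (ivec (- l))"
    proof -
      define f where "f n x = indicator b x *\<^sub>R (cis (- (x \<bullet> ivec l)) * (a n * cis (- (ivec (lat n) \<bullet> x))))" for n x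
      have fi: "integrable lborel (f n)" for n unfolding f_def by (intro ib continuous_intros)
      have nf: "norm (f n x) = indicator b x * norm (a n)" for n x
        by (simp add: f_def norm_mult)
      have f_sums: "(\<lambda>n. integral\<^sup>L lborel (f n)) sums (\<integral>x. (\<Sum>n. f n x) \<partial>lborel)"
      proof (rule sums_integral[OF fi])
        show "AE x in lborel. summable (\<lambda>n. norm (f n x))" unfolding nf by (intro AE_I2 summable_mult a)
        show "summable (\<lambda>n. \<integral>x. norm (f n x) \<partial>lborel)" unfolding nf by (simp add: summable_mult a)
      qed
      have fsum: "(\<Sum>n. f n x) = indicator b x *\<^sub>R (cis (- (x \<bullet> ivec l)) * P x)" for x
        unfolding f_def P_def
        by (rule sums_unique[symmetric]) (intro bounded_linear.sums[OF bounded_linear_scaleR_right] sums_mult summable_sums Ps)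
      \<comment> \<open>Orthogonality of the characters leaves the single term whose lattice point
        is \<open>- l\<close>; the sign comes from \<open>cis (- (ivec l \<bullet> x))\<close> in
        the series.\<close>
      have fint: "integral\<^sup>L lborel (f n) = (if lat n = - l then a n * of_real ((2 * pi) ^ CARD('n)) else 0)" for n
      proof -
        have "f n x = a n * (indicator b x *\<^sub>R cis (- (x \<bullet> ivec (lat n + l))))" for x
        proof -
          have "cis (- (x \<bullet> ivec (lat n + l))) = cis (- (x \<bullet> ivec l)) * cis (- (ivec (lat n) \<bullet> x))"
            by (simp add: cis_mult ivec_add inner_add_right inner_commute algebra_simps)
          then show ?thesis by (simp add: f_def scaleR_conv_of_real)
        qed
        then have fn: "f n = (\<lambda>x. a n * (indicator b x *\<^sub>R cis (- (x \<bullet> ivec (lat n + l)))))" by (rule ext)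
        have "integral\<^sup>L lborel (f n) = a n * (\<integral>x. indicator b x *\<^sub>R cis (- (x \<bullet> ivec (lat n + l))) \<partial>lborel)"
          unfolding fn by (rule integral_mult_right_zero)
        also have "\<dots> = (if lat n = - l then a n * of_real ((2 * pi) ^ CARD('n)) else 0)"
          unfolding b_def integral_cis_cube by (auto simp: add_eq_0_iff2)
        finally show ?thesis .
      qed
      obtain n0 where n0: "lat n0 = - l" using bij_lat by (metis bij_pointE)
      have "lat n = - l \<longleftrightarrow> n = n0" for n using bij_lat n0 by (metis bij_pointE)
      then have "(\<lambda>n. if n = n0 then a n * of_real ((2 * pi) ^ CARD('n)) else 0) sums (\<integral>x. (\<Sum>n. f n x) \<partial>lborel)"
        using f_sums unfolding fint by simp
      then have "(\<integral>x. (\<Sum>n. f n x) \<partial>lborel) = a n0 * of_real ((2 * pi) ^ CARD('n))"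
        using sums_single[of n0 "\<lambda>n. a n * of_real ((2 * pi) ^ CARD('n))"] sums_unique2 by blast
      then show ?thesis unfolding fsum by (simp add: a_def n0 mult.commute)
    qed
    also have "\<dots> = (\<integral>x. cis (- (x \<bullet> ivec l)) * m x \<partial>lborel)"
      by (simp add: fourier_coeff_def ivec_minus)
    finally show "fourier h (\<chi> i. of_int (l $ i)) = 0" by (simp add: ivec_def)
  qed
  moreover have "y \<in> b"
  proof -
    have "\<bar>y $ i\<bar> \<le> pi" for i using component_le_norm_cart[of y i] y pi_gt3 by linarith
    then show ?thesis unfolding b_def by (auto simp: abs_le_iff minus_le_iff)
  qed
  ultimately have "P y = m y" by (simp add: h_def)
  then show ?thesis using summable_sums[OF Ps[of y]] by (simp add: P_def a_def)
qed

section \<open>Schwartz functions\<close>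

lemma schwartz_smooth: "f \<in> schwartz \<Longrightarrow> smooth f"
  by (simp add: schwartz_def)

lemma partial_derivs_Nil [simp]: "partial_derivs [] f = f"
  by (simp add: partial_derivs_def)

lemma partial_derivs_Cons: "partial_derivs (i # is) f = partial_deriv i (partial_derivs is f)"
  by (simp add: partial_derivs_def)

lemma smooth_differentiable: "smooth f \<Longrightarrow> partial_derivs is f differentiable (at x)"
  by (simp add: smooth_def)

lemma smooth_has_derivative:
  "smooth f \<Longrightarrow> (partial_derivs is f has_derivative frechet_derivative (partial_derivs is f) (at x)) (at x)"
  using smooth_differentiable by (simp add: frechet_derivative_works)

lemma smooth_continuous: "smooth f \<Longrightarrow> continuous_on UNIV (partial_derivs is f)"
  by (meson continuous_at_imp_continuous_on differentiable_imp_continuous_within smooth_differentiable)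

lemma smooth_partial_derivative:
  fixes f :: "real^'n::finite \<Rightarrow> complex"
  assumes "smooth f"
  shows "((\<lambda>t. partial_derivs is f (x + t *\<^sub>R axis i 1)) has_vector_derivative partial_derivs (i # is) f x) (at 0)"
proof -
  let ?D = "frechet_derivative (partial_derivs is f) (at x)"
  have D: "(partial_derivs is f has_derivative ?D) (at (x + 0 *\<^sub>R axis i 1))"
    using smooth_has_derivative[OF assms] by simp
  have "((\<lambda>t. x + t *\<^sub>R axis i 1) has_derivative (\<lambda>t. t *\<^sub>R axis i 1)) (at 0)"
    by (auto intro!: derivative_eq_intros)
  from diff_chain_at[OF this D]
  have "((\<lambda>t. partial_derivs is f (x + t *\<^sub>R axis i 1)) has_derivative (\<lambda>t. ?D (t *\<^sub>R axis i 1))) (at 0)"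
    by (simp add: o_def)
  moreover have "?D (t *\<^sub>R axis i 1) = t *\<^sub>R partial_derivs (i # is) f x" for t
    using has_derivative_linear[OF smooth_has_derivative[OF assms]]
    by (simp add: partial_derivs_Cons partial_deriv_def linear_cmul)
  ultimately show ?thesis by (simp add: has_vector_derivative_def)
qed

lemma partial_deriv_eqI:
  assumes "(f has_derivative D) (at x)"
  shows "partial_deriv i f x = D (axis i 1)"
  using frechet_derivative_at[OF assms] by (simp add: partial_deriv_def)

lemma partial_derivs_affine:
  fixes f :: "real^'n::finite \<Rightarrow> complex"
  assumes "smooth f"
  shows "partial_derivs is (\<lambda>y. c * f (t + a *\<^sub>R y)) = (\<lambda>y. c * of_real a ^ length is * partial_derivs is f (t + a *\<^sub>R y))"
    (is "?A is")
    and "partial_derivs is (\<lambda>y. c * f (t + a *\<^sub>R y)) differentiable (at x)" (is "?B is x")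
proof -
  have der: "((\<lambda>y. d * partial_derivs is f (t + a *\<^sub>R y)) has_derivative
      (\<lambda>h. d * frechet_derivative (partial_derivs is f) (at (t + a *\<^sub>R x)) (a *\<^sub>R h))) (at x)" for d "is" x
  proof -
    have "((\<lambda>y. t + a *\<^sub>R y) has_derivative (\<lambda>h. a *\<^sub>R h)) (at x)" by (auto intro!: derivative_eq_intros)
    from diff_chain_at[OF this smooth_has_derivative[OF assms, of "is"]]
    have "((\<lambda>y. partial_derivs is f (t + a *\<^sub>R y)) has_derivative
      (\<lambda>h. frechet_derivative (partial_derivs is f) (at (t + a *\<^sub>R x)) (a *\<^sub>R h))) (at x)" by (simp add: o_def)
    then show ?thesis by (rule has_derivative_mult_right)
  qed
  show A: "?A is" for "is"
  proof (induction "is")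
    case (Cons i "is")
    show ?case
    proof
      fix y
      have "partial_derivs (i # is) (\<lambda>y. c * f (t + a *\<^sub>R y)) y = partial_deriv i (\<lambda>y. (c * of_real a ^ length is) * partial_derivs is f (t + a *\<^sub>R y)) y"
        by (simp only: partial_derivs_Cons Cons.IH)
      also have "\<dots> = (c * of_real a ^ length is) * frechet_derivative (partial_derivs is f) (at (t + a *\<^sub>R y)) (a *\<^sub>R axis i 1)"
        by (rule partial_deriv_eqI[OF der])
      also have "frechet_derivative (partial_derivs is f) (at (t + a *\<^sub>R y)) (a *\<^sub>R axis i 1) = a *\<^sub>R partial_derivs (i # is) f (t + a *\<^sub>R y)"
        using has_derivative_linear[OF smooth_has_derivative[OF assms]]
        by (simp add: partial_derivs_Cons partial_deriv_def linear_cmul)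
      finally show "partial_derivs (i # is) (\<lambda>y. c * f (t + a *\<^sub>R y)) y = c * of_real a ^ length (i # is) * partial_derivs (i # is) f (t + a *\<^sub>R y)"
        by (simp add: scaleR_conv_of_real mult_ac)
    qed
  qed simp
  show "?B is x" unfolding A using der by (auto simp: differentiable_def)
qed

lemma partial_derivs_add:
  fixes f g :: "real^'n::finite \<Rightarrow> complex"
  assumes "smooth f" "smooth g"
  shows "partial_derivs is (\<lambda>y. f y + g y) = (\<lambda>y. partial_derivs is f y + partial_derivs is g y)" (is "?A is")
    and "partial_derivs is (\<lambda>y. f y + g y) differentiable (at x)" (is "?B is x")
proof -
  note der = has_derivative_add[OF smooth_has_derivative[OF assms(1)] smooth_has_derivative[OF assms(2)]]
  show A: "?A is" for "is"
  proof (induction "is")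
    case (Cons i "is")
    show ?case
    proof
      fix y
      show "partial_derivs (i # is) (\<lambda>y. f y + g y) y = partial_derivs (i # is) f y + partial_derivs (i # is) g y"
        using partial_deriv_eqI[OF has_derivative_add[OF smooth_has_derivative[OF assms(1), of "is" y] smooth_has_derivative[OF assms(2), of "is" y]], of i]
        by (simp only: partial_derivs_Cons Cons.IH) (simp add: partial_deriv_def)
    qed
  qed simp
  show "?B is x" unfolding A using der by (auto simp: differentiable_def)
qed

lemma monomial_le:
  fixes x :: "real^'n::finite"
  shows "\<bar>monomial \<gamma> x\<bar> \<le> (1 + norm x) ^ (\<Sum>i\<in>UNIV. \<gamma> i)"
proof -
  have "\<bar>monomial \<gamma> x\<bar> = (\<Prod>i\<in>UNIV. \<bar>x $ i\<bar> ^ \<gamma> i)"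
    by (simp add: monomial_def abs_prod power_abs)
  also have "\<dots> \<le> (\<Prod>i\<in>UNIV. (1 + norm x) ^ \<gamma> i)"
  proof (intro prod_mono conjI power_mono)
    fix i show "\<bar>x $ i\<bar> \<le> 1 + norm x" using component_le_norm_cart[of x i] by linarith
  qed auto
  finally show ?thesis by (simp add: power_sum)
qed

text \<open>Bounds with monomials and bounds with powers of 1 + |x| imply each other, by
  \<open>weight_power_le\<close> and \<open>monomial_le\<close>. The second form is the one that
  behaves well under affine changes of variable.\<close>

lemma schwartz_iff:
  fixes f :: "real^'n::finite \<Rightarrow> complex"
  shows "f \<in> schwartz \<longleftrightarrow> smooth f \<and> (\<forall>is. rapid (partial_derivs is f))"
proof
  assume f: "f \<in> schwartz"
  have "rapid (partial_derivs is f)" for "is"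
  proof (rule rapidI)
    show "partial_derivs is f \<in> borel_measurable borel"
      by (rule borel_measurable_continuous_onI[OF smooth_continuous[OF schwartz_smooth[OF f]]])
    fix N
    have "\<exists>C. \<forall>x. norm (of_real (monomial \<gamma> x) * partial_derivs is f x) \<le> C" for \<gamma>
      using f unfolding schwartz_def bounded_iff by auto
    then obtain C where C: "\<And>\<gamma> x. norm (of_real (monomial \<gamma> x) * partial_derivs is f x) \<le> C \<gamma>" by metis
    define A where "A = (real CARD('n) + 1) ^ N * (C (\<lambda>_. 0) + (\<Sum>i\<in>UNIV. C ((\<lambda>_. 0)(i := N))))"
    have "(1 + norm x) ^ N * norm (partial_derivs is f x) \<le> A" for x
    proof -
      have m: "monomial ((\<lambda>_. 0)(i := N)) x = (x $ i) ^ N" for i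
      proof -
        have "(\<Prod>j\<in>UNIV. (x $ j) ^ ((\<lambda>_. 0)(i := N)) j) = (\<Prod>j\<in>UNIV. if j = i then (x $ i) ^ N else 1)"
          by (intro prod.cong) auto
        then show ?thesis by (simp add: monomial_def)
      qed
      have "(1 + norm x) ^ N * norm (partial_derivs is f x) \<le> ((real CARD('n) + 1) ^ N * (1 + (\<Sum>i\<in>UNIV. \<bar>x $ i\<bar> ^ N))) * norm (partial_derivs is f x)"
        by (intro mult_right_mono weight_power_le) simp
      also have "\<dots> = (real CARD('n) + 1) ^ N * (norm (of_real (monomial (\<lambda>_. 0) x) * partial_derivs is f x)
         + (\<Sum>i\<in>UNIV. norm (of_real (monomial ((\<lambda>_. 0)(i := N)) x) * partial_derivs is f x)))"
        unfolding m by (simp add: monomial_def norm_mult power_abs algebra_simps sum_distrib_left sum_distrib_right norm_power)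
      also have "\<dots> \<le> A" unfolding A_def by (intro mult_left_mono add_mono sum_mono C) auto
      finally show ?thesis .
    qed
    then show "\<exists>C. \<forall>x. (1 + norm x) ^ N * norm (partial_derivs is f x) \<le> C" by blast
  qed
  with f show "smooth f \<and> (\<forall>is. rapid (partial_derivs is f))" by (simp add: schwartz_smooth)
next
  assume f: "smooth f \<and> (\<forall>is. rapid (partial_derivs is f))"
  have "bounded (range (\<lambda>x. of_real (monomial \<gamma> x) * partial_derivs is f x))" for \<gamma> "is"
  proof -
    obtain C where C: "\<And>x. (1 + norm x) ^ (\<Sum>i\<in>UNIV. \<gamma> i) * norm (partial_derivs is f x) \<le> C"
      using f rapidD by metis
    have "norm (of_real (monomial \<gamma> x) * partial_derivs is f x) \<le> C" for x
      using mult_right_mono[OF monomial_le[of \<gamma> x], of "norm (partial_derivs is f x)"] C[of x]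
      by (simp add: norm_mult)
    then show ?thesis by (auto simp: bounded_iff)
  qed
  with f show "f \<in> schwartz" by (simp add: schwartz_def)
qed

lemma schwartz_rapid_derivs: "f \<in> schwartz \<Longrightarrow> rapid (partial_derivs is f)"
  by (simp add: schwartz_iff)

lemma schwartz_rapid: "f \<in> schwartz \<Longrightarrow> rapid f"
  using schwartz_rapid_derivs[of f "[]"] by simp

lemma schwartz_affine:
  fixes f :: "real^'n::finite \<Rightarrow> complex"
  assumes "f \<in> schwartz" "a \<noteq> 0" shows "(\<lambda>y. c * f (t + a *\<^sub>R y)) \<in> schwartz"
proof -
  note A = partial_derivs_affine[OF schwartz_smooth[OF assms(1)]]
  have "smooth (\<lambda>y. c * f (t + a *\<^sub>R y))" unfolding smooth_def using A(2) by blast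
  moreover have "rapid (partial_derivs is (\<lambda>y. c * f (t + a *\<^sub>R y)))" for "is"
    unfolding A(1) by (intro rapid_cmult rapid_affine schwartz_rapid_derivs assms)
  ultimately show ?thesis by (simp add: schwartz_iff)
qed

lemma schwartz_add:
  fixes f g :: "real^'n::finite \<Rightarrow> complex"
  assumes "f \<in> schwartz" "g \<in> schwartz" shows "(\<lambda>y. f y + g y) \<in> schwartz"
proof -
  note A = partial_derivs_add[OF schwartz_smooth[OF assms(1)] schwartz_smooth[OF assms(2)]]
  have "smooth (\<lambda>y. f y + g y)" unfolding smooth_def using A(2) by blast
  moreover have "rapid (partial_derivs is (\<lambda>y. f y + g y))" for "is"
    unfolding A(1) by (intro rapid_add schwartz_rapid_derivs assms)
  ultimately show ?thesis by (simp add: schwartz_iff)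
qed

lemma schwartz_cmult: "f \<in> schwartz \<Longrightarrow> (\<lambda>y. c * f y) \<in> schwartz"
  using schwartz_affine[of f 1 c 0] by simp

lemma partial_derivs_cmult: "smooth f \<Longrightarrow> partial_derivs is (\<lambda>y. c * f y) = (\<lambda>y. c * partial_derivs is f y)"
  using partial_derivs_affine(1)[of f "is" c 0 1] by simp

lemma schwartz_zero: "(\<lambda>y. 0) \<in> (schwartz :: (real^'n::finite \<Rightarrow> complex) set)"
proof -
  have z: "partial_derivs is (\<lambda>y::real^'n. 0) = (\<lambda>y. 0)" for "is"
  proof (induction "is")
    case (Cons i "is")
    show ?case unfolding partial_derivs_Cons Cons.IH
      by (rule ext) (rule partial_deriv_eqI[OF has_derivative_const])
  qed simp
  show ?thesis by (auto simp: schwartz_iff smooth_def z rapid_def intro!: exI[of _ "0::real"])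
qed

lemma fourier_partial_derivs:
  fixes f :: "real^'n::finite \<Rightarrow> complex"
  assumes f: "f \<in> schwartz"
  shows "fourier (partial_derivs is f) \<xi> = (\<Prod>i\<leftarrow>is. \<i> * of_real (\<xi> $ i)) * fourier f \<xi>"
proof (induction "is")
  case (Cons i "is")
  have "fourier (partial_derivs (i # is) f) \<xi> = \<i> * of_real (\<xi> $ i) * fourier (partial_derivs is f) \<xi>"
    by (rule fourier_partial_derivative[OF smooth_partial_derivative[OF schwartz_smooth[OF f]]])
       (intro schwartz_rapid_derivs f)+
  then show ?case using Cons by (simp add: mult_ac)
qed simp

section \<open>Continuous functionals\<close>

text \<open>Linearity together with a bound by finitely many weighted derivatives. Compared with
  \<open>schwartz_inf_dual\<close> the condition \<open>extensional\<close> is dropped, since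
  \<open>rescale\<close> need not preserve it. Quantifying over upper bounds \<open>B\<close> avoids
  suprema.\<close>

definition tame :: "((real^'n::finite \<Rightarrow> complex) \<Rightarrow> complex) \<Rightarrow> bool" where
  "tame u \<longleftrightarrow> (\<forall>f\<in>schwartz_inf. \<forall>g\<in>schwartz_inf. u (\<lambda>x. f x + g x) = u f + u g) \<and>
     (\<forall>c. \<forall>f\<in>schwartz_inf. u (\<lambda>x. c * f x) = c * u f) \<and>
     (\<exists>C N. C \<ge> 0 \<and> (\<forall>h\<in>schwartz_inf. \<forall>B. (\<forall>is x. length is \<le> N \<longrightarrow> (1 + norm x) ^ N * norm (partial_derivs is h x) \<le> B) \<longrightarrow>
        norm (u h) \<le> C * B))"

text \<open>Induction over the generation of the open set from the subbasis. A subbasic set centred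
  at \<open>f\<close> contains a neighbourhood of \<open>h\<close> because the seminorm
  \<open>e\<close> of \<open>h - f\<close> is strictly below its radius; half of the gap is granted,
  so the inequality stays strict.\<close>

lemma schwartz_topology_neighbourhood:
  fixes h :: "real^'n::finite \<Rightarrow> complex"
  assumes "openin schwartz_topology U" "h \<in> U" "h \<in> schwartz"
  shows "\<exists>N \<delta>. \<delta> > 0 \<and> (\<forall>g\<in>schwartz. (\<forall>is x. length is \<le> N \<longrightarrow>
    (1 + norm x) ^ N * norm (partial_derivs is (\<lambda>y. g y - h y) x) \<le> \<delta>) \<longrightarrow> g \<in> U)"
proof -
  define near where "near N \<delta> g \<longleftrightarrow> (\<forall>is x. length is \<le> N \<longrightarrow>
    (1 + norm x) ^ N * norm (partial_derivs is (\<lambda>y. g y - h y) x) \<le> \<delta>)" for N \<delta> g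
  have near_mono: "near N \<delta> g" if "near M \<epsilon> g" "N \<le> M" "\<epsilon> \<le> \<delta>" for N M \<delta> \<epsilon> g
    unfolding near_def
  proof (intro allI impI)
    fix "is" :: "'n list" and x :: "real^'n" assume l: "length is \<le> N"
    have "(1 + norm x) ^ N * norm (partial_derivs is (\<lambda>y. g y - h y) x) \<le> (1 + norm x) ^ M * norm (partial_derivs is (\<lambda>y. g y - h y) x)"
      using that by (intro mult_right_mono power_increasing) auto
    also have "\<dots> \<le> \<epsilon>" using that l unfolding near_def by auto
    finally show "(1 + norm x) ^ N * norm (partial_derivs is (\<lambda>y. g y - h y) x) \<le> \<delta>" using that by simp
  qed
  have "generate_topology_on {{g \<in> schwartz. schwartz_seminorm \<gamma> is (\<lambda>x. g x - f x) < \<epsilon>} | f \<gamma> is \<epsilon>. f \<in> schwartz \<and> 0 < \<epsilon>} U"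
    using assms(1) unfolding schwartz_topology_def openin_topology_generated_by_iff .
  then have "\<exists>N \<delta>. \<delta> > 0 \<and> (\<forall>g\<in>schwartz. near N \<delta> g \<longrightarrow> g \<in> U)"
    using assms(2)
  proof (induction rule: generate_topology_on.induct)
    case (Int a b)
    obtain N \<delta> where a: "\<delta> > 0" "\<forall>g\<in>schwartz. near N \<delta> g \<longrightarrow> g \<in> a"
      using Int.IH(1)[OF IntD1[OF Int.prems]] by (elim exE conjE)
    obtain M \<epsilon> where b: "\<epsilon> > 0" "\<forall>g\<in>schwartz. near M \<epsilon> g \<longrightarrow> g \<in> b"
      using Int.IH(2)[OF IntD2[OF Int.prems]] by (elim exE conjE)
    note 1 = a b
    have "g \<in> a \<inter> b" if "g \<in> schwartz" "near (max N M) (min \<delta> \<epsilon>) g" for g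
      using 1 that near_mono[OF that(2), of N \<delta>] near_mono[OF that(2), of M \<epsilon>] by auto
    then show ?case using 1 by (intro exI[of _ "max N M"] exI[of _ "min \<delta> \<epsilon>"]) auto
  next
    case (UN K)
    then obtain k where k: "k \<in> K" "h \<in> k" by blast
    obtain N \<delta> where "\<delta> > 0" "\<forall>g\<in>schwartz. near N \<delta> g \<longrightarrow> g \<in> k"
      using UN.IH[OF k] by (elim exE conjE)
    with \<open>k \<in> K\<close> show ?case by (intro exI[of _ N] exI[of _ \<delta>]) blast
  next
    case (Basis s)
    then obtain f \<gamma> "is" \<epsilon> where s: "s = {g \<in> schwartz. schwartz_seminorm \<gamma> is (\<lambda>x. g x - f x) < \<epsilon>}" "f \<in> schwartz" "0 < \<epsilon>"
      by auto
    define e where "e = schwartz_seminorm \<gamma> is (\<lambda>x. h x - f x)"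
    have e: "e < \<epsilon>" using Basis s by (simp add: e_def)
    define N where "N = max (length is) (\<Sum>i\<in>UNIV. \<gamma> i)"
    have diff: "(\<lambda>x. p x - q x) \<in> schwartz" if "p \<in> schwartz" "q \<in> schwartz" for p q :: "real^'n \<Rightarrow> complex"
      using schwartz_add[OF that(1) schwartz_cmult[OF that(2), of "-1"]] by simp
    have hf: "norm (of_real (monomial \<gamma> x) * partial_derivs is (\<lambda>x. h x - f x) x) \<le> e" for x
      unfolding e_def schwartz_seminorm_def
    proof (rule cSUP_upper)
      show "bdd_above (range (\<lambda>x. norm (of_real (monomial \<gamma> x) * partial_derivs is (\<lambda>x. h x - f x) x)))"
        using diff[OF assms(3) s(2)] unfolding schwartz_def bounded_iff by (force simp: bdd_above_def)
    qed simp
    have "g \<in> s" if g: "g \<in> schwartz" "near N ((\<epsilon> - e) / 2) g" for g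
    proof -
      have "schwartz_seminorm \<gamma> is (\<lambda>x. g x - f x) \<le> (\<epsilon> - e) / 2 + e"
        unfolding schwartz_seminorm_def
      proof (rule cSUP_least)
        fix x :: "real^'n"
        have "\<bar>monomial \<gamma> x\<bar> \<le> (1 + norm x) ^ N"
          by (rule order.trans[OF monomial_le power_increasing]) (auto simp: N_def)
        then have "norm (of_real (monomial \<gamma> x) * partial_derivs is (\<lambda>x. g x - h x) x) \<le> (1 + norm x) ^ N * norm (partial_derivs is (\<lambda>x. g x - h x) x)"
          by (simp add: norm_mult mult_right_mono)
        also have "\<dots> \<le> (\<epsilon> - e) / 2" using g(2) unfolding near_def N_def by auto
        finally have 1: "norm (of_real (monomial \<gamma> x) * partial_derivs is (\<lambda>x. g x - h x) x) \<le> (\<epsilon> - e) / 2" .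
        have "(\<lambda>x. g x - f x) = (\<lambda>x. (g x - h x) + (h x - f x))" by auto
        then have "partial_derivs is (\<lambda>x. g x - f x) = (\<lambda>x. partial_derivs is (\<lambda>x. g x - h x) x + partial_derivs is (\<lambda>x. h x - f x) x)"
          using partial_derivs_add(1)[OF schwartz_smooth[OF diff[OF g(1) assms(3)]] schwartz_smooth[OF diff[OF assms(3) s(2)]], of "is"] by simp
        then have "norm (of_real (monomial \<gamma> x) * partial_derivs is (\<lambda>x. g x - f x) x)
           \<le> norm (of_real (monomial \<gamma> x) * partial_derivs is (\<lambda>x. g x - h x) x) + norm (of_real (monomial \<gamma> x) * partial_derivs is (\<lambda>x. h x - f x) x)"
          by (simp only: distrib_left norm_triangle_ineq)
        then show "norm (of_real (monomial \<gamma> x) * partial_derivs is (\<lambda>x. g x - f x) x) \<le> (\<epsilon> - e) / 2 + e"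
          using 1 hf[of x] by linarith
      qed simp
      also have "\<dots> < \<epsilon>" using e by (simp add: field_simps)
      finally show ?thesis using s g by simp
    qed
    then show ?case using e by (intro exI[of _ N] exI[of _ "(\<epsilon> - e) / 2"]) auto
  qed simp
  then show ?thesis unfolding near_def .
qed

lemma schwartz_inf_zero: "(\<lambda>y. 0) \<in> schwartz_inf"
  by (simp add: schwartz_inf_def schwartz_zero)

lemma schwartz_inf_schwartz: "h \<in> schwartz_inf \<Longrightarrow> h \<in> schwartz"
  by (simp add: schwartz_inf_def)

lemma schwartz_inf_cmult: "h \<in> schwartz_inf \<Longrightarrow> (\<lambda>x. c * h x) \<in> schwartz_inf"
  by (simp add: schwartz_inf_def schwartz_cmult mult.assoc)

text \<open>The preimage of the unit disc contains a neighbourhood of 0, and \<open>h\<close> is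
  scaled into it. If \<open>B = 0\<close>, arbitrarily large multiples of \<open>h\<close> fit,
  which forces \<open>u h = 0\<close>.\<close>

lemma dual_tame:
  fixes u :: "(real^'n::finite \<Rightarrow> complex) \<Rightarrow> complex"
  assumes u: "u \<in> schwartz_inf_dual"
  shows "tame u"
proof -
  let ?T = "subtopology schwartz_topology schwartz_inf :: (real^'n \<Rightarrow> complex) topology"
  have lin: "\<forall>f\<in>schwartz_inf. \<forall>g\<in>schwartz_inf. u (\<lambda>x. f x + g x) = u f + u g"
    and hom: "\<And>c f. f \<in> schwartz_inf \<Longrightarrow> u (\<lambda>x. c * f x) = c * u f"
    and cont: "continuous_map ?T euclidean u"
    using u by (auto simp: schwartz_inf_dual_def)
  have u0: "u (\<lambda>x. 0) = 0" using hom[OF schwartz_inf_zero, of 0] by simp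
  have "openin ?T {h \<in> topspace ?T. u h \<in> ball 0 1}"
    by (rule openin_continuous_map_preimage[OF cont]) simp
  then obtain U where U: "openin schwartz_topology U" "{h \<in> topspace ?T. u h \<in> ball 0 1} = U \<inter> schwartz_inf"
    unfolding openin_subtopology by blast
  have top: "topspace schwartz_topology = (schwartz :: (real^'n \<Rightarrow> complex) set)"
  proof -
    let ?B = "{{g \<in> schwartz. schwartz_seminorm \<gamma> is (\<lambda>x. g x - f x) < \<epsilon>} | f \<gamma> is \<epsilon>. f \<in> schwartz \<and> 0 < \<epsilon>} :: (real^'n \<Rightarrow> complex) set set"
    have "g \<in> \<Union>?B" if "g \<in> schwartz" for g
    proof (rule UnionI)
      show "{g' \<in> schwartz. schwartz_seminorm (\<lambda>_. 0) [] (\<lambda>x. g' x - g x) < 1} \<in> ?B"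
        using that by (intro CollectI exI[of _ g] exI[of _ "\<lambda>_. 0"] exI[of _ "[]"] exI[of _ 1]) simp
      show "g \<in> {g' \<in> schwartz. schwartz_seminorm (\<lambda>_. 0) [] (\<lambda>x. g' x - g x) < 1}"
        using that by (simp add: schwartz_seminorm_def)
    qed
    then show ?thesis unfolding schwartz_topology_def topology_generated_by_topspace by blast
  qed
  have "(\<lambda>x. 0) \<in> {h \<in> topspace ?T. u h \<in> ball 0 1}" by (simp add: top u0 schwartz_zero schwartz_inf_zero)
  then have "(\<lambda>x. 0) \<in> U" unfolding U(2) by simp
  from schwartz_topology_neighbourhood[OF U(1) this schwartz_zero]
  obtain N \<delta> where N0: "\<delta> > 0" "\<forall>g\<in>schwartz. (\<forall>is x. length is \<le> N \<longrightarrow>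
    (1 + norm x) ^ N * norm (partial_derivs is (\<lambda>y. g y - 0) x) \<le> \<delta>) \<longrightarrow> g \<in> U" by blast
  have N: "g \<in> U" if "g \<in> schwartz" "\<And>is x. length is \<le> N \<Longrightarrow>
    (1 + norm x) ^ N * norm (partial_derivs is g x) \<le> \<delta>" for g
    using N0(2) that by simp
  have "norm (u h) \<le> 1 / \<delta> * B" if h: "h \<in> schwartz_inf"
    and B: "\<And>is x. length is \<le> N \<Longrightarrow> (1 + norm x) ^ N * norm (partial_derivs is h x) \<le> B" for h B
  proof -
    have small: "norm (u h) * c \<le> 1" if c: "c > 0" "c * B \<le> \<delta>" for c
    proof -
      have "(\<lambda>x. of_real c * h x) \<in> U"
      proof (rule N[OF schwartz_cmult[OF schwartz_inf_schwartz[OF h]]])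
        fix "is" :: "'n list" and x :: "real^'n" assume l: "length is \<le> N"
        have "(1 + norm x) ^ N * norm (partial_derivs is (\<lambda>x. of_real c * h x) x) = c * ((1 + norm x) ^ N * norm (partial_derivs is h x))"
          using c by (simp add: partial_derivs_cmult[OF schwartz_smooth[OF schwartz_inf_schwartz[OF h]]] norm_mult)
        also have "\<dots> \<le> c * B" using c B[OF l] by (intro mult_left_mono) auto
        finally show "(1 + norm x) ^ N * norm (partial_derivs is (\<lambda>x. of_real c * h x) x) \<le> \<delta>" using c by simp
      qed
      then have "(\<lambda>x. of_real c * h x) \<in> U \<inter> schwartz_inf" using schwartz_inf_cmult[OF h] by simp
      then have "norm (u (\<lambda>x. of_real c * h x)) < 1" unfolding U(2)[symmetric] by simp
      then show ?thesis using c hom[OF h, of "of_real c"] by (simp add: norm_mult mult.commute)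
    qed
    have B0: "B \<ge> 0" using B[of "[]" 0] by (simp add: order.trans[OF norm_ge_zero])
    show ?thesis
    proof (cases "B = 0")
      case True
      have "norm (u h) \<le> 0"
      proof (rule field_le_epsilon)
        fix e :: real assume "e > 0"
        then show "norm (u h) \<le> 0 + e" using small[of "1/e"] True N0(1) by (simp add: field_simps)
      qed
      then show ?thesis using True by simp
    next
      case False
      then show ?thesis using small[of "\<delta> / B"] B0 N0(1) by (simp add: field_simps)
    qed
  qed
  then show ?thesis unfolding tame_def using lin hom N0(1) by (intro conjI exI[of _ "1/\<delta>"] exI[of _ N]) auto
qed

section \<open>Band-limited test functions\<close>

text \<open>In contrast to \<open>admissible\<close>, this property survives all dilations,
  reflections and translations, and it still puts the function into
  \<open>schwartz_inf\<close>.\<close>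

definition band :: "(real^'n::finite \<Rightarrow> complex) \<Rightarrow> bool" where
  "band \<phi> \<longleftrightarrow> \<phi> \<in> schwartz \<and> (\<exists>r>0. \<forall>\<xi>. norm \<xi> < r \<longrightarrow> fourier \<phi> \<xi> = 0)"

lemma band_schwartz: "band \<phi> \<Longrightarrow> \<phi> \<in> schwartz"
  by (simp add: band_def)

lemma fourier_coord_vanishes:
  fixes h :: "real^'n::finite \<Rightarrow> complex"
  assumes h: "rapid h" and z: "\<And>\<xi>. norm \<xi> < r \<Longrightarrow> fourier h \<xi> = 0" and \<xi>: "norm \<xi> < r"
  shows "fourier (\<lambda>x. of_real (x $ i) * h x) \<xi> = 0"
proof -
  have "((\<lambda>t. fourier h (\<xi> + t *\<^sub>R axis i 1)) has_vector_derivative 0) (at 0)"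
    by (rule has_vector_derivative_transform_within_open[OF has_vector_derivative_const
        open_line_preimage[of "{x. norm x < r}" \<xi> "axis i 1"]])
       (auto intro!: open_Collect_less continuous_intros simp: \<xi> z)
  with fourier_has_partial_derivative[OF h, of \<xi> i]
  have "fourier (\<lambda>x. - \<i> * (of_real (x $ i) * h x)) \<xi> = 0" by (rule vector_derivative_unique_at)
  then show ?thesis unfolding fourier_cmult by simp
qed

text \<open>Moments are derivatives of the transform at 0 up to constants, and the transform
  vanishes near 0. The invariant \<open>good\<close> keeps the vanishing on the whole ball, so that
  multiplication by coordinates can be iterated.\<close>

lemma band_schwartz_inf:
  fixes \<phi> :: "real^'n::finite \<Rightarrow> complex"
  assumes "band \<phi>" shows "\<phi> \<in> schwartz_inf"
proof -
  obtain r where r: "r > 0" "\<And>\<xi>. norm \<xi> < r \<Longrightarrow> fourier \<phi> \<xi> = 0" using assms by (auto simp: band_def)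
  define good where "good h \<longleftrightarrow> rapid h \<and> (\<forall>\<xi>. norm \<xi> < r \<longrightarrow> fourier h \<xi> = 0)" for h :: "real^'n \<Rightarrow> complex"
  have step: "good (\<lambda>x. of_real (x $ i ^ k) * h x)" if "good h" for h i k
  proof (induction k)
    case (Suc k)
    have "good (\<lambda>x. of_real (x $ i) * (of_real (x $ i ^ k) * h x))"
      using Suc fourier_coord_vanishes[of "\<lambda>x. of_real (x $ i ^ k) * h x" r] rapid_coord[of "\<lambda>x. of_real (x $ i ^ k) * h x" i]
      unfolding good_def by blast
    then show ?case by (simp add: mult.assoc)
  qed (use that in simp)
  have "good (\<lambda>x. of_real (\<Prod>i\<in>S. x $ i ^ \<gamma> i) * \<phi> x)" if "finite S" for S \<gamma>
    using that
  proof (induction S)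
    case empty then show ?case using r band_schwartz[OF assms] by (simp add: good_def schwartz_rapid)
  next
    case (insert i S)
    then show ?case using step[OF insert.IH, of i "\<gamma> i"] by (simp add: mult.assoc)
  qed
  from this[of UNIV] r have "fourier (\<lambda>x. of_real (\<Prod>i\<in>UNIV. x $ i ^ \<gamma> i) * \<phi> x) 0 = 0" for \<gamma>
    by (simp add: good_def)
  then have "(\<integral>x. \<phi> x * of_real (monomial \<gamma> x) \<partial>lborel) = 0" for \<gamma>
    unfolding fourier_def monomial_def by (simp add: mult.commute)
  then show ?thesis using band_schwartz[OF assms] by (simp add: schwartz_inf_def)
qed

lemma band_affine:
  fixes \<phi> :: "real^'n::finite \<Rightarrow> complex"
  assumes "band \<phi>" "a \<noteq> 0" shows "band (\<lambda>y. c * \<phi> (t + a *\<^sub>R y))"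
proof -
  obtain r where r: "r > 0" "\<And>\<xi>. norm \<xi> < r \<Longrightarrow> fourier \<phi> \<xi> = 0" using assms by (auto simp: band_def)
  have i: "integrable lborel \<phi>" by (intro rapid_integrable schwartz_rapid band_schwartz assms)
  have "fourier (\<lambda>y. c * \<phi> (t + a *\<^sub>R y)) \<xi> = 0" if "norm \<xi> < \<bar>a\<bar> * r" for \<xi>
    using that assms(2) r(2)[of "\<xi> /\<^sub>R a"] unfolding fourier_cmult fourier_affine[OF i assms(2)]
    by (simp add: field_simps)
  moreover have "\<bar>a\<bar> * r > 0" using assms r by simp
  ultimately show ?thesis using schwartz_affine[OF band_schwartz[OF assms(1)] assms(2)] unfolding band_def by blast
qed

lemma band_reflect_translate: "band \<phi> \<Longrightarrow> band (\<lambda>y. \<phi> (x - y))"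
  using band_affine[of \<phi> "-1" 1 x] by simp

lemma integrable_mult_monomial:
  fixes h :: "real^'n::finite \<Rightarrow> complex"
  assumes r: "rapid h" shows "integrable lborel (\<lambda>x. h x * of_real (monomial \<gamma> x))"
proof (rule rapid_integrable, rule rapid_dominated[OF r, where B=1])
  show "(\<lambda>x. h x * of_real (monomial \<gamma> x)) \<in> borel_measurable borel"
    unfolding monomial_def using rapid_measurable[OF r] by measurable
  show "norm (h x * of_real (monomial \<gamma> x)) \<le> 1 * (1 + norm x) ^ (\<Sum>i\<in>UNIV. \<gamma> i) * norm (h x)" for x
    using mult_right_mono[OF monomial_le[of \<gamma> x], of "norm (h x)"] by (simp add: norm_mult mult.commute)
qed simp

lemma schwartz_inf_add:
  assumes "f \<in> schwartz_inf" "g \<in> schwartz_inf" shows "(\<lambda>x. f x + g x) \<in> schwartz_inf"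
  using assms integrable_mult_monomial[OF schwartz_rapid, of f] integrable_mult_monomial[OF schwartz_rapid, of g]
  by (auto simp: schwartz_inf_def schwartz_add distrib_right)

lemma schwartz_inf_sum: "finite I \<Longrightarrow> (\<And>i. i \<in> I \<Longrightarrow> f i \<in> schwartz_inf) \<Longrightarrow> (\<lambda>x. \<Sum>i\<in>I. f i x) \<in> schwartz_inf"
  by (induction I rule: finite_induct) (auto intro: schwartz_inf_zero schwartz_inf_add)

lemma partial_derivs_sum:
  assumes "finite I" "\<And>i. i \<in> I \<Longrightarrow> f i \<in> schwartz_inf"
  shows "partial_derivs is (\<lambda>x. \<Sum>i\<in>I. f i x) = (\<lambda>x. \<Sum>i\<in>I. partial_derivs is (f i) x)"
  using assms
proof (induction I rule: finite_induct)
  case empty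
  then show ?case using partial_derivs_cmult[OF schwartz_smooth[OF schwartz_zero], of "is" 0] by simp
next
  case (insert i I)
  have "partial_derivs is (\<lambda>x. f i x + (\<Sum>i\<in>I. f i x)) = (\<lambda>x. partial_derivs is (f i) x + partial_derivs is (\<lambda>x. \<Sum>i\<in>I. f i x) x)"
    using insert by (intro partial_derivs_add schwartz_smooth schwartz_inf_schwartz schwartz_inf_sum) auto
  then show ?case using insert by simp
qed

lemma tame_add: "tame u \<Longrightarrow> f \<in> schwartz_inf \<Longrightarrow> g \<in> schwartz_inf \<Longrightarrow> u (\<lambda>x. f x + g x) = u f + u g"
  by (simp add: tame_def)

lemma tame_cmult: "tame u \<Longrightarrow> f \<in> schwartz_inf \<Longrightarrow> u (\<lambda>x. c * f x) = c * u f"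
  by (simp add: tame_def)

lemma tame_sum:
  assumes u: "tame u" and "finite I" "\<And>i. i \<in> I \<Longrightarrow> f i \<in> schwartz_inf"
  shows "u (\<lambda>x. \<Sum>i\<in>I. f i x) = (\<Sum>i\<in>I. u (f i))"
  using assms(2,3)
proof (induction I rule: finite_induct)
  case empty then show ?case using tame_cmult[OF u schwartz_inf_zero, of 0] by simp
next
  case (insert i I)
  then show ?case by (simp add: tame_add[OF u _ schwartz_inf_sum])
qed

text \<open>There are finitely many lists of length at most \<open>N\<close>; the sum of their
  bounds serves all of them at once.\<close>

lemma schwartz_uniform_bound:
  fixes f :: "real^'n::finite \<Rightarrow> complex"
  assumes "f \<in> schwartz"
  obtains B where "B > 0" "\<And>is x. length is \<le> N \<Longrightarrow> (1 + norm x) ^ N * norm (partial_derivs is f x) \<le> B"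
proof -
  have "\<exists>C. C > 0 \<and> (\<forall>x. (1 + norm x) ^ N * norm (partial_derivs is f x) \<le> C)" for "is"
    using rapidD[OF schwartz_rapid_derivs[OF assms]] by metis
  then obtain C where C: "\<And>is. C is > 0" "\<And>is x. (1 + norm x) ^ N * norm (partial_derivs is f x) \<le> C is" by metis
  let ?L = "{is :: 'n list. set is \<subseteq> UNIV \<and> length is \<le> N}"
  have fin: "finite ?L" by (rule finite_lists_length_le) simp
  have "(1 + norm x) ^ N * norm (partial_derivs is f x) \<le> sum C ?L" if "length is \<le> N" for "is" x
    using C(2)[of x "is"] member_le_sum[of "is" ?L C] that fin C(1) by (auto simp: less_imp_le intro: order.trans)
  moreover have "sum C ?L > 0" using fin C(1) by (intro sum_pos) (auto intro: exI[of _ "[]"])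
  ultimately show ?thesis using that by blast
qed

text \<open>Translating a test function by \<open>x\<close> costs at most (1 + |x|)^N in its
  weighted bounds. Both \<open>C\<close> and \<open>N\<close> belong to \<open>u\<close>, so no
  uniform estimate may retain them; they only secure convergence.\<close>

lemma tame_growth:
  fixes \<phi> :: "real^'n::finite \<Rightarrow> complex"
  assumes u: "tame u" and \<phi>: "band \<phi>"
  obtains C N where "C > 0" "\<And>x. norm (u (\<lambda>y. \<phi> (x - y))) \<le> C * (1 + norm x) ^ N"
proof -
  obtain C N where C: "C \<ge> 0" "\<And>h B. h \<in> schwartz_inf \<Longrightarrow> (\<And>is x. length is \<le> N \<Longrightarrow> (1 + norm x) ^ N * norm (partial_derivs is h x) \<le> B) \<Longrightarrow>
        norm (u h) \<le> C * B"
    using u unfolding tame_def by metis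
  obtain B where B: "B > 0" "\<And>is x. length is \<le> N \<Longrightarrow> (1 + norm x) ^ N * norm (partial_derivs is \<phi> x) \<le> B"
    using schwartz_uniform_bound[OF band_schwartz[OF \<phi>]] by metis
  have "norm (u (\<lambda>y. \<phi> (x - y))) \<le> C * (B * (1 + norm x) ^ N)" for x
  proof (rule C(2)[OF band_schwartz_inf[OF band_reflect_translate[OF \<phi>]]])
    fix "is" :: "'n list" and y :: "real^'n" assume l: "length is \<le> N"
    have "norm (partial_derivs is (\<lambda>y. \<phi> (x - y)) y) = norm (partial_derivs is \<phi> (x - y))"
      using partial_derivs_affine(1)[OF schwartz_smooth[OF band_schwartz[OF \<phi>]], of "is" 1 x "-1"] by (simp add: norm_mult norm_power)
    moreover have "(1 + norm y) ^ N \<le> (1 + norm x) ^ N * (1 + norm (x - y)) ^ N"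
      using power_mono[OF weight_add[of x "y - x"], of N] by (simp add: power_mult_distrib norm_minus_commute)
    ultimately have "(1 + norm y) ^ N * norm (partial_derivs is (\<lambda>y. \<phi> (x - y)) y) \<le> (1 + norm x) ^ N * (1 + norm (x - y)) ^ N * norm (partial_derivs is \<phi> (x - y))"
      by (simp add: mult_right_mono)
    also have "\<dots> \<le> (1 + norm x) ^ N * B" using B(2)[OF l, of "x - y"] by (simp add: mult.assoc mult_left_mono)
    finally show "(1 + norm y) ^ N * norm (partial_derivs is (\<lambda>y. \<phi> (x - y)) y) \<le> B * (1 + norm x) ^ N" by (simp add: mult.commute)
  qed
  also have "C * (B * (1 + norm x) ^ N) \<le> (C * B + 1) * (1 + norm x) ^ N" for x by (simp add: algebra_simps)
  finally show ?thesis using C(1) B(1) by (intro that[of "C * B + 1" N]) (auto simp: add_nonneg_pos)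
qed

section \<open>Series of translates\<close>

lemma fourier_translate_series:
  fixes \<phi> :: "real^'n::finite \<Rightarrow> complex" and l :: "nat \<Rightarrow> real^'n"
  assumes \<phi>: "rapid \<phi>" "continuous_on UNIV \<phi>" and a: "summable (\<lambda>n. norm (a n))"
  defines "S \<equiv> (\<lambda>x. \<Sum>n. a n * \<phi> (x - l n))"
  shows "integrable lborel S" "continuous_on UNIV S" "\<exists>B. \<forall>x. norm (S x) \<le> B"
    "fourier S \<xi> = (\<Sum>n. a n * cis (- (l n \<bullet> \<xi>))) * fourier \<phi> \<xi>" "summable (\<lambda>n. a n * \<phi> (x - l n))"
proof -
  obtain M where M: "M > 0" "\<And>x. norm (\<phi> x) \<le> M" using rapid_bounded[OF \<phi>(1)] by blast
  have i\<phi>: "integrable lborel \<phi>" by (rule rapid_integrable[OF \<phi>(1)])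
  have sn: "summable (\<lambda>n. norm (a n * \<phi> (x - l n)))" for x
    by (rule summable_comparison_test'[where g="\<lambda>n. norm (a n) * M" and N=0])
       (auto simp: norm_mult intro!: summable_mult2 a mult_left_mono M)
  show s: "summable (\<lambda>n. a n * \<phi> (x - l n))" for x by (rule summable_norm_cancel[OF sn])
  have "uniform_limit UNIV (\<lambda>N x. \<Sum>n<N. a n * \<phi> (x - l n)) S sequentially"
    unfolding S_def by (rule Weierstrass_m_test[where M="\<lambda>n. norm (a n) * M"])
       (auto simp: norm_mult intro!: summable_mult2 a mult_left_mono M)
  then show "continuous_on UNIV S"
    by (rule uniform_limit_theorem[rotated])
       (auto intro!: always_eventually continuous_intros continuous_on_compose2[OF \<phi>(2)])
  have "norm (S x) \<le> (\<Sum>n. norm (a n) * M)" for x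
    unfolding S_def
    by (rule order.trans[OF summable_norm[OF sn] suminf_le[OF _ sn]])
       (auto simp: norm_mult intro!: summable_mult2 a mult_left_mono M)
  then show "\<exists>B. \<forall>x. norm (S x) \<le> B" by blast
  have tr: "integrable lborel (\<lambda>x. \<phi> (x - l n))" for n
    using integrable_affine_vec[OF i\<phi>, of 1 "- l n"] by simp
  have ni: "(\<integral>x. norm (\<phi> (x - l n)) \<partial>lborel) = (\<integral>x. norm (\<phi> x) \<partial>lborel)" for n
    using integral_affine_vec[OF integrable_norm[OF i\<phi>], of 1 "- l n"] by simp
  have sI: "summable (\<lambda>n. \<integral>x. norm (a n * \<phi> (x - l n)) \<partial>lborel)"
    by (simp add: norm_mult ni summable_mult2 a)
  show "integrable lborel S" unfolding S_def
    by (rule integrable_suminf) (use tr sn sI in auto)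
  define f where "f n x = cis (- (x \<bullet> \<xi>)) * (a n * \<phi> (x - l n))" for n x
  have nf: "norm (f n x) = norm (a n * \<phi> (x - l n))" for n x by (simp add: f_def norm_mult)
  have fi: "integrable lborel (f n)" for n unfolding f_def
    by (intro integrable_cis_mult integrable_mult_right tr) measurable
  have fs: "(\<lambda>n. integral\<^sup>L lborel (f n)) sums (\<integral>x. (\<Sum>n. f n x) \<partial>lborel)"
    by (rule sums_integral[OF fi]) (use sn sI in \<open>auto simp: nf\<close>)
  have "(\<Sum>n. f n x) = cis (- (x \<bullet> \<xi>)) * S x" for x
    unfolding f_def S_def by (rule suminf_mult[OF s])
  then have 1: "(\<integral>x. (\<Sum>n. f n x) \<partial>lborel) = fourier S \<xi>" unfolding fourier_def by simp
  have "integral\<^sup>L lborel (f n) = fourier (\<lambda>x. a n * \<phi> (x - l n)) \<xi>" for n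
    unfolding fourier_def f_def ..
  then have 2: "integral\<^sup>L lborel (f n) = a n * cis (- (l n \<bullet> \<xi>)) * fourier \<phi> \<xi>" for n
    unfolding fourier_cmult fourier_translate[OF i\<phi>] by simp
  have "summable (\<lambda>n. a n * cis (- (l n \<bullet> \<xi>)))"
    by (rule summable_norm_cancel) (simp add: norm_mult a)
  from sums_mult2[OF summable_sums[OF this], of "fourier \<phi> \<xi>"] fs
  show "fourier S \<xi> = (\<Sum>n. a n * cis (- (l n \<bullet> \<xi>))) * fourier \<phi> \<xi>"
    unfolding 1 2 by (rule sums_unique2[symmetric])
qed

text \<open>Both sides are integrable, continuous and bounded, hence determined by their transforms.
  The index set \<open>J\<close> is a singleton for sampling and consists of three scales for the
  Calderon formula.\<close>

lemma translate_series_identity: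
  fixes \<psi> :: "real^'n::finite \<Rightarrow> complex"
  assumes J: "finite J" and \<psi>: "rapid \<psi>" "continuous_on UNIV \<psi>"
    and \<phi>: "\<And>k. k \<in> J \<Longrightarrow> rapid (\<phi> k)" "\<And>k. k \<in> J \<Longrightarrow> continuous_on UNIV (\<phi> k)"
    and a: "\<And>k. k \<in> J \<Longrightarrow> summable (\<lambda>n. norm (a k n))"
    and eq: "\<And>\<xi>. fourier \<psi> \<xi> = (\<Sum>k\<in>J. (\<Sum>n. a k n * cis (- (l n \<bullet> \<xi>))) * fourier (\<phi> k) \<xi>)"
  shows "\<psi> x = (\<Sum>k\<in>J. \<Sum>n. a k n * \<phi> k (x - l n))"
proof -
  define S where "S k x = (\<Sum>n. a k n * \<phi> k (x - l n))" for k x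
  have S: "integrable lborel (S k)" "continuous_on UNIV (S k)" "\<exists>B. \<forall>x. norm (S k x) \<le> B"
    "fourier (S k) \<xi> = (\<Sum>n. a k n * cis (- (l n \<bullet> \<xi>))) * fourier (\<phi> k) \<xi>" if "k \<in> J" for k \<xi>
    unfolding S_def using fourier_translate_series(1-4)[OF \<phi>(1)[OF that] \<phi>(2)[OF that] a[OF that], of l] by auto
  obtain B where B: "\<And>k x. k \<in> J \<Longrightarrow> norm (S k x) \<le> B k" using S(3) by metis
  obtain M where M: "M > 0" "\<And>x. norm (\<psi> x) \<le> M" using rapid_bounded[OF \<psi>(1)] by blast
  have iS: "integrable lborel (\<lambda>x. \<Sum>k\<in>J. S k x)" by (intro Bochner_Integration.integrable_sum S)
  have FS: "fourier (\<lambda>x. \<Sum>k\<in>J. S k x) \<xi> = (\<Sum>k\<in>J. fourier (S k) \<xi>)" for \<xi>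
  proof -
    have "fourier (\<lambda>x. \<Sum>k\<in>J. S k x) \<xi> = (\<integral>x. (\<Sum>k\<in>J. cis (- (x \<bullet> \<xi>)) * S k x) \<partial>lborel)"
      unfolding fourier_def by (simp add: sum_distrib_left)
    also have "\<dots> = (\<Sum>k\<in>J. \<integral>x. cis (- (x \<bullet> \<xi>)) * S k x \<partial>lborel)"
      by (intro Bochner_Integration.integral_sum integrable_cis_mult S) auto
    finally show ?thesis unfolding fourier_def .
  qed
  have "\<psi> x - (\<Sum>k\<in>J. S k x) = 0"
  proof (rule fourier_injective[where h="\<lambda>x. \<psi> x - (\<Sum>k\<in>J. S k x)"])
    show "integrable lborel (\<lambda>x. \<psi> x - (\<Sum>k\<in>J. S k x))"
      using rapid_integrable[OF \<psi>(1)] iS by (rule Bochner_Integration.integrable_diff)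
    show "continuous_on UNIV (\<lambda>x. \<psi> x - (\<Sum>k\<in>J. S k x))" by (intro continuous_intros \<psi> S)
    show "norm (\<psi> x - (\<Sum>k\<in>J. S k x)) \<le> M + (\<Sum>k\<in>J. B k)" for x
      by (intro order.trans[OF norm_triangle_ineq4] add_mono M order.trans[OF norm_sum] sum_mono B)
    show "fourier (\<lambda>x. \<psi> x - (\<Sum>k\<in>J. S k x)) \<xi> = 0" for \<xi>
      unfolding fourier_diff[OF rapid_integrable[OF \<psi>(1)] iS] FS using S(4) eq by simp
  qed
  then show ?thesis by (simp add: S_def)
qed

text \<open>Every weighted derivative of the remainder after \<open>m\<close> terms is at most the
  tail \<open>\<epsilon> m\<close> of a convergent series, so \<open>u\<close> may be applied term
  by term. The polynomial weights in the hypothesis on the coefficients pay for the translations by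
  \<open>l n\<close>.\<close>

lemma tame_translate_series:
  fixes \<psi> :: "real^'n::finite \<Rightarrow> complex"
  assumes u: "tame u" and J: "finite J" and \<psi>: "band \<psi>" and \<phi>: "\<And>k. k \<in> J \<Longrightarrow> band (\<phi> k)"
    and a: "\<And>k N. k \<in> J \<Longrightarrow> summable (\<lambda>n. norm (a k n) * (1 + norm (l n)) ^ N)"
    and eq: "\<And>\<xi>. fourier \<psi> \<xi> = (\<Sum>k\<in>J. (\<Sum>n. a k n * cis (- (l n \<bullet> \<xi>))) * fourier (\<phi> k) \<xi>)"
  shows "\<And>k. k \<in> J \<Longrightarrow> summable (\<lambda>n. norm (a k n * u (\<lambda>y. \<phi> k (x - l n - y))))"
    and "u (\<lambda>y. \<psi> (x - y)) = (\<Sum>k\<in>J. \<Sum>n. a k n * u (\<lambda>y. \<phi> k (x - l n - y)))"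
proof -
  obtain C N where C: "C \<ge> 0" "\<And>h B. h \<in> schwartz_inf \<Longrightarrow> (\<And>is x. length is \<le> N \<Longrightarrow> (1 + norm x) ^ N * norm (partial_derivs is h x) \<le> B) \<Longrightarrow>
        norm (u h) \<le> C * B"
    using u unfolding tame_def by metis
  have "\<exists>B>0. \<forall>is x. length is \<le> N \<longrightarrow> (1 + norm x) ^ N * norm (partial_derivs is (\<phi> k) x) \<le> B" if "k \<in> J" for k
    using schwartz_uniform_bound[OF band_schwartz[OF \<phi>[OF that]]] by metis
  then obtain B where B: "\<And>k. k \<in> J \<Longrightarrow> B k > 0"
    "\<And>k is x. k \<in> J \<Longrightarrow> length is \<le> N \<Longrightarrow> (1 + norm x) ^ N * norm (partial_derivs is (\<phi> k) x) \<le> B k" by metis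
  have a1: "summable (\<lambda>n. norm (a k n))" if "k \<in> J" for k using a[OF that, of 0] by simp
  \<comment> \<open>The weight at y is split by \<open>weight_add\<close> among x,
    \<open>l n\<close> and x - y - \<open>l n\<close>; the last share is absorbed by the bound
    \<open>B k\<close> for the derivatives of \<open>\<phi> k\<close>.\<close>
  define c where "c k n = norm (a k n) * (1 + norm (l n)) ^ N * ((1 + norm x) ^ N * B k)" for k n
  have c: "summable (c k)" if "k \<in> J" for k unfolding c_def[abs_def] by (intro summable_mult2 a that)
  have term_le: "(1 + norm y) ^ N * norm (a k n * partial_derivs is (\<phi> k) (x - y - l n)) \<le> c k n"
    if "k \<in> J" "length is \<le> N" for k n "is" y
  proof -
    have "1 + norm y \<le> (1 + norm x) * ((1 + norm (l n)) * (1 + norm (x - y - l n)))"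
    proof -
      have "1 + norm y \<le> (1 + norm x) * (1 + norm (y - x))" using weight_add[of x "y - x"] by simp
      also have "1 + norm (y - x) \<le> (1 + norm (- l n)) * (1 + norm (y - x + l n))" using weight_add[of "- l n" "y - x + l n"] by simp
      also have "norm (y - x + l n) = norm (x - y - l n)" using norm_minus_cancel[of "y - x + l n"] by (simp add: algebra_simps)
      finally show ?thesis by (simp add: mult_left_mono)
    qed
    then have "(1 + norm y) ^ N \<le> ((1 + norm x) * ((1 + norm (l n)) * (1 + norm (x - y - l n)))) ^ N" by (rule power_mono) simp
    then have "(1 + norm y) ^ N * norm (a k n * partial_derivs is (\<phi> k) (x - y - l n))
        \<le> ((1 + norm x) * ((1 + norm (l n)) * (1 + norm (x - y - l n)))) ^ N * norm (a k n * partial_derivs is (\<phi> k) (x - y - l n))"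
      by (rule mult_right_mono) simp
    also have "\<dots> = norm (a k n) * (1 + norm (l n)) ^ N * ((1 + norm x) ^ N * ((1 + norm (x - y - l n)) ^ N * norm (partial_derivs is (\<phi> k) (x - y - l n))))"
      by (simp add: power_mult_distrib norm_mult mult_ac)
    also have "\<dots> \<le> c k n" unfolding c_def by (intro mult_left_mono B that) auto
    finally show ?thesis .
  qed
  have mem: "(\<lambda>y. \<phi> k (z - y)) \<in> schwartz_inf" if "k \<in> J" for k z
    by (rule band_schwartz_inf[OF band_reflect_translate[OF \<phi>[OF that]]])
  have mem': "(\<lambda>y. \<psi> (x - y)) \<in> schwartz_inf"
    by (rule band_schwartz_inf[OF band_reflect_translate[OF \<psi>]])
  define T where "T m y = (\<Sum>p\<in>J \<times> {..<m}. a (fst p) (snd p) * \<phi> (fst p) (x - l (snd p) - y))" for m y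
  have Tmem: "T m \<in> schwartz_inf" for m unfolding T_def[abs_def]
    by (intro schwartz_inf_sum schwartz_inf_cmult mem) (use J in auto)
  have uT: "u (T m) = (\<Sum>k\<in>J. \<Sum>n<m. a k n * u (\<lambda>y. \<phi> k (x - l n - y)))" for m
  proof -
    have "u (T m) = (\<Sum>p\<in>J \<times> {..<m}. u (\<lambda>y. a (fst p) (snd p) * \<phi> (fst p) (x - l (snd p) - y)))"
      unfolding T_def[abs_def] by (intro tame_sum u schwartz_inf_cmult mem) (use J in auto)
    also have "\<dots> = (\<Sum>p\<in>J \<times> {..<m}. a (fst p) (snd p) * u (\<lambda>y. \<phi> (fst p) (x - l (snd p) - y)))"
      by (intro sum.cong refl tame_cmult u mem) auto
    finally show ?thesis by (simp add: sum.cartesian_product case_prod_unfold)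
  qed
  define h where "h m y = \<psi> (x - y) + (-1) * T m y" for m y
  define \<epsilon> where "\<epsilon> m = (\<Sum>k\<in>J. \<Sum>n. c k (n + m))" for m
  have uh: "norm (u (h m)) \<le> C * \<epsilon> m" for m
  proof (rule C(2))
    show "h m \<in> schwartz_inf" unfolding h_def[abs_def] by (intro schwartz_inf_add mem' schwartz_inf_cmult Tmem)
    fix "is" :: "'n list" and y :: "real^'n" assume len: "length is \<le> N"
    define d where "d k n = a k n * partial_derivs is (\<phi> k) (x - y - l n)" for k n
    have sd: "summable (d k)" if "k \<in> J" for k unfolding d_def[abs_def]
      by (intro fourier_translate_series(5) schwartz_rapid_derivs smooth_continuous schwartz_smooth band_schwartz \<phi> a1 that)
    have refl: "partial_derivs is (\<lambda>y. f (z - y)) y = (-1) ^ length is * partial_derivs is f (z - y)" if "band f" for f z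
      using partial_derivs_affine(1)[OF schwartz_smooth[OF band_schwartz[OF that]], of "is" 1 z "-1"] by simp
    have "partial_derivs is (h m) y = partial_derivs is (\<lambda>y. \<psi> (x - y)) y + (-1) * partial_derivs is (T m) y"
      unfolding h_def[abs_def]
      by (simp only: partial_derivs_add(1)[OF schwartz_smooth[OF schwartz_inf_schwartz[OF mem']] schwartz_smooth[OF schwartz_inf_schwartz[OF schwartz_inf_cmult[OF Tmem]]]]
        partial_derivs_cmult[OF schwartz_smooth[OF schwartz_inf_schwartz[OF Tmem]]])
    also have "partial_derivs is (T m) y = (\<Sum>p\<in>J \<times> {..<m}. partial_derivs is (\<lambda>y. a (fst p) (snd p) * \<phi> (fst p) (x - l (snd p) - y)) y)"
      unfolding T_def[abs_def] by (subst partial_derivs_sum) (use J in \<open>auto intro!: schwartz_inf_cmult mem\<close>)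
    also have "\<dots> = (\<Sum>p\<in>J \<times> {..<m}. (-1) ^ length is * d (fst p) (snd p))"
    proof (intro sum.cong HOL.refl)
      fix p assume "p \<in> J \<times> {..<m}"
      then have p: "fst p \<in> J" by auto
      have "partial_derivs is (\<lambda>y. a (fst p) (snd p) * \<phi> (fst p) (x - l (snd p) - y)) y
        = a (fst p) (snd p) * ((-1) ^ length is * partial_derivs is (\<phi> (fst p)) (x - l (snd p) - y))"
        by (simp only: partial_derivs_cmult[OF schwartz_smooth[OF schwartz_inf_schwartz[OF mem[OF p]]]] refl[OF \<phi>[OF p]])
      then show "partial_derivs is (\<lambda>y. a (fst p) (snd p) * \<phi> (fst p) (x - l (snd p) - y)) y = (-1) ^ length is * d (fst p) (snd p)"
        by (simp add: d_def algebra_simps)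
    qed
    also have "\<dots> = (-1) ^ length is * (\<Sum>k\<in>J. \<Sum>n<m. d k n)"
      by (simp add: sum_distrib_left[symmetric] sum.cartesian_product case_prod_unfold)
    also have "partial_derivs is (\<lambda>y. \<psi> (x - y)) y = (-1) ^ length is * partial_derivs is \<psi> (x - y)" by (rule refl[OF \<psi>])
    \<comment> \<open>The series is not differentiated. A derivative multiplies the transforms of
      both sides by the same polynomial, so the uniqueness argument proves the differentiated
      identity afresh.\<close>
    also have "partial_derivs is \<psi> (x - y) = (\<Sum>k\<in>J. \<Sum>n. d k n)" unfolding d_def
    proof (rule translate_series_identity[OF J])
      fix \<xi>
      show "fourier (partial_derivs is \<psi>) \<xi> = (\<Sum>k\<in>J. (\<Sum>n. a k n * cis (- (l n \<bullet> \<xi>))) * fourier (partial_derivs is (\<phi> k)) \<xi>)"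
        by (simp add: fourier_partial_derivs[OF band_schwartz[OF \<psi>]] fourier_partial_derivs[OF band_schwartz[OF \<phi>]] eq sum_distrib_left mult_ac)
    qed (intro schwartz_rapid_derivs smooth_continuous schwartz_smooth band_schwartz \<psi> \<phi> a1; assumption)+
    finally have "partial_derivs is (h m) y = (-1) ^ length is * (\<Sum>k\<in>J. (\<Sum>n. d k n) - (\<Sum>n<m. d k n))"
      by (simp add: sum_subtractf algebra_simps)
    also have "\<dots> = (-1) ^ length is * (\<Sum>k\<in>J. \<Sum>n. d k (n + m))"
      using suminf_minus_initial_segment[OF sd] by simp
    finally have "norm (partial_derivs is (h m) y) = norm (\<Sum>k\<in>J. \<Sum>n. d k (n + m))" by (simp add: norm_mult norm_power)
    then have "(1 + norm y) ^ N * norm (partial_derivs is (h m) y) = norm (\<Sum>k\<in>J. of_real ((1 + norm y) ^ N) * (\<Sum>n. d k (n + m)))"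
      by (simp add: sum_distrib_left[symmetric] norm_mult norm_power abs_of_nonneg del: of_real_power)
    also have "\<dots> \<le> (\<Sum>k\<in>J. \<Sum>n. c k (n + m))"
    proof (intro order.trans[OF norm_sum] sum_mono)
      fix k assume k: "k \<in> J"
      have le: "norm (of_real ((1 + norm y) ^ N) * d k n) \<le> c k n" for n
        using term_le[OF k len, of y n] by (simp add: d_def norm_mult norm_power abs_of_nonneg del: of_real_power)
      have cs: "summable (\<lambda>n. c k (n + m))" using c[OF k] by (simp add: summable_iff_shift)
      have ds: "summable (\<lambda>n. norm (of_real ((1 + norm y) ^ N) * d k (n + m)))"
        by (rule summable_comparison_test'[OF cs, of 0]) (use le in simp)
      have "of_real ((1 + norm y) ^ N) * (\<Sum>n. d k (n + m)) = (\<Sum>n. of_real ((1 + norm y) ^ N) * d k (n + m))"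
        using sd[OF k] by (intro suminf_mult[symmetric]) (simp add: summable_iff_shift)
      also have "norm \<dots> \<le> (\<Sum>n. norm (of_real ((1 + norm y) ^ N) * d k (n + m)))" by (rule summable_norm[OF ds])
      also have "\<dots> \<le> (\<Sum>n. c k (n + m))" by (rule suminf_le[OF le ds cs])
      finally show "norm (of_real ((1 + norm y) ^ N) * (\<Sum>n. d k (n + m))) \<le> (\<Sum>n. c k (n + m))" .
    qed
    finally show "(1 + norm y) ^ N * norm (partial_derivs is (h m) y) \<le> \<epsilon> m" unfolding \<epsilon>_def .
  qed
  have "\<epsilon> \<longlonglongrightarrow> (\<Sum>k\<in>J. 0)" unfolding \<epsilon>_def[abs_def]
  proof (rule tendsto_sum)
    fix k assume k: "k \<in> J"
    have "(\<lambda>m. suminf (c k) - (\<Sum>n<m. c k n)) \<longlonglongrightarrow> suminf (c k) - suminf (c k)"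
      by (intro tendsto_intros summable_LIMSEQ c k)
    then show "(\<lambda>m. \<Sum>n. c k (n + m)) \<longlonglongrightarrow> 0" using suminf_minus_initial_segment[OF c[OF k]] by simp
  qed
  then have "(\<lambda>m. C * \<epsilon> m) \<longlonglongrightarrow> 0" using tendsto_mult_left[of \<epsilon> 0 sequentially C] by simp
  then have "(\<lambda>m. u (h m)) \<longlonglongrightarrow> 0" by (rule Lim_null_comparison[OF always_eventually, rule_format, OF uh])
  moreover have "u (h m) = u (\<lambda>y. \<psi> (x - y)) - u (T m)" for m
    unfolding h_def[abs_def] tame_add[OF u mem' schwartz_inf_cmult[OF Tmem]] tame_cmult[OF u Tmem] by simp
  ultimately have "(\<lambda>m. u (\<lambda>y. \<psi> (x - y)) - (u (\<lambda>y. \<psi> (x - y)) - u (T m))) \<longlonglongrightarrow> u (\<lambda>y. \<psi> (x - y)) - 0"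
    by (intro tendsto_diff tendsto_const) simp
  then have lim: "(\<lambda>m. u (T m)) \<longlonglongrightarrow> u (\<lambda>y. \<psi> (x - y))" by simp
  show sm: "summable (\<lambda>n. norm (a k n * u (\<lambda>y. \<phi> k (x - l n - y))))" if k: "k \<in> J" for k
  proof -
    obtain D M where D: "D > 0" "\<And>x. norm (u (\<lambda>y. \<phi> k (x - y))) \<le> D * (1 + norm x) ^ M"
      using tame_growth[OF u \<phi>[OF k]] by metis
    show ?thesis
    proof (rule summable_comparison_test'[where N=0])
      show "summable (\<lambda>n. norm (a k n) * (1 + norm (l n)) ^ M * (D * (1 + norm x) ^ M))"
        by (intro summable_mult2 a k)
      fix n
      have "1 + norm (x - l n) \<le> (1 + norm (l n)) * (1 + norm x)" using weight_add[of "- l n" x] by simp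
      then have "(1 + norm (x - l n)) ^ M \<le> ((1 + norm (l n)) * (1 + norm x)) ^ M" by (rule power_mono) simp
      then have "D * (1 + norm (x - l n)) ^ M \<le> D * ((1 + norm (l n)) * (1 + norm x)) ^ M" using D by simp
      then have "norm (u (\<lambda>y. \<phi> k (x - l n - y))) \<le> D * ((1 + norm (l n)) * (1 + norm x)) ^ M" using D(2)[of "x - l n"] by linarith
      then have "norm (a k n) * norm (u (\<lambda>y. \<phi> k (x - l n - y))) \<le> norm (a k n) * (D * ((1 + norm (l n)) * (1 + norm x)) ^ M)"
        by (rule mult_left_mono) simp
      then show "norm (norm (a k n * u (\<lambda>y. \<phi> k (x - l n - y)))) \<le> norm (a k n) * (1 + norm (l n)) ^ M * (D * (1 + norm x) ^ M)"
        by (simp add: norm_mult power_mult_distrib mult_ac)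
    qed
  qed
  have "(\<lambda>m. \<Sum>k\<in>J. \<Sum>n<m. a k n * u (\<lambda>y. \<phi> k (x - l n - y))) \<longlonglongrightarrow> (\<Sum>k\<in>J. \<Sum>n. a k n * u (\<lambda>y. \<phi> k (x - l n - y)))"
    by (intro tendsto_sum summable_LIMSEQ summable_norm_cancel[OF sm])
  with lim show "u (\<lambda>y. \<psi> (x - y)) = (\<Sum>k\<in>J. \<Sum>n. a k n * u (\<lambda>y. \<phi> k (x - l n - y)))"
    unfolding uT by (rule LIMSEQ_unique)
qed

section \<open>Sampling and change of the test function\<close>

lemma admissible_support:
  assumes "admissible \<phi>" "fourier \<phi> \<xi> \<noteq> 0" shows "1/2 \<le> norm \<xi>" "norm \<xi> \<le> 2"
  using assms closure_subset[of "{\<xi>. fourier \<phi> \<xi> \<noteq> 0}"] unfolding admissible_def by auto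

lemma admissible_nonzero:
  assumes "admissible \<phi>" "3/5 \<le> norm \<xi>" "norm \<xi> \<le> 5/3" shows "fourier \<phi> \<xi> \<noteq> 0"
  using assms unfolding admissible_def by (metis less_le_trans norm_zero order_less_irrefl)

lemma admissible_schwartz: "admissible \<phi> \<Longrightarrow> \<phi> \<in> schwartz"
  by (simp add: admissible_def)

lemma admissible_band: assumes "admissible \<phi>" shows "band \<phi>"
proof -
  have "fourier \<phi> \<xi> = 0" if "norm \<xi> < 1/2" for \<xi>
    using admissible_support(1)[OF assms, of \<xi>] that by fastforce
  then show ?thesis using admissible_schwartz[OF assms] unfolding band_def by (intro conjI exI[of _ "1/2"]) auto
qed

lemma admissible_integrable: "admissible \<phi> \<Longrightarrow> integrable lborel \<phi>"
  by (intro rapid_integrable schwartz_rapid admissible_schwartz)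

definition decaying :: "(real^'n::finite \<Rightarrow> complex) \<Rightarrow> bool" where
  "decaying \<kappa> \<longleftrightarrow> (\<forall>N. \<exists>C>0. \<forall>y. (1 + norm y) ^ N * norm (\<kappa> y) \<le> C)"

text \<open>Of the available decay, N powers offset polynomial growth and 2n powers provide the
  summable weight \<open>wt\<close>; the shift by \<open>x\<close> is paid for by powers of 1 +
  |x|.\<close>

lemma decaying_weighted_bound:
  fixes \<kappa> :: "real^'n::finite \<Rightarrow> complex"
  assumes "decaying \<kappa>"
  obtains C where "C > 0" "\<And>x y. norm (\<kappa> (x + y)) * (1 + norm y) ^ N \<le> C * (1 + norm x) ^ (N + 2 * CARD('n)) * wt y"
proof -
  define M where "M = N + 2 * CARD('n)"
  obtain C where C: "C > 0" "\<And>y. (1 + norm y) ^ M * norm (\<kappa> y) \<le> C"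
    using assms unfolding decaying_def by blast
  have "norm (\<kappa> (x + y)) * (1 + norm y) ^ N \<le> C * (1 + norm x) ^ M * wt y" for x y
  proof -
    have "1 + norm y \<le> (1 + norm x) * (1 + norm (x + y))" using weight_add[of "-x" "x + y"] by simp
    then have "(1 + norm y) ^ M \<le> ((1 + norm x) * (1 + norm (x + y))) ^ M" by (rule power_mono) simp
    then have "(1 + norm y) ^ M * norm (\<kappa> (x + y)) \<le> ((1 + norm x) * (1 + norm (x + y))) ^ M * norm (\<kappa> (x + y))"
      by (rule mult_right_mono) simp
    also have "\<dots> = (1 + norm x) ^ M * ((1 + norm (x + y)) ^ M * norm (\<kappa> (x + y)))" by (simp add: power_mult_distrib)
    also have "\<dots> \<le> (1 + norm x) ^ M * C" by (intro mult_left_mono C) auto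
    finally have "(1 + norm y) ^ N * norm (\<kappa> (x + y)) * (1 + norm y) ^ (2 * CARD('n)) \<le> C * (1 + norm x) ^ M"
      unfolding M_def by (simp add: power_add mult_ac)
    moreover have "(1 + norm y) ^ (2 * CARD('n)) > 0" by (simp add: add_pos_nonneg)
    ultimately have "(1 + norm y) ^ N * norm (\<kappa> (x + y)) \<le> C * (1 + norm x) ^ M / (1 + norm y) ^ (2 * CARD('n))"
      by (simp add: pos_le_divide_eq)
    then show ?thesis by (simp add: wt_def mult.commute)
  qed
  then show ?thesis using C(1) that unfolding M_def by blast
qed

lemma decaying_summable:
  fixes \<kappa> :: "real^'n::finite \<Rightarrow> complex"
  assumes "decaying \<kappa>"
  shows "summable (\<lambda>n. norm (\<kappa> (x + ivec (lat n))) * (1 + norm (ivec (lat n) :: real^'n)) ^ N)"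
proof -
  obtain C where C: "C > 0" "\<And>x y. norm (\<kappa> (x + y)) * (1 + norm y) ^ N \<le> C * (1 + norm x) ^ (N + 2 * CARD('n)) * wt y"
    using decaying_weighted_bound[OF assms] by blast
  show ?thesis
    by (rule summable_comparison_test'[OF summable_mult[OF summable_lat_wt[where ?'n='n], of "C * (1 + norm x) ^ (N + 2 * CARD('n))"], of 0])
       (use C(2) in simp)
qed

lemma decaying_fourier_coeff:
  assumes "\<And>k i. dsm k i UNIV m" "\<And>x. R < norm x \<Longrightarrow> m x = 0"
  shows "decaying (fourier_coeff m)"
  unfolding decaying_def
proof
  fix N
  obtain C where C: "C > 0" "\<And>y. (1 + norm y) ^ N * norm (\<integral>x. cis (x \<bullet> y) * m x \<partial>lborel) \<le> C"
    using fourier_integral_decay[OF assms] by blast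
  define P where "P = (2 * pi) ^ CARD('a)"
  have P: "P > 0" by (simp add: P_def)
  have "(1 + norm y) ^ N * norm (fourier_coeff m y) \<le> C / P" for y
    using divide_right_mono[OF C(2)[of y], of P] P
    unfolding fourier_coeff_def P_def[symmetric] norm_divide norm_of_real by simp
  moreover have "C / P > 0" using C P by simp
  ultimately show "\<exists>C>0. \<forall>y. (1 + norm y) ^ N * norm (fourier_coeff m y) \<le> C" by blast
qed

text \<open>No bump functions are needed: the cut-off is a quotient of sums of \<open>|fourier \<phi> (\<xi> / a)|\<^sup>2\<close>, with dilation
  factors \<open>a\<close> chosen such that the denominator has no zeros on the support of the numerator and coincides with
  it on the annulus \<open>1/2 \<le> |\<xi>| \<le> 2\<close>.\<close>

lemma admissible_cutoff:
  fixes \<phi> :: "real^'n::finite \<Rightarrow> complex"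
  assumes \<phi>: "admissible \<phi>"
  obtains \<theta> where "\<And>k i. dsm k i UNIV \<theta>" "\<And>\<xi>. 3 < norm \<xi> \<Longrightarrow> \<theta> \<xi> = 0" "\<And>\<xi>. fourier \<phi> \<xi> \<noteq> 0 \<Longrightarrow> \<theta> \<xi> = 1"
proof -
  define s where "s a \<xi> = fourier \<phi> (\<xi> /\<^sub>R a) * cnj (fourier \<phi> (\<xi> /\<^sub>R a))" for a \<xi>
  have s_real: "s a \<xi> = of_real ((norm (fourier \<phi> (\<xi> /\<^sub>R a)))\<^sup>2)" for a \<xi>
    by (simp add: s_def complex_norm_square del: of_real_power)
  have dil: "dsm k i UNIV (\<lambda>\<xi>. fourier \<phi> (\<xi> /\<^sub>R a))" if "a > 0" for a k i
  proof -
    have "rapid (\<lambda>x. of_real (a ^ CARD('n)) * \<phi> (0 + a *\<^sub>R x))"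
      using that by (intro rapid_cmult rapid_affine schwartz_rapid admissible_schwartz[OF \<phi>]) auto
    moreover have "fourier (\<lambda>x. of_real (a ^ CARD('n)) * \<phi> (0 + a *\<^sub>R x)) = (\<lambda>\<xi>. fourier \<phi> (\<xi> /\<^sub>R a))"
    proof
      fix \<xi>
      show "fourier (\<lambda>x. of_real (a ^ CARD('n)) * \<phi> (0 + a *\<^sub>R x)) \<xi> = fourier \<phi> (\<xi> /\<^sub>R a)"
        unfolding fourier_cmult using fourier_affine[OF admissible_integrable[OF \<phi>], of a 0 \<xi>] that by simp
    qed
    ultimately show ?thesis using dsm_fourier by metis
  qed
  have ds: "dsm k i UNIV (s a)" if "a > 0" for a k i
    unfolding s_def by (intro dsm_mult dsm_cnj dil that)
  \<comment> \<open>The term with factor a is nonzero for 3a/5 <= |\<xi>| <= 5a/3 and vanishes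
    outside a/2 <= |\<xi>| <= 2a. The factors 2/3 and 3/2 cover [2/5, 5/2] and live inside [1/3, 3].
    The factors 6/25 and 41/10 add [1/3, 2/5] and [5/2, 3], while their terms vanish on
    [1/2, 2].\<close>
  define A where "A \<xi> = s (2/3) \<xi> + s (3/2) \<xi>" for \<xi>
  define W where "W \<xi> = A \<xi> + (s (6/25) \<xi> + s (41/10) \<xi>)" for \<xi>
  define Z where "Z = {\<xi>::real^'n. 1/3 \<le> norm \<xi> \<and> norm \<xi> \<le> 3}"
  have s0: "s a \<xi> = 0" if "a > 0" "norm \<xi> < a / 2 \<or> norm \<xi> > 2 * a" for a \<xi>
  proof (rule ccontr)
    assume "s a \<xi> \<noteq> 0"
    then have "fourier \<phi> (\<xi> /\<^sub>R a) \<noteq> 0" by (auto simp: s_def)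
    from admissible_support[OF \<phi> this] that show False by (auto simp: field_simps)
  qed
  have spos: "s a \<xi> \<noteq> 0" if "a > 0" "3/5 * a \<le> norm \<xi>" "norm \<xi> \<le> 5/3 * a" for a \<xi>
  proof -
    have "fourier \<phi> (\<xi> /\<^sub>R a) \<noteq> 0"
      by (rule admissible_nonzero[OF \<phi>]) (use that in \<open>auto simp: field_simps\<close>)
    then show ?thesis by (simp add: s_def)
  qed
  have W_real: "W \<xi> = of_real ((norm (fourier \<phi> (\<xi> /\<^sub>R (2/3))))\<^sup>2 + (norm (fourier \<phi> (\<xi> /\<^sub>R (3/2))))\<^sup>2
      + ((norm (fourier \<phi> (\<xi> /\<^sub>R (6/25))))\<^sup>2 + (norm (fourier \<phi> (\<xi> /\<^sub>R (41/10))))\<^sup>2))" for \<xi>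
    unfolding W_def A_def s_real of_real_add by simp
  have W0: "W \<xi> \<noteq> 0" if "s (2/3) \<xi> \<noteq> 0 \<or> s (3/2) \<xi> \<noteq> 0 \<or> s (6/25) \<xi> \<noteq> 0 \<or> s (41/10) \<xi> \<noteq> 0" for \<xi>
    using that unfolding W_real s_real of_real_eq_0_iff by (auto simp: add_nonneg_eq_0_iff add_nonneg_nonneg)
  have cover: "W \<xi> \<noteq> 0" if "1/3 \<le> norm \<xi>" "norm \<xi> \<le> 3" for \<xi>
  proof -
    consider "norm \<xi> \<le> 2/5" | "2/5 \<le> norm \<xi>" "norm \<xi> \<le> 1" | "1 \<le> norm \<xi>" "norm \<xi> \<le> 5/2" | "5/2 \<le> norm \<xi>" by linarith
    then show ?thesis
    proof cases
      case 1 then have "s (6/25) \<xi> \<noteq> 0" using that by (intro spos) auto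
      then show ?thesis using W0 by blast
    next
      case 2 then have "s (2/3) \<xi> \<noteq> 0" using that by (intro spos) auto
      then show ?thesis using W0 by blast
    next
      case 3 then have "s (3/2) \<xi> \<noteq> 0" using that by (intro spos) auto
      then show ?thesis using W0 by blast
    next
      case 4 then have "s (41/10) \<xi> \<noteq> 0" using that by (intro spos) auto
      then show ?thesis using W0 by blast
    qed
  qed
  have AZ: "A \<xi> = 0" if "\<xi> \<notin> Z" for \<xi>
    using that s0[of "2/3" \<xi>] s0[of "3/2" \<xi>] by (auto simp: A_def Z_def not_le)
  show ?thesis
  proof (rule that[of "\<lambda>\<xi>. A \<xi> / W \<xi>"])
    show "dsm k i UNIV (\<lambda>\<xi>. A \<xi> / W \<xi>)" for k i
    proof (rule dsm_divide[where Z=Z])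
      show "dsm k i UNIV A" unfolding A_def by (intro dsm_add ds) auto
      show "dsm k i UNIV W" unfolding W_def A_def by (intro dsm_add ds) auto
      have "closed ({\<xi>::real^'n. 1/3 \<le> norm \<xi>} \<inter> {\<xi>. norm \<xi> \<le> 3})"
        by (intro closed_Int closed_Collect_le continuous_intros)
      then show "closed Z" unfolding Z_def by (simp add: Collect_conj_eq)
      show "W \<xi> \<noteq> 0" if "\<xi> \<in> Z" for \<xi> using that cover by (auto simp: Z_def)
    qed (rule AZ)
    show "A \<xi> / W \<xi> = 0" if "3 < norm \<xi>" for \<xi> using that AZ[of \<xi>] by (simp add: Z_def)
    show "A \<xi> / W \<xi> = 1" if "fourier \<phi> \<xi> \<noteq> 0" for \<xi>
    proof -
      have n: "1/2 \<le> norm \<xi>" "norm \<xi> \<le> 2" using admissible_support[OF \<phi> that] by auto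
      then have "W \<xi> = A \<xi>" using s0[of "6/25" \<xi>] s0[of "41/10" \<xi>] by (simp add: W_def)
      moreover have "W \<xi> \<noteq> 0" using n by (intro cover) auto
      ultimately show ?thesis by simp
    qed
  qed
qed

text \<open>The functional is quantified inside, so one kernel, and with it one set of constants,
  serves all functionals.\<close>

definition sampling_kernel :: "(real^'n::finite \<Rightarrow> complex) \<Rightarrow> (real^'n \<Rightarrow> complex) \<Rightarrow> bool" where
  "sampling_kernel \<phi> \<kappa> \<longleftrightarrow> decaying \<kappa> \<and> continuous_on UNIV \<kappa> \<and> (\<forall>u x0 x. tame u \<longrightarrow>
     summable (\<lambda>n. norm (\<kappa> (x + ivec (lat n)) * u (\<lambda>y. \<phi> (x0 - ivec (lat n) - y)))) \<and>
     u (\<lambda>y. \<phi> (x0 + x - y)) = (\<Sum>n. \<kappa> (x + ivec (lat n)) * u (\<lambda>y. \<phi> (x0 - ivec (lat n) - y))))"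

text \<open>Translating \<phi> by \<open>x\<close> multiplies its transform by a character. On the
  spectrum of \<phi> the character may be multiplied by the cut-off \<open>\<theta>\<close>, and the
  product has a Fourier series with coefficients \<kappa>(x + l). Off the spectrum the factor
  \<open>fourier \<phi>\<close> makes both sides 0, whatever the periodic series does there.\<close>

lemma sampling_kernel_exists:
  fixes \<phi> :: "real^'n::finite \<Rightarrow> complex"
  assumes \<phi>: "admissible \<phi>"
  shows "\<exists>\<kappa>. sampling_kernel \<phi> \<kappa>"
proof -
  obtain \<theta> where \<theta>: "\<And>k i. dsm k i UNIV \<theta>" "\<And>\<xi>. 3 < norm \<xi> \<Longrightarrow> \<theta> \<xi> = 0" "\<And>\<xi>. fourier \<phi> \<xi> \<noteq> 0 \<Longrightarrow> \<theta> \<xi> = 1"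
    using admissible_cutoff[OF \<phi>] by blast
  define \<kappa> where "\<kappa> = fourier_coeff \<theta>"
  have cont\<theta>: "continuous_on UNIV \<theta>" using dsm_continuous[OF \<theta>(1)] .
  have dec: "decaying \<kappa>" unfolding \<kappa>_def by (rule decaying_fourier_coeff[OF \<theta>(1,2)])
  have "\<kappa> y = fourier \<theta> (- y) / of_real ((2 * pi) ^ CARD('n))" for y
    by (simp add: \<kappa>_def fourier_coeff_def fourier_def)
  moreover have "continuous_on UNIV (\<lambda>y. fourier \<theta> (- y) / of_real ((2 * pi) ^ CARD('n)))"
    by (intro continuous_intros continuous_on_compose2[OF continuous_fourier[OF rapid_compact_support[OF cont\<theta> \<theta>(2)]]]) auto
  ultimately have cont: "continuous_on UNIV \<kappa>" by simp
  have main: "summable (\<lambda>n. norm (\<kappa> (x + ivec (lat n)) * u (\<lambda>y. \<phi> (x0 - ivec (lat n) - y))))"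
     "u (\<lambda>y. \<phi> (x0 + x - y)) = (\<Sum>n. \<kappa> (x + ivec (lat n)) * u (\<lambda>y. \<phi> (x0 - ivec (lat n) - y)))"
    if u: "tame u" for u x0 x
  proof -
    define \<psi> where "\<psi> y = \<phi> (x + y)" for y
    have band\<psi>: "band \<psi>" unfolding \<psi>_def using band_affine[OF admissible_band[OF \<phi>], of 1 1 x] by simp
    have eq: "fourier \<psi> \<xi> = (\<Sum>k\<in>{()}. (\<Sum>n. \<kappa> (x + ivec (lat n)) * cis (- (ivec (lat n) \<bullet> \<xi>))) * fourier \<phi> \<xi>)" for \<xi>
    proof -
      have F\<psi>: "fourier \<psi> \<xi> = cis (x \<bullet> \<xi>) * fourier \<phi> \<xi>"
        using fourier_affine[OF admissible_integrable[OF \<phi>], of 1 x \<xi>] by (simp add: \<psi>_def[abs_def])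
      show ?thesis
      proof (cases "fourier \<phi> \<xi> = 0")
        case False
        define m where "m \<eta> = \<theta> \<eta> * cis (\<eta> \<bullet> x)" for \<eta>
        have fc: "fourier_coeff m l = \<kappa> (x + l)" for l
        proof -
          have "cis (\<eta> \<bullet> l) * m \<eta> = cis (\<eta> \<bullet> (x + l)) * \<theta> \<eta>" for \<eta>
            by (simp add: m_def inner_add_right cis_mult[symmetric])
          then show ?thesis by (simp add: fourier_coeff_def \<kappa>_def)
        qed
        have "(\<lambda>n. fourier_coeff m (ivec (lat n)) * cis (- (ivec (lat n) \<bullet> \<xi>))) sums m \<xi>"
        proof (rule fourier_series)
          show "continuous_on UNIV m" unfolding m_def by (intro continuous_intros cont\<theta>)
          show "m \<eta> = 0" if "3 < norm \<eta>" for \<eta> using that \<theta>(2) by (simp add: m_def)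
          show "summable (\<lambda>n. norm (fourier_coeff m (ivec (lat n))))"
            unfolding fc using decaying_summable[OF dec, of x 0] by simp
          show "norm \<xi> \<le> 3" using admissible_support(2)[OF \<phi> False] by simp
        qed
        then show ?thesis unfolding fc using F\<psi> \<theta>(3)[OF False]
          by (simp add: sums_unique[symmetric] m_def inner_commute)
      qed (simp add: F\<psi>)
    qed
    have x: "\<psi> (x0 - y) = \<phi> (x0 + x - y)" for y by (simp add: \<psi>_def algebra_simps)
    have fin: "finite {()}" by simp
    note T = tame_translate_series[OF u fin band\<psi> admissible_band[OF \<phi>] decaying_summable[OF dec] eq]
    show "summable (\<lambda>n. norm (\<kappa> (x + ivec (lat n)) * u (\<lambda>y. \<phi> (x0 - ivec (lat n) - y))))"
      using T(1) by simp
    show "u (\<lambda>y. \<phi> (x0 + x - y)) = (\<Sum>n. \<kappa> (x + ivec (lat n)) * u (\<lambda>y. \<phi> (x0 - ivec (lat n) - y)))"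
      using T(2)[of x0] unfolding x by simp
  qed
  show ?thesis unfolding sampling_kernel_def using dec cont main by blast
qed

lemma sampling_kernelD:
  assumes "sampling_kernel \<phi> \<kappa>"
  shows "decaying \<kappa>" "continuous_on UNIV \<kappa>"
    "tame u \<Longrightarrow> summable (\<lambda>n. norm (\<kappa> (x + ivec (lat n)) * u (\<lambda>y. \<phi> (x0 - ivec (lat n) - y))))"
    "tame u \<Longrightarrow> u (\<lambda>y. \<phi> (x0 + x - y)) = (\<Sum>n. \<kappa> (x + ivec (lat n)) * u (\<lambda>y. \<phi> (x0 - ivec (lat n) - y)))"
  using assms unfolding sampling_kernel_def by simp_all

lemma integer_part:
  fixes x :: "real^'n::finite"
  obtains k :: "int^'n" where "\<And>i. of_int (k $ i) \<le> x $ i" "\<And>i. x $ i < of_int (k $ i) + 1"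
  by (rule that[of "\<chi> i. \<lfloor>x $ i\<rfloor>"]) auto

lemma norm_le_card:
  fixes x :: "real^'n::finite"
  assumes "\<And>i. \<bar>x $ i\<bar> \<le> d" shows "norm x \<le> real CARD('n) * d"
proof -
  have "norm x \<le> (\<Sum>i\<in>UNIV. \<bar>x $ i\<bar>)" by (rule norm_le_l1_cart)
  also have "\<dots> \<le> (\<Sum>i\<in>(UNIV::'n set). d)" by (intro sum_mono assms)
  finally show ?thesis by simp
qed

text \<open>The integer part of \<open>x\<close> goes into the base point of the sampling formula.
  The kernel is then evaluated at shifts of a point \<open>x'\<close> of the unit cube, where its
  lattice sums are bounded uniformly.\<close>

lemma sampling_bound:
  fixes \<phi> :: "real^'n::finite \<Rightarrow> complex"
  assumes \<phi>: "admissible \<phi>"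
  shows "\<exists>C>0. \<forall>u D. tame u \<longrightarrow> (\<forall>l. norm (u (\<lambda>y. \<phi> (ivec l - y))) \<le> D) \<longrightarrow> (\<forall>x. norm (u (\<lambda>y. \<phi> (x - y))) \<le> C * D)"
proof -
  obtain \<kappa> where K: "sampling_kernel \<phi> \<kappa>" using sampling_kernel_exists[OF \<phi>] by blast
  note \<kappa> = sampling_kernelD(1)[OF K] and \<kappa>_summable = sampling_kernelD(3)[OF K] and \<kappa>_series = sampling_kernelD(4)[OF K]
  obtain C where C: "C > 0" "\<And>x y. norm (\<kappa> (x + y)) * (1 + norm y) ^ 0 \<le> C * (1 + norm x) ^ (0 + 2 * CARD('n)) * wt y"
    using decaying_weighted_bound[OF \<kappa>] by blast
  define E where "E = C * (1 + real CARD('n)) ^ (2 * CARD('n))"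
  have E: "E > 0" using C by (simp add: E_def add_pos_nonneg)
  define K where "K = (\<Sum>n. E * wt (ivec (lat n) :: real^'n)) + 1"
  have sE: "summable (\<lambda>n. E * wt (ivec (lat n) :: real^'n))" by (intro summable_mult summable_lat_wt)
  have "(\<Sum>n. E * wt (ivec (lat n) :: real^'n)) \<ge> 0"
    by (rule suminf_nonneg[OF sE]) (intro mult_nonneg_nonneg less_imp_le E wt_pos)
  then have "K > 0" unfolding K_def by simp
  moreover have "norm (u (\<lambda>y. \<phi> (x - y))) \<le> K * D"
    if u: "tame u" and D: "\<forall>l. norm (u (\<lambda>y. \<phi> (ivec l - y))) \<le> D" for u D x
  proof -
    obtain k :: "int^'n" where k: "\<And>i. of_int (k $ i) \<le> x $ i" "\<And>i. x $ i < of_int (k $ i) + 1" using integer_part by blast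
    define x' where "x' = x - ivec k"
    have "norm x' \<le> real CARD('n) * 1"
      by (rule norm_le_card) (use k in \<open>auto simp: x'_def abs_le_iff algebra_simps less_imp_le\<close>)
    then have "(1 + norm x') ^ (2 * CARD('n)) \<le> (1 + real CARD('n)) ^ (2 * CARD('n))" by (intro power_mono) auto
    then have \<kappa>_le: "norm (\<kappa> (x' + y)) \<le> E * wt y" for y
      using C(2)[of x' y] C(1) wt_pos[of y] unfolding E_def
      by (auto intro!: order.trans[OF C(2)[of x' y, simplified]] mult_right_mono mult_left_mono)
    have D0: "D \<ge> 0" using D[rule_format, of 0] by (rule order.trans[OF norm_ge_zero])
    have le: "norm (\<kappa> (x' + ivec (lat n)) * u (\<lambda>y. \<phi> (ivec k - ivec (lat n) - y))) \<le> E * wt (ivec (lat n) :: real^'n) * D" for n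
    proof -
      have "ivec k - ivec (lat n) = (ivec (k - lat n) :: real^'n)" by (simp add: vec_eq_iff)
      then show ?thesis unfolding norm_mult using D E wt_pos[of "ivec (lat n) :: real^'n"]
        by (intro mult_mono \<kappa>_le) (auto simp: less_imp_le)
    qed
    have "u (\<lambda>y. \<phi> (x - y)) = (\<Sum>n. \<kappa> (x' + ivec (lat n)) * u (\<lambda>y. \<phi> (ivec k - ivec (lat n) - y)))"
      using \<kappa>_series[OF u, of "ivec k" x'] by (simp add: x'_def)
    also have "norm \<dots> \<le> (\<Sum>n. norm (\<kappa> (x' + ivec (lat n)) * u (\<lambda>y. \<phi> (ivec k - ivec (lat n) - y))))"
      by (rule summable_norm[OF \<kappa>_summable[OF u]])
    also have "\<dots> \<le> (\<Sum>n. E * wt (ivec (lat n) :: real^'n) * D)"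
      by (rule suminf_le[OF le \<kappa>_summable[OF u] summable_mult2[OF sE]])
    also have "\<dots> = (\<Sum>n. E * wt (ivec (lat n) :: real^'n)) * D" by (rule suminf_mult2[OF sE, symmetric])
    also have "\<dots> \<le> K * D" using D0 by (simp add: K_def distrib_right)
    finally show ?thesis .
  qed
  ultimately show ?thesis by blast
qed

text \<open>The left side is convex in \<epsilon> and hence lies below its chord between 0 and 1. It
  shows that the damping weight exceeds 1 by no more than a small multiple of a fixed polynomial
  weight.\<close>

lemma one_plus_power_convex:
  fixes t \<epsilon> :: real
  assumes "t \<ge> 0" "0 \<le> \<epsilon>" "\<epsilon> \<le> 1"
  shows "(1 + \<epsilon> * t) ^ N \<le> 1 + \<epsilon> * (1 + t) ^ N"
proof -
  have "(1 + \<epsilon> * t) ^ N \<le> 1 + \<epsilon> * ((1 + t) ^ N - 1)"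
  proof (induction N)
    case (Suc N)
    define s where "s = (1 + t) ^ N - 1"
    have s: "s \<ge> 0" unfolding s_def using assms by simp
    have "(1 + \<epsilon> * t) ^ Suc N \<le> (1 + \<epsilon> * t) * (1 + \<epsilon> * s)"
      using Suc assms unfolding s_def by (simp add: mult_left_mono)
    also have "\<dots> = 1 + \<epsilon> * s + \<epsilon> * t + \<epsilon> * (\<epsilon> * (s * t))" by (simp add: algebra_simps)
    also have "\<dots> \<le> 1 + \<epsilon> * s + \<epsilon> * t + 1 * (\<epsilon> * (s * t))" using assms s by (intro add_left_mono mult_right_mono) auto
    also have "\<dots> = 1 + \<epsilon> * ((1 + t) ^ Suc N - 1)" by (simp add: s_def algebra_simps)
    finally show ?case .
  qed simp
  also have "\<dots> \<le> 1 + \<epsilon> * (1 + t) ^ N" using assms by (simp add: algebra_simps)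
  finally show ?thesis .
qed

text \<open>For |x| < 1 the terms have the common summable majorant \<open>E 1 * wt\<close>, so the
  sum is continuous in \<open>x\<close> on the unit ball, and it is 0 at 0. It measures the relative
  oscillation of any function that obeys the sampling formula.\<close>

lemma sampling_kernel_modulus:
  fixes \<kappa> :: "real^'n::finite \<Rightarrow> complex"
  assumes \<kappa>: "decaying \<kappa>" "continuous_on UNIV \<kappa>"
  shows "\<And>x. summable (\<lambda>n. norm (\<kappa> (x + ivec (lat n)) - \<kappa> (ivec (lat n))))"
    and "((\<lambda>x. \<Sum>n. norm (\<kappa> (x + ivec (lat n)) - \<kappa> (ivec (lat n)))) \<longlongrightarrow> 0) (at 0)"
proof -
  obtain C where C: "C > 0" "\<And>x y. norm (\<kappa> (x + y)) * (1 + norm y) ^ 0 \<le> C * (1 + norm x) ^ (0 + 2 * CARD('n)) * wt y"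
    using decaying_weighted_bound[OF \<kappa>(1)] by blast
  define E where "E r = C * (1 + r) ^ (2 * CARD('n)) + C" for r :: real
  have sE: "summable (\<lambda>n. E r * wt (ivec (lat n) :: real^'n))" for r by (intro summable_mult summable_lat_wt)
  have le: "norm (\<kappa> (x + y) - \<kappa> y) \<le> E r * wt y" if "norm x \<le> r" for x y r
  proof -
    have "norm (\<kappa> (x + y)) \<le> C * (1 + norm x) ^ (2 * CARD('n)) * wt y" using C(2)[of x y] by simp
    also have "\<dots> \<le> C * (1 + r) ^ (2 * CARD('n)) * wt y"
      using that C(1) less_imp_le[OF wt_pos[of y]] by (intro mult_right_mono mult_left_mono power_mono) auto
    finally have "norm (\<kappa> (x + y)) \<le> C * (1 + r) ^ (2 * CARD('n)) * wt y" .
    moreover have "norm (\<kappa> y) \<le> C * wt y" using C(2)[of 0 y] by simp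
    ultimately show ?thesis using norm_triangle_ineq4[of "\<kappa> (x + y)" "\<kappa> y"] by (simp add: E_def distrib_right)
  qed
  show "summable (\<lambda>n. norm (\<kappa> (x + ivec (lat n)) - \<kappa> (ivec (lat n))))" for x
    by (rule summable_comparison_test'[OF sE[of "norm x"], of 0]) (use le in auto)
  define S where "S x = (\<Sum>n. norm (\<kappa> (x + ivec (lat n)) - \<kappa> (ivec (lat n))))" for x
  have "uniform_limit (ball 0 1) (\<lambda>N x. \<Sum>n<N. norm (\<kappa> (x + ivec (lat n)) - \<kappa> (ivec (lat n)))) S sequentially"
    unfolding S_def by (rule Weierstrass_m_test[OF _ sE[of 1]]) (use le in auto)
  then have "continuous_on (ball 0 1) S"
    by (rule uniform_limit_theorem[rotated])
       (auto intro!: always_eventually continuous_intros continuous_on_compose2[OF \<kappa>(2)])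
  then have "isCont S 0" by (simp add: continuous_on_eq_continuous_at)
  moreover have "S 0 = 0" by (simp add: S_def)
  ultimately show "((\<lambda>x. \<Sum>n. norm (\<kappa> (x + ivec (lat n)) - \<kappa> (ivec (lat n)))) \<longlongrightarrow> 0) (at 0)"
    unfolding S_def[symmetric] by (simp add: isCont_def)
qed

lemma sampling_increment:
  fixes \<kappa> :: "real^'n::finite \<Rightarrow> complex"
  assumes K: "sampling_kernel \<phi> \<kappa>" and u: "tame u"
  shows "summable (\<lambda>n. norm ((\<kappa> (x + ivec (lat n)) - \<kappa> (ivec (lat n))) * u (\<lambda>y. \<phi> (x0 - ivec (lat n) - y))))"
    and "u (\<lambda>y. \<phi> (x0 + x - y)) - u (\<lambda>y. \<phi> (x0 - y)) = (\<Sum>n. (\<kappa> (x + ivec (lat n)) - \<kappa> (ivec (lat n))) * u (\<lambda>y. \<phi> (x0 - ivec (lat n) - y)))"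
proof -
  note s = sampling_kernelD(3)[OF K u] and e = sampling_kernelD(4)[OF K u]
  have e0: "u (\<lambda>y. \<phi> (x0 - y)) = (\<Sum>n. \<kappa> (0 + ivec (lat n)) * u (\<lambda>y. \<phi> (x0 - ivec (lat n) - y)))"
    using e[of x0 0] by simp
  show "u (\<lambda>y. \<phi> (x0 + x - y)) - u (\<lambda>y. \<phi> (x0 - y)) = (\<Sum>n. (\<kappa> (x + ivec (lat n)) - \<kappa> (ivec (lat n))) * u (\<lambda>y. \<phi> (x0 - ivec (lat n) - y)))"
    unfolding e[of x0 x] e0 suminf_diff[OF summable_norm_cancel[OF s] summable_norm_cancel[OF s]]
    by (simp add: left_diff_distrib)
  show "summable (\<lambda>n. norm ((\<kappa> (x + ivec (lat n)) - \<kappa> (ivec (lat n))) * u (\<lambda>y. \<phi> (x0 - ivec (lat n) - y))))"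
  proof (rule summable_comparison_test'[OF summable_add[OF s[of x x0] s[of 0 x0]], of 0])
    show "norm (norm ((\<kappa> (x + ivec (lat n)) - \<kappa> (ivec (lat n))) * u (\<lambda>y. \<phi> (x0 - ivec (lat n) - y))))
      \<le> norm (\<kappa> (x + ivec (lat n)) * u (\<lambda>y. \<phi> (x0 - ivec (lat n) - y))) + norm (\<kappa> (0 + ivec (lat n)) * u (\<lambda>y. \<phi> (x0 - ivec (lat n) - y)))" for n
      unfolding left_diff_distrib by (simp add: norm_triangle_ineq4)
  qed
qed

text \<open>Continuity is read off the sampling series: the decay of the kernel absorbs the growth
  of \<open>u\<close>, so the series converges uniformly on unit balls.\<close>

lemma tame_continuous:
  fixes \<phi> :: "real^'n::finite \<Rightarrow> complex"
  assumes \<phi>: "admissible \<phi>" and u: "tame u"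
  shows "continuous_on UNIV (\<lambda>x. u (\<lambda>y. \<phi> (x - y)))"
proof -
  obtain \<kappa> where K: "sampling_kernel \<phi> \<kappa>" using sampling_kernel_exists[OF \<phi>] by blast
  obtain C N where C: "C > 0" "\<And>x. norm (u (\<lambda>y. \<phi> (x - y))) \<le> C * (1 + norm x) ^ N"
    using tame_growth[OF u admissible_band[OF \<phi>]] by blast
  obtain D where D: "D > 0" "\<And>x y. norm (\<kappa> (x + y)) * (1 + norm y) ^ N \<le> D * (1 + norm x) ^ (N + 2 * CARD('n)) * wt y"
    using decaying_weighted_bound[OF sampling_kernelD(1)[OF K]] by blast
  define g where "g x = u (\<lambda>y. \<phi> (x - y))" for x
  have "continuous_on (ball x0 1) g" for x0
  proof -
    define f where "f n x = \<kappa> ((x - x0) + ivec (lat n)) * g (x0 - ivec (lat n))" for n x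
    define M where "M n = (C * (1 + norm x0) ^ N) * (D * 2 ^ (N + 2 * CARD('n))) * wt (ivec (lat n) :: real^'n)" for n
    have gs: "g x = (\<Sum>n. f n x)" for x
      using sampling_kernelD(4)[OF K u, of x0 "x - x0"] by (simp add: f_def g_def)
    have fM: "norm (f n x) \<le> M n" if "x \<in> ball x0 1" for n x
    proof -
      let ?l = "ivec (lat n) :: real^'n"
      have "norm (g (x0 - ?l)) \<le> C * (1 + norm (x0 - ?l)) ^ N" unfolding g_def by (rule C)
      also have "\<dots> \<le> C * ((1 + norm x0) * (1 + norm ?l)) ^ N"
        using weight_add[of x0 "- ?l"] C(1) by (intro mult_left_mono power_mono) auto
      finally have "norm (f n x) \<le> norm (\<kappa> ((x - x0) + ?l)) * (C * ((1 + norm x0) * (1 + norm ?l)) ^ N)"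
        unfolding f_def norm_mult by (intro mult_left_mono) auto
      also have "\<dots> = (C * (1 + norm x0) ^ N) * (norm (\<kappa> ((x - x0) + ?l)) * (1 + norm ?l) ^ N)" by (simp add: power_mult_distrib)
      also have "\<dots> \<le> (C * (1 + norm x0) ^ N) * (D * (1 + norm (x - x0)) ^ (N + 2 * CARD('n)) * wt ?l)"
        using C(1) by (intro mult_left_mono D) auto
      also have "\<dots> \<le> (C * (1 + norm x0) ^ N) * (D * 2 ^ (N + 2 * CARD('n)) * wt ?l)"
        using C(1) D(1) that wt_pos[of ?l] by (intro mult_left_mono mult_right_mono power_mono) (auto simp: dist_norm norm_minus_commute less_imp_le)
      finally show ?thesis by (simp add: M_def)
    qed
    have "summable M" unfolding M_def[abs_def] by (intro summable_mult summable_lat_wt)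
    then have "uniform_limit (ball x0 1) (\<lambda>N x. \<Sum>n<N. f n x) (\<lambda>x. \<Sum>n. f n x) sequentially"
      by (intro Weierstrass_m_test[OF fM])
    then have "uniform_limit (ball x0 1) (\<lambda>N x. \<Sum>n<N. f n x) g sequentially"
      unfolding gs[symmetric] .
    then show ?thesis
      by (rule uniform_limit_theorem[rotated])
        (auto intro!: always_eventually continuous_intros continuous_on_compose2[OF sampling_kernelD(2)[OF K]] simp: f_def)
  qed
  then have "isCont g x0" for x0
    using continuous_on_eq_continuous_at[OF open_ball, of x0 1 g] centre_in_ball[of x0 1] by auto
  then show ?thesis unfolding g_def[symmetric] by (simp add: continuous_at_imp_continuous_on)
qed

text \<open>The Plancherel-Polya argument: near an almost maximal point of \<open>|g| / (1 + \<epsilon>|x|)\<^sup>N\<close>, \<open>|g|\<close> is comparable to its maximum on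
  a small cube. The weight only serves to make the supremum finite and disappears as \<open>\<epsilon> \<rightarrow> 0\<close>, so that the
  constants do not depend on the functional.\<close>

lemma local_lower_bound:
  fixes \<phi> :: "real^'n::finite \<Rightarrow> complex"
  assumes \<phi>: "admissible \<phi>"
  shows "\<exists>\<delta>>0. \<delta> \<le> 1/2 \<and> (\<forall>u D. tame u \<longrightarrow>
    (\<forall>(k::int^'n) q c. (\<forall>i. of_int (k $ i) \<le> q $ i \<and> q $ i + \<delta> \<le> of_int (k $ i) + 1) \<longrightarrow>
       (\<forall>x. (\<forall>i. q $ i \<le> x $ i \<and> x $ i < q $ i + \<delta>) \<longrightarrow> c \<le> norm (u (\<lambda>y. \<phi> (x - y)))) \<longrightarrow> c \<le> D) \<longrightarrow>
    (\<forall>x. norm (u (\<lambda>y. \<phi> (x - y))) \<le> 4 * D))"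
proof -
  obtain \<kappa> where K: "sampling_kernel \<phi> \<kappa>" using sampling_kernel_exists[OF \<phi>] by blast
  define S where "S x = (\<Sum>n. norm (\<kappa> (x + ivec (lat n)) - \<kappa> (ivec (lat n))))" for x
  note mod = sampling_kernel_modulus[OF sampling_kernelD(1,2)[OF K]]
  have "eventually (\<lambda>x. S x < 1/8) (at 0)"
    using order_tendstoD(2)[OF mod(2), of "1/8"] by (simp add: S_def)
  then obtain r where r: "r > 0" "\<And>x. x \<noteq> 0 \<Longrightarrow> norm x < r \<Longrightarrow> S x < 1/8"
    unfolding eventually_at by (auto simp: dist_norm)
  have "S 0 = 0" by (simp add: S_def)
  then have S: "S x < 1/8" if "norm x < r" for x using r(2)[of x] that by (cases "x = 0") auto
  define n where "n = real CARD('n)"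
  have n: "n \<ge> 1" using zero_less_card_finite[where ?'a='n] by (simp add: n_def del: zero_less_card_finite)
  \<comment> \<open>Points of a cube of side \<delta> that touches \<open>x0\<close> stay within n
    \<delta> of it. This must be below \<open>r\<close>, where the oscillation is less than 1/8, and
    at most 1, where \<open>kap\<close> applies. The bound 1/2 lets the cube fit into the unit cell
    on one side of \<open>x0\<close>.\<close>
  define \<delta> where "\<delta> = min (1/2) (min (r / (2 * n)) (1 / n))"
  have \<delta>: "\<delta> > 0" "\<delta> \<le> 1/2" "n * \<delta> < r" "n * \<delta> \<le> 1"
  proof -
    show "\<delta> > 0" "\<delta> \<le> 1/2" using r(1) n by (auto simp: \<delta>_def)
    have "n * \<delta> \<le> n * (r / (2 * n))" "n * \<delta> \<le> n * (1 / n)" using n by (intro mult_left_mono; simp add: \<delta>_def)+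
    then show "n * \<delta> < r" "n * \<delta> \<le> 1" using n r(1) by auto
  qed
  show ?thesis
  proof (intro exI[of _ \<delta>] conjI \<delta> allI impI)
    fix u D and x :: "real^'n"
    assume u: "tame u" and hyp: "\<forall>(k::int^'n) q c. (\<forall>i. of_int (k $ i) \<le> q $ i \<and> q $ i + \<delta> \<le> of_int (k $ i) + 1) \<longrightarrow>
       (\<forall>x. (\<forall>i. q $ i \<le> x $ i \<and> x $ i < q $ i + \<delta>) \<longrightarrow> c \<le> norm (u (\<lambda>y. \<phi> (x - y)))) \<longrightarrow> c \<le> D"
    define g where "g x = u (\<lambda>y. \<phi> (x - y))" for x
    obtain C N where C: "C > 0" "\<And>x. norm (g x) \<le> C * (1 + norm x) ^ N"
      using tame_growth[OF u admissible_band[OF \<phi>]] unfolding g_def by blast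
    obtain E where E: "E > 0" "\<And>x y. norm (\<kappa> (x + y)) * (1 + norm y) ^ N \<le> E * (1 + norm x) ^ (N + 2 * CARD('n)) * wt y"
      using decaying_weighted_bound[OF sampling_kernelD(1)[OF K]] by blast
    define F where "F = E * 2 ^ (N + 2 * CARD('n)) + E"
    have F: "F > 0" using E by (simp add: F_def add_pos_pos)
    have kap: "norm (\<kappa> (x + y) - \<kappa> y) * (1 + norm y) ^ N \<le> F * wt y" if "norm x \<le> 1" for x y
    proof -
      have "norm (\<kappa> (x + y) - \<kappa> y) * (1 + norm y) ^ N \<le> (norm (\<kappa> (x + y)) + norm (\<kappa> y)) * (1 + norm y) ^ N"
        by (intro mult_right_mono norm_triangle_ineq4) simp
      also have "\<dots> \<le> E * (1 + norm x) ^ (N + 2 * CARD('n)) * wt y + E * wt y"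
        using E(2)[of x y] E(2)[of 0 y] by (simp add: distrib_right)
      also have "E * (1 + norm x) ^ (N + 2 * CARD('n)) * wt y \<le> E * 2 ^ (N + 2 * CARD('n)) * wt y"
        using E(1) that wt_pos[of y] by (intro mult_right_mono mult_left_mono power_mono) (auto simp: less_imp_le)
      finally show ?thesis by (simp add: F_def distrib_right)
    qed
    have sF: "summable (\<lambda>n. F * wt (ivec (lat n) :: real^'n))" by (intro summable_mult summable_lat_wt)
    define T where "T = (\<Sum>n. F * wt (ivec (lat n) :: real^'n))"
    have T: "T \<ge> 0" unfolding T_def by (rule suminf_nonneg[OF sF]) (intro mult_nonneg_nonneg less_imp_le F wt_pos)
    have weighted: "norm (g x) \<le> 4 * D * (1 + \<epsilon> * norm x) ^ N" if \<epsilon>: "\<epsilon> > 0" "\<epsilon> \<le> 1" "\<epsilon> * T \<le> 1/8" for \<epsilon> x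
    proof -
      define w where "w x = (1 + \<epsilon> * norm x) ^ N" for x :: "real^'n"
      have w1: "w x \<ge> 1" and w0: "w x > 0" for x
      proof -
        show "w x \<ge> 1" unfolding w_def using \<epsilon> by (intro one_le_power) simp
        then show "w x > 0" by simp
      qed
      have w_add: "w (x + y) \<le> w x * w y" for x y
      proof -
        have "1 + \<epsilon> * norm (x + y) = 1 + norm (\<epsilon> *\<^sub>R x + \<epsilon> *\<^sub>R y)"
          using \<epsilon> by (simp add: scaleR_add_right[symmetric])
        also have "\<dots> \<le> (1 + norm (\<epsilon> *\<^sub>R x)) * (1 + norm (\<epsilon> *\<^sub>R y))" by (rule weight_add)
        finally have "1 + \<epsilon> * norm (x + y) \<le> (1 + \<epsilon> * norm x) * (1 + \<epsilon> * norm y)" using \<epsilon> by simp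
        then show ?thesis unfolding w_def power_mult_distrib[symmetric] using \<epsilon> by (intro power_mono) auto
      qed
      define A where "A = (SUP x. norm (g x) / w x)"
      have bdd: "bdd_above (range (\<lambda>x. norm (g x) / w x))"
      proof (rule bdd_aboveI2)
        fix x
        have "\<epsilon> ^ N * (1 + norm x) ^ N \<le> w x"
          unfolding w_def power_mult_distrib[symmetric] using \<epsilon> by (intro power_mono) (auto simp: algebra_simps)
        then have "(1 + norm x) ^ N \<le> w x / \<epsilon> ^ N" using \<epsilon> by (simp add: field_simps)
        then have "norm (g x) \<le> C * (w x / \<epsilon> ^ N)" using C by (meson order.trans mult_left_mono less_imp_le)
        then show "norm (g x) / w x \<le> C / \<epsilon> ^ N" using w0[of x] by (simp add: field_simps)
      qed
      have gA: "norm (g x) \<le> A * w x" for x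
        using cSUP_upper[OF UNIV_I bdd, of x] w0[of x] unfolding A_def by (simp add: pos_divide_le_eq)
      have "0 \<le> A * w 0" by (rule order.trans[OF norm_ge_zero gA])
      then have "A \<ge> 0" using w0[of 0] by (simp add: zero_le_mult_iff)
      have "A / 4 \<le> D"
      proof (cases "A = 0")
        case True
        \<comment> \<open>The lower bound \<open>c = 0\<close> holds on every subcube, so the
          hypothesis itself makes \<open>D\<close> nonnegative.\<close>
        have "0 \<le> D"
          by (rule hyp[rule_format, of 0 0 0]) (use \<delta> in auto)
        then show ?thesis using True by simp
      next
        case False
        then have A: "A > 0" using \<open>A \<ge> 0\<close> by simp
        then have "A / 2 < (SUP x. norm (g x) / w x)" by (simp flip: A_def)
        then obtain x0 where "A / 2 < norm (g x0) / w x0"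
          using less_cSUP_iff[OF _ bdd, of "A / 2"] by auto
        then have x0: "A / 2 * w x0 < norm (g x0)" using w0[of x0] by (simp add: pos_less_divide_eq)
        \<comment> \<open>At \<open>x0\<close> half of the weighted supremum is exceeded. The
          increment loses at most a quarter: one eighth from the oscillation \<open>S x\<close>, and
          one eighth from \<open>\<epsilon> * T\<close>, the part of the weight above 1.\<close>
        have near: "A / 4 \<le> norm (g (x0 + x))" if x: "norm x < r" "norm x \<le> 1" for x
        proof -
          let ?d = "\<lambda>n. \<kappa> (x + ivec (lat n)) - \<kappa> (ivec (lat n))"
          have term_le: "norm (?d n * g (x0 - ivec (lat n))) \<le> A * w x0 * (norm (?d n) + \<epsilon> * (F * wt (ivec (lat n) :: real^'n)))" for n
          proof -
            let ?l = "ivec (lat n) :: real^'n"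
            have "norm (g (x0 - ?l)) \<le> A * w (x0 - ?l)" by (rule gA)
            also have "\<dots> \<le> A * (w x0 * w (- ?l))" using w_add[of x0 "- ?l"] A by simp
            also have "w (- ?l) \<le> 1 + \<epsilon> * (1 + norm ?l) ^ N"
              unfolding w_def using \<epsilon> by (simp add: one_plus_power_convex)
            finally have "norm (g (x0 - ?l)) \<le> A * (w x0 * (1 + \<epsilon> * (1 + norm ?l) ^ N))"
              using A w0[of x0] by (simp add: mult_left_mono)
            then have "norm (?d n * g (x0 - ?l)) \<le> norm (?d n) * (A * (w x0 * (1 + \<epsilon> * (1 + norm ?l) ^ N)))"
              unfolding norm_mult by (rule mult_left_mono) simp
            also have "\<dots> = A * w x0 * (norm (?d n) + \<epsilon> * (norm (?d n) * (1 + norm ?l) ^ N))" by (simp add: algebra_simps)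
            also have "\<dots> \<le> A * w x0 * (norm (?d n) + \<epsilon> * (F * wt ?l))"
              using A w0[of x0] \<epsilon> by (intro mult_left_mono add_left_mono kap x(2)) auto
            finally show ?thesis .
          qed
          have sR: "(\<lambda>n. A * w x0 * (norm (?d n) + \<epsilon> * (F * wt (ivec (lat n) :: real^'n)))) sums (A * w x0 * (S x + \<epsilon> * T))"
            unfolding S_def T_def by (intro sums_mult sums_add summable_sums mod(1) sF)
          have "g (x0 + x) - g x0 = (\<Sum>n. ?d n * g (x0 - ivec (lat n)))"
            unfolding g_def by (rule sampling_increment(2)[OF K u])
          also have "norm \<dots> \<le> (\<Sum>n. norm (?d n * g (x0 - ivec (lat n))))"
            unfolding g_def by (rule summable_norm[OF sampling_increment(1)[OF K u]])
          also have "\<dots> \<le> (\<Sum>n. A * w x0 * (norm (?d n) + \<epsilon> * (F * wt (ivec (lat n) :: real^'n))))"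
            using term_le sums_summable[OF sR] sampling_increment(1)[OF K u] unfolding g_def by (intro suminf_le) auto
          also have "\<dots> = A * w x0 * (S x + \<epsilon> * T)" using sR by (simp add: sums_iff)
          also have "\<dots> \<le> A * w x0 * (1/8 + 1/8)" using A w0[of x0] S[OF x(1)] \<epsilon> by (intro mult_left_mono add_mono) auto
          finally have "norm (g (x0 + x) - g x0) \<le> A * w x0 / 4" by simp
          moreover have "norm (g x0) \<le> norm (g (x0 + x)) + norm (g (x0 + x) - g x0)"
            using norm_triangle_ineq4[of "g (x0 + x)" "g (x0 + x) - g x0"] by simp
          moreover have "A * w x0 \<ge> A" using w1[of x0] A by simp
          ultimately show ?thesis using x0 by simp
        qed
        obtain k :: "int^'n" where k: "\<And>i. of_int (k $ i) \<le> x0 $ i" "\<And>i. x0 $ i < of_int (k $ i) + 1" using integer_part by blast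
        \<comment> \<open>In each coordinate the subcube extends to the right of \<open>x0\<close>
          if that stays in the unit cell, and to the left otherwise.\<close>
        define q where "q = (\<chi> i. if x0 $ i + \<delta> \<le> of_int (k $ i) + 1 then x0 $ i else x0 $ i - \<delta>)"
        have q: "of_int (k $ i) \<le> q $ i" "q $ i + \<delta> \<le> of_int (k $ i) + 1" "q $ i \<le> x0 $ i" "x0 $ i - \<delta> \<le> q $ i" for i
          using k[of i] \<delta> by (auto simp: q_def)
        have q1: "\<forall>i. of_int (k $ i) \<le> q $ i \<and> q $ i + \<delta> \<le> of_int (k $ i) + 1" using q by simp
        have "\<forall>x. (\<forall>i. q $ i \<le> x $ i \<and> x $ i < q $ i + \<delta>) \<longrightarrow> A / 4 \<le> norm (u (\<lambda>y. \<phi> (x - y)))"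
        proof (intro allI impI)
          fix x assume x: "\<forall>i. q $ i \<le> x $ i \<and> x $ i < q $ i + \<delta>"
          have "\<bar>(x - x0) $ i\<bar> \<le> \<delta>" for i using x[rule_format, of i] q[of i] by (simp add: abs_le_iff)
          then have "norm (x - x0) \<le> n * \<delta>" unfolding n_def by (rule norm_le_card)
          then have "A / 4 \<le> norm (g (x0 + (x - x0)))" using \<delta> by (intro near) auto
          then show "A / 4 \<le> norm (u (\<lambda>y. \<phi> (x - y)))" by (simp add: g_def)
        qed
        with hyp q1 show ?thesis by blast
      qed
      then have "A * w x \<le> 4 * D * w x" using w0[of x] by (intro mult_right_mono) auto
      then show ?thesis using gA[of x] unfolding w_def by linarith
    qed
    \<comment> \<open>\<open>T\<close> depends on the functional through its growth order
      \<open>N\<close>, but it only limits how small \<epsilon> must be. In the limit neither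
      \<open>T\<close> nor \<open>N\<close> is left.\<close>
    define e where "e m = min 1 (1 / (8 * (T + 1))) * (1 / real (Suc m))" for m
    have e: "e m > 0" "e m \<le> 1" "e m * T \<le> 1/8" for m
    proof -
      define b where "b = min 1 (1 / (8 * (T + 1)))"
      have b: "b > 0" "b \<le> 1" "b \<le> 1 / (8 * (T + 1))" using T by (auto simp: b_def)
      have m: "1 / real (Suc m) > 0" "1 / real (Suc m) \<le> 1" by auto
      have em: "e m = b * (1 / real (Suc m))" by (simp add: e_def b_def)
      show "e m > 0" unfolding em using b(1) m(1) by (rule mult_pos_pos)
      have le: "e m \<le> b" unfolding em using b m by (intro mult_left_le) auto
      then show "e m \<le> 1" using b by simp
      have "e m * T \<le> 1 / (8 * (T + 1)) * T" using le b T by (intro mult_right_mono) auto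
      also have "\<dots> \<le> 1/8" using T by (simp add: field_simps)
      finally show "e m * T \<le> 1/8" .
    qed
    have "e \<longlonglongrightarrow> min 1 (1 / (8 * (T + 1))) * 0" unfolding e_def[abs_def]
      using LIMSEQ_inverse_real_of_nat by (intro tendsto_intros) (simp add: inverse_eq_divide)
    then have e0: "e \<longlonglongrightarrow> 0" by simp
    have "(\<lambda>m. 4 * D * (1 + e m * norm x) ^ N) \<longlonglongrightarrow> 4 * D * (1 + 0 * norm x) ^ N" by (intro tendsto_intros e0)
    then have "norm (g x) \<le> 4 * D * (1 + 0 * norm x) ^ N"
      by (rule LIMSEQ_le_const) (use weighted[OF e] in auto)
    then show "norm (u (\<lambda>y. \<phi> (x - y))) \<le> 4 * D" by (simp add: g_def)
  qed
qed

section \<open>The local Calderon formula\<close>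

lemma admissible_dilate:
  assumes "admissible \<phi>" shows "rapid (dilate k \<phi>)" "band (dilate k \<phi>)"
    "fourier (dilate k \<phi>) \<xi> = fourier \<phi> ((2 powi (- k)) *\<^sub>R \<xi>)"
proof -
  have eq: "dilate k \<phi> = (\<lambda>x. of_real (2 powi (k * int CARD('a))) * \<phi> (0 + (2 powi k) *\<^sub>R x))"
    by (simp add: dilate_def fun_eq_iff)
  show "band (dilate k \<phi>)" unfolding eq by (intro band_affine admissible_band assms) simp
  then show "rapid (dilate k \<phi>)" by (intro schwartz_rapid band_schwartz)
  have p: "2 powi (k * int CARD('a)) = (2 powi k :: real) ^ CARD('a)" by (simp add: power_int_mult)
  show "fourier (dilate k \<phi>) \<xi> = fourier \<phi> ((2 powi (- k)) *\<^sub>R \<xi>)"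
    unfolding eq fourier_cmult using fourier_affine[OF admissible_integrable[OF assms], of "2 powi k" 0 \<xi>]
    by (simp add: p power_int_minus)
qed

text \<open>A local Calderon formula. The scale of \<open>\<psi>\<close> is shifted by one so that all spectra stay inside the ball
  of radius 3, where the Fourier series represents the multipliers.\<close>

lemma change_of_test_function:
  fixes \<phi> \<psi> :: "real^'n::finite \<Rightarrow> complex"
  assumes \<phi>: "admissible \<phi>" and \<psi>: "admissible \<psi>"
  shows "\<exists>C>0. \<forall>u D. tame u \<longrightarrow> (\<forall>k\<in>{-2,-1,0}. \<forall>x. norm (u (\<lambda>y. dilate k \<phi> (x - y))) \<le> D) \<longrightarrow>
    (\<forall>x. norm (u (\<lambda>y. dilate (-1) \<psi> (x - y))) \<le> C * D)"
proof -
  let ?J = "{-2,-1,0} :: int set"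
  define p where "p k = fourier (dilate k \<phi>)" for k
  define q where "q = fourier (dilate (-1) \<psi>)"
  define W where "W \<xi> = (\<Sum>k\<in>?J. p k \<xi> * cnj (p k \<xi>))" for \<xi>
  \<comment> \<open>These multipliers solve the equation that the sum of \<open>m k * p k\<close>
    over the three scales equals \<open>q\<close>. The conjugates make the denominator a sum of
    squares.\<close>
  define m where "m k \<xi> = (q \<xi> * cnj (p k \<xi>)) / W \<xi>" for k \<xi>
  \<comment> \<open>This annulus contains the spectrum of \<open>dilate (-1) \<psi>\<close>. The
    transforms at scales -2, -1 and 0 are nonzero for |\<xi>| in [3/20, 5/12], [3/10, 5/6] and
    [3/5, 5/3], which cover [1/4, 1]; the case distinction below splits at 2/5 and 7/10.\<close>
  define Z where "Z = {\<xi>::real^'n. 1/4 \<le> norm \<xi> \<and> norm \<xi> \<le> 1}"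
  have dp: "dsm j i UNIV (p k)" for i j k unfolding p_def by (intro dsm_fourier admissible_dilate \<phi>)
  have dq: "dsm j i UNIV q" for i j unfolding q_def by (intro dsm_fourier admissible_dilate \<psi>)
  have q0: "q \<xi> = 0" if "\<xi> \<notin> Z" for \<xi>
  proof (rule ccontr)
    assume "q \<xi> \<noteq> 0"
    then have "fourier \<psi> (2 *\<^sub>R \<xi>) \<noteq> 0" unfolding q_def admissible_dilate(3)[OF \<psi>] by simp
    from admissible_support[OF \<psi> this] that show False by (simp add: Z_def)
  qed
  have W_real: "W \<xi> = of_real (\<Sum>k\<in>?J. (norm (p k \<xi>))\<^sup>2)" for \<xi>
    unfolding W_def of_real_sum by (intro sum.cong refl) (simp add: complex_norm_square del: of_real_power)
  have W0: "W \<xi> \<noteq> 0" if "\<xi> \<in> Z" for \<xi>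
  proof -
    have "\<exists>k\<in>?J. p k \<xi> \<noteq> 0"
    proof -
      have pk: "p k \<xi> \<noteq> 0" if "3/5 \<le> 2 powi (- k) * norm \<xi>" "2 powi (- k) * norm \<xi> \<le> 5/3" for k
        unfolding p_def admissible_dilate(3)[OF \<phi>] by (rule admissible_nonzero[OF \<phi>]) (use that in simp_all)
      consider "norm \<xi> \<le> 2/5" | "2/5 \<le> norm \<xi>" "norm \<xi> \<le> 7/10" | "7/10 \<le> norm \<xi>" by linarith
      then show ?thesis
      proof cases
        case 1 then have "p (-2) \<xi> \<noteq> 0" using that by (intro pk) (auto simp: Z_def)
        then show ?thesis by blast
      next
        case 2 then have "p (-1) \<xi> \<noteq> 0" using that by (intro pk) (auto simp: Z_def)
        then show ?thesis by blast
      next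
        case 3 then have "p 0 \<xi> \<noteq> 0" using that by (intro pk) (auto simp: Z_def)
        then show ?thesis by blast
      qed
    qed
    then have "(\<Sum>k\<in>?J. (norm (p k \<xi>))\<^sup>2) \<noteq> 0" by (subst sum_nonneg_eq_0_iff) auto
    then show ?thesis unfolding W_real of_real_eq_0_iff .
  qed
  have dm: "dsm j i UNIV (m k)" for i j k unfolding m_def
  proof (rule dsm_divide[where Z=Z])
    show "dsm j i UNIV (\<lambda>\<xi>. q \<xi> * cnj (p k \<xi>))" by (intro dsm_mult dsm_cnj dp dq)
    show "dsm j i UNIV W" unfolding W_def by (intro dsm_sum dsm_mult dsm_cnj dp)
    have "closed ({\<xi>::real^'n. 1/4 \<le> norm \<xi>} \<inter> {\<xi>. norm \<xi> \<le> 1})"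
      by (intro closed_Int closed_Collect_le continuous_intros)
    then show "closed Z" unfolding Z_def by (simp add: Collect_conj_eq)
  qed (use q0 W0 in auto)
  have m_out: "m k \<xi> = 0" if "3 < norm \<xi>" for k \<xi> using q0[of \<xi>] that by (simp add: m_def Z_def)
  have dec: "decaying (fourier_coeff (m k))" for k by (rule decaying_fourier_coeff[OF dm m_out])
  define a where "a k n = fourier_coeff (m k) (ivec (lat n))" for k n
  have a_sum: "summable (\<lambda>n. norm (a k n) * (1 + norm (ivec (lat n) :: real^'n)) ^ N)" for k N
    using decaying_summable[OF dec, of k 0 N] by (simp add: a_def)
  have a_sum0: "summable (\<lambda>n. norm (a k n))" for k using a_sum[of k 0] by simp
  have eq: "fourier (dilate (-1) \<psi>) \<xi> = (\<Sum>k\<in>?J. (\<Sum>n. a k n * cis (- (ivec (lat n) \<bullet> \<xi>))) * fourier (dilate k \<phi>) \<xi>)" for \<xi>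
  proof -
    \<comment> \<open>The series represents \<open>m k\<close> on the ball of radius 3 only. This
      suffices, since \<open>p k\<close> vanishes where |\<xi>| > 2.\<close>
    have "(\<Sum>n. a k n * cis (- (ivec (lat n) \<bullet> \<xi>))) * p k \<xi> = m k \<xi> * p k \<xi>" if "k \<in> ?J" for k
    proof (cases "p k \<xi> = 0")
      case False
      then have "fourier \<phi> ((2 powi (- k)) *\<^sub>R \<xi>) \<noteq> 0" unfolding p_def admissible_dilate(3)[OF \<phi>] .
      from admissible_support(2)[OF \<phi> this] have le: "2 powi (- k) * norm \<xi> \<le> 2" by simp
      have "norm \<xi> \<le> 3" using le that norm_ge_zero[of \<xi>] by (auto simp del: norm_ge_zero)
      then have "(\<lambda>n. a k n * cis (- (ivec (lat n) \<bullet> \<xi>))) sums m k \<xi>"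
        unfolding a_def by (intro fourier_series dsm_continuous[OF dm] m_out) (use a_sum0[of k] in \<open>simp_all add: a_def\<close>)
      then show ?thesis by (simp add: sums_iff)
    qed simp
    then have "(\<Sum>k\<in>?J. (\<Sum>n. a k n * cis (- (ivec (lat n) \<bullet> \<xi>))) * p k \<xi>) = (\<Sum>k\<in>?J. m k \<xi> * p k \<xi>)" by (rule sum.cong[OF refl])
    also have "\<dots> = q \<xi> * W \<xi> / W \<xi>" unfolding m_def W_def sum_distrib_left sum_divide_distrib
      by (intro sum.cong refl) (simp add: mult_ac)
    also have "\<dots> = q \<xi>" using q0[of \<xi>] W0[of \<xi>] by (cases "\<xi> \<in> Z") auto
    finally show ?thesis unfolding p_def q_def by simp
  qed
  define C where "C = (\<Sum>k\<in>?J. \<Sum>n. norm (a k n)) + 1"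
  have "(\<Sum>k\<in>?J. \<Sum>n. norm (a k n)) \<ge> 0" by (intro sum_nonneg suminf_nonneg a_sum0) auto
  then have "C > 0" by (simp add: C_def)
  moreover have "norm (u (\<lambda>y. dilate (-1) \<psi> (x - y))) \<le> C * D"
    if u: "tame u" and D: "\<forall>k\<in>?J. \<forall>x. norm (u (\<lambda>y. dilate k \<phi> (x - y))) \<le> D" for u D x
  proof -
    have D0: "D \<ge> 0" using D[rule_format, of 0 0] by (simp add: order.trans[OF norm_ge_zero])
    have fin: "finite ?J" by simp
    note T = tame_translate_series[OF u fin admissible_dilate(2)[OF \<psi>] admissible_dilate(2)[OF \<phi>] a_sum eq, where x=x]
    have "norm (u (\<lambda>y. dilate (-1) \<psi> (x - y))) \<le> (\<Sum>k\<in>?J. (\<Sum>n. norm (a k n)) * D)"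
      unfolding T(2)
    proof (intro order.trans[OF norm_sum] sum_mono)
      fix k assume k: "k \<in> ?J"
      have le: "norm (a k n * u (\<lambda>y. dilate k \<phi> (x - ivec (lat n) - y))) \<le> norm (a k n) * D" for n
        unfolding norm_mult using D k by (intro mult_left_mono) auto
      have "norm (\<Sum>n. a k n * u (\<lambda>y. dilate k \<phi> (x - ivec (lat n) - y))) \<le> (\<Sum>n. norm (a k n * u (\<lambda>y. dilate k \<phi> (x - ivec (lat n) - y))))"
        by (rule summable_norm[OF T(1)[OF k]])
      also have "\<dots> \<le> (\<Sum>n. norm (a k n) * D)" by (rule suminf_le[OF le T(1)[OF k] summable_mult2[OF a_sum0]])
      also have "\<dots> = (\<Sum>n. norm (a k n)) * D" by (rule suminf_mult2[OF a_sum0, symmetric])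
      finally show "norm (\<Sum>n. a k n * u (\<lambda>y. dilate k \<phi> (x - ivec (lat n) - y))) \<le> (\<Sum>n. norm (a k n)) * D" .
    qed
    also have "\<dots> \<le> C * D" using D0 unfolding C_def by (simp add: sum_distrib_right[symmetric] distrib_right)
    finally show ?thesis .
  qed
  ultimately show ?thesis by blast
qed

section \<open>Rescaling to arbitrary dyadic levels\<close>

lemma schwartz_inf_dilate:
  fixes h :: "real^'n::finite \<Rightarrow> complex"
  assumes h: "h \<in> schwartz_inf" and a: "a \<noteq> 0"
  shows "(\<lambda>y. h (a *\<^sub>R y)) \<in> schwartz_inf"
proof -
  have r: "rapid h" by (rule schwartz_rapid[OF schwartz_inf_schwartz[OF h]])
  have "(\<integral>y. h (a *\<^sub>R y) * of_real (monomial \<gamma> y) \<partial>lborel) = 0" for \<gamma>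
  proof -
    have m: "monomial \<gamma> (a *\<^sub>R y) = a ^ (\<Sum>i\<in>UNIV. \<gamma> i) * monomial \<gamma> y" for y :: "real^'n"
      by (simp add: monomial_def power_mult_distrib prod.distrib power_sum)
    note i = integrable_mult_monomial[OF r, of \<gamma>]
    have "0 = \<bar>a\<bar> ^ CARD('n) *\<^sub>R (\<integral>y. h (0 + a *\<^sub>R y) * of_real (monomial \<gamma> (0 + a *\<^sub>R y)) \<partial>lborel)"
      using integral_affine_vec[OF i a, of 0] h by (simp add: schwartz_inf_def)
    then have "(\<integral>y. of_real (a ^ (\<Sum>i\<in>UNIV. \<gamma> i)) * (h (a *\<^sub>R y) * of_real (monomial \<gamma> y)) \<partial>lborel) = 0"
      using a by (simp add: m mult_ac)
    then show ?thesis using a by (simp del: of_real_power)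
  qed
  moreover have "(\<lambda>y. h (a *\<^sub>R y)) \<in> schwartz"
    using schwartz_affine[OF schwartz_inf_schwartz[OF h] a, of 1 0] by simp
  ultimately show ?thesis by (simp add: schwartz_inf_def)
qed

text \<open>The Jacobian factor is chosen such that convolving the rescaled functional with \<phi>
  at \<open>x\<close> gives the convolution of \<open>f\<close> with \<open>dilate j \<phi>\<close>
  at 2^(-j) x.\<close>

definition rescale :: "int \<Rightarrow> ((real^'n::finite \<Rightarrow> complex) \<Rightarrow> complex) \<Rightarrow> (real^'n \<Rightarrow> complex) \<Rightarrow> complex" where
  "rescale j f h = of_real ((2 powi j) ^ CARD('n)) * f (\<lambda>y. h ((2 powi j) *\<^sub>R y))"

text \<open>The constants obtained here depend on \<open>j\<close>. This does no harm, because the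
  estimates at unit scale are uniform over all \<open>tame\<close> functionals.\<close>

lemma tame_rescale:
  fixes f :: "(real^'n::finite \<Rightarrow> complex) \<Rightarrow> complex"
  assumes f: "tame f"
  shows "tame (rescale j f)"
proof -
  define a :: real where "a = 2 powi j"
  have a: "a > 0" by (simp add: a_def)
  have mem: "(\<lambda>y. h (a *\<^sub>R y)) \<in> schwartz_inf" if "h \<in> schwartz_inf" for h :: "real^'n \<Rightarrow> complex"
    using schwartz_inf_dilate[OF that] a by simp
  obtain C N where C: "C \<ge> 0" "\<And>h B. h \<in> schwartz_inf \<Longrightarrow> (\<And>is x. length is \<le> N \<Longrightarrow> (1 + norm x) ^ N * norm (partial_derivs is h x) \<le> B) \<Longrightarrow>
        norm (f h) \<le> C * B"
    using f unfolding tame_def by metis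
  \<comment> \<open>The first factor bounds the powers of \<open>a\<close> produced by the chain
    rule, the second the change of the polynomial weight under dilation.\<close>
  define b where "b = (1 + a) ^ N * (1 + 1 / a) ^ N"
  have b: "b \<ge> 0" using a by (simp add: b_def)
  have bound: "norm (rescale j f h) \<le> a ^ CARD('n) * (C * b) * B"
    if h: "h \<in> schwartz_inf" and B: "\<forall>is x. length is \<le> N \<longrightarrow> (1 + norm x) ^ N * norm (partial_derivs is h x) \<le> B" for h B
  proof -
    have "norm (f (\<lambda>y. h (a *\<^sub>R y))) \<le> C * (b * B)"
    proof (rule C(2)[OF mem[OF h]])
      fix "is" :: "'n list" and x :: "real^'n" assume l: "length is \<le> N"
      have "partial_derivs is (\<lambda>y. h (a *\<^sub>R y)) x = of_real a ^ length is * partial_derivs is h (a *\<^sub>R x)"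
        using partial_derivs_affine(1)[OF schwartz_smooth[OF schwartz_inf_schwartz[OF h]], of "is" 1 0 a] by simp
      then have "norm (partial_derivs is (\<lambda>y. h (a *\<^sub>R y)) x) = a ^ length is * norm (partial_derivs is h (a *\<^sub>R x))"
        using a by (simp add: norm_mult norm_power)
      also have "\<dots> \<le> (1 + a) ^ N * norm (partial_derivs is h (a *\<^sub>R x))"
      proof (rule mult_right_mono)
        have "a ^ length is \<le> (1 + a) ^ length is" using a by (intro power_mono) auto
        also have "\<dots> \<le> (1 + a) ^ N" using a l by (intro power_increasing) auto
        finally show "a ^ length is \<le> (1 + a) ^ N" .
      qed simp
      finally have 1: "norm (partial_derivs is (\<lambda>y. h (a *\<^sub>R y)) x) \<le> (1 + a) ^ N * norm (partial_derivs is h (a *\<^sub>R x))" .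
      have "1 + norm x \<le> (1 + 1 / a) * (1 + norm (a *\<^sub>R x))" using a by (simp add: field_simps)
      then have "(1 + norm x) ^ N \<le> ((1 + 1 / a) * (1 + norm (a *\<^sub>R x))) ^ N" by (intro power_mono) auto
      then have "(1 + norm x) ^ N * norm (partial_derivs is (\<lambda>y. h (a *\<^sub>R y)) x)
        \<le> ((1 + 1 / a) * (1 + norm (a *\<^sub>R x))) ^ N * ((1 + a) ^ N * norm (partial_derivs is h (a *\<^sub>R x)))"
        using 1 a by (intro mult_mono) auto
      also have "\<dots> = b * ((1 + norm (a *\<^sub>R x)) ^ N * norm (partial_derivs is h (a *\<^sub>R x)))"
        by (simp add: b_def power_mult_distrib mult_ac)
      also have "\<dots> \<le> b * B" using B l by (intro mult_left_mono[OF _ b]) blast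
      finally show "(1 + norm x) ^ N * norm (partial_derivs is (\<lambda>y. h (a *\<^sub>R y)) x) \<le> b * B" .
    qed
    then have "a ^ CARD('n) * norm (f (\<lambda>y. h (a *\<^sub>R y))) \<le> a ^ CARD('n) * (C * (b * B))" using a by (intro mult_left_mono) auto
    then show ?thesis using a by (simp add: rescale_def a_def[symmetric] norm_mult norm_power mult.assoc)
  qed
  show ?thesis unfolding tame_def
  proof (intro conjI ballI allI)
    show "rescale j f (\<lambda>x. g x + h x) = rescale j f g + rescale j f h" if "g \<in> schwartz_inf" "h \<in> schwartz_inf" for g h
      unfolding rescale_def a_def[symmetric] tame_add[OF f mem[OF that(1)] mem[OF that(2)]] by (simp add: distrib_left)
    show "rescale j f (\<lambda>x. c * h x) = c * rescale j f h" if "h \<in> schwartz_inf" for c h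
      unfolding rescale_def a_def[symmetric] tame_cmult[OF f mem[OF that]] by simp
    show "\<exists>C N. C \<ge> 0 \<and> (\<forall>h\<in>schwartz_inf. \<forall>B. (\<forall>is x. length is \<le> N \<longrightarrow> (1 + norm x) ^ N * norm (partial_derivs is h x) \<le> B) \<longrightarrow>
        norm (rescale j f h) \<le> C * B)"
      using bound C(1) b a by (intro exI[of _ "a ^ CARD('n) * (C * b)"] exI[of _ N]) auto
  qed
qed

lemma rescale_conv:
  fixes f :: "(real^'n::finite \<Rightarrow> complex) \<Rightarrow> complex"
  assumes f: "tame f" and \<phi>: "admissible \<phi>"
  shows "rescale j f (\<lambda>y. dilate k \<phi> (x - y)) = conv f (dilate (j + k) \<phi>) ((2 powi (- j)) *\<^sub>R x)"
proof -
  have p: "2 powi (m * int CARD('n)) = (2 powi m :: real) ^ CARD('n)" for m by (simp add: power_int_mult)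
  have jk: "(2 powi (j + k) :: real) = 2 powi j * 2 powi k" by (simp add: power_int_add)
  have mem: "(\<lambda>y. dilate k \<phi> (x - (2 powi j) *\<^sub>R y)) \<in> schwartz_inf"
  proof -
    have "(\<lambda>y. dilate k \<phi> (x - y)) \<in> schwartz_inf"
      by (intro band_schwartz_inf band_reflect_translate admissible_dilate \<phi>)
    from schwartz_inf_dilate[OF this, of "2 powi j"] show ?thesis by simp
  qed
  have "dilate (j + k) \<phi> ((2 powi (- j)) *\<^sub>R x - y) = of_real ((2 powi j) ^ CARD('n)) * dilate k \<phi> (x - (2 powi j) *\<^sub>R y)" for y
  proof -
    have "(2 powi (j + k)) *\<^sub>R ((2 powi (- j)) *\<^sub>R x - y) = (2 powi k) *\<^sub>R (x - (2 powi j) *\<^sub>R y)"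
    proof -
      have "(a * b) *\<^sub>R (inverse a *\<^sub>R x - y) = b *\<^sub>R (x - a *\<^sub>R y)" if "a \<noteq> 0" for a b :: real
      proof -
        have "a * b * inverse a = b" using that by simp
        then show ?thesis by (simp only: scaleR_diff_right scaleR_scaleR) (simp add: mult.commute)
      qed
      then show ?thesis unfolding jk power_int_minus by simp
    qed
    then show ?thesis unfolding dilate_def p jk by (simp add: power_mult_distrib)
  qed
  then have "conv f (dilate (j + k) \<phi>) ((2 powi (- j)) *\<^sub>R x) = f (\<lambda>y. of_real ((2 powi j) ^ CARD('n)) * dilate k \<phi> (x - (2 powi j) *\<^sub>R y))"
    unfolding conv_def by simp
  also have "\<dots> = of_real ((2 powi j) ^ CARD('n)) * f (\<lambda>y. dilate k \<phi> (x - (2 powi j) *\<^sub>R y))"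
    by (rule tame_cmult[OF f mem])
  finally show ?thesis by (simp add: rescale_def)
qed

lemma dilate_0: "dilate 0 \<phi> = \<phi>"
  by (simp add: dilate_def fun_eq_iff)

lemma rescale_conv_0:
  assumes "tame f" "admissible \<phi>"
  shows "rescale j f (\<lambda>y. \<phi> (x - y)) = conv f (dilate j \<phi>) ((2 powi (- j)) *\<^sub>R x)"
  using rescale_conv[OF assms, of j 0 x] by (simp add: dilate_0)

lemma conv_rescale:
  assumes "tame f" "admissible \<phi>"
  shows "conv f (dilate (j + k) \<phi>) x = rescale j f (\<lambda>y. dilate k \<phi> ((2 powi j) *\<^sub>R x - y))"
  using rescale_conv[OF assms, of j k "(2 powi j) *\<^sub>R x"] by (simp add: power_int_minus)

lemma conv_continuous:
  fixes f :: "(real^'n::finite \<Rightarrow> complex) \<Rightarrow> complex"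
  assumes "tame f" "admissible \<phi>"
  shows "continuous_on UNIV (conv f (dilate j \<phi>))"
proof -
  have "continuous_on UNIV (\<lambda>x. rescale j f (\<lambda>y. \<phi> ((2 powi j) *\<^sub>R x - y)))"
    by (rule continuous_on_compose2[OF tame_continuous[OF assms(2) tame_rescale[OF assms(1)]]]) (auto intro!: continuous_intros)
  then show ?thesis using conv_rescale[OF assms, of j 0] by (simp add: dilate_0)
qed

section \<open>Dyadic cubes\<close>

lemma side_pos: "side Q > 0"
  by (simp add: side_def)

lemma cube_eq: "cube Q = {x. \<forall>i. corner Q $ i \<le> x $ i \<and> x $ i < corner Q $ i + side Q}"
  using mem_cube_iff by blast

lemma cube_borel [measurable]: "cube Q \<in> sets borel"
  unfolding cube_eq by (rule box_halfopen_measure(2)) (simp add: side_pos less_imp_le)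

lemma vol_eq: fixes Q :: "'n::finite dyadic" shows "vol Q = side Q ^ CARD('n)"
  using box_halfopen_measure(1)[of "side Q" "corner Q"] side_pos[of Q]
  unfolding vol_def measure_def cube_eq by (simp add: less_imp_le)

lemma vol_pos: "vol Q > 0"
  unfolding vol_eq by (rule zero_less_power[OF side_pos])

lemma emeasure_cube: "emeasure lborel (cube Q) = ennreal (vol Q)"
  using box_halfopen_measure(1)[of "side Q" "corner Q"] side_pos[of Q] unfolding vol_eq cube_eq by (simp add: less_imp_le)

lemma vol_powr:
  fixes Q :: "'n::finite dyadic"
  shows "vol Q powr a = 2 powr (- of_int (fst Q) * (real CARD('n) * a))"
proof -
  have "side Q = 2 powr (- of_int (fst Q))"
    using powr_real_of_int'[of 2 "- fst Q"] by (simp add: side_def)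
  then have "vol Q = 2 powr (- of_int (fst Q) * real CARD('n))"
    unfolding vol_eq by (simp add: powr_realpow[symmetric] powr_powr)
  then show ?thesis by (simp add: powr_powr mult.assoc)
qed

lemma corner_eq: "corner (j, l) = (2 powi (- j)) *\<^sub>R ivec l"
  by (simp add: corner_def ivec_def)

lemma cube_unique:
  assumes "x \<in> cube Q" "x \<in> cube R" "fst Q = fst R" shows "Q = R"
proof -
  have s: "side Q = side R" using assms(3) by (simp add: side_def)
  have "snd Q $ i = snd R $ i" for i
  proof -
    have c: "corner Q $ i = side R * of_int (snd Q $ i)" "corner R $ i = side R * of_int (snd R $ i)"
      using assms(3) by (simp_all add: corner_def side_def)
    have "side R * of_int (snd Q $ i) < side R * (of_int (snd R $ i) + 1)" "side R * of_int (snd R $ i) < side R * (of_int (snd Q $ i) + 1)"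
      using assms(1)[unfolded mem_cube_iff, rule_format, of i] assms(2)[unfolded mem_cube_iff, rule_format, of i]
      unfolding c s by (simp_all add: distrib_left)
    then have "real_of_int (snd Q $ i) < of_int (snd R $ i) + 1" "real_of_int (snd R $ i) < of_int (snd Q $ i) + 1"
      using side_pos[of R] by simp_all
    then show ?thesis by linarith
  qed
  then show ?thesis using assms(3) by (simp add: prod_eq_iff vec_eq_iff)
qed

text \<open>Comparing volumes is enough; the nested structure of dyadic cubes does not
  enter.\<close>

lemma cube_subset_level:
  fixes Q P :: "'n::finite dyadic"
  assumes "cube Q \<subseteq> cube P" shows "fst P \<le> fst Q"
proof -
  have "emeasure lborel (cube Q) \<le> emeasure lborel (cube P)"
    using assms by (intro emeasure_mono) auto
  then have "vol Q \<le> vol P" unfolding emeasure_cube using vol_pos[of P] vol_pos[of Q] by (simp add: ennreal_le_iff)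
  then have "vol Q powr 1 \<le> vol P powr 1" using vol_pos[of Q] vol_pos[of P] by simp
  then have "- of_int (fst Q) * real CARD('n) \<le> - of_int (fst P) * real CARD('n)" unfolding vol_powr by simp
  then have "real_of_int (fst P) * real CARD('n) \<le> of_int (fst Q) * real CARD('n)" by simp
  then have "real_of_int (fst P) \<le> of_int (fst Q)" by (rule mult_right_le_imp_le) simp
  then show ?thesis by simp
qed

section \<open>Estimates at a dyadic level\<close>

lemma level_sampling:
  fixes \<phi> :: "real^'n::finite \<Rightarrow> complex"
  assumes \<phi>: "admissible \<phi>"
  obtains C where "C > 0" "\<And>f j D x. tame f \<Longrightarrow> (\<And>Q. fst Q = j \<Longrightarrow> norm (conv f (dilate j \<phi>) (corner Q)) \<le> D) \<Longrightarrow>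
     norm (conv f (dilate j \<phi>) x) \<le> C * D"
proof -
  obtain C where C: "C > 0" "\<forall>u D. tame u \<longrightarrow> (\<forall>l. norm (u (\<lambda>y. \<phi> (ivec l - y))) \<le> D) \<longrightarrow> (\<forall>x. norm (u (\<lambda>y. \<phi> (x - y))) \<le> C * D)"
    using sampling_bound[OF \<phi>] by blast
  have "norm (conv f (dilate j \<phi>) x) \<le> C * D"
    if f: "tame f" and D: "\<And>Q. fst Q = j \<Longrightarrow> norm (conv f (dilate j \<phi>) (corner Q)) \<le> D" for f j D x
  proof -
    have "norm (rescale j f (\<lambda>y. \<phi> (ivec l - y))) \<le> D" for l
      unfolding rescale_conv_0[OF f \<phi>] using D[of "(j, l)"] by (simp add: corner_eq)
    then have "norm (rescale j f (\<lambda>y. \<phi> ((2 powi j) *\<^sub>R x - y))) \<le> C * D"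
      using C(2)[rule_format, OF tame_rescale[OF f]] by blast
    then show ?thesis using conv_rescale[OF f \<phi>, of j 0 x] by (simp add: dilate_0)
  qed
  then show ?thesis using C(1) that by blast
qed

text \<open>Rescaling is by \<open>j + 1\<close>, since at unit scale the function \<psi> sits at
  scale -1; the scales -2, -1 and 0 of \<phi> then become \<open>j - 1\<close>, \<open>j\<close> and
  \<open>j + 1\<close>.\<close>

lemma level_change:
  fixes \<phi> \<psi> :: "real^'n::finite \<Rightarrow> complex"
  assumes \<phi>: "admissible \<phi>" and \<psi>: "admissible \<psi>"
  obtains C where "C > 0" "\<And>f j D x. tame f \<Longrightarrow> (\<And>k x. k \<in> {j-1,j,j+1} \<Longrightarrow> norm (conv f (dilate k \<phi>) x) \<le> D) \<Longrightarrow>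
     norm (conv f (dilate j \<psi>) x) \<le> C * D"
proof -
  obtain C where C: "C > 0" "\<forall>u D. tame u \<longrightarrow> (\<forall>k\<in>{-2,-1,0}. \<forall>x. norm (u (\<lambda>y. dilate k \<phi> (x - y))) \<le> D) \<longrightarrow>
    (\<forall>x. norm (u (\<lambda>y. dilate (-1) \<psi> (x - y))) \<le> C * D)"
    using change_of_test_function[OF \<phi> \<psi>] by blast
  have "norm (conv f (dilate j \<psi>) x) \<le> C * D"
    if f: "tame f" and D: "\<And>k x. k \<in> {j-1,j,j+1} \<Longrightarrow> norm (conv f (dilate k \<phi>) x) \<le> D" for f j D x
  proof -
    have "norm (rescale (j + 1) f (\<lambda>y. dilate k \<phi> (x - y))) \<le> D" if "k \<in> {-2,-1,0}" for k x
      unfolding rescale_conv[OF f \<phi>] by (rule D) (use that in auto)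
    then have "norm (rescale (j + 1) f (\<lambda>y. dilate (-1) \<psi> ((2 powi (j + 1)) *\<^sub>R x - y))) \<le> C * D"
      using C(2)[rule_format, OF tame_rescale[OF f], of "j + 1" D] by blast
    then show ?thesis using conv_rescale[OF f \<psi>, of "j + 1" "-1" x] by simp
  qed
  then show ?thesis using C(1) that by blast
qed

text \<open>Of the subcube only its measurability and its measure are retained, with
  \<open>v = \<delta>^n\<close>. This is all that an L^p norm sees, whatever p is.\<close>

lemma level_local_lower_bound:
  fixes \<phi> :: "real^'n::finite \<Rightarrow> complex"
  assumes \<phi>: "admissible \<phi>"
  obtains v where "v > 0" "\<And>f j D x. tame f \<Longrightarrow>
     (\<And>Q S c. fst Q = j \<Longrightarrow> S \<in> sets borel \<Longrightarrow> S \<subseteq> cube Q \<Longrightarrow> emeasure lborel S = ennreal (v * vol Q) \<Longrightarrow>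
       (\<And>x. x \<in> S \<Longrightarrow> c \<le> norm (conv f (dilate j \<phi>) x)) \<Longrightarrow> c \<le> D) \<Longrightarrow>
     norm (conv f (dilate j \<phi>) x) \<le> 4 * D"
proof -
  obtain \<delta> where \<delta>: "\<delta> > 0" "\<forall>u D. tame u \<longrightarrow>
    (\<forall>(k::int^'n) q c. (\<forall>i. of_int (k $ i) \<le> q $ i \<and> q $ i + \<delta> \<le> of_int (k $ i) + 1) \<longrightarrow>
       (\<forall>x. (\<forall>i. q $ i \<le> x $ i \<and> x $ i < q $ i + \<delta>) \<longrightarrow> c \<le> norm (u (\<lambda>y. \<phi> (x - y)))) \<longrightarrow> c \<le> D) \<longrightarrow>
    (\<forall>x. norm (u (\<lambda>y. \<phi> (x - y))) \<le> 4 * D)"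
    using local_lower_bound[OF \<phi>] by blast
  have main: "norm (conv f (dilate j \<phi>) x) \<le> 4 * D"
    if f: "tame f" and hyp: "\<And>Q S c. fst Q = j \<Longrightarrow> S \<in> sets borel \<Longrightarrow> S \<subseteq> cube Q \<Longrightarrow> emeasure lborel S = ennreal (\<delta> ^ CARD('n) * vol Q) \<Longrightarrow>
       (\<And>x. x \<in> S \<Longrightarrow> c \<le> norm (conv f (dilate j \<phi>) x)) \<Longrightarrow> c \<le> D" for f j D x
  proof -
    define a :: real where "a = 2 powi (- j)"
    have a: "a > 0" by (simp add: a_def)
    have "c \<le> D" if q: "\<forall>i. of_int (k $ i) \<le> q $ i \<and> q $ i + \<delta> \<le> of_int (k $ i) + 1"
      and c: "\<forall>x. (\<forall>i. q $ i \<le> x $ i \<and> x $ i < q $ i + \<delta>) \<longrightarrow> c \<le> norm (rescale j f (\<lambda>y. \<phi> (x - y)))" for k :: "int^'n" and q c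
    proof -
      define S where "S = {x::real^'n. \<forall>i. (a *\<^sub>R q) $ i \<le> x $ i \<and> x $ i < (a *\<^sub>R q) $ i + a * \<delta>}"
      have a\<delta>: "a * \<delta> \<ge> 0" using a \<delta> by simp
      show ?thesis
      proof (rule hyp[of "(j, k)" S])
        show "S \<in> sets borel" unfolding S_def by (rule box_halfopen_measure(2)[OF a\<delta>])
        have "emeasure lborel S = ennreal ((a * \<delta>) ^ CARD('n))" unfolding S_def by (rule box_halfopen_measure(1)[OF a\<delta>])
        then show "emeasure lborel S = ennreal (\<delta> ^ CARD('n) * vol (j, k))"
          by (simp add: vol_eq side_def a_def power_mult_distrib mult.commute)
        show "S \<subseteq> cube (j, k)"
        proof
          fix x assume x: "x \<in> S"
          show "x \<in> cube (j, k)" unfolding mem_cube_iff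
          proof
            fix i
            have "a * of_int (k $ i) \<le> a * q $ i" "a * (q $ i + \<delta>) \<le> a * (of_int (k $ i) + 1)"
              using q a by (auto intro!: mult_left_mono)
            moreover have "a * q $ i \<le> x $ i" "x $ i < a * q $ i + a * \<delta>" using x by (auto simp: S_def)
            ultimately show "corner (j, k) $ i \<le> x $ i \<and> x $ i < corner (j, k) $ i + side (j, k)"
              by (auto simp: corner_eq side_def a_def[symmetric] distrib_left)
          qed
        qed
        show "c \<le> norm (conv f (dilate j \<phi>) x)" if "x \<in> S" for x
        proof -
          have "\<forall>i. q $ i \<le> ((1 / a) *\<^sub>R x) $ i \<and> ((1 / a) *\<^sub>R x) $ i < q $ i + \<delta>"
            using that a unfolding S_def by (auto simp: field_simps)
          then have "c \<le> norm (rescale j f (\<lambda>y. \<phi> ((1 / a) *\<^sub>R x - y)))" using c by blast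
          then show ?thesis using a unfolding rescale_conv_0[OF f \<phi>] by (simp add: a_def[symmetric])
        qed
      qed simp
    qed
    then have "norm (rescale j f (\<lambda>y. \<phi> ((1 / a) *\<^sub>R x - y))) \<le> 4 * D"
      using \<delta>(2)[rule_format, OF tame_rescale[OF f], of j D] by blast
    then show ?thesis using a unfolding rescale_conv_0[OF f \<phi>] by (simp add: a_def[symmetric])
  qed
  show ?thesis by (rule that[of "\<delta> ^ CARD('n)"]) (use \<delta>(1) main in \<open>simp, blast\<close>)
qed

definition reflect :: "(real^'n::finite \<Rightarrow> complex) \<Rightarrow> real^'n \<Rightarrow> complex" where
  "reflect \<phi> x = \<phi> (- x)"

lemma admissible_reflect:
  fixes \<phi> :: "real^'n::finite \<Rightarrow> complex"
  assumes \<phi>: "admissible \<phi>" shows "admissible (reflect \<phi>)"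
proof -
  have F: "fourier (reflect \<phi>) \<xi> = fourier \<phi> (- \<xi>)" for \<xi>
    using fourier_affine[OF admissible_integrable[OF \<phi>], of "-1" 0 \<xi>] by (simp add: reflect_def[abs_def])
  have "reflect \<phi> \<in> schwartz"
    using schwartz_affine[OF admissible_schwartz[OF \<phi>], of "-1" 1 0] by (simp add: reflect_def[abs_def])
  moreover have "closure {\<xi>. fourier (reflect \<phi>) \<xi> \<noteq> 0} \<subseteq> {\<xi>. 1/2 \<le> norm \<xi> \<and> norm \<xi> \<le> 2}"
  proof (rule closure_minimal)
    show "{\<xi>. fourier (reflect \<phi>) \<xi> \<noteq> 0} \<subseteq> {\<xi>. 1/2 \<le> norm \<xi> \<and> norm \<xi> \<le> 2}"
    proof
      fix \<xi> assume "\<xi> \<in> {\<xi>. fourier (reflect \<phi>) \<xi> \<noteq> 0}"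
      then have "fourier \<phi> (- \<xi>) \<noteq> 0" by (simp add: F)
      from admissible_support[OF \<phi> this] show "\<xi> \<in> {\<xi>. 1/2 \<le> norm \<xi> \<and> norm \<xi> \<le> 2}" by simp
    qed
    have "closed ({\<xi>::real^'n. 1/2 \<le> norm \<xi>} \<inter> {\<xi>. norm \<xi> \<le> 2})"
      by (intro closed_Int closed_Collect_le continuous_intros)
    then show "closed {\<xi>::real^'n. 1/2 \<le> norm \<xi> \<and> norm \<xi> \<le> 2}" by (simp add: Collect_conj_eq)
  qed
  moreover have "\<exists>C>0. \<forall>\<xi>. 3/5 \<le> norm \<xi> \<and> norm \<xi> \<le> 5/3 \<longrightarrow> C \<le> norm (fourier (reflect \<phi>) \<xi>)"
  proof -
    obtain C where C: "C > 0" "\<forall>\<xi>. 3/5 \<le> norm \<xi> \<and> norm \<xi> \<le> 5/3 \<longrightarrow> C \<le> norm (fourier \<phi> \<xi>)"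
      using \<phi> unfolding admissible_def by blast
    have "C \<le> norm (fourier (reflect \<phi>) \<xi>)" if "3/5 \<le> norm \<xi> \<and> norm \<xi> \<le> 5/3" for \<xi>
      unfolding F using C(2)[rule_format, of "- \<xi>"] that by simp
    with C(1) show ?thesis by blast
  qed
  ultimately show ?thesis unfolding admissible_def by blast
qed

text \<open>\<open>phi_cube \<phi> Q\<close> is the square root of the volume times the dilate of
  the reflected function, translated to the corner of \<open>Q\<close>. The half powers of the
  volume cancel and |Q|^(-s/n) is left, which is 2^(js).\<close>

lemma phi_cube_conv:
  fixes \<phi> :: "real^'n::finite \<Rightarrow> complex"
  assumes f: "tame f" and \<phi>: "admissible \<phi>"
  shows "vol Q powr (- s / real CARD('n) - 1/2) * norm (f (phi_cube \<phi> Q))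
    = 2 powr (of_int (fst Q) * s) * norm (conv f (dilate (fst Q) (reflect \<phi>)) (corner Q))"
proof -
  define V where "V = vol Q"
  have V: "V > 0" by (simp add: V_def vol_pos)
  have Vinv: "2 powi (fst Q * int CARD('n)) = 1 / V"
    by (simp add: V_def vol_eq side_def power_int_mult power_int_minus power_one_over inverse_eq_divide)
  have "phi_cube \<phi> Q x = of_real (V powr (1/2)) * dilate (fst Q) (reflect \<phi>) (corner Q - x)" for x
  proof -
    have "(x - corner Q) /\<^sub>R side Q = - ((2 powi fst Q) *\<^sub>R (corner Q - x))"
      by (simp add: side_def power_int_minus scaleR_diff_right)
    moreover have "V powr (1/2 - 1) = V powr (1/2) / V powr 1" by (rule powr_diff)
    then have "V powr (-1/2) = V powr (1/2) * (1 / V)" using V by simp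
    ultimately show ?thesis
      unfolding phi_cube_def dilate_def Vinv reflect_def V_def[symmetric] by (simp only: of_real_mult mult.assoc)
  qed
  then have "phi_cube \<phi> Q = (\<lambda>x. of_real (V powr (1/2)) * dilate (fst Q) (reflect \<phi>) (corner Q - x))" by (rule ext)
  moreover have "(\<lambda>x. dilate (fst Q) (reflect \<phi>) (corner Q - x)) \<in> schwartz_inf"
    by (intro band_schwartz_inf band_reflect_translate admissible_dilate admissible_reflect \<phi>)
  ultimately have "f (phi_cube \<phi> Q) = of_real (V powr (1/2)) * conv f (dilate (fst Q) (reflect \<phi>)) (corner Q)"
    unfolding conv_def using tame_cmult[OF f] by simp
  then have "V powr (- s / real CARD('n) - 1/2) * norm (f (phi_cube \<phi> Q))
     = (V powr (- s / real CARD('n) - 1/2) * V powr (1/2)) * norm (conv f (dilate (fst Q) (reflect \<phi>)) (corner Q))"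
    by (simp add: norm_mult)
  also have "V powr (- s / real CARD('n) - 1/2) * V powr (1/2) = V powr (- s / real CARD('n))"
    using V by (simp add: powr_add[symmetric])
  also have "\<dots> = 2 powr (of_int (fst Q) * s)" unfolding V_def vol_powr by simp
  finally show ?thesis by (simp add: V_def)
qed

section \<open>Quasi-norms\<close>

lemma epowr_ennreal: "x \<ge> 0 \<Longrightarrow> epowr (ennreal x) a = ennreal (x powr a)"
  by (simp add: epowr_def)

lemma epowr_mono:
  assumes "x \<le> y" "a > 0" shows "epowr x a \<le> epowr y a"
proof (cases "y = \<infinity>")
  case False
  then have "y < \<infinity>" by (simp add: less_top)
  then have "x < \<infinity>" using assms(1) by (rule le_less_trans[rotated])
  then show ?thesis using False assms \<open>y < \<infinity>\<close>
    by (auto simp: epowr_def intro!: ennreal_leI powr_mono2 enn2real_mono)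
qed (simp add: epowr_def)

lemma epowr_epowr_inverse:
  assumes "a > 0" shows "epowr (epowr x a) (1 / a) = x"
proof (cases "x = \<infinity>")
  case True
  then show ?thesis by (simp add: epowr_def)
next
  case False
  then obtain r where "x = ennreal r" "r \<ge> 0" by (cases x) auto
  then show ?thesis using assms by (simp add: epowr_ennreal powr_powr)
qed

lemma infsum_ennreal_le:
  fixes f :: "'a \<Rightarrow> ennreal"
  assumes "\<And>F. finite F \<Longrightarrow> F \<subseteq> A \<Longrightarrow> sum f F \<le> b" shows "infsum f A \<le> b"
  by (rule infsum_le_finite_sums[OF nonneg_summable_on_complete assms]) simp_all

lemma infsum_ennreal_ge:
  fixes f :: "'a \<Rightarrow> ennreal"
  assumes "x \<in> A" shows "f x \<le> infsum f A"
proof -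
  have "infsum f A = (SUP F\<in>{F. finite F \<and> F \<subseteq> A}. sum f F)" by (rule nonneg_infsum_complete) simp
  moreover have "sum f {x} \<le> (SUP F\<in>{F. finite F \<and> F \<subseteq> A}. sum f F)" using assms by (intro SUP_upper) auto
  ultimately show ?thesis by simp
qed

lemma geometric_sum_int_le:
  fixes t :: real
  assumes "finite F" "F \<subseteq> {J..}" "t > 0"
  shows "(\<Sum>j\<in>F. 2 powr (- of_int j * t)) \<le> 2 powr (- of_int J * t) / (1 - 2 powr (- t))"
proof -
  define x :: real where "x = 2 powr (- t)"
  have x: "0 < x" "x < 1" using assms(3) by (auto simp: x_def powr_less_one)
  have inj: "inj_on (\<lambda>j. nat (j - J)) F"
  proof (rule inj_onI)
    fix i j assume "i \<in> F" "j \<in> F" "nat (i - J) = nat (j - J)"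
    moreover from this have "J \<le> i" "J \<le> j" using assms(2) by auto
    ultimately show "i = j" by (simp add: eq_nat_nat_iff)
  qed
  have "2 powr (- of_int j * t) = 2 powr (- of_int J * t) * x ^ nat (j - J)" if "j \<in> F" for j
  proof -
    have "x ^ nat (j - J) = 2 powr (- t * of_int (j - J))"
      using that assms(2) x by (auto simp: x_def powr_realpow[symmetric] powr_powr)
    then show ?thesis by (simp add: powr_add[symmetric] algebra_simps)
  qed
  then have "(\<Sum>j\<in>F. 2 powr (- of_int j * t)) = 2 powr (- of_int J * t) * (\<Sum>i\<in>(\<lambda>j. nat (j - J)) ` F. x ^ i)"
    by (simp add: sum.reindex[OF inj] sum_distrib_left)
  also have "(\<Sum>i\<in>(\<lambda>j. nat (j - J)) ` F. x ^ i) \<le> (\<Sum>i. x ^ i)"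
    using x assms(1) by (intro sum_le_suminf summable_geometric) auto
  also have "(\<Sum>i. x ^ i) = 1 / (1 - x)" using x by (intro suminf_geometric) auto
  finally show ?thesis by (simp add: x_def)
qed

text \<open>The assumption on \<tau> takes effect here. For t > 0 the levels form a geometric series
  governed by its first term, the level of the largest cube; for a supremum t >= 0 is
  enough.\<close>

lemma seq_norm_le:
  assumes q: "q > 0" and t: "t \<ge> 0" and qt: "q = \<infinity> \<or> t > 0"
  shows "\<exists>C>0. \<forall>M\<ge>0. \<forall>J a. (\<forall>j\<ge>J. a j \<le> ennreal (M * 2 powr (- of_int j * t))) \<longrightarrow>
    seq_norm q {J..} a \<le> ennreal (C * M * 2 powr (- of_int J * t))"
proof (cases "q = \<infinity>")
  case True
  have "seq_norm q {J..} a \<le> ennreal (1 * M * 2 powr (- of_int J * t))"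
    if M: "M \<ge> 0" and a: "\<forall>j\<ge>J. a j \<le> ennreal (M * 2 powr (- of_int j * t))" for M J a
  proof -
    have "a j \<le> ennreal (1 * M * 2 powr (- of_int J * t))" if "j \<in> {J..}" for j
    proof -
      have "2 powr (- of_int j * t) \<le> 2 powr (- of_int J * t)" using that t by (simp add: mult_right_mono)
      then have "ennreal (M * 2 powr (- of_int j * t)) \<le> ennreal (1 * M * 2 powr (- of_int J * t))"
        using M by (intro ennreal_leI) (simp add: mult_left_mono)
      with a that show ?thesis by (auto intro: order.trans)
    qed
    then show ?thesis unfolding seq_norm_def using True by (simp add: SUP_le_iff)
  qed
  then show ?thesis by (intro exI[of _ 1]) auto
next
  case False
  define r where "r = enn2real q"
  have r: "r > 0" using q False by (auto simp: r_def enn2real_positive_iff less_top)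
  have t: "t > 0" using False qt by simp
  define K where "K = 1 / (1 - 2 powr (- (t * r)))"
  have "2 powr (- (t * r)) < 1" using t r by (simp add: powr_less_one)
  then have K: "K > 0" by (simp add: K_def)
  have "seq_norm q {J..} a \<le> ennreal (K powr (1 / r) * M * 2 powr (- of_int J * t))"
    if M: "M \<ge> 0" and a: "\<forall>j\<ge>J. a j \<le> ennreal (M * 2 powr (- of_int j * t))" for M J a
  proof -
    have "(\<Sum>\<^sub>\<infinity>j\<in>{J..}. epowr (a j) r) \<le> ennreal (M powr r * (2 powr (- of_int J * (t * r)) * K))"
    proof (rule infsum_ennreal_le)
      fix F assume F: "finite F" "F \<subseteq> {J..}"
      have "(\<Sum>j\<in>F. epowr (a j) r) \<le> (\<Sum>j\<in>F. ennreal (M powr r * 2 powr (- of_int j * (t * r))))"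
      proof (rule sum_mono)
        fix j assume "j \<in> F"
        then have "epowr (a j) r \<le> epowr (ennreal (M * 2 powr (- of_int j * t))) r"
          using a F r by (intro epowr_mono) auto
        also have "\<dots> = ennreal (M powr r * 2 powr (- of_int j * (t * r)))"
          using M by (subst epowr_ennreal) (simp_all add: powr_mult powr_powr mult.assoc)
        finally show "epowr (a j) r \<le> ennreal (M powr r * 2 powr (- of_int j * (t * r)))" .
      qed
      also have "\<dots> = ennreal (M powr r * (\<Sum>j\<in>F. 2 powr (- of_int j * (t * r))))"
        by (subst sum_ennreal) (auto simp: sum_distrib_left)
      also have "\<dots> \<le> ennreal (M powr r * (2 powr (- of_int J * (t * r)) * K))"
        using geometric_sum_int_le[OF F, of "t * r"] t r by (intro ennreal_leI mult_left_mono) (auto simp: K_def)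
      finally show "(\<Sum>j\<in>F. epowr (a j) r) \<le> ennreal (M powr r * (2 powr (- of_int J * (t * r)) * K))" .
    qed
    then have "seq_norm q {J..} a \<le> epowr (ennreal (M powr r * (2 powr (- of_int J * (t * r)) * K))) (1 / r)"
      unfolding seq_norm_def r_def[symmetric] using False r by (auto intro: epowr_mono)
    also have "\<dots> = ennreal (K powr (1 / r) * M * 2 powr (- of_int J * t))"
    proof -
      have "(M powr r * (2 powr (- of_int J * (t * r)) * K)) powr (1 / r)
        = (M powr r) powr (1 / r) * ((2 powr (- of_int J * (t * r))) powr (1 / r) * K powr (1 / r))"
        using K by (simp add: powr_mult)
      also have "(M powr r) powr (1 / r) = M" using M r by (simp add: powr_powr)
      also have "(2 powr (- of_int J * (t * r))) powr (1 / r) = 2 powr (- of_int J * t)" using r by (simp add: powr_powr)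
      finally show ?thesis using K by (subst epowr_ennreal) (simp_all add: mult_ac)
    qed
    finally show ?thesis .
  qed
  moreover have "K powr (1 / r) > 0" using K by simp
  ultimately show ?thesis by blast
qed

lemma seq_norm_ge:
  assumes "q > 0" "j \<in> A" shows "a j \<le> seq_norm q A a"
proof (cases "q = \<infinity>")
  case True
  then show ?thesis unfolding seq_norm_def using assms(2) by (simp add: SUP_upper)
next
  case False
  then have r: "enn2real q > 0" using assms(1) by (auto simp: enn2real_positive_iff less_top)
  have "a j = epowr (epowr (a j) (enn2real q)) (1 / enn2real q)" using r by (simp add: epowr_epowr_inverse)
  also have "\<dots> \<le> epowr (\<Sum>\<^sub>\<infinity>j\<in>A. epowr (a j) (enn2real q)) (1 / enn2real q)"
    using r infsum_ennreal_ge[OF assms(2)] by (intro epowr_mono) auto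
  finally show ?thesis unfolding seq_norm_def using False by simp
qed

lemma enn2real_inverse:
  fixes p :: ennreal
  assumes "p > 0" "p \<noteq> \<infinity>" shows "enn2real (1 / p) = 1 / enn2real p" "enn2real p > 0"
proof -
  obtain r where r: "p = ennreal r" "r \<ge> 0" using assms(2) by (cases p) auto
  with assms have "r > 0" by (simp add: order_less_le)
  then have "1 / p = ennreal (1 / r)" using r by (simp add: divide_ennreal flip: ennreal_1)
  then show "enn2real (1 / p) = 1 / enn2real p" "enn2real p > 0" using r \<open>r > 0\<close> by simp_all
qed

text \<open>The integral is monotone for arbitrary functions, whereas \<open>esssup\<close> takes
  the value \<open>top\<close> on a nonmeasurable one. Measurability is therefore demanded exactly
  when \<open>p = \<infinity>\<close>.\<close>

lemma lebesgue_norm_le: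
  fixes g :: "'a::euclidean_space \<Rightarrow> ennreal"
  assumes p: "p > 0" and g: "p = \<infinity> \<Longrightarrow> g \<in> borel_measurable borel" and [measurable]: "A \<in> sets borel"
    and A: "emeasure lborel A = ennreal v" "v > 0" and V: "V \<ge> 0" "\<And>x. x \<in> A \<Longrightarrow> g x \<le> ennreal V"
  shows "lebesgue_norm p A g \<le> ennreal (V * v powr enn2real (1 / p))"
proof (cases "p = \<infinity>")
  case True
  have "esssup (restrict_space lborel A) g \<le> ennreal V"
  proof (rule esssup_I)
    show "g \<in> borel_measurable (restrict_space lborel A)" using g[OF True] by (intro measurable_restrict_space1) simp
    show "AE x in restrict_space lborel A. g x \<le> ennreal V" by (rule AE_I2) (use V in \<open>auto simp: space_restrict_space\<close>)
  qed
  then show ?thesis unfolding lebesgue_norm_def using True A by simp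
next
  case False
  define r where "r = enn2real p"
  note r = enn2real_inverse[OF p False, folded r_def]
  have "(\<integral>\<^sup>+x\<in>A. epowr (g x) r \<partial>lborel) \<le> (\<integral>\<^sup>+x\<in>A. ennreal (V powr r) \<partial>lborel)"
  proof (rule nn_integral_mono)
    fix x
    show "epowr (g x) r * indicator A x \<le> ennreal (V powr r) * indicator A x"
    proof (cases "x \<in> A")
      case True
      then have "epowr (g x) r \<le> epowr (ennreal V) r" using V r by (intro epowr_mono)
      then show ?thesis using V by (simp add: epowr_ennreal mult_right_mono)
    qed simp
  qed
  also have "\<dots> = ennreal (V powr r * v)" using A by (subst nn_integral_cmult_indicator) (simp_all add: ennreal_mult)
  finally have "lebesgue_norm p A g \<le> epowr (ennreal (V powr r * v)) (1 / r)"
    unfolding lebesgue_norm_def r_def[symmetric] using False r by (auto intro: epowr_mono)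
  also have "\<dots> = ennreal (V * v powr enn2real (1 / p))"
    using A V r by (subst epowr_ennreal) (simp_all add: powr_mult powr_powr)
  finally show ?thesis .
qed

lemma lebesgue_norm_ge:
  fixes g :: "'a::euclidean_space \<Rightarrow> ennreal"
  assumes p: "p > 0" and [measurable]: "A \<in> sets borel" "S \<in> sets borel" and S: "S \<subseteq> A" "emeasure lborel S = ennreal v" "v > 0"
    and c: "c \<ge> 0" "\<And>x. x \<in> S \<Longrightarrow> ennreal c \<le> g x"
  shows "ennreal (c * v powr enn2real (1 / p)) \<le> lebesgue_norm p A g"
proof (cases "p = \<infinity>")
  case True
  \<comment> \<open>Otherwise \<open>g\<close> would lie below \<open>c\<close> almost everywhere on
    \<open>A\<close>, and \<open>S\<close> would be a null set.\<close>
  have "ennreal c \<le> esssup (restrict_space lborel A) g"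
  proof (rule ccontr)
    assume "\<not> ennreal c \<le> esssup (restrict_space lborel A) g"
    then have lt: "esssup (restrict_space lborel A) g < ennreal c" by simp
    have "AE x in restrict_space lborel A. g x < ennreal c"
      using esssup_AE[of g "restrict_space lborel A"] by eventually_elim (use lt in auto)
    then have "AE x in lborel. x \<in> A \<longrightarrow> g x < ennreal c" by (subst (asm) AE_restrict_space_iff) auto
    then have "AE x in lborel. x \<notin> S" by eventually_elim (use S c(2) in \<open>auto simp: not_less[symmetric]\<close>)
    then have "emeasure lborel S = 0" by (subst (asm) AE_iff_measurable[OF _ refl]) auto
    then show False using S by simp
  qed
  then show ?thesis unfolding lebesgue_norm_def using True S by simp
next
  case False
  define r where "r = enn2real p"
  note r = enn2real_inverse[OF p False, folded r_def]
  have "ennreal (c powr r * v) = (\<integral>\<^sup>+x\<in>S. ennreal (c powr r) \<partial>lborel)"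
    using S by (subst nn_integral_cmult_indicator) (simp_all add: ennreal_mult)
  also have "\<dots> \<le> (\<integral>\<^sup>+x\<in>A. epowr (g x) r \<partial>lborel)"
  proof (rule nn_integral_mono)
    fix x
    show "ennreal (c powr r) * indicator S x \<le> epowr (g x) r * indicator A x"
    proof (cases "x \<in> S")
      case True
      then have "epowr (ennreal c) r \<le> epowr (g x) r" using c r by (intro epowr_mono)
      then show ?thesis using c True S by (auto simp: epowr_ennreal)
    qed simp
  qed
  finally have "epowr (ennreal (c powr r * v)) (1 / r) \<le> lebesgue_norm p A g"
    unfolding lebesgue_norm_def r_def[symmetric] using False r by (auto intro: epowr_mono)
  moreover have "epowr (ennreal (c powr r * v)) (1 / r) = ennreal (c * v powr enn2real (1 / p))"
    using S c r by (subst epowr_ennreal) (simp_all add: powr_mult powr_powr)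
  ultimately show ?thesis by simp
qed

text \<open>Comparing with real bounds \<open>M\<close> keeps the estimates in the reals. An
  infinite norm satisfies the inequality trivially, as a positive constant times infinity is
  infinite.\<close>

lemma same_space_equiv_normsI:
  assumes "C1 > 0" "\<And>f M. f \<in> schwartz_inf_dual \<Longrightarrow> M \<ge> 0 \<Longrightarrow> N f \<le> ennreal M \<Longrightarrow> N' f \<le> ennreal (C1 * M)"
    and "C2 > 0" "\<And>f M. f \<in> schwartz_inf_dual \<Longrightarrow> M \<ge> 0 \<Longrightarrow> N' f \<le> ennreal M \<Longrightarrow> N f \<le> ennreal (C2 * M)"
  shows "same_space_equiv_norms N N'"
proof -
  have 1: "N' f \<le> ennreal C1 * N f" if f: "f \<in> schwartz_inf_dual" for f
  proof (cases "N f")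
    case (real r)
    then show ?thesis using assms(2)[OF f, of r] assms(1) by (simp add: ennreal_mult)
  qed (use assms(1) in \<open>simp add: ennreal_mult_top\<close>)
  have 2: "N f \<le> ennreal C2 * N' f" if f: "f \<in> schwartz_inf_dual" for f
  proof (cases "N' f")
    case (real r)
    then show ?thesis using assms(4)[OF f, of r] assms(3) by (simp add: ennreal_mult)
  qed (use assms(3) in \<open>simp add: ennreal_mult_top\<close>)
  define C where "C = max C1 C2"
  have C: "C > 0" using assms by (simp add: C_def)
  have le: "ennreal C1 * x \<le> ennreal C * x" "ennreal C2 * x \<le> ennreal C * x" for x
    by (intro mult_right_mono ennreal_leI; simp add: C_def)+
  have "N f < \<infinity> \<longleftrightarrow> N' f < \<infinity>" if f: "f \<in> schwartz_inf_dual" for f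
    using 1[OF f] 2[OF f] by (auto simp: ennreal_mult_less_top intro: le_less_trans)
  then have "finite_norm_space N = finite_norm_space N'" unfolding finite_norm_space_def by blast
  moreover have "\<forall>f\<in>finite_norm_space N. N' f \<le> ennreal C * N f \<and> N f \<le> ennreal C * N' f"
    using 1 2 le unfolding finite_norm_space_def by (blast intro: order.trans)
  ultimately show ?thesis unfolding same_space_equiv_norms_def using C by blast
qed

section \<open>Comparison of the quasi-norms with the supremum norm\<close>

definition level_bound :: "(real^'n::finite \<Rightarrow> complex) \<Rightarrow> real \<Rightarrow> ((real^'n \<Rightarrow> complex) \<Rightarrow> complex) \<Rightarrow> real \<Rightarrow> bool" where
  "level_bound \<phi> \<sigma> f M \<longleftrightarrow> (\<forall>j x. norm (conv f (dilate j \<phi>) x) \<le> M * 2 powr (- of_int j * \<sigma>))"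

lemma AE_le_imp_le:
  fixes h :: "real^'n::finite \<Rightarrow> real"
  assumes cont: "continuous_on UNIV h" and ae: "AE x in lborel. h x \<le> c"
  shows "h x \<le> c"
proof (rule ccontr)
  assume "\<not> h x \<le> c"
  then have "x \<in> {x. c < h x}" by simp
  moreover have "open {x. c < h x}" by (intro open_Collect_less cont continuous_intros)
  ultimately obtain e where e: "e > 0" "ball x e \<subseteq> {x. c < h x}" using open_contains_ball by blast
  define s where "s = e / (2 * real CARD('n))"
  have s: "s > 0" "real CARD('n) * s < e" using e(1) by (auto simp: s_def)
  define A where "A = {y::real^'n. \<forall>i. x $ i \<le> y $ i \<and> y $ i < x $ i + s}"
  have A: "A \<in> sets borel" "emeasure lborel A = ennreal (s ^ CARD('n))"
    unfolding A_def using box_halfopen_measure[of s x] s by simp_all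
  have sub: "A \<subseteq> ball x e"
  proof
    fix y assume y: "y \<in> A"
    have "\<bar>(y - x) $ i\<bar> \<le> s" for i
      using y[unfolded A_def, simplified, rule_format, of i] s(1) by (simp add: abs_le_iff)
    then have "norm (y - x) \<le> real CARD('n) * s" by (rule norm_le_card)
    then show "y \<in> ball x e" using s by (simp add: dist_norm norm_minus_commute)
  qed
  have "AE y in lborel. y \<notin> A" using ae by eventually_elim (use e sub in force)
  then have "emeasure lborel A = 0" using A by (subst (asm) AE_iff_measurable[OF _ refl]) auto
  then show False using A(2) s(1) by simp
qed

text \<open>The convolutions are continuous, so an almost everywhere bound holds at every point.
  This lets all further estimates work with the pointwise and real-valued
  \<open>level_bound\<close>.\<close>

lemma classical_norm_iff:
  fixes f :: "(real^'n::finite \<Rightarrow> complex) \<Rightarrow> complex"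
  assumes \<phi>: "admissible \<phi>" and f: "tame f" and M: "M \<ge> 0"
  shows "classical_inf_norm \<phi> \<sigma> f \<le> ennreal M \<longleftrightarrow> level_bound \<phi> \<sigma> f M"
proof
  assume le: "classical_inf_norm \<phi> \<sigma> f \<le> ennreal M"
  show "level_bound \<phi> \<sigma> f M" unfolding level_bound_def
  proof (intro allI)
    fix j x
    let ?g = "\<lambda>x. norm (conv f (dilate j \<phi>) x)"
    have 1: "ennreal (2 powr (of_int j * \<sigma>)) * esssup lborel (\<lambda>x. ennreal (?g x)) \<le> ennreal M"
      using le unfolding classical_inf_norm_def by (simp add: SUP_le_iff)
    have "AE x in lborel. ?g x \<le> M * 2 powr (- of_int j * \<sigma>)"
      using esssup_AE[of "\<lambda>x. ennreal (?g x)" lborel]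
    proof eventually_elim
      case (elim x)
      have "ennreal (2 powr (of_int j * \<sigma>)) * ennreal (?g x) \<le> ennreal M"
        by (rule order.trans[OF mult_left_mono[OF elim] 1]) simp
      then have "2 powr (of_int j * \<sigma>) * ?g x \<le> M" using M by (simp add: ennreal_mult[symmetric])
      then have "?g x \<le> M / 2 powr (of_int j * \<sigma>)" by (simp add: pos_le_divide_eq mult.commute)
      then show ?case by (simp add: powr_minus_divide)
    qed
    then show "?g x \<le> M * 2 powr (- of_int j * \<sigma>)"
      by (intro AE_le_imp_le continuous_intros conv_continuous f \<phi>)
  qed
next
  assume lb: "level_bound \<phi> \<sigma> f M"
  show "classical_inf_norm \<phi> \<sigma> f \<le> ennreal M" unfolding classical_inf_norm_def
  proof (rule SUP_least)
    fix j :: int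
    have [measurable]: "conv f (dilate j \<phi>) \<in> borel_measurable borel"
      by (rule borel_measurable_continuous_onI[OF conv_continuous[OF f \<phi>]])
    have "esssup lborel (\<lambda>x. ennreal (norm (conv f (dilate j \<phi>) x))) \<le> ennreal (M * 2 powr (- of_int j * \<sigma>))"
      by (intro esssup_I AE_I2 ennreal_leI lb[unfolded level_bound_def, rule_format]) measurable
    then have "ennreal (2 powr (of_int j * \<sigma>)) * esssup lborel (\<lambda>x. ennreal (norm (conv f (dilate j \<phi>) x)))
      \<le> ennreal (2 powr (of_int j * \<sigma>)) * ennreal (M * 2 powr (- of_int j * \<sigma>))"
      by (intro mult_left_mono) auto
    also have "\<dots> = ennreal (2 powr (of_int j * \<sigma>) * 2 powr (- of_int j * \<sigma>) * M)"
      using M by (simp add: ennreal_mult[symmetric] mult_ac)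
    also have "2 powr (of_int j * \<sigma>) * 2 powr (- of_int j * \<sigma>) = 1" by (simp add: powr_add[symmetric])
    finally show "ennreal (2 powr (of_int j * \<sigma>)) * esssup lborel (\<lambda>x. ennreal (norm (conv f (dilate j \<phi>) x))) \<le> ennreal M" by simp
  qed
qed

lemma inverse_vol_powr: "1 / vol P powr a = vol P powr (- a)"
  by (simp add: powr_minus_divide)

text \<open>At every point the terms of level \<open>j\<close> are at most a multiple of 2^(-jt)
  with t = n(\<tau> - 1/p), so the sequence norm is bounded by a constant on \<open>P\<close>. The
  L^p norm of that constant contributes |P|^(1/p), and all powers of |P| cancel.\<close>

lemma triebel_lizorkin_le:
  fixes \<phi> :: "real^'n::finite \<Rightarrow> complex" and s \<tau> :: real
  assumes \<phi>: "admissible \<phi>" and p: "0 < p" "p \<noteq> \<infinity>" and q: "0 < q"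
    and \<tau>: "(q \<noteq> \<infinity> \<and> enn2real (1 / p) < \<tau>) \<or> (q = \<infinity> \<and> enn2real (1 / p) \<le> \<tau>)"
  defines "\<sigma> \<equiv> s + real CARD('n) * (\<tau> - enn2real (1 / p))"
  shows "\<exists>C>0. \<forall>f M. M \<ge> 0 \<longrightarrow> level_bound \<phi> \<sigma> f M \<longrightarrow> triebel_lizorkin_norm \<phi> s \<tau> p q f \<le> ennreal (C * M)"
proof -
  define a where "a = enn2real (1 / p)"
  define t where "t = real CARD('n) * (\<tau> - a)"
  have t: "t \<ge> 0" "q = \<infinity> \<or> t > 0" using \<tau> by (auto simp: t_def a_def)
  obtain C where C: "C > 0" "\<forall>M\<ge>0. \<forall>J a. (\<forall>j\<ge>J. a j \<le> ennreal (M * 2 powr (- of_int j * t))) \<longrightarrow>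
    seq_norm q {J..} a \<le> ennreal (C * M * 2 powr (- of_int J * t))"
    using seq_norm_le[OF q t] by blast
  have "triebel_lizorkin_norm \<phi> s \<tau> p q f \<le> ennreal (C * M)" if M: "M \<ge> 0" and lb: "level_bound \<phi> \<sigma> f M" for f M
    unfolding triebel_lizorkin_norm_def
  proof (rule SUP_least)
    fix P :: "'n dyadic"
    let ?V = "C * M * 2 powr (- of_int (fst P) * t)"
    have V: "?V \<ge> 0" using C M by simp
    have "seq_norm q {fst P..} (\<lambda>j. ennreal (2 powr (of_int j * s) * norm (conv f (dilate j \<phi>) x))) \<le> ennreal ?V" for x
    proof (rule C(2)[rule_format, OF M])
      fix j :: int
      have "2 powr (of_int j * s) * norm (conv f (dilate j \<phi>) x) \<le> 2 powr (of_int j * s) * (M * 2 powr (- of_int j * \<sigma>))"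
        using lb unfolding level_bound_def by (intro mult_left_mono) auto
      also have "\<dots> = M * (2 powr (of_int j * s) * 2 powr (- of_int j * \<sigma>))" by simp
      also have "2 powr (of_int j * s) * 2 powr (- of_int j * \<sigma>) = 2 powr (- of_int j * t)"
        by (simp add: powr_add[symmetric] \<sigma>_def t_def a_def algebra_simps)
      finally show "ennreal (2 powr (of_int j * s) * norm (conv f (dilate j \<phi>) x)) \<le> ennreal (M * 2 powr (- of_int j * t))"
        by (rule ennreal_leI)
    qed
    then have "lebesgue_norm p (cube P) (\<lambda>x. seq_norm q {fst P..} (\<lambda>j. ennreal (2 powr (of_int j * s) * norm (conv f (dilate j \<phi>) x))))
      \<le> ennreal (?V * vol P powr a)"
      unfolding a_def using p by (intro lebesgue_norm_le emeasure_cube vol_pos V cube_borel) auto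
    then have "ennreal (1 / vol P powr \<tau>) * lebesgue_norm p (cube P) (\<lambda>x. seq_norm q {fst P..} (\<lambda>j. ennreal (2 powr (of_int j * s) * norm (conv f (dilate j \<phi>) x))))
      \<le> ennreal (1 / vol P powr \<tau>) * ennreal (?V * vol P powr a)"
      by (intro mult_left_mono) auto
    also have "\<dots> = ennreal ((vol P powr (- \<tau>) * vol P powr a * 2 powr (- of_int (fst P) * t)) * (C * M))"
      unfolding inverse_vol_powr using C M by (simp add: ennreal_mult[symmetric] mult_ac)
    also have "vol P powr (- \<tau>) * vol P powr a * 2 powr (- of_int (fst P) * t) = 1"
      unfolding vol_powr by (simp add: powr_add[symmetric] t_def algebra_simps)
    finally show "ennreal (1 / vol P powr \<tau>) * lebesgue_norm p (cube P) (\<lambda>x. seq_norm q {fst P..} (\<lambda>j. ennreal (2 powr (of_int j * s) * norm (conv f (dilate j \<phi>) x))))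
      \<le> ennreal (C * M)" by simp
  qed
  with C(1) show ?thesis by blast
qed

text \<open>The L^p norm is innermost here and \<open>p = \<infinity>\<close> is allowed; tameness
  supplies the measurability that \<open>esssup\<close> demands. Each level carries the same factor
  |P|^(1/p), which is taken out of the sequence norm.\<close>

lemma besov_le:
  fixes \<phi> :: "real^'n::finite \<Rightarrow> complex" and s \<tau> :: real
  assumes \<phi>: "admissible \<phi>" and p: "0 < p" and q: "0 < q"
    and \<tau>: "(q \<noteq> \<infinity> \<and> enn2real (1 / p) < \<tau>) \<or> (q = \<infinity> \<and> enn2real (1 / p) \<le> \<tau>)"
  defines "\<sigma> \<equiv> s + real CARD('n) * (\<tau> - enn2real (1 / p))"
  shows "\<exists>C>0. \<forall>f M. tame f \<longrightarrow> M \<ge> 0 \<longrightarrow> level_bound \<phi> \<sigma> f M \<longrightarrow> besov_norm \<phi> s \<tau> p q f \<le> ennreal (C * M)"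
proof -
  define a where "a = enn2real (1 / p)"
  define t where "t = real CARD('n) * (\<tau> - a)"
  have t: "t \<ge> 0" "q = \<infinity> \<or> t > 0" using \<tau> by (auto simp: t_def a_def)
  obtain C where C: "C > 0" "\<forall>M\<ge>0. \<forall>J a. (\<forall>j\<ge>J. a j \<le> ennreal (M * 2 powr (- of_int j * t))) \<longrightarrow>
    seq_norm q {J..} a \<le> ennreal (C * M * 2 powr (- of_int J * t))"
    using seq_norm_le[OF q t] by blast
  have "besov_norm \<phi> s \<tau> p q f \<le> ennreal (C * M)" if f: "tame f" and M: "M \<ge> 0" and lb: "level_bound \<phi> \<sigma> f M" for f M
    unfolding besov_norm_def
  proof (rule SUP_least)
    fix P :: "'n dyadic"
    have Mv: "M * vol P powr a \<ge> 0" using M by simp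
    have "seq_norm q {fst P..} (\<lambda>j. ennreal (2 powr (of_int j * s)) * lebesgue_norm p (cube P) (\<lambda>x. ennreal (norm (conv f (dilate j \<phi>) x))))
      \<le> ennreal (C * (M * vol P powr a) * 2 powr (- of_int (fst P) * t))"
    proof (rule C(2)[rule_format, OF Mv])
      fix j :: int
      have [measurable]: "conv f (dilate j \<phi>) \<in> borel_measurable borel"
        by (rule borel_measurable_continuous_onI[OF conv_continuous[OF f \<phi>]])
      have "lebesgue_norm p (cube P) (\<lambda>x. ennreal (norm (conv f (dilate j \<phi>) x))) \<le> ennreal (M * 2 powr (- of_int j * \<sigma>) * vol P powr a)"
        unfolding a_def using lb M
        by (intro lebesgue_norm_le emeasure_cube vol_pos p cube_borel) (auto simp: level_bound_def intro!: ennreal_leI)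
      then have "ennreal (2 powr (of_int j * s)) * lebesgue_norm p (cube P) (\<lambda>x. ennreal (norm (conv f (dilate j \<phi>) x)))
        \<le> ennreal (2 powr (of_int j * s)) * ennreal (M * 2 powr (- of_int j * \<sigma>) * vol P powr a)" by (intro mult_left_mono) auto
      also have "\<dots> = ennreal (M * vol P powr a * (2 powr (of_int j * s) * 2 powr (- of_int j * \<sigma>)))"
        using M by (simp add: ennreal_mult[symmetric] mult_ac)
      also have "2 powr (of_int j * s) * 2 powr (- of_int j * \<sigma>) = 2 powr (- of_int j * t)"
        by (simp add: powr_add[symmetric] \<sigma>_def t_def a_def algebra_simps)
      finally show "ennreal (2 powr (of_int j * s)) * lebesgue_norm p (cube P) (\<lambda>x. ennreal (norm (conv f (dilate j \<phi>) x)))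
        \<le> ennreal (M * vol P powr a * 2 powr (- of_int j * t))" .
    qed
    then have "ennreal (1 / vol P powr \<tau>) * seq_norm q {fst P..} (\<lambda>j. ennreal (2 powr (of_int j * s)) * lebesgue_norm p (cube P) (\<lambda>x. ennreal (norm (conv f (dilate j \<phi>) x))))
      \<le> ennreal (1 / vol P powr \<tau>) * ennreal (C * (M * vol P powr a) * 2 powr (- of_int (fst P) * t))"
      by (intro mult_left_mono) auto
    also have "\<dots> = ennreal ((vol P powr (- \<tau>) * vol P powr a * 2 powr (- of_int (fst P) * t)) * (C * M))"
      unfolding inverse_vol_powr using C M by (simp add: ennreal_mult[symmetric] mult_ac)
    also have "vol P powr (- \<tau>) * vol P powr a * 2 powr (- of_int (fst P) * t) = 1"
      unfolding vol_powr by (simp add: powr_add[symmetric] t_def algebra_simps)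
    finally show "ennreal (1 / vol P powr \<tau>) * seq_norm q {fst P..} (\<lambda>j. ennreal (2 powr (of_int j * s)) * lebesgue_norm p (cube P) (\<lambda>x. ennreal (norm (conv f (dilate j \<phi>) x))))
      \<le> ennreal (C * M)" by simp
  qed
  with C(1) show ?thesis by blast
qed

text \<open>Both norms control \<open>2\<^sup>j\<^sup>s |\<phi>\<^sub>j * f|\<close> in \<open>L\<^sup>p\<close> of every dyadic cube of level \<open>j\<close>, which is all that is needed
  for the converse estimates.\<close>

definition controls_cubes :: "(real^'n::finite \<Rightarrow> complex) \<Rightarrow> real \<Rightarrow> real \<Rightarrow> ennreal \<Rightarrow>
    ((real^'n \<Rightarrow> complex) \<Rightarrow> complex) \<Rightarrow> ennreal \<Rightarrow> bool" where
  "controls_cubes \<phi> s \<tau> p f M \<longleftrightarrow> (\<forall>P S c. S \<in> sets borel \<longrightarrow> S \<subseteq> cube P \<longrightarrow> emeasure lborel S > 0 \<longrightarrow> c \<ge> 0 \<longrightarrow>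
     (\<forall>x\<in>S. c \<le> norm (conv f (dilate (fst P) \<phi>) x)) \<longrightarrow>
     ennreal (vol P powr (- \<tau>) * 2 powr (of_int (fst P) * s) * c * measure lborel S powr enn2real (1 / p)) \<le> M)"

text \<open>The Plancherel-Polya bound reduces the claim to constants \<open>c\<close> that are
  lower bounds on a set \<open>S\<close> filling the fraction \<open>v\<close> of a cube
  \<open>Q\<close>. For these the hypothesis is a scalar inequality, in which the powers of |Q|
  combine to 2^(j\<sigma>).\<close>

lemma level_bound_of_cube_norms:
  fixes \<phi> :: "real^'n::finite \<Rightarrow> complex" and s \<tau> :: real
  assumes \<phi>: "admissible \<phi>" and p: "0 < p"
  defines "\<sigma> \<equiv> s + real CARD('n) * (\<tau> - enn2real (1 / p))"
  shows "\<exists>C>0. \<forall>f M. tame f \<longrightarrow> M \<ge> 0 \<longrightarrow> controls_cubes \<phi> s \<tau> p f (ennreal M) \<longrightarrow>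
     level_bound \<phi> \<sigma> f (C * M)"
proof -
  define a where "a = enn2real (1 / p)"
  obtain v where v: "v > 0" "\<And>f j D x. tame f \<Longrightarrow>
     (\<And>Q S c. fst Q = j \<Longrightarrow> S \<in> sets borel \<Longrightarrow> S \<subseteq> cube Q \<Longrightarrow> emeasure lborel S = ennreal (v * vol Q) \<Longrightarrow>
       (\<And>x. x \<in> S \<Longrightarrow> c \<le> norm (conv f (dilate j \<phi>) x)) \<Longrightarrow> c \<le> D) \<Longrightarrow>
     norm (conv f (dilate j \<phi>) x) \<le> 4 * D"
    using level_local_lower_bound[OF \<phi>] by metis
  \<comment> \<open>The price of integrating over \<open>S\<close> only instead of the whole cube;
    it equals 1 for \<open>p = \<infinity>\<close>.\<close>
  define K where "K = v powr (- a)"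
  have K: "K > 0" using v(1) by (simp add: K_def)
  have "level_bound \<phi> \<sigma> f (4 * K * M)"
    if f: "tame f" and M: "M \<ge> 0" and hyp: "controls_cubes \<phi> s \<tau> p f (ennreal M)" for f M
    unfolding level_bound_def
  proof (intro allI)
    fix j x
    define D where "D = K * M * 2 powr (- of_int j * \<sigma>)"
    have D: "D \<ge> 0" using K M by (simp add: D_def)
    have "norm (conv f (dilate j \<phi>) x) \<le> 4 * D"
    proof (rule v(2)[OF f])
      fix Q :: "'n dyadic" and S c
      assume Q: "fst Q = j" and S: "S \<in> sets borel" "S \<subseteq> cube Q" "emeasure lborel S = ennreal (v * vol Q)"
        and c: "\<And>x. x \<in> S \<Longrightarrow> c \<le> norm (conv f (dilate j \<phi>) x)"
      show "c \<le> D"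
      proof (cases "c \<ge> 0")
        case True
        have vQ: "v * vol Q > 0" using v(1) vol_pos[of Q] by simp
        then have m: "measure lborel S = v * vol Q" using S(3) by (simp add: measure_def)
        have pos: "emeasure lborel S > 0" using S(3) vQ by simp
        have "ennreal (vol Q powr (- \<tau>) * 2 powr (of_int (fst Q) * s) * c * measure lborel S powr a) \<le> ennreal M"
          by (rule hyp[unfolded controls_cubes_def, folded a_def, rule_format, OF S(1,2) pos True]) (simp add: Q c)
        then have "vol Q powr (- \<tau>) * 2 powr (of_int j * s) * c * (v * vol Q) powr a \<le> M"
          using M Q m by simp
        also have "(v * vol Q) powr a = v powr a * vol Q powr a" using v(1) vol_pos[of Q] by (simp add: powr_mult)
        finally have "c * (v powr a * (2 powr (of_int j * s) * (vol Q powr (- \<tau>) * vol Q powr a))) \<le> M" by (simp add: mult_ac)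
        also have "2 powr (of_int j * s) * (vol Q powr (- \<tau>) * vol Q powr a) = 2 powr (of_int j * \<sigma>)"
          unfolding vol_powr Q \<sigma>_def a_def[symmetric] by (simp add: powr_add[symmetric] algebra_simps)
        finally have "c \<le> M / (v powr a * 2 powr (of_int j * \<sigma>))" using v(1) by (simp add: pos_le_divide_eq)
        then show ?thesis unfolding D_def K_def by (simp add: powr_minus_divide)
      qed (use D in simp)
    qed
    then show "norm (conv f (dilate j \<phi>) x) \<le> 4 * K * M * 2 powr (- of_int j * \<sigma>)" by (simp add: D_def mult.assoc)
  qed
  moreover have "4 * K > 0" using K by simp
  ultimately show ?thesis by blast
qed

text \<open>Only the first level of the sequence norm and only the points of \<open>S\<close> are
  kept.\<close>

lemma triebel_lizorkin_controls_cubes: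
  fixes \<phi> :: "real^'n::finite \<Rightarrow> complex"
  assumes p: "0 < p" and q: "0 < q"
  shows "controls_cubes \<phi> s \<tau> p f (triebel_lizorkin_norm \<phi> s \<tau> p q f)"
  unfolding controls_cubes_def
proof (intro allI impI)
  fix P :: "'n dyadic" and S c
  assume S: "S \<in> sets borel" "S \<subseteq> cube P" "emeasure lborel S > 0" and c: "c \<ge> 0" "\<forall>x\<in>S. c \<le> norm (conv f (dilate (fst P) \<phi>) x)"
  have "emeasure lborel S \<le> emeasure lborel (cube P)" using S by (intro emeasure_mono) auto
  then have "emeasure lborel S < \<infinity>" unfolding emeasure_cube by (simp add: le_less_trans)
  then have m: "emeasure lborel S = ennreal (measure lborel S)" by (intro emeasure_eq_ennreal_measure) auto
  have m0: "measure lborel S > 0" using S(3) unfolding m by (simp add: ennreal_less_zero_iff)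
  let ?g = "\<lambda>x. seq_norm q {fst P..} (\<lambda>j. ennreal (2 powr (of_int j * s) * norm (conv f (dilate j \<phi>) x)))"
  have "ennreal ((2 powr (of_int (fst P) * s) * c) * measure lborel S powr enn2real (1 / p)) \<le> lebesgue_norm p (cube P) ?g"
  proof (rule lebesgue_norm_ge[OF p cube_borel S(1,2) m m0])
    show "0 \<le> 2 powr (of_int (fst P) * s) * c" using c by simp
    fix x assume "x \<in> S"
    then have "ennreal (2 powr (of_int (fst P) * s) * c) \<le> ennreal (2 powr (of_int (fst P) * s) * norm (conv f (dilate (fst P) \<phi>) x))"
      using c by (intro ennreal_leI mult_left_mono) auto
    also have "\<dots> \<le> ?g x" using seq_norm_ge[OF q, of "fst P" "{fst P..}" "\<lambda>j. ennreal (2 powr (of_int j * s) * norm (conv f (dilate j \<phi>) x))"] by simp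
    finally show "ennreal (2 powr (of_int (fst P) * s) * c) \<le> ?g x" .
  qed
  then have "ennreal (1 / vol P powr \<tau>) * ennreal ((2 powr (of_int (fst P) * s) * c) * measure lborel S powr enn2real (1 / p))
    \<le> ennreal (1 / vol P powr \<tau>) * lebesgue_norm p (cube P) ?g" by (intro mult_left_mono) auto
  also have "\<dots> \<le> triebel_lizorkin_norm \<phi> s \<tau> p q f" unfolding triebel_lizorkin_norm_def by (rule SUP_upper) simp
  finally show "ennreal (vol P powr (- \<tau>) * 2 powr (of_int (fst P) * s) * c * measure lborel S powr enn2real (1 / p)) \<le> triebel_lizorkin_norm \<phi> s \<tau> p q f"
    using c(1) unfolding inverse_vol_powr by (simp add: ennreal_mult[symmetric] mult.assoc)
qed

lemma besov_controls_cubes: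
  fixes \<phi> :: "real^'n::finite \<Rightarrow> complex"
  assumes p: "0 < p" and q: "0 < q"
  shows "controls_cubes \<phi> s \<tau> p f (besov_norm \<phi> s \<tau> p q f)"
  unfolding controls_cubes_def
proof (intro allI impI)
  fix P :: "'n dyadic" and S c
  assume S: "S \<in> sets borel" "S \<subseteq> cube P" "emeasure lborel S > 0" and c: "c \<ge> 0" "\<forall>x\<in>S. c \<le> norm (conv f (dilate (fst P) \<phi>) x)"
  have "emeasure lborel S \<le> emeasure lborel (cube P)" using S by (intro emeasure_mono) auto
  then have "emeasure lborel S < \<infinity>" unfolding emeasure_cube by (simp add: le_less_trans)
  then have m: "emeasure lborel S = ennreal (measure lborel S)" by (intro emeasure_eq_ennreal_measure) auto
  have m0: "measure lborel S > 0" using S(3) unfolding m by (simp add: ennreal_less_zero_iff)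
  let ?a = "\<lambda>j. ennreal (2 powr (of_int j * s)) * lebesgue_norm p (cube P) (\<lambda>x. ennreal (norm (conv f (dilate j \<phi>) x)))"
  have "ennreal (c * measure lborel S powr enn2real (1 / p)) \<le> lebesgue_norm p (cube P) (\<lambda>x. ennreal (norm (conv f (dilate (fst P) \<phi>) x)))"
    using c by (intro lebesgue_norm_ge[OF p cube_borel S(1,2) m m0]) (auto intro!: ennreal_leI)
  then have "ennreal (2 powr (of_int (fst P) * s)) * ennreal (c * measure lborel S powr enn2real (1 / p)) \<le> ?a (fst P)"
    by (intro mult_left_mono) auto
  also have "\<dots> \<le> seq_norm q {fst P..} ?a" by (rule seq_norm_ge[OF q]) simp
  finally have "ennreal (1 / vol P powr \<tau>) * (ennreal (2 powr (of_int (fst P) * s)) * ennreal (c * measure lborel S powr enn2real (1 / p)))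
    \<le> ennreal (1 / vol P powr \<tau>) * seq_norm q {fst P..} ?a" by (intro mult_left_mono) auto
  also have "\<dots> \<le> besov_norm \<phi> s \<tau> p q f" unfolding besov_norm_def by (rule SUP_upper) simp
  finally show "ennreal (vol P powr (- \<tau>) * 2 powr (of_int (fst P) * s) * c * measure lborel S powr enn2real (1 / p)) \<le> besov_norm \<phi> s \<tau> p q f"
    using c(1) unfolding inverse_vol_powr by (simp add: ennreal_mult[symmetric] mult.assoc)
qed

section \<open>Carleson measure spaces\<close>

definition corner_bound :: "(real^'n::finite \<Rightarrow> complex) \<Rightarrow> real \<Rightarrow> ((real^'n \<Rightarrow> complex) \<Rightarrow> complex) \<Rightarrow> real \<Rightarrow> bool" where
  "corner_bound \<phi> \<sigma> f M \<longleftrightarrow> (\<forall>Q. norm (conv f (dilate (fst Q) \<phi>) (corner Q)) \<le> M * 2 powr (- of_int (fst Q) * \<sigma>))"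

text \<open>The bounds at adjacent levels differ by at most the factor 2^|\<sigma>|, so three
  neighbouring levels cost only a constant.\<close>

lemma level_bound_change:
  fixes \<phi> \<psi> :: "real^'n::finite \<Rightarrow> complex"
  assumes \<phi>: "admissible \<phi>" and \<psi>: "admissible \<psi>"
  shows "\<exists>C>0. \<forall>f M. tame f \<longrightarrow> M \<ge> 0 \<longrightarrow> level_bound \<phi> \<sigma> f M \<longrightarrow> level_bound \<psi> \<sigma> f (C * M)"
proof -
  obtain C where C: "C > 0" "\<And>f j D x. tame f \<Longrightarrow> (\<And>k x. k \<in> {j-1,j,j+1} \<Longrightarrow> norm (conv f (dilate k \<phi>) x) \<le> D) \<Longrightarrow>
     norm (conv f (dilate j \<psi>) x) \<le> C * D"
    using level_change[OF \<phi> \<psi>] by metis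
  have "level_bound \<psi> \<sigma> f (C * 2 powr \<bar>\<sigma>\<bar> * M)" if f: "tame f" and M: "M \<ge> 0" and lb: "level_bound \<phi> \<sigma> f M" for f M
    unfolding level_bound_def
  proof (intro allI)
    fix j x
    have "norm (conv f (dilate j \<psi>) x) \<le> C * (2 powr \<bar>\<sigma>\<bar> * M * 2 powr (- of_int j * \<sigma>))"
    proof (rule C(2)[OF f])
      fix k x assume k: "k \<in> {j-1,j,j+1}"
      have "of_int (j - k) * \<sigma> \<le> \<bar>\<sigma>\<bar>" using k by (auto simp: abs_if)
      then have "- of_int k * \<sigma> \<le> \<bar>\<sigma>\<bar> + - of_int j * \<sigma>" by (simp add: algebra_simps)
      then have "2 powr (- of_int k * \<sigma>) \<le> 2 powr (\<bar>\<sigma>\<bar> + - of_int j * \<sigma>)" by (intro powr_mono) auto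
      then have "M * 2 powr (- of_int k * \<sigma>) \<le> M * (2 powr \<bar>\<sigma>\<bar> * 2 powr (- of_int j * \<sigma>))"
        using M unfolding powr_add by (rule mult_left_mono)
      moreover have "norm (conv f (dilate k \<phi>) x) \<le> M * 2 powr (- of_int k * \<sigma>)" using lb unfolding level_bound_def by blast
      ultimately show "norm (conv f (dilate k \<phi>) x) \<le> 2 powr \<bar>\<sigma>\<bar> * M * 2 powr (- of_int j * \<sigma>)" by (simp add: mult_ac)
    qed
    then show "norm (conv f (dilate j \<psi>) x) \<le> C * 2 powr \<bar>\<sigma>\<bar> * M * 2 powr (- of_int j * \<sigma>)" by (simp add: mult.assoc)
  qed
  moreover have "C * 2 powr \<bar>\<sigma>\<bar> > 0" using C(1) by simp
  ultimately show ?thesis by blast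
qed

text \<open>The coefficients \<open>f (phi_cube \<phi> Q)\<close> sample the convolution with the reflection of \<open>\<phi>\<close>, because the
  pairing is bilinear.\<close>

lemma corner_bound_of_level_bound:
  fixes \<phi> :: "real^'n::finite \<Rightarrow> complex"
  assumes \<phi>: "admissible \<phi>"
  shows "\<exists>C>0. \<forall>f M. tame f \<longrightarrow> M \<ge> 0 \<longrightarrow> level_bound \<phi> \<sigma> f M \<longrightarrow> corner_bound (reflect \<phi>) \<sigma> f (C * M)"
  using level_bound_change[OF \<phi> admissible_reflect[OF \<phi>], of \<sigma>] unfolding corner_bound_def level_bound_def by blast

text \<open>Sampling first passes from the corners to all points for the reflected function itself;
  only then is the test function changed, since the Calderon formula needs bounds at every
  point.\<close>

lemma level_bound_of_corner_bound:
  fixes \<phi> :: "real^'n::finite \<Rightarrow> complex"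
  assumes \<phi>: "admissible \<phi>"
  shows "\<exists>C>0. \<forall>f M. tame f \<longrightarrow> M \<ge> 0 \<longrightarrow> corner_bound (reflect \<phi>) \<sigma> f M \<longrightarrow> level_bound \<phi> \<sigma> f (C * M)"
proof -
  note \<psi> = admissible_reflect[OF \<phi>]
  obtain C where C: "C > 0" "\<forall>f M. tame f \<longrightarrow> M \<ge> 0 \<longrightarrow> level_bound (reflect \<phi>) \<sigma> f M \<longrightarrow> level_bound \<phi> \<sigma> f (C * M)"
    using level_bound_change[OF \<psi> \<phi>, of \<sigma>] by blast
  obtain D where D: "D > 0" "\<And>f j M x. tame f \<Longrightarrow> (\<And>Q. fst Q = j \<Longrightarrow> norm (conv f (dilate j (reflect \<phi>)) (corner Q)) \<le> M) \<Longrightarrow>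
     norm (conv f (dilate j (reflect \<phi>)) x) \<le> D * M"
    using level_sampling[OF \<psi>] by metis
  have "level_bound \<phi> \<sigma> f (C * D * M)" if f: "tame f" and M: "M \<ge> 0" and cb: "corner_bound (reflect \<phi>) \<sigma> f M" for f M
  proof -
    have "level_bound (reflect \<phi>) \<sigma> f (D * M)" unfolding level_bound_def
    proof (intro allI)
      fix j x
      have "norm (conv f (dilate j (reflect \<phi>)) x) \<le> D * (M * 2 powr (- of_int j * \<sigma>))"
        by (rule D(2)[OF f]) (use cb in \<open>auto simp: corner_bound_def\<close>)
      then show "norm (conv f (dilate j (reflect \<phi>)) x) \<le> D * M * 2 powr (- of_int j * \<sigma>)" by (simp add: mult.assoc)
    qed
    then have "level_bound \<phi> \<sigma> f (C * (D * M))" using C(2) f M D(1) by (auto simp: less_imp_le)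
    then show ?thesis by (simp add: mult.assoc)
  qed
  moreover have "C * D > 0" using C(1) D(1) by simp
  ultimately show ?thesis by blast
qed

lemma corner_bound_iff:
  fixes \<phi> :: "real^'n::finite \<Rightarrow> complex"
  assumes \<phi>: "admissible \<phi>" and f: "tame f"
  shows "corner_bound (reflect \<phi>) (s + t) f M \<longleftrightarrow>
    (\<forall>Q. vol Q powr (- s / real CARD('n) - 1/2) * norm (f (phi_cube \<phi> Q)) \<le> M * 2 powr (- of_int (fst Q) * t))"
proof -
  have "x \<le> M * 2 powr (- of_int j * (s + t)) \<longleftrightarrow> 2 powr (of_int j * s) * x \<le> M * 2 powr (- of_int j * t)" for x :: real and j :: int
  proof -
    have "2 powr (- of_int j * (s + t)) = 2 powr (- of_int j * t) / 2 powr (of_int j * s)"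
    proof -
      have "- of_int j * (s + t) = - of_int j * t - of_int j * s" by (simp add: algebra_simps)
      then show ?thesis by (simp only: powr_diff)
    qed
    then show ?thesis by (simp add: pos_le_divide_eq mult.commute)
  qed
  then show ?thesis unfolding corner_bound_def phi_cube_conv[OF f \<phi>] by blast
qed

text \<open>As \<open>t\<close> is nonnegative, enlarging \<open>P\<close> only decreases the factor
  |P|^(-t), so the worst \<open>P\<close> for a given \<open>Q\<close> is \<open>Q\<close> itself
  and the double supremum collapses.\<close>

lemma cmo_inf_norm_iff:
  fixes \<phi> :: "real^'n::finite \<Rightarrow> complex"
  assumes \<phi>: "admissible \<phi>" and f: "tame f" and M: "M \<ge> 0" and t: "t \<ge> 0"
  shows "cmo_inf_norm \<phi> s t f \<le> ennreal M \<longleftrightarrow> corner_bound (reflect \<phi>) (s + real CARD('n) * t) f M"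
proof -
  define w where "w Q = vol Q powr (- s / real CARD('n) - 1/2) * norm (f (phi_cube \<phi> Q))" for Q :: "'n dyadic"
  have w: "w Q \<ge> 0" for Q by (simp add: w_def)
  have "cmo_inf_norm \<phi> s t f \<le> ennreal M \<longleftrightarrow> (\<forall>P Q. cube Q \<subseteq> cube P \<longrightarrow> vol P powr (- t) * w Q \<le> M)"
  proof
    assume le: "cmo_inf_norm \<phi> s t f \<le> ennreal M"
    show "\<forall>P Q. cube Q \<subseteq> cube P \<longrightarrow> vol P powr (- t) * w Q \<le> M"
    proof (intro allI impI)
      fix P Q :: "'n dyadic" assume sub: "cube Q \<subseteq> cube P"
      have "ennreal (vol P powr (- t) * w Q) = ennreal (vol P powr (- t)) * ennreal (w Q)" using w by (simp add: ennreal_mult)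
      also have "\<dots> \<le> ennreal (vol P powr (- t)) * (SUP Q\<in>{Q. cube Q \<subseteq> cube P}. ennreal (w Q))"
        using sub by (intro mult_left_mono SUP_upper) auto
      also have "\<dots> \<le> cmo_inf_norm \<phi> s t f" unfolding cmo_inf_norm_def w_def by (rule SUP_upper) simp
      finally have "ennreal (vol P powr (- t) * w Q) \<le> ennreal M" using le by (rule order.trans)
      then show "vol P powr (- t) * w Q \<le> M" using M by simp
    qed
  next
    assume R: "\<forall>P Q. cube Q \<subseteq> cube P \<longrightarrow> vol P powr (- t) * w Q \<le> M"
    show "cmo_inf_norm \<phi> s t f \<le> ennreal M" unfolding cmo_inf_norm_def w_def[symmetric]
    proof (rule SUP_least)
      fix P :: "'n dyadic"
      have pos: "vol P powr (- t) > 0" using vol_pos[of P] by simp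
      have "(SUP Q\<in>{Q. cube Q \<subseteq> cube P}. ennreal (w Q)) \<le> ennreal (M / vol P powr (- t))"
      proof (intro SUP_least ennreal_leI)
        fix Q assume "Q \<in> {Q. cube Q \<subseteq> cube P}"
        then have "vol P powr (- t) * w Q \<le> M" using R by blast
        then show "w Q \<le> M / vol P powr (- t)" unfolding pos_le_divide_eq[OF pos] by (simp only: mult.commute)
      qed
      then have "ennreal (vol P powr (- t)) * (SUP Q\<in>{Q. cube Q \<subseteq> cube P}. ennreal (w Q)) \<le> ennreal (vol P powr (- t)) * ennreal (M / vol P powr (- t))"
        by (rule mult_left_mono) simp
      also have "\<dots> = ennreal M" using pos M by (subst ennreal_mult[symmetric]) auto
      finally show "ennreal (vol P powr (- t)) * (SUP Q\<in>{Q. cube Q \<subseteq> cube P}. ennreal (w Q)) \<le> ennreal M" .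
    qed
  qed
  also have "\<dots> \<longleftrightarrow> (\<forall>Q. vol Q powr (- t) * w Q \<le> M)"
  proof
    assume R: "\<forall>Q. vol Q powr (- t) * w Q \<le> M"
    show "\<forall>P Q. cube Q \<subseteq> cube P \<longrightarrow> vol P powr (- t) * w Q \<le> M"
    proof (intro allI impI)
      fix P Q :: "'n dyadic" assume "cube Q \<subseteq> cube P"
      then have "fst P \<le> fst Q" by (rule cube_subset_level)
      then have "real_of_int (fst P) * (real CARD('n) * t) \<le> of_int (fst Q) * (real CARD('n) * t)"
        using t by (intro mult_right_mono) auto
      then have "vol P powr (- t) \<le> vol Q powr (- t)" unfolding vol_powr by simp
      then have "vol P powr (- t) * w Q \<le> vol Q powr (- t) * w Q" using w by (rule mult_right_mono)
      then show "vol P powr (- t) * w Q \<le> M" using R order.trans by blast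
    qed
  qed blast
  also have "\<dots> \<longleftrightarrow> (\<forall>Q. w Q \<le> M * 2 powr (- of_int (fst Q) * (real CARD('n) * t)))"
  proof -
    have "vol Q powr (- t) * w Q \<le> M \<longleftrightarrow> w Q \<le> M * 2 powr (- of_int (fst Q) * (real CARD('n) * t))" for Q :: "'n dyadic"
    proof -
      have "2 powr (- of_int (fst Q) * (real CARD('n) * t)) = 1 / vol Q powr (- t)"
        unfolding vol_powr by (simp add: powr_minus_divide)
      then show ?thesis using vol_pos[of Q] by (simp add: pos_le_divide_eq mult.commute)
    qed
    then show ?thesis by blast
  qed
  finally show ?thesis unfolding corner_bound_iff[OF \<phi> f] w_def .
qed

text \<open>A point lies in at most one cube of each level, so at every point the sum over cubes
  inside \<open>P\<close> is dominated by a geometric series over the levels from that of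
  \<open>P\<close> on. The resulting bound is constant on \<open>P\<close>, and integrating it
  yields the factor |P| that the summand 1 in \<open>q * t + 1\<close> compensates.\<close>

lemma cmo_norm_le:
  fixes \<phi> :: "real^'n::finite \<Rightarrow> complex" and s t q :: real
  assumes \<phi>: "admissible \<phi>" and q: "q > 0" and t: "t > 0"
  shows "\<exists>C>0. \<forall>f M. tame f \<longrightarrow> M \<ge> 0 \<longrightarrow> corner_bound (reflect \<phi>) (s + real CARD('n) * t) f M \<longrightarrow> cmo_norm \<phi> s q (q * t + 1) f \<le> ennreal (C * M)"
proof -
  define b where "b = real CARD('n) * t * q"
  have b: "b > 0" using q t by (simp add: b_def)
  define K where "K = 1 / (1 - 2 powr (- b))"
  have "2 powr (- b) < 1" using b by (simp add: powr_less_one)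
  then have K: "K > 0" by (simp add: K_def)
  have "cmo_norm \<phi> s q (q * t + 1) f \<le> ennreal (K powr (1 / q) * M)"
    if f: "tame f" and M: "M \<ge> 0" and cb: "corner_bound (reflect \<phi>) (s + real CARD('n) * t) f M" for f M
    unfolding cmo_norm_def
  proof (rule SUP_least)
    fix P :: "'n dyadic"
    define w where "w Q = vol Q powr (- s / real CARD('n) - 1/2) * norm (f (phi_cube \<phi> Q))" for Q :: "'n dyadic"
    have w: "0 \<le> w Q" "w Q \<le> M * 2 powr (- of_int (fst Q) * (real CARD('n) * t))" for Q
    proof -
      show "0 \<le> w Q" by (simp add: w_def)
      show "w Q \<le> M * 2 powr (- of_int (fst Q) * (real CARD('n) * t))"
        using cb unfolding corner_bound_iff[OF \<phi> f] w_def by blast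
    qed
    have wq: "w Q powr q \<le> M powr q * 2 powr (- of_int (fst Q) * b)" for Q
    proof -
      have "w Q powr q \<le> (M * 2 powr (- of_int (fst Q) * (real CARD('n) * t))) powr q" using w q by (intro powr_mono2) auto
      also have "\<dots> = M powr q * 2 powr (- of_int (fst Q) * b)" using M by (simp add: powr_mult powr_powr b_def mult_ac)
      finally show ?thesis .
    qed
    let ?V = "M powr q * (2 powr (- of_int (fst P) * b) * K)"
    have V: "?V \<ge> 0" using K by simp
    have pt: "(\<Sum>\<^sub>\<infinity>Q\<in>{Q. cube Q \<subseteq> cube P}. ennreal ((w Q * indicator (cube Q) x) powr q)) \<le> ennreal ?V" for x
    proof (rule infsum_ennreal_le)
      fix F assume F: "finite F" "F \<subseteq> {Q. cube Q \<subseteq> cube P}"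
      define G where "G = {Q\<in>F. x \<in> cube Q}"
      have G: "finite G" "G \<subseteq> F" using F by (auto simp: G_def)
      have inj: "inj_on fst G" unfolding G_def by (intro inj_onI cube_unique[of x]) simp_all
      have "(\<Sum>Q\<in>F. ennreal ((w Q * indicator (cube Q) x) powr q)) = (\<Sum>Q\<in>G. ennreal ((w Q * indicator (cube Q) x) powr q))"
        using F by (intro sum.mono_neutral_right) (auto simp: G_def)
      also have "\<dots> \<le> (\<Sum>Q\<in>G. ennreal (M powr q * 2 powr (- of_int (fst Q) * b)))"
      proof (intro sum_mono ennreal_leI)
        fix Q assume "Q \<in> G"
        then have "indicator (cube Q) x = (1::real)" by (simp add: G_def)
        with wq[of Q] show "(w Q * indicator (cube Q) x) powr q \<le> M powr q * 2 powr (- of_int (fst Q) * b)" by (simp only: mult_1_right)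
      qed
      also have "\<dots> = ennreal (M powr q * (\<Sum>j\<in>fst ` G. 2 powr (- of_int j * b)))"
        by (subst sum_ennreal) (simp_all add: sum_distrib_left sum.reindex[OF inj])
      also have "\<dots> \<le> ennreal ?V"
      proof (intro ennreal_leI mult_left_mono)
        have "fst P \<le> fst Q" if "Q \<in> G" for Q using that G F by (intro cube_subset_level) blast
        then have "fst ` G \<subseteq> {fst P..}" by blast
        then show "(\<Sum>j\<in>fst ` G. 2 powr (- of_int j * b)) \<le> 2 powr (- of_int (fst P) * b) * K"
          using geometric_sum_int_le[of "fst ` G" "fst P" b] G b by (simp add: K_def)
      qed simp
      finally show "(\<Sum>Q\<in>F. ennreal ((w Q * indicator (cube Q) x) powr q)) \<le> ennreal ?V" .
    qed
    have "(\<integral>\<^sup>+x\<in>cube P. (\<Sum>\<^sub>\<infinity>Q\<in>{Q. cube Q \<subseteq> cube P}. ennreal ((w Q * indicator (cube Q) x) powr q)) \<partial>lborel)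
      \<le> (\<integral>\<^sup>+x\<in>cube P. ennreal ?V \<partial>lborel)"
      by (intro nn_integral_mono mult_right_mono pt) simp
    also have "\<dots> = ennreal (?V * vol P)"
      using V vol_pos[of P] by (subst nn_integral_cmult_indicator) (simp_all add: emeasure_cube ennreal_mult)
    finally have "ennreal (vol P powr (- (q * t + 1))) * (\<integral>\<^sup>+x\<in>cube P. (\<Sum>\<^sub>\<infinity>Q\<in>{Q. cube Q \<subseteq> cube P}. ennreal ((w Q * indicator (cube Q) x) powr q)) \<partial>lborel)
      \<le> ennreal (vol P powr (- (q * t + 1))) * ennreal (?V * vol P)" by (rule mult_left_mono) simp
    also have "\<dots> = ennreal (vol P powr (- (q * t + 1)) * (?V * vol P))"
      using K vol_pos[of P] by (intro ennreal_mult[symmetric] mult_nonneg_nonneg) auto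
    also have "vol P powr (- (q * t + 1)) * (?V * vol P) = M powr q * K * (vol P powr (- (q * t + 1)) * vol P powr 1 * 2 powr (- of_int (fst P) * b))"
      using vol_pos[of P] by (simp add: mult_ac)
    also have "vol P powr (- (q * t + 1)) * vol P powr 1 * 2 powr (- of_int (fst P) * b) = 1"
      unfolding vol_powr by (simp add: powr_add[symmetric] b_def algebra_simps)
    finally have "epowr (ennreal (vol P powr (- (q * t + 1))) * (\<integral>\<^sup>+x\<in>cube P. (\<Sum>\<^sub>\<infinity>Q\<in>{Q. cube Q \<subseteq> cube P}. ennreal ((w Q * indicator (cube Q) x) powr q)) \<partial>lborel)) (1 / q)
      \<le> epowr (ennreal (M powr q * K * 1)) (1 / q)" using q by (intro epowr_mono) auto
    also have "\<dots> = ennreal (K powr (1 / q) * M)"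
      using K M q by (subst epowr_ennreal) (simp_all add: powr_mult powr_powr mult.commute)
    finally show "epowr (ennreal (vol P powr (- (q * t + 1))) * (\<integral>\<^sup>+x\<in>cube P. (\<Sum>\<^sub>\<infinity>Q\<in>{Q. cube Q \<subseteq> cube P}.
        ennreal ((vol Q powr (- s / real CARD('n) - 1/2) * norm (f (phi_cube \<phi> Q)) * indicator (cube Q) x) powr q)) \<partial>lborel)) (1 / q)
      \<le> ennreal (K powr (1 / q) * M)" unfolding w_def .
  qed
  moreover have "K powr (1 / q) > 0" using K by simp
  ultimately show ?thesis by blast
qed

text \<open>Of the sum over cubes inside \<open>P\<close> only the term of \<open>P\<close> itself
  is kept, which contributes at every point of \<open>P\<close>.\<close>

lemma corner_bound_of_cmo_norm:
  fixes \<phi> :: "real^'n::finite \<Rightarrow> complex" and s t q :: real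
  assumes \<phi>: "admissible \<phi>" and f: "tame f" and q: "q > 0" and M: "M \<ge> 0" and le: "cmo_norm \<phi> s q (q * t + 1) f \<le> ennreal M"
  shows "corner_bound (reflect \<phi>) (s + real CARD('n) * t) f M"
  unfolding corner_bound_iff[OF \<phi> f]
proof
  fix P :: "'n dyadic"
  define w where "w Q = vol Q powr (- s / real CARD('n) - 1/2) * norm (f (phi_cube \<phi> Q))" for Q :: "'n dyadic"
  have w: "0 \<le> w P" by (simp add: w_def)
  let ?I = "\<integral>\<^sup>+x\<in>cube P. (\<Sum>\<^sub>\<infinity>Q\<in>{Q. cube Q \<subseteq> cube P}. ennreal ((w Q * indicator (cube Q) x) powr q)) \<partial>lborel"
  have "ennreal (w P powr q * vol P) = (\<integral>\<^sup>+x\<in>cube P. ennreal (w P powr q) \<partial>lborel)"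
    using vol_pos[of P] by (subst nn_integral_cmult_indicator) (simp_all add: emeasure_cube ennreal_mult)
  also have "\<dots> \<le> ?I"
  proof (rule nn_integral_mono)
    fix x
    show "ennreal (w P powr q) * indicator (cube P) x \<le> (\<Sum>\<^sub>\<infinity>Q\<in>{Q. cube Q \<subseteq> cube P}. ennreal ((w Q * indicator (cube Q) x) powr q)) * indicator (cube P) x"
      using infsum_ennreal_ge[of P "{Q. cube Q \<subseteq> cube P}" "\<lambda>Q. ennreal ((w Q * indicator (cube Q) x) powr q)"]
      by (auto simp: indicator_def)
  qed
  finally have "ennreal (vol P powr (- (q * t + 1))) * ennreal (w P powr q * vol P) \<le> ennreal (vol P powr (- (q * t + 1))) * ?I"
    by (rule mult_left_mono) simp
  then have "epowr (ennreal (vol P powr (- (q * t + 1))) * ennreal (w P powr q * vol P)) (1 / q) \<le> epowr (ennreal (vol P powr (- (q * t + 1))) * ?I) (1 / q)"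
    using q by (intro epowr_mono) auto
  also have "\<dots> \<le> cmo_norm \<phi> s q (q * t + 1) f" unfolding cmo_norm_def w_def by (rule SUP_upper) simp
  also have "\<dots> \<le> ennreal M" by (rule le)
  also have "ennreal (vol P powr (- (q * t + 1))) * ennreal (w P powr q * vol P) = ennreal (w P powr q * vol P powr (- (q * t)))"
  proof -
    have "vol P powr (- (q * t + 1)) * vol P powr 1 = vol P powr (- (q * t))"
      unfolding powr_add[symmetric] by simp
    then have "vol P powr (- (q * t + 1)) * (w P powr q * vol P) = w P powr q * vol P powr (- (q * t))"
      using vol_pos[of P] by (simp add: mult_ac)
    then show ?thesis using vol_pos[of P] by (simp add: ennreal_mult[symmetric])
  qed
  also have "epowr (ennreal (w P powr q * vol P powr (- (q * t)))) (1 / q) = ennreal (w P * vol P powr (- t))"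
    using w q by (subst epowr_ennreal) (simp_all add: powr_mult powr_powr)
  finally have "w P * vol P powr (- t) \<le> M" using M by simp
  then have "w P \<le> M / vol P powr (- t)" using vol_pos[of P] by (simp add: pos_le_divide_eq)
  also have "M / vol P powr (- t) = M * 2 powr (- of_int (fst P) * (real CARD('n) * t))"
    unfolding vol_powr by (simp add: powr_minus_divide)
  finally show "vol P powr (- s / real CARD('n) - 1/2) * norm (f (phi_cube \<phi> P)) \<le> M * 2 powr (- of_int (fst P) * (real CARD('n) * t))"
    unfolding w_def .
qed

section \<open>The equivalences of norms\<close>

lemma classical_cmo_equiv:
  fixes \<phi> :: "real^'n::finite \<Rightarrow> complex" and s \<tau> :: real
  assumes \<phi>: "admissible \<phi>" and p: "0 < p" and q: "0 < q"
    and \<tau>: "(q \<noteq> \<infinity> \<and> enn2real (1 / p) < \<tau>) \<or> (q = \<infinity> \<and> enn2real (1 / p) \<le> \<tau>)"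
  shows "same_space_equiv_norms (classical_inf_norm \<phi> (s + real CARD('n) * (\<tau> - enn2real (1 / p)))) (cmo_norm_ext \<phi> s \<tau> p q)"
proof -
  define t where "t = \<tau> - enn2real (1 / p)"
  define \<sigma> where "\<sigma> = s + real CARD('n) * t"
  obtain A where A: "A > 0" "\<forall>f M. tame f \<longrightarrow> M \<ge> 0 \<longrightarrow> level_bound \<phi> \<sigma> f M \<longrightarrow> corner_bound (reflect \<phi>) \<sigma> f (A * M)"
    using corner_bound_of_level_bound[OF \<phi>] by blast
  obtain B where B: "B > 0" "\<forall>f M. tame f \<longrightarrow> M \<ge> 0 \<longrightarrow> corner_bound (reflect \<phi>) \<sigma> f M \<longrightarrow> level_bound \<phi> \<sigma> f (B * M)"
    using level_bound_of_corner_bound[OF \<phi>] by blast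
  have "\<exists>C>0. \<forall>f M. tame f \<longrightarrow> M \<ge> 0 \<longrightarrow>
      (corner_bound (reflect \<phi>) \<sigma> f M \<longrightarrow> cmo_norm_ext \<phi> s \<tau> p q f \<le> ennreal (C * M)) \<and>
      (cmo_norm_ext \<phi> s \<tau> p q f \<le> ennreal M \<longrightarrow> corner_bound (reflect \<phi>) \<sigma> f M)"
  proof (cases "q = \<infinity>")
    case True
    then have "t \<ge> 0" using \<tau> by (auto simp: t_def)
    then show ?thesis using cmo_inf_norm_iff[OF \<phi>] True unfolding cmo_norm_ext_def t_def[symmetric] \<sigma>_def
      by (intro exI[of _ 1]) auto
  next
    case False
    define r where "r = enn2real q"
    have r: "r > 0" using q False by (auto simp: r_def enn2real_positive_iff less_top)
    have t: "t > 0" using \<tau> False by (auto simp: t_def)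
    \<comment> \<open>This identity of extended numbers includes \<open>p = \<infinity>\<close>,
      where both sides are 0. It rewrites the index \<tau> q + 1 - q/p as \<open>r * t + 1\<close>,
      in which only the difference t = \<tau> - 1/p is left.\<close>
    have "q / p = q * (1 / p)" by (simp add: divide_ennreal_def)
    then have "enn2real (q / p) = r * enn2real (1 / p)" by (simp add: r_def enn2real_mult)
    then have e: "cmo_norm_ext \<phi> s \<tau> p q = cmo_norm \<phi> s r (r * t + 1)"
      unfolding cmo_norm_ext_def using False by (simp add: r_def[symmetric] t_def algebra_simps)
    show ?thesis unfolding e
      using cmo_norm_le[OF \<phi> r t, of s] corner_bound_of_cmo_norm[OF \<phi> _ r, of _ _ s t] unfolding \<sigma>_def by blast
  qed
  then obtain C where C: "C > 0" "\<forall>f M. tame f \<longrightarrow> M \<ge> 0 \<longrightarrow>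
      (corner_bound (reflect \<phi>) \<sigma> f M \<longrightarrow> cmo_norm_ext \<phi> s \<tau> p q f \<le> ennreal (C * M)) \<and>
      (cmo_norm_ext \<phi> s \<tau> p q f \<le> ennreal M \<longrightarrow> corner_bound (reflect \<phi>) \<sigma> f M)" by blast
  have "same_space_equiv_norms (classical_inf_norm \<phi> \<sigma>) (cmo_norm_ext \<phi> s \<tau> p q)"
  proof (rule same_space_equiv_normsI[of "C * A" _ _ B])
    show "C * A > 0" "B > 0" using A B C by auto
    fix f :: "(real^'n \<Rightarrow> complex) \<Rightarrow> complex" and M :: real
    assume "f \<in> schwartz_inf_dual" and M: "M \<ge> 0"
    then have f: "tame f" by (simp add: dual_tame)
    show "cmo_norm_ext \<phi> s \<tau> p q f \<le> ennreal (C * A * M)" if "classical_inf_norm \<phi> \<sigma> f \<le> ennreal M"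
    proof -
      have "corner_bound (reflect \<phi>) \<sigma> f (A * M)"
        using that A(2) f M unfolding classical_norm_iff[OF \<phi> f M] by blast
      moreover have "A * M \<ge> 0" using A(1) M by simp
      ultimately show ?thesis using C(2) f by (simp add: mult.assoc)
    qed
    show "classical_inf_norm \<phi> \<sigma> f \<le> ennreal (B * M)" if "cmo_norm_ext \<phi> s \<tau> p q f \<le> ennreal M"
    proof -
      have "B * M \<ge> 0" using B(1) M by simp
      moreover have "level_bound \<phi> \<sigma> f (B * M)" using that B(2) C(2) f M by blast
      ultimately show ?thesis using classical_norm_iff[OF \<phi> f] by blast
    qed
  qed
  then show ?thesis by (simp add: \<sigma>_def t_def)
qed

lemma triebel_lizorkin_classical_equiv:
  fixes \<phi> :: "real^'n::finite \<Rightarrow> complex" and s \<tau> :: real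
  assumes \<phi>: "admissible \<phi>" and p: "0 < p" "p \<noteq> \<infinity>" and q: "0 < q"
    and \<tau>: "(q \<noteq> \<infinity> \<and> enn2real (1 / p) < \<tau>) \<or> (q = \<infinity> \<and> enn2real (1 / p) \<le> \<tau>)"
  shows "same_space_equiv_norms (triebel_lizorkin_norm \<phi> s \<tau> p q) (classical_inf_norm \<phi> (s + real CARD('n) * (\<tau> - enn2real (1 / p))))"
proof -
  let ?\<sigma> = "s + real CARD('n) * (\<tau> - enn2real (1 / p))"
  obtain A where A: "A > 0" "\<forall>f M. tame f \<longrightarrow> M \<ge> 0 \<longrightarrow> controls_cubes \<phi> s \<tau> p f (ennreal M) \<longrightarrow> level_bound \<phi> ?\<sigma> f (A * M)"
    using level_bound_of_cube_norms[OF \<phi> p(1), of s \<tau>] by blast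
  obtain B where B: "B > 0" "\<forall>f M. M \<ge> 0 \<longrightarrow> level_bound \<phi> ?\<sigma> f M \<longrightarrow> triebel_lizorkin_norm \<phi> s \<tau> p q f \<le> ennreal (B * M)"
    using triebel_lizorkin_le[OF \<phi> p q \<tau>, of s] by blast
  show ?thesis
  proof (rule same_space_equiv_normsI[OF A(1) _ B(1)])
    fix f :: "(real^'n \<Rightarrow> complex) \<Rightarrow> complex" and M :: real
    assume "f \<in> schwartz_inf_dual" and M: "M \<ge> 0"
    then have f: "tame f" by (simp add: dual_tame)
    show "triebel_lizorkin_norm \<phi> s \<tau> p q f \<le> ennreal (B * M)" if "classical_inf_norm \<phi> ?\<sigma> f \<le> ennreal M"
      using that B(2) M unfolding classical_norm_iff[OF \<phi> f M] by blast
    show "classical_inf_norm \<phi> ?\<sigma> f \<le> ennreal (A * M)" if le: "triebel_lizorkin_norm \<phi> s \<tau> p q f \<le> ennreal M"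
    proof -
      have "controls_cubes \<phi> s \<tau> p f (ennreal M)"
        using triebel_lizorkin_controls_cubes[OF p(1) q, of \<phi> s \<tau> f] le unfolding controls_cubes_def by (blast intro: order.trans)
      then have "level_bound \<phi> ?\<sigma> f (A * M)" using A(2) f M by blast
      moreover have "A * M \<ge> 0" using A(1) M by simp
      ultimately show ?thesis using classical_norm_iff[OF \<phi> f] by blast
    qed
  qed
qed

lemma besov_classical_equiv:
  fixes \<phi> :: "real^'n::finite \<Rightarrow> complex" and s \<tau> :: real
  assumes \<phi>: "admissible \<phi>" and p: "0 < p" and q: "0 < q"
    and \<tau>: "(q \<noteq> \<infinity> \<and> enn2real (1 / p) < \<tau>) \<or> (q = \<infinity> \<and> enn2real (1 / p) \<le> \<tau>)"
  shows "same_space_equiv_norms (besov_norm \<phi> s \<tau> p q) (classical_inf_norm \<phi> (s + real CARD('n) * (\<tau> - enn2real (1 / p))))"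
proof -
  let ?\<sigma> = "s + real CARD('n) * (\<tau> - enn2real (1 / p))"
  obtain A where A: "A > 0" "\<forall>f M. tame f \<longrightarrow> M \<ge> 0 \<longrightarrow> controls_cubes \<phi> s \<tau> p f (ennreal M) \<longrightarrow> level_bound \<phi> ?\<sigma> f (A * M)"
    using level_bound_of_cube_norms[OF \<phi> p, of s \<tau>] by blast
  obtain B where B: "B > 0" "\<forall>f M. tame f \<longrightarrow> M \<ge> 0 \<longrightarrow> level_bound \<phi> ?\<sigma> f M \<longrightarrow> besov_norm \<phi> s \<tau> p q f \<le> ennreal (B * M)"
    using besov_le[OF \<phi> p q \<tau>, of s] by blast
  show ?thesis
  proof (rule same_space_equiv_normsI[OF A(1) _ B(1)])
    fix f :: "(real^'n \<Rightarrow> complex) \<Rightarrow> complex" and M :: real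
    assume "f \<in> schwartz_inf_dual" and M: "M \<ge> 0"
    then have f: "tame f" by (simp add: dual_tame)
    show "besov_norm \<phi> s \<tau> p q f \<le> ennreal (B * M)" if "classical_inf_norm \<phi> ?\<sigma> f \<le> ennreal M"
      using that B(2) f M unfolding classical_norm_iff[OF \<phi> f M] by blast
    show "classical_inf_norm \<phi> ?\<sigma> f \<le> ennreal (A * M)" if le: "besov_norm \<phi> s \<tau> p q f \<le> ennreal M"
    proof -
      have "controls_cubes \<phi> s \<tau> p f (ennreal M)"
        using besov_controls_cubes[OF p q, of \<phi> s \<tau> f] le unfolding controls_cubes_def by (blast intro: order.trans)
      then have "level_bound \<phi> ?\<sigma> f (A * M)" using A(2) f M by blast
      moreover have "A * M \<ge> 0" using A(1) M by simp
      ultimately show ?thesis using classical_norm_iff[OF \<phi> f] by blast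
    qed
  qed
qed

theorem corollary4:
  fixes \<phi> :: "real^'n::finite \<Rightarrow> complex" and s :: real
  assumes "admissible \<phi>"
  shows
    "(\<forall>(p::ennreal) (q::ennreal) (\<tau>::real).
       0 < p \<and> p < \<infinity> \<and>
       ((0 < q \<and> q < \<infinity> \<and> enn2real (1 / p) < \<tau>) \<or> (q = \<infinity> \<and> enn2real (1 / p) \<le> \<tau>)) \<longrightarrow>
       same_space_equiv_norms
         (triebel_lizorkin_norm \<phi> s \<tau> p q)
         (classical_inf_norm \<phi> (s + real CARD('n) * (\<tau> - enn2real (1 / p)))) \<and>
       same_space_equiv_norms
         (classical_inf_norm \<phi> (s + real CARD('n) * (\<tau> - enn2real (1 / p))))
         (cmo_norm_ext \<phi> s \<tau> p q)) \<and>
     (\<forall>(p::ennreal) (q::ennreal) (\<tau>::real).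
       0 < p \<and>
       ((0 < q \<and> q < \<infinity> \<and> enn2real (1 / p) < \<tau>) \<or> (q = \<infinity> \<and> enn2real (1 / p) \<le> \<tau>)) \<longrightarrow>
       same_space_equiv_norms
         (besov_norm \<phi> s \<tau> p q)
         (classical_inf_norm \<phi> (s + real CARD('n) * (\<tau> - enn2real (1 / p)))) \<and>
       same_space_equiv_norms
         (classical_inf_norm \<phi> (s + real CARD('n) * (\<tau> - enn2real (1 / p))))
         (cmo_norm_ext \<phi> s \<tau> p q))"
proof -
  have T: "same_space_equiv_norms (triebel_lizorkin_norm \<phi> s \<tau> p q) (classical_inf_norm \<phi> (s + real CARD('n) * (\<tau> - enn2real (1 / p))))"
    if "0 < p" "p < \<infinity>" "(0 < q \<and> q < \<infinity> \<and> enn2real (1 / p) < \<tau>) \<or> (q = \<infinity> \<and> enn2real (1 / p) \<le> \<tau>)" for p q \<tau>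
    by (rule triebel_lizorkin_classical_equiv[OF assms]) (use that in auto)
  have B: "same_space_equiv_norms (besov_norm \<phi> s \<tau> p q) (classical_inf_norm \<phi> (s + real CARD('n) * (\<tau> - enn2real (1 / p))))"
    if "0 < p" "(0 < q \<and> q < \<infinity> \<and> enn2real (1 / p) < \<tau>) \<or> (q = \<infinity> \<and> enn2real (1 / p) \<le> \<tau>)" for p q \<tau>
    by (rule besov_classical_equiv[OF assms]) (use that in auto)
  have C: "same_space_equiv_norms (classical_inf_norm \<phi> (s + real CARD('n) * (\<tau> - enn2real (1 / p)))) (cmo_norm_ext \<phi> s \<tau> p q)"
    if "0 < p" "(0 < q \<and> q < \<infinity> \<and> enn2real (1 / p) < \<tau>) \<or> (q = \<infinity> \<and> enn2real (1 / p) \<le> \<tau>)" for p q \<tau>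
    by (rule classical_cmo_equiv[OF assms]) (use that in auto)
  show ?thesis
    by (intro conjI allI impI; elim conjE; rule T B C; assumption)
qed

end
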